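(* Let $\bar\kappa>0$ be a finite constant. There exist a radius $R_0=R_0(\bar\kappa,n,p,\|\nabla a^{ij}\|_{L^p(B_1^+)})\in(0,\frac12)$ and a constant $C=C(\bar\kappa,n,p,\|\nabla a^{ij}\|_{L^p(B_1^+)})$ such that for every solution $w$ of the variable coefficient thin obstacle problem $$\partial_i a^{ij}\partial_j w=0\ \text{ in }B_1^+,\qquad w\ge0,\ \ -\partial_{n+1}w\ge0,\ \ w\,\partial_{n+1}w=0\ \text{ on }B_1',$$ under the standing assumptions listed in the context, and for all $x_0\in\Gamma_w\cap B_{1/2}$, $$\sup_{B_r^+(x_0)}|w|\le C\,r^{\min\{\kappa_{x_0},\bar\kappa\}}|\ln r|^2\qquad\text{for all }0<r\le R_0.$$
   Context: $n\ge1$, Einstein summation. $B_r^+(x_0)=\{x\in\mathbb{R}^{n+1}:x_{n+1}\ge0,\ |x-x_0|<r\}$ for $x_0=(x_0',0)$, $B_r^+=B_r^+(0)$, $B_r'=B_r^+\cap\{x_{n+1}=0\}$, $A_{r,R}^+(x_0)=B_R^+(x_0)\setminus B_r^+(x_0)$. The free boundary is $\Gamma_w=\partial_{B_1'}\{x\in B_1':w(x)>0\}$ (boundary relative to $B_1'$). Standing assumptions: (A0) $\|w\|_{L^2(B_1^+)}=1$; (A1) $a^{i,n+1}(x',0)=0$ on $\{x_{n+1}=0\}$ for $i=1,\dots,n$; (A2) $a^{ij}$ is symmetric and uniformly elliptic with eigenvalues in $[1/2,2]$; (A3) $a^{ij}\in W^{1,p}(B_1^+)$ for some $p\in(n+1,\infty]$;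 (A4) $a^{ij}(0)=\delta^{ij}$; (W) $w\in C^{1,\alpha}$ (locally up to $B_1'$) for some $\alpha\in(0,\frac12]$. The equation is understood weakly. Vanishing order: $$\kappa_{x_0}=\limsup_{r\to0_+}\frac{\ln\Big(\frac{1}{|A^+_{r/2,r}(x_0)|}\int_{A^+_{r/2,r}(x_0)}w^2\Big)^{1/2}}{\ln r}\in[-\infty,\infty].$$ *)

theory Defs
  imports "HOL-Probability.Essential_Supremum"
begin

text \<open>
  Points of \<open>\<real>\<^bsup>n+1\<^esup>\<close>, \<open>n = CARD('n) \<ge> 1\<close>, are vectors indexed by \<open>'n option\<close>: the components
  \<open>Some i\<close> are the tangential coordinates \<open>x'\<close>, the component \<open>None\<close> is \<open>x\<^bsub>n+1\<^esub>\<close>.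
\<close>

type_synonym 'n point = "real ^ ('n option)"
type_synonym 'n coeff = "'n point \<Rightarrow> real ^ ('n option) ^ ('n option)"

definition half_ball :: "'n::finite point \<Rightarrow> real \<Rightarrow> 'n point set" where
  "half_ball x0 r = {x. x $ None \<ge> 0 \<and> norm (x - x0) < r}"

definition half_annulus :: "'n::finite point \<Rightarrow> real \<Rightarrow> real \<Rightarrow> 'n point set" where
  "half_annulus x0 r R = half_ball x0 R - half_ball x0 r"

text \<open>\<open>B\<^sup>+\<^sub>1\<close> contains its flat boundary part \<open>B'\<^sub>1\<close>; \<open>unit_half_ball_int\<close> is its interior, the open
  set on which the equation and the weak derivatives of the coefficients live.\<close>

definition unit_half_ball :: "'n::finite point set" where
  "unit_half_ball = half_ball 0 1"

definition unit_half_ball_int :: "'n::finite point set" where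
  "unit_half_ball_int = interior unit_half_ball"

definition unit_thin_ball :: "'n::finite point set" where
  "unit_thin_ball = unit_half_ball \<inter> {x. x $ None = 0}"

text \<open>On \<open>B\<^sup>+\<^sub>1\<close> (convex, with nonempty interior) the derivative within the set is unique, also at
  points of \<open>B'\<^sub>1\<close>, where it is the one-sided derivative.\<close>

definition partial_on :: "(real ^ 'm) set \<Rightarrow> 'm::finite \<Rightarrow> (real ^ 'm \<Rightarrow> real) \<Rightarrow> real ^ 'm \<Rightarrow> real" where
  "partial_on S k f x = frechet_derivative f (at x within S) (axis k 1)"

text \<open>\<open>f \<in> C\<^bsup>1,\<alpha>\<^esup>\<close> on compact subsets of \<open>S\<close>. For \<open>S = B\<^sup>+\<^sub>1\<close> such compact sets may touch
  \<open>B'\<^sub>1\<close> but stay away from the spherical part of the boundary.\<close>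

definition C1_holder_loc :: "(real ^ 'm::finite) set \<Rightarrow> real \<Rightarrow> (real ^ 'm \<Rightarrow> real) \<Rightarrow> bool" where
  "C1_holder_loc S \<alpha> f \<longleftrightarrow> f differentiable_on S \<and>
     (\<forall>K. compact K \<and> K \<subseteq> S \<longrightarrow> (\<forall>k. \<exists>L. \<forall>x\<in>K. \<forall>y\<in>K.
        \<bar>partial_on S k f x - partial_on S k f y\<bar> \<le> L * dist x y powr \<alpha>))"

primrec C_times :: "nat \<Rightarrow> (real ^ 'm::finite \<Rightarrow> real) \<Rightarrow> bool" where
  "C_times 0 f = continuous_on UNIV f"
| "C_times (Suc m) f = (f differentiable_on UNIV \<and> (\<forall>k. C_times m (partial_on UNIV k f)))"

text \<open>\<open>C\<^sub>c\<^sup>\<infinity>(U)\<close>, functions being extended by zero outside \<open>U\<close>.\<close>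

definition test_function :: "(real ^ 'm::finite) set \<Rightarrow> (real ^ 'm \<Rightarrow> real) \<Rightarrow> bool" where
  "test_function U \<phi> \<longleftrightarrow> (\<forall>m. C_times m \<phi>) \<and>
     compact (closure {x. \<phi> x \<noteq> 0}) \<and> closure {x. \<phi> x \<noteq> 0} \<subseteq> U"

definition Lp_norm :: "ennreal \<Rightarrow> 'a::euclidean_space set \<Rightarrow> ('a \<Rightarrow> real) \<Rightarrow> ennreal" where
  "Lp_norm p S f =
     (if p = \<infinity> then esssup (lebesgue_on S) (\<lambda>x. ennreal \<bar>f x\<bar>)
      else let I = (\<integral>\<^sup>+ x. ennreal (\<bar>f x\<bar> powr enn2real p) \<partial>lebesgue_on S)
           in if I = \<infinity> then \<infinity> else ennreal (enn2real I powr (1 / enn2real p)))"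

definition in_Lp :: "ennreal \<Rightarrow> 'a::euclidean_space set \<Rightarrow> ('a \<Rightarrow> real) \<Rightarrow> bool" where
  "in_Lp p S f \<longleftrightarrow> f \<in> borel_measurable (lebesgue_on S) \<and> Lp_norm p S f < \<infinity>"

definition is_weak_partial ::
    "(real ^ 'm) set \<Rightarrow> 'm::finite \<Rightarrow> (real ^ 'm \<Rightarrow> real) \<Rightarrow> (real ^ 'm \<Rightarrow> real) \<Rightarrow> bool" where
  "is_weak_partial U k f g \<longleftrightarrow>
     (\<forall>K. compact K \<and> K \<subseteq> U \<longrightarrow> f absolutely_integrable_on K \<and> g absolutely_integrable_on K) \<and>
     (\<forall>\<phi>. test_function U \<phi> \<longrightarrow>
        (LINT x:U|lebesgue. f x * partial_on UNIV k \<phi> x) = - (LINT x:U|lebesgue. g x * \<phi> x))"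

text \<open>Weak derivatives are unique up to null sets, so the choice does not affect \<open>Lp_norm\<close>.\<close>

definition weak_partial ::
    "(real ^ 'm) set \<Rightarrow> 'm::finite \<Rightarrow> (real ^ 'm \<Rightarrow> real) \<Rightarrow> real ^ 'm \<Rightarrow> real" where
  "weak_partial U k f = (SOME g. is_weak_partial U k f g)"

definition in_W1p :: "ennreal \<Rightarrow> (real ^ 'm::finite) set \<Rightarrow> (real ^ 'm \<Rightarrow> real) \<Rightarrow> bool" where
  "in_W1p p U f \<longleftrightarrow> in_Lp p U f \<and> (\<forall>k. \<exists>g. is_weak_partial U k f g \<and> in_Lp p U g)"

definition grad_norm :: "ennreal \<Rightarrow> 'n::finite coeff \<Rightarrow> ennreal" where
  "grad_norm p a = Lp_norm p unit_half_ball_int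
     (\<lambda>x. sqrt (\<Sum>k\<in>UNIV. \<Sum>i\<in>UNIV. \<Sum>j\<in>UNIV.
        (weak_partial unit_half_ball_int k (\<lambda>y. a y $ i $ j) x)\<^sup>2))"

definition matrix_eigenvalue :: "real ^ 'm ^ 'm \<Rightarrow> real \<Rightarrow> bool" where
  "matrix_eigenvalue A l \<longleftrightarrow> (\<exists>v. v \<noteq> 0 \<and> A *v v = l *\<^sub>R v)"

text \<open>Since \<open>p > n + 1\<close>, coefficients in \<open>W\<^bsup>1,p\<^esup>(B\<^sup>+\<^sub>1)\<close> have a representative that is continuous up
  to the boundary. The pointwise conditions refer to that representative, hence the
  \<open>continuous_on\<close> clause.\<close>

definition admissible_coeff :: "ennreal \<Rightarrow> 'n::finite coeff \<Rightarrow> bool" where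
  "admissible_coeff p a \<longleftrightarrow>
     (\<forall>i j. in_W1p p unit_half_ball_int (\<lambda>x. a x $ i $ j)) \<and>
     continuous_on unit_half_ball a \<and>
     (\<forall>x\<in>unit_half_ball. transpose (a x) = a x) \<and>
     (\<forall>x\<in>unit_half_ball. \<forall>l. matrix_eigenvalue (a x) l \<longrightarrow> 1/2 \<le> l \<and> l \<le> 2) \<and>
     (\<forall>x\<in>unit_thin_ball. \<forall>i. a x $ Some i $ None = 0) \<and>
     a 0 = mat 1"

text \<open>Test functions are supported in the open half ball, so the weak equation imposes no
  condition on \<open>B'\<^sub>1\<close>.\<close>

definition weak_solution :: "'n::finite coeff \<Rightarrow> ('n point \<Rightarrow> real) \<Rightarrow> bool" where
  "weak_solution a w \<longleftrightarrow>
     (\<forall>\<phi>. test_function unit_half_ball_int \<phi> \<longrightarrow>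
        (LINT x:unit_half_ball_int|lebesgue. \<Sum>i\<in>UNIV. \<Sum>j\<in>UNIV.
           a x $ i $ j * partial_on unit_half_ball j w x * partial_on UNIV i \<phi> x) = 0)"

definition thin_obstacle_solution :: "'n::finite coeff \<Rightarrow> ('n point \<Rightarrow> real) \<Rightarrow> bool" where
  "thin_obstacle_solution a w \<longleftrightarrow>
     (\<exists>\<alpha>. 0 < \<alpha> \<and> \<alpha> \<le> 1/2 \<and> C1_holder_loc unit_half_ball \<alpha> w) \<and>
     weak_solution a w \<and>
     (\<forall>x\<in>unit_thin_ball.
        w x \<ge> 0 \<and> - partial_on unit_half_ball None w x \<ge> 0 \<and>
        w x * partial_on unit_half_ball None w x = 0)"

definition free_boundary :: "('n::finite point \<Rightarrow> real) \<Rightarrow> 'n point set" where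
  "free_boundary w = top_of_set unit_thin_ball frontier_of {x \<in> unit_thin_ball. w x > 0}"

text \<open>Extended logarithm with \<open>ln 0 = -\<infinity>\<close>. The library's real \<open>ln\<close> has \<open>ln 0 = 0\<close>, which would
  give the wrong vanishing order for functions vanishing on half annuli.\<close>

definition ext_ln :: "real \<Rightarrow> ereal" where
  "ext_ln t = (if t \<le> 0 then -\<infinity> else ereal (ln t))"

text \<open>For a \<open>C\<^sup>1\<close> function vanishing at \<open>x0\<close> (in particular at a free boundary point) this is at
  least 1, so \<open>min (vanishing_order w x0) (ereal k)\<close> with real \<open>k\<close> is then a finite exponent.\<close>

definition vanishing_order :: "('n::finite point \<Rightarrow> real) \<Rightarrow> 'n point \<Rightarrow> ereal" where
  "vanishing_order w x0 = Limsup (at_right 0) (\<lambda>r.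
     ext_ln (sqrt (1 / measure lebesgue (half_annulus x0 (r/2) r) *
                     (LINT x:half_annulus x0 (r/2) r|lebesgue. (w x)\<^sup>2)))
       / ereal (ln r))"

end

theory Submission
  imports Defs
begin

text \<open>Translate \<open>x\<^sub>0\<close> to the origin and measure radii with the gauge \<open>N x = (x \<bullet> a(x\<^sub>0)\<^sup>-\<^sup>1 x)\<^sup>1\<^sup>/\<^sup>2\<close>. By Morrey's
  inequality the coefficients are Hoelder continuous, and nothing else about their regularity is
  used. Comparing \<open>w\<close> with the \<open>\<kappa>\<close>-homogeneous extension of its values on a gauge sphere shows that a
  small correction of the Weiss energy \<open>W\<close> becomes nondecreasing after multiplication by
  \<open>exp (c r\<^sup>\<gamma>)\<close>. If the corrected energy is negative at some radius, it stays negative at all smaller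
  ones, the sphere mass is at least \<open>d r\<^sup>2\<^sup>\<kappa>\<close>, and the vanishing order is at most \<open>\<kappa>\<close>. Otherwise the
  normalised sphere mass grows at most like \<open>\<bar>ln r\<bar>\<close> as \<open>r \<rightarrow> 0\<close>, and De Giorgi's iteration turns this
  into a pointwise bound. The theorem follows by letting \<open>\<kappa>\<close> increase to the minimum of the vanishing
  order and the given constant.\<close>

text \<open>A monotonicity formula obtained from domain variations would differentiate the
  coefficients. Comparison with a competitor only freezes them at the point, and the relative error
  of order \<open>r powr \<gamma>\<close> can be absorbed because it is integrable against dr/r. The
  extension keeps the sign on the flat boundary and is Lipschitz for
  \<open>\<kappa> \<ge> 1\<close>, but no better in general, so the weak equation has to be tested
  with Lipschitz functions. Constants must be uniform over all solutions. The Hoelder modulus of the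
  gradient of \<open>w\<close> therefore enters only qualitatively; quantitative bounds come from
  the L2 normalisation and are uniform for \<open>\<kappa>\<close> in a bounded interval. The
  vanishing order excludes negative energy only for strictly smaller \<open>\<kappa>\<close>, hence
  the limit. For \<open>\<kappa> = 1\<close> it is excluded by the vanishing gradient at free
  boundary points.\<close>

abbreviation has_gradient (infix "has'_gradient" 50) where
  "(f has_gradient v) F \<equiv> (f has_derivative (\<lambda>h. v \<bullet> h)) F"

section \<open>Smooth bump functions\<close>

text \<open>One-variable counterpart of \<open>C_times\<close>. The test functions below are
  products of functions of single coordinates, or convolutions with such products, so their
  smoothness reduces to dimension one.\<close>

primrec D_times :: "nat \<Rightarrow> (real \<Rightarrow> real) \<Rightarrow> bool" where
  "D_times 0 f = continuous_on UNIV f"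
| "D_times (Suc m) f = ((\<forall>x. f field_differentiable at x) \<and> D_times m (deriv f))"

definition smooth1 :: "(real \<Rightarrow> real) \<Rightarrow> bool" where
  "smooth1 f \<longleftrightarrow> (\<forall>m. D_times m f)"

lemma D_times_SucI:
  assumes "\<And>x. (f has_real_derivative f' x) (at x)" "D_times m f'"
  shows "D_times (Suc m) f"
proof -
  have "deriv f = f'" using assms(1) by (auto intro: DERIV_imp_deriv)
  then show ?thesis using assms by (auto simp: field_differentiable_def)
qed

lemma D_times_Suc_derivative: "D_times (Suc m) f \<Longrightarrow> (f has_real_derivative deriv f x) (at x)"
  by (auto simp: field_differentiable_derivI)

lemma D_times_continuous: "D_times m f \<Longrightarrow> continuous_on UNIV f"
proof (cases m)
  case (Suc k)
  assume "D_times m f"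
  then have "\<forall>x. (f has_real_derivative deriv f x) (at x)" using Suc D_times_Suc_derivative by blast
  then show ?thesis by (meson DERIV_isCont continuous_at_imp_continuous_on)
qed simp

lemma D_times_Suc_imp: "D_times (Suc m) f \<Longrightarrow> D_times m f"
proof (induction m arbitrary: f)
  case 0 then show ?case using D_times_continuous[of "Suc 0" f] by simp
next
  case (Suc m) then show ?case by simp
qed

lemma D_times_const: "D_times m (\<lambda>x. c)"
proof (induction m arbitrary: c)
  case (Suc m)
  show ?case by (rule D_times_SucI[where f' = "\<lambda>x. 0"]) (auto intro: Suc)
qed simp

lemma D_times_ident: "D_times m (\<lambda>x. x)"
proof (cases m)
  case (Suc k)
  show ?thesis unfolding Suc by (rule D_times_SucI[where f' = "\<lambda>x. 1"]) (auto intro: D_times_const)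
qed simp

lemma D_times_add: "D_times m f \<Longrightarrow> D_times m g \<Longrightarrow> D_times m (\<lambda>x. f x + g x)"
proof (induction m arbitrary: f g)
  case 0 then show ?case by (auto intro: continuous_intros)
next
  case (Suc m)
  show ?case by (rule D_times_SucI[where f' = "\<lambda>x. deriv f x + deriv g x"])
       (use Suc D_times_Suc_derivative in \<open>auto intro!: DERIV_add Suc.IH\<close>)
qed

lemma D_times_mult: "D_times m f \<Longrightarrow> D_times m g \<Longrightarrow> D_times m (\<lambda>x. f x * g x)"
proof (induction m arbitrary: f g)
  case 0 then show ?case by (auto intro: continuous_intros)
next
  case (Suc m)
  show ?case
  proof (rule D_times_SucI)
    show "((\<lambda>x. f x * g x) has_real_derivative (deriv f x * g x + f x * deriv g x)) (at x)" for x
      using DERIV_mult[OF D_times_Suc_derivative[OF Suc.prems(1)] D_times_Suc_derivative[OF Suc.prems(2)]]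
      by (simp add: algebra_simps)
    show "D_times m (\<lambda>x. deriv f x * g x + f x * deriv g x)"
      using Suc.prems D_times_Suc_imp[OF Suc.prems(1)] D_times_Suc_imp[OF Suc.prems(2)]
      by (intro D_times_add Suc.IH) auto
  qed
qed

lemma D_times_affine: "D_times m f \<Longrightarrow> D_times m (\<lambda>x. f (c * x + d))"
proof (induction m arbitrary: f)
  case 0
  then have "continuous_on UNIV f" by simp
  moreover have "continuous_on UNIV (\<lambda>x. c * x + d)" by (intro continuous_intros)
  ultimately show ?case by (auto intro: continuous_on_compose2)
next
  case (Suc m)
  show ?case
  proof (rule D_times_SucI)
    show "((\<lambda>x. f (c * x + d)) has_real_derivative c * deriv f (c * x + d)) (at x)" for x
    proof -
      have "((\<lambda>x. c * x + d) has_real_derivative c) (at x)" by (auto intro!: derivative_eq_intros)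
      from DERIV_chain2[OF D_times_Suc_derivative[OF Suc.prems] this]
      show ?thesis by (simp only: mult.commute[of c])
    qed
    show "D_times m (\<lambda>x. c * deriv f (c * x + d))" using Suc by (intro D_times_mult D_times_const Suc.IH) auto
  qed
qed


lemma smooth1_has_derivative: "smooth1 f \<Longrightarrow> (f has_real_derivative deriv f x) (at x)"
  by (meson smooth1_def D_times_Suc_derivative)

lemma smooth1_deriv: "smooth1 f \<Longrightarrow> smooth1 (deriv f)"
  by (metis smooth1_def D_times.simps(2))

lemma smooth1_const: "smooth1 (\<lambda>x. c)"
  by (simp add: smooth1_def D_times_const)

lemma smooth1_ident: "smooth1 (\<lambda>x. x)"
  by (simp add: smooth1_def D_times_ident)

lemma smooth1_mult: "smooth1 f \<Longrightarrow> smooth1 g \<Longrightarrow> smooth1 (\<lambda>x. f x * g x)"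
  by (simp add: smooth1_def D_times_mult)

lemma smooth1_affine: "smooth1 f \<Longrightarrow> smooth1 (\<lambda>x. f (c * x + d))"
  by (simp add: smooth1_def D_times_affine)

text \<open>The classical function exp(-1/t), flat at 0. The factor \<open>(1 / t) ^ k\<close> makes
  the family stable under differentiation: derivatives are linear combinations of members with
  larger \<open>k\<close>, so one induction on the order gives smoothness for all \<open>k\<close>
  at once.\<close>

definition flat_exp :: "nat \<Rightarrow> real \<Rightarrow> real" where
  "flat_exp k t = (if t \<le> 0 then 0 else (1 / t) ^ k * exp (- (1 / t)))"

lemma flat_exp_tendsto_0: "((\<lambda>t. (1 / t) ^ k * exp (- (1 / t))) \<longlongrightarrow> 0) (at_right (0::real))"
proof -
  have "((\<lambda>x::real. x ^ k / exp x) \<longlongrightarrow> 0) at_top" by (rule tendsto_power_div_exp_0)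
  from filterlim_compose[OF this filterlim_inverse_at_top_right]
  show ?thesis by (simp add: exp_minus field_simps)
qed

lemma flat_exp_has_derivative:
  "(flat_exp k has_real_derivative (flat_exp (k + 2) t - real k * flat_exp (k + 1) t)) (at t)"
proof (cases t "0::real" rule: linorder_cases)
  case less
  have "((\<lambda>t. 0) has_real_derivative 0) (at t)" by simp
  then have "(flat_exp k has_real_derivative 0) (at t)"
    by (rule has_field_derivative_transform_within_open[where S = "{..<0}"])
       (use less in \<open>auto simp: flat_exp_def\<close>)
  then show ?thesis using less by (simp add: flat_exp_def)
next
  case equal
  \<comment> \<open>From the left the difference quotient is 0; from the right it is the same
    expression with \<open>k + 1\<close> in place of \<open>k\<close>.\<close>
  have "((\<lambda>h. (flat_exp k (0 + h) - flat_exp k 0) / h) \<longlongrightarrow> 0) (at 0)"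
  proof (rule filterlim_split_at)
    have "\<forall>\<^sub>F h in at_left 0. (flat_exp k (0 + h) - flat_exp k 0) / h = 0"
      by (auto simp: flat_exp_def eventually_at_left_field intro!: exI[of _ "-1"])
    then show "((\<lambda>h. (flat_exp k (0 + h) - flat_exp k 0) / h) \<longlongrightarrow> 0) (at_left 0)"
      by (simp add: tendsto_eventually)
    have "\<forall>\<^sub>F h in at_right 0. (1 / h) ^ (k+1) * exp (- (1 / h)) = (flat_exp k (0 + h) - flat_exp k 0) / h"
      by (auto simp: flat_exp_def eventually_at_right_field intro!: exI[of _ "1"])
    then show "((\<lambda>h. (flat_exp k (0 + h) - flat_exp k 0) / h) \<longlongrightarrow> 0) (at_right 0)"
      using flat_exp_tendsto_0[of "k+1"] by (rule Lim_transform_eventually[rotated])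
  qed
  then show ?thesis using equal by (simp add: DERIV_def flat_exp_def)
next
  case greater
  have "((\<lambda>t. (1 / t) ^ k * exp (- (1 / t))) has_real_derivative
      (flat_exp (k + 2) t - real k * flat_exp (k + 1) t)) (at t)"
  proof -
    have e: "((\<lambda>t. 1 / t) has_real_derivative - ((1 / t)^2)) (at t)"
      using greater by (auto intro!: derivative_eq_intros simp: power2_eq_square)
    have "((\<lambda>t. (1 / t) ^ k) has_real_derivative real k * (- ((1 / t)^2) * (1 / t) ^ (k - 1))) (at t)"
      using DERIV_power[OF e, of k] by simp
    moreover have "((\<lambda>t. exp (- (1 / t))) has_real_derivative exp (- (1 / t)) * (1 / t)^2) (at t)"
      using DERIV_chain2[OF DERIV_exp DERIV_minus[OF e]] by simp
    ultimately have "((\<lambda>t. (1 / t) ^ k * exp (- (1 / t))) has_real_derivative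
        (real k * (- ((1 / t)^2) * (1 / t) ^ (k - 1))) * exp (- (1 / t)) +
        (exp (- (1 / t)) * (1 / t)^2) * (1 / t) ^ k) (at t)" by (rule DERIV_mult)
    moreover have "(real k * (- ((1 / t)^2) * (1 / t) ^ (k - 1))) * exp (- (1 / t)) +
        (exp (- (1 / t)) * (1 / t)^2) * (1 / t) ^ k = flat_exp (k + 2) t - real k * flat_exp (k + 1) t"
      using greater unfolding flat_exp_def
      by (cases k) (simp_all add: power2_eq_square algebra_simps del: power_one_over)
    ultimately show ?thesis by simp
  qed
  then show ?thesis by (rule has_field_derivative_transform_within_open[where S = "{0<..}"])
       (use greater in \<open>auto simp: flat_exp_def\<close>)
qed

lemma smooth1_flat_exp: "smooth1 (flat_exp k)"
proof -
  have "D_times m (flat_exp k)" for m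
  proof (induction m arbitrary: k)
    case 0
    show ?case using DERIV_isCont[OF flat_exp_has_derivative] by (simp add: continuous_at_imp_continuous_on)
  next
    case (Suc m)
    have "D_times m (\<lambda>t. flat_exp (k + 2) t + (- real k) * flat_exp (k + 1) t)"
      by (intro D_times_add D_times_mult D_times_const Suc)
    then show ?case using D_times_SucI[OF flat_exp_has_derivative] by simp
  qed
  then show ?thesis by (simp add: smooth1_def)
qed

definition bump1 :: "real \<Rightarrow> real \<Rightarrow> real \<Rightarrow> real" where
  "bump1 c d s = flat_exp 0 (s - c) * flat_exp 0 (d - s)"

lemma smooth1_bump1: "smooth1 (bump1 c d)"
proof -
  have "smooth1 (\<lambda>s. flat_exp 0 (1 * s + (- c)) * flat_exp 0 ((-1) * s + d))"
    by (intro smooth1_mult smooth1_affine smooth1_flat_exp)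
  then show ?thesis by (simp add: bump1_def[abs_def] algebra_simps)
qed

lemma bump1_nonneg: "0 \<le> bump1 c d s"
  by (simp add: bump1_def flat_exp_def)

lemma bump1_pos_iff: "0 < bump1 c d s \<longleftrightarrow> c < s \<and> s < d"
  by (auto simp: bump1_def flat_exp_def)

lemma bump1_eq_0_iff: "bump1 c d s = 0 \<longleftrightarrow> s \<le> c \<or> d \<le> s"
  by (auto simp: bump1_def flat_exp_def)

text \<open>A partial derivative of such a product is again one, with a single factor replaced by
  its derivative. Inductions on the order of differentiability therefore generalise over the family
  \<open>b\<close>.\<close>

definition prodf :: "('m \<Rightarrow> real \<Rightarrow> real) \<Rightarrow> real ^ 'm::finite \<Rightarrow> real" where
  "prodf b x = (\<Prod>i\<in>UNIV. b i (x $ i))"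

definition prodf_grad :: "('m \<Rightarrow> real \<Rightarrow> real) \<Rightarrow> real ^ 'm::finite \<Rightarrow> real ^ 'm" where
  "prodf_grad b x = (\<chi> k. prodf (b(k := deriv (b k))) x)"

lemma prodf_has_derivative:
  assumes "\<And>i. smooth1 (b i)"
  shows "(prodf b has_gradient prodf_grad b x) (at x)"
proof -
  have d: "((\<lambda>x. b i (x $ i)) has_derivative (\<lambda>h. deriv (b i) (x $ i) * (h $ i))) (at x)" for i
  proof -
    have "((\<lambda>y. y $ i) has_derivative (\<lambda>h. h $ i)) (at x)"
      by (rule bounded_linear_imp_has_derivative) (rule bounded_linear_vec_nth)
    from has_derivative_compose[OF this, of "b i" "\<lambda>h. deriv (b i) (x $ i) * h"]
    show ?thesis using smooth1_has_derivative[OF assms, of i "x $ i"] by (simp add: has_field_derivative_def)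
  qed
  have "(prodf b has_derivative (\<lambda>h. \<Sum>i\<in>UNIV. (deriv (b i) (x $ i) * (h $ i)) * (\<Prod>j\<in>UNIV - {i}. b j (x $ j)))) (at x)"
    unfolding prodf_def[abs_def] by (rule has_derivative_prod) (rule d)
  moreover have "(\<Sum>i\<in>UNIV. (deriv (b i) (x $ i) * (h $ i)) * (\<Prod>j\<in>UNIV - {i}. b j (x $ j))) = prodf_grad b x \<bullet> h" for h
  proof -
    have "prodf (b(i := deriv (b i))) x = deriv (b i) (x $ i) * (\<Prod>j\<in>UNIV - {i}. b j (x $ j))" for i
      unfolding prodf_def by (subst prod.remove[of UNIV i]) auto
    then show ?thesis by (simp add: inner_vec_def prodf_grad_def mult_ac)
  qed
  ultimately show ?thesis by simp
qed

lemma partial_onI: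
  assumes "(f has_gradient g) (at x)"
  shows "partial_on UNIV k f x = g $ k"
proof -
  have "partial_on UNIV k f x = g \<bullet> axis k 1"
    unfolding partial_on_def frechet_derivative_at[OF assms, symmetric] ..
  then show ?thesis by (simp add: inner_axis)
qed

lemma C_times_SucI:
  assumes "\<And>x. (f has_gradient g x) (at x)" "\<And>k. C_times m (\<lambda>x. g x $ k)"
  shows "C_times (Suc m) f"
proof -
  have "partial_on UNIV k f = (\<lambda>x. g x $ k)" for k using partial_onI[OF assms(1)] by auto
  then show ?thesis using assms by (auto simp: differentiable_on_def differentiable_def)
qed

lemma continuous_prodf:
  assumes "\<And>i. smooth1 (b i)"
  shows "continuous_on S (prodf b)"
  by (intro continuous_at_imp_continuous_on ballI has_derivative_continuous[OF prodf_has_derivative[OF assms]])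

lemma continuous_prodf_grad:
  assumes "\<And>i. smooth1 (b i)"
  shows "continuous_on S (prodf_grad b)" unfolding prodf_grad_def[abs_def]
  by (intro continuous_on_vec_lambda continuous_prodf) (simp add: assms smooth1_deriv)

lemma C_times_prodf:
  assumes "\<And>i. smooth1 (b i)"
  shows "C_times m (prodf b)" using assms
proof (induction m arbitrary: b)
  case 0 then show ?case by (simp add: continuous_prodf)
next
  case (Suc m)
  show ?case
  proof (rule C_times_SucI[OF prodf_has_derivative])
    show "C_times m (\<lambda>x. prodf_grad b x $ k)" for k
      unfolding prodf_grad_def vec_lambda_beta by (rule Suc.IH) (simp add: Suc.prems smooth1_deriv)
  qed (rule Suc.prems)
qed

text \<open>The kernel takes the derivative, so continuity of \<open>\<phi>\<close> suffices. The
  integral runs over a fixed box, later one that contains the support of \<open>\<phi>\<close>, so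
  that Leibniz' rule applies; the derivative is again a convolution with products, which permits
  iteration.\<close>

lemma conv_prodf_has_derivative:
  fixes \<phi> :: "real ^ 'm::finite \<Rightarrow> real"
  assumes b: "\<And>i. smooth1 (b i)" and \<phi>: "continuous_on UNIV \<phi>"
  shows "((\<lambda>x. integral (cbox l u) (\<lambda>y. \<phi> y * prodf b (x - y))) has_derivative
    (\<lambda>h. (\<chi> k. integral (cbox l u) (\<lambda>y. \<phi> y * prodf (b(k := deriv (b k))) (x - y))) \<bullet> h)) (at x)"
proof -
  define fx where "fx x y = \<phi> y *\<^sub>R blinfun_inner_right (prodf_grad b (x - y))" for x y
  have "((\<lambda>x. integral (cbox l u) (\<lambda>y. \<phi> y * prodf b (x - y))) has_derivative
      integral (cbox l u) (fx x)) (at x within UNIV)" (is "(_ has_derivative ?D) _")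
  proof (rule leibniz_rule)
    show "((\<lambda>x. \<phi> t * prodf b (x - t)) has_derivative blinfun_apply (fx x t)) (at x within UNIV)" for x t
    proof -
      have "((\<lambda>x. prodf b (x - t)) has_gradient prodf_grad b (x - t)) (at x)"
        by (rule has_derivative_compose[where f = "\<lambda>x. x - t" and f' = "\<lambda>h. h", simplified])
           (auto intro!: derivative_eq_intros prodf_has_derivative b)
      then show ?thesis by (auto intro!: derivative_eq_intros simp: fx_def blinfun.scaleR_left inner_commute)
    qed
    show "(\<lambda>y. \<phi> y * prodf b (x - y)) integrable_on cbox l u" for x
      by (intro integrable_continuous continuous_intros continuous_on_compose2[OF continuous_prodf[OF b]]
          continuous_on_subset[OF \<phi>]) auto
    have "continuous_on (UNIV \<times> cbox l u) (\<lambda>p. \<phi> (snd p) *\<^sub>R blinfun_inner_right (prodf_grad b (fst p - snd p)))"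
      by (intro continuous_intros continuous_on_compose2[OF continuous_prodf_grad[OF b]]
          continuous_on_compose2[OF \<phi>]
          bounded_linear.continuous_on[OF bounded_linear_blinfun_inner_right]) auto
    then show "continuous_on (UNIV \<times> cbox l u) (\<lambda>(x, t). fx x t)" by (simp add: fx_def case_prod_beta)
  qed auto
  moreover have "?D = (\<lambda>h. (\<chi> k. integral (cbox l u) (\<lambda>y. \<phi> y * prodf (b(k := deriv (b k))) (x - y))) \<bullet> h)"
  proof
    fix h
    have b': "\<And>i. smooth1 ((b(k := deriv (b k))) i)" for k using b smooth1_deriv by simp
    have c: "continuous_on (cbox l u) (\<lambda>y. \<phi> y * prodf (b(k := deriv (b k))) (x - y))" for k
      by (intro continuous_intros continuous_on_compose2[OF continuous_prodf[OF b']]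
          continuous_on_subset[OF \<phi>]) auto
    have cf: "continuous_on (cbox l u) (fx x)" unfolding fx_def
      by (intro continuous_intros continuous_on_compose2[OF continuous_prodf_grad[OF b]]
          continuous_on_subset[OF \<phi>]
          bounded_linear.continuous_on[OF bounded_linear_blinfun_inner_right]) auto
    have "integral (cbox l u) (fx x) h = integral (cbox l u) (\<lambda>y. fx x y h)"
      by (rule blinfun_apply_integral) (rule integrable_continuous[OF cf])
    also have "\<dots> = integral (cbox l u) (\<lambda>y. \<Sum>k\<in>UNIV. (\<phi> y * prodf (b(k := deriv (b k))) (x - y)) * h $ k)"
      by (simp add: fx_def blinfun.scaleR_left inner_vec_def prodf_grad_def sum_distrib_left mult_ac)
    also have "\<dots> = (\<Sum>k\<in>UNIV. integral (cbox l u) (\<lambda>y. \<phi> y * prodf (b(k := deriv (b k))) (x - y)) * h $ k)"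
      by (subst integral_sum) (auto intro!: integrable_continuous continuous_intros c)
    finally show "integral (cbox l u) (fx x) h = (\<chi> k. integral (cbox l u)
        (\<lambda>y. \<phi> y * prodf (b(k := deriv (b k))) (x - y))) \<bullet> h" by (simp add: inner_vec_def)
  qed
  ultimately show ?thesis by simp
qed

lemma C_times_conv_prodf:
  fixes \<phi> :: "real ^ 'm::finite \<Rightarrow> real"
  assumes "\<And>i. smooth1 (b i)" "continuous_on UNIV \<phi>"
  shows "C_times m (\<lambda>x. integral (cbox l u) (\<lambda>y. \<phi> y * prodf b (x - y)))" using assms(1)
proof (induction m arbitrary: b)
  case 0
  show ?case unfolding C_times.simps by (intro continuous_at_imp_continuous_on ballI
        has_derivative_continuous[OF conv_prodf_has_derivative[OF 0 assms(2)]])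
next
  case (Suc m)
  show ?case
  proof (rule C_times_SucI[OF conv_prodf_has_derivative])
    show "C_times m (\<lambda>x. (\<chi> k. integral (cbox l u) (\<lambda>y. \<phi> y * prodf (b(k := deriv (b k))) (x - y))) $ k)" for k
      unfolding vec_lambda_beta by (rule Suc.IH) (simp add: Suc.prems smooth1_deriv)
  qed (rule Suc.prems assms)+
qed

definition cube_bump :: "real \<Rightarrow> real ^ 'm::finite \<Rightarrow> real" where
  "cube_bump e = prodf (\<lambda>i. bump1 (- e) e)"

lemma cube_bump_nonneg: "0 \<le> cube_bump e x"
  unfolding cube_bump_def prodf_def by (intro prod_nonneg) (simp add: bump1_nonneg)

lemma cube_bump_le_1: "cube_bump e x \<le> 1"
proof -
  have "flat_exp 0 t \<le> 1" "0 \<le> flat_exp 0 t" for t by (simp_all add: flat_exp_def)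
  then have "bump1 c d s \<le> 1" for c d s unfolding bump1_def by (simp add: mult_le_one)
  then show ?thesis unfolding cube_bump_def prodf_def by (intro prod_le_1) (simp add: bump1_nonneg)
qed

lemma cube_bump_pos: "0 < cube_bump e x \<longleftrightarrow> (\<forall>i. \<bar>x $ i\<bar> < e)"
proof
  assume pos: "0 < cube_bump e x"
  show "\<forall>i. \<bar>x $ i\<bar> < e"
  proof
    fix i
    have "bump1 (- e) e (x $ i) \<noteq> 0"
    proof
      assume "bump1 (- e) e (x $ i) = 0"
      then have "cube_bump e x = 0" unfolding cube_bump_def prodf_def by (intro prod_zero) auto
      then show False using pos by simp
    qed
    then show "\<bar>x $ i\<bar> < e" by (simp add: bump1_eq_0_iff abs_less_iff)
  qed
next
  assume a: "\<forall>i. \<bar>x $ i\<bar> < e"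
  have "0 < bump1 (- e) e (x $ i)" for i using a[rule_format, of i] unfolding bump1_pos_iff by linarith
  then show "0 < cube_bump e x" unfolding cube_bump_def prodf_def by (simp add: prod_pos)
qed

text \<open>The support is a cube of half-width \<open>e\<close>; since the norm is at most the sum
  of the absolute coordinates, the cube lies in the ball of radius
  \<open>e * real CARD('m)\<close>.\<close>

lemma cube_bump_eq_0: "cube_bump e x = 0" if "norm x \<ge> e * real CARD('m)" "e > 0" for x :: "real ^ 'm::finite"
proof (rule ccontr)
  assume "cube_bump e x \<noteq> 0"
  then have *: "\<bar>x $ i\<bar> < e" for i using cube_bump_pos[of e x] cube_bump_nonneg[of e x] by auto
  have "norm x \<le> (\<Sum>i\<in>UNIV. \<bar>x $ i\<bar>)" by (rule norm_le_l1_cart)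
  also have "\<dots> < (\<Sum>i\<in>(UNIV::'m set). e)" using * by (intro sum_strict_mono) auto
  finally show False using that by (simp add: mult.commute)
qed

lemma continuous_cube_bump: "continuous_on S (cube_bump e)"
  unfolding cube_bump_def by (rule continuous_prodf) (rule smooth1_bump1)

section \<open>Lipschitz test functions\<close>

lemma nn_integral_lborel_affine:
  fixes f :: "'a::euclidean_space \<Rightarrow> ennreal"
  assumes [measurable]: "f \<in> borel_measurable borel" and c: "c \<noteq> 0"
  shows "(\<integral>\<^sup>+x. f x \<partial>lborel) = ennreal (\<bar>c\<bar> ^ DIM('a)) * (\<integral>\<^sup>+x. f (t + c *\<^sub>R x) \<partial>lborel)"
  by (subst lborel_affine[OF c, of t])
     (simp add: nn_integral_density nn_integral_distr nn_integral_cmult)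

lemma integral_lborel_translate:
  fixes f :: "'a::euclidean_space \<Rightarrow> 'b::{banach, second_countable_topology}"
  assumes [measurable]: "f \<in> borel_measurable borel"
  shows "(LBINT x. f (t + x)) = (LBINT x. f x)"
  by (subst (2) lborel_distr_plus[of t, symmetric]) (simp add: integral_distr)

lemma borel_measurable_vec_nth [measurable (raw)]:
  fixes f :: "'a \<Rightarrow> real ^ 'm::finite"
  assumes "f \<in> borel_measurable M"
  shows "(\<lambda>x. f x $ k) \<in> borel_measurable M"
proof -
  have "(\<lambda>x. f x \<bullet> axis k 1) \<in> borel_measurable M" using assms by measurable
  then show ?thesis by (simp add: inner_axis)
qed

lemma integrable_compact_support:
  fixes f :: "'a::euclidean_space \<Rightarrow> 'b::{banach, second_countable_topology}"
  assumes "compact S" "continuous_on S f" "\<And>x. x \<notin> S \<Longrightarrow> f x = 0"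
  shows "integrable lborel f"
proof -
  have "(\<lambda>x. indicator S x *\<^sub>R f x) = f" using assms(3) by (auto simp: indicator_def fun_eq_iff)
  then show ?thesis using borel_integrable_compact[OF assms(1,2)] by simp
qed

lemma integrable_bounded_on:
  fixes f :: "'a \<Rightarrow> real"
  assumes "f \<in> borel_measurable M" "A \<in> sets M" "emeasure M A < \<infinity>"
    and "\<And>x. x \<in> A \<Longrightarrow> \<bar>f x\<bar> \<le> B" "\<And>x. x \<notin> A \<Longrightarrow> f x = 0"
  shows "integrable M f" by (rule integrableI_bounded_set[where A = A and B = B]) (use assms in auto)

lemma AE_zero_continuous_on_open:
  fixes f :: "'a::euclidean_space \<Rightarrow> real"
  assumes "open U" "continuous_on U f" "AE x in lborel. x \<in> U \<longrightarrow> f x = 0" "x \<in> U"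
  shows "f x = 0"
proof (rule ccontr)
  assume "f x \<noteq> 0"
  have "open (U \<inter> f -` (- {0}))" using assms by (intro continuous_open_preimage) auto
  moreover have "U \<inter> f -` (- {0}) \<in> null_sets lborel"
  proof (rule AE_iff_null_sets[THEN iffD2])
    show "U \<inter> f -` (- {0}) \<in> sets lborel" using \<open>open (U \<inter> f -` (- {0}))\<close> by simp
    show "AE x in lborel. x \<notin> U \<inter> f -` (- {0})" using assms(3) by eventually_elim auto
  qed
  then have "negligible (U \<inter> f -` (- {0}))" by (simp add: negligible_iff_null_sets null_sets_completionI)
  ultimately have "U \<inter> f -` (- {0}) = {}" using open_not_negligible by blast
  then show False using \<open>f x \<noteq> 0\<close> assms(4) by auto
qed

text \<open>By the mean value theorem the bound on the derivatives is also a bound on the difference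
  quotients, so dominated convergence applies.\<close>

lemma has_derivative_integral_param:
  fixes f f' :: "real \<Rightarrow> 'a \<Rightarrow> real"
  assumes r0: "r0 \<in> {a<..<b}"
    and int: "\<And>r. r \<in> {a<..<b} \<Longrightarrow> integrable M (f r)"
    and der: "\<And>r x. r \<in> {a<..<b} \<Longrightarrow> x \<in> space M \<Longrightarrow> ((\<lambda>r. f r x) has_real_derivative f' r x) (at r)"
    and bnd: "\<And>r x. r \<in> {a<..<b} \<Longrightarrow> x \<in> space M \<Longrightarrow> \<bar>f' r x\<bar> \<le> w x"
    and w: "integrable M w"
    and meas: "f' r0 \<in> borel_measurable M"
  shows "((\<lambda>r. \<integral>x. f r x \<partial>M) has_real_derivative (\<integral>x. f' r0 x \<partial>M)) (at r0)"
  unfolding has_field_derivative_iff tendsto_at_iff_sequentially comp_def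
proof (intro allI impI)
  fix X :: "nat \<Rightarrow> real"
  assume X: "\<forall>i. X i \<in> UNIV - {r0}" "X \<longlonglongrightarrow> r0"
  have ev: "\<forall>\<^sub>F i in sequentially. X i \<in> {a<..<b}"
    using topological_tendstoD[OF X(2) open_greaterThanLessThan r0] .
  \<comment> \<open>The value 0 outside the interval makes the domination hold for every index; the
    sequence is only eventually inside.\<close>
  define s where "s i x = (if X i \<in> {a<..<b} then (f (X i) x - f r0 x) / (X i - r0) else 0)" for i x
  have "(\<lambda>i. \<integral>x. s i x \<partial>M) \<longlonglongrightarrow> (\<integral>x. f' r0 x \<partial>M)"
  proof (rule integral_dominated_convergence[where w = w])
    show "s i \<in> borel_measurable M" for i
      using borel_measurable_integrable[OF int[OF r0]] borel_measurable_integrable[OF int[of "X i"]]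
      unfolding s_def by (cases "X i \<in> {a<..<b}") auto
    show "AE x in M. (\<lambda>i. s i x) \<longlonglongrightarrow> f' r0 x"
    proof (rule AE_I2)
      fix x assume x: "x \<in> space M"
      have "((\<lambda>y. (f y x - f r0 x) / (y - r0)) \<longlongrightarrow> f' r0 x) (at r0)"
        using der[OF r0 x] by (simp add: has_field_derivative_iff)
      then have "(\<lambda>i. (f (X i) x - f r0 x) / (X i - r0)) \<longlonglongrightarrow> f' r0 x"
        using X by (auto simp: tendsto_at_iff_sequentially comp_def)
      moreover have "\<forall>\<^sub>F i in sequentially. (f (X i) x - f r0 x) / (X i - r0) = s i x"
        using ev by eventually_elim (simp add: s_def)
      ultimately show "(\<lambda>i. s i x) \<longlonglongrightarrow> f' r0 x" by (rule Lim_transform_eventually)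
    qed
    show "AE x in M. norm (s i x) \<le> w x" for i
    proof (rule AE_I2)
      fix x assume x: "x \<in> space M"
      show "norm (s i x) \<le> w x"
      proof (cases "X i \<in> {a<..<b}")
        case True
        have "norm (f (X i) x - f r0 x) \<le> w x * norm (X i - r0)"
        proof (rule field_differentiable_bound[of "{a<..<b}" "\<lambda>r. f r x" "\<lambda>r. f' r x"])
          show "((\<lambda>r. f r x) has_real_derivative f' z x) (at z within {a<..<b})" if "z \<in> {a<..<b}" for z
            using der[OF that x] by (rule has_field_derivative_at_within)
        qed (use True r0 x bnd in auto)
        moreover have "X i \<noteq> r0" using X by auto
        ultimately show ?thesis using True by (simp add: s_def divide_le_eq)
      next
        case False
        have "0 \<le> w x" using bnd[OF r0 x] by linarith
        moreover have "s i x = 0" using False unfolding s_def by (rule if_not_P)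
        ultimately show ?thesis by simp
      qed
    qed
  qed (use meas w in auto)
  moreover have "\<forall>\<^sub>F i in sequentially. (\<integral>x. s i x \<partial>M) = ((\<integral>x. f (X i) x \<partial>M) - (\<integral>x. f r0 x \<partial>M)) / (X i - r0)"
    using ev
  proof eventually_elim
    case (elim i)
    then show ?case using int[OF r0] int[OF elim] by (simp add: s_def)
  qed
  ultimately show "(\<lambda>i. ((\<integral>x. f (X i) x \<partial>M) - (\<integral>x. f r0 x \<partial>M)) / (X i - r0)) \<longlonglongrightarrow> (\<integral>x. f' r0 x \<partial>M)"
    by (rule Lim_transform_eventually)
qed

lemma cube_bump_integrable: "e > 0 \<Longrightarrow> integrable lborel (cube_bump e :: real ^ 'm::finite \<Rightarrow> real)"
  by (rule integrable_compact_support[of "cball 0 (e * real CARD('m))"])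
    (auto simp: cube_bump_eq_0 continuous_cube_bump)

lemma cube_bump_integral_pos: "e > 0 \<Longrightarrow> 0 < (LBINT x. cube_bump e (x :: real ^ 'm::finite))"
proof (rule ccontr)
  assume e: "e > 0" and "\<not> 0 < (LBINT x. cube_bump e (x :: real ^ 'm))"
  moreover have "0 \<le> (LBINT x. cube_bump e (x :: real ^ 'm))" by (simp add: cube_bump_nonneg)
  ultimately have "AE x in lborel. cube_bump e (x :: real ^ 'm) = 0"
    using integral_nonneg_eq_0_iff_AE[OF cube_bump_integrable[OF e]] cube_bump_nonneg by force
  then have "cube_bump e (0 :: real ^ 'm) = 0"
    using AE_zero_continuous_on_open[of UNIV "cube_bump e" 0] continuous_cube_bump by auto
  then show False using cube_bump_pos[of e "0 :: real ^ 'm"] e by simp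
qed

text \<open>The mollification of a Lipschitz function can be differentiated by moving the difference
  quotients onto the function, since these are bounded and converge almost everywhere.\<close>

lemma conv_cube_bump_gradient:
  fixes \<phi> :: "real ^ 'm::finite \<Rightarrow> real"
  assumes e: "e > 0" and lip: "\<And>x y. \<bar>\<phi> x - \<phi> y\<bar> \<le> L * norm (x - y)"
    and supp: "\<And>x. x \<notin> cbox l u \<Longrightarrow> \<phi> x = 0"
    and N: "N \<in> null_sets lborel"
    and der: "\<And>x. x \<notin> N \<Longrightarrow> (\<phi> has_gradient g x) (at x)"
    and [measurable]: "g \<in> borel_measurable borel"
  shows "partial_on UNIV k (\<lambda>x. integral (cbox l u) (\<lambda>y. \<phi> y * cube_bump e (x - y))) x
     = (LBINT y. g y $ k * cube_bump e (x - y))"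
proof -
  define \<Phi> where "\<Phi> x = integral (cbox l u) (\<lambda>y. \<phi> y * cube_bump e (x - y))" for x
  have L0: "L \<ge> 0" using order_trans[OF abs_ge_zero lip[of "axis k 1" 0]] by (simp add: norm_axis_1)
  have c\<phi>: "continuous_on UNIV \<phi>"
  proof (rule lipschitz_on_continuous_on)
    show "lipschitz_on L UNIV \<phi>" using lip L0 by (intro lipschitz_onI) (auto simp: dist_norm)
  qed
  have [measurable]: "\<phi> \<in> borel_measurable borel" by (rule borel_measurable_continuous_onI[OF c\<phi>])
  have [measurable]: "(cube_bump e :: real ^ 'm \<Rightarrow> real) \<in> borel_measurable borel"
    by (rule borel_measurable_continuous_onI[OF continuous_cube_bump])
  have cc: "continuous_on S (\<lambda>y. \<phi> y * cube_bump e (x - y))" for S x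
    by (intro continuous_intros continuous_on_compose2[OF continuous_cube_bump[of UNIV]]
          continuous_on_subset[OF c\<phi>]) auto
  have \<Phi>: "\<Phi> x = (LBINT y. \<phi> y * cube_bump e (x - y))" and
    int: "integrable lborel (\<lambda>y. \<phi> y * cube_bump e (x - y))" for x
  proof -
    have eq: "indicator (cbox l u) y *\<^sub>R (\<phi> y * cube_bump e (x - y)) = \<phi> y * cube_bump e (x - y)" for y
      using supp by (auto simp: indicator_def)
    show int: "integrable lborel (\<lambda>y. \<phi> y * cube_bump e (x - y))"
      by (rule integrable_compact_support[OF compact_cbox cc]) (use supp in auto)
    have "\<Phi> x = (LINT y:cbox l u|lborel. \<phi> y * cube_bump e (x - y))"
      unfolding \<Phi>_def using int by (intro set_borel_integral_eq_integral(2)[symmetric]) (simp only: set_integrable_def eq)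
    then show "\<Phi> x = (LBINT y. \<phi> y * cube_bump e (x - y))" by (simp only: set_lebesgue_integral_def eq)
  qed
  let ?e = "axis k 1 :: real ^ 'm"
  define q where "q j y = (\<phi> (y + (1 / real (Suc j)) *\<^sub>R ?e) - \<phi> y) * real (Suc j)" for j y
  have [measurable]: "q j \<in> borel_measurable borel" for j unfolding q_def by measurable
  have quot: "(\<Phi> (x + (1 / real (Suc j)) *\<^sub>R ?e) - \<Phi> x) * real (Suc j)
      = (LBINT y. q j y * cube_bump e (x - y))" for j
  proof -
    let ?t = "(1 / real (Suc j)) *\<^sub>R ?e"
    have "\<Phi> (x + ?t) = (LBINT y. \<phi> (?t + y) * cube_bump e (x + ?t - (?t + y)))"
      unfolding \<Phi> by (rule integral_lborel_translate[symmetric]) measurable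
    also have "\<dots> = (LBINT y. \<phi> (y + ?t) * cube_bump e (x - y))" by (simp add: algebra_simps)
    finally have 1: "\<Phi> (x + ?t) = (LBINT y. \<phi> (y + ?t) * cube_bump e (x - y))" .
    have i2: "integrable lborel (\<lambda>y. \<phi> (y + ?t) * cube_bump e (x - y))"
    proof -
      have "integrable lborel (\<lambda>y. \<phi> y * cube_bump e (x + ?t - y))" by (rule int)
      then have "integrable (distr lborel borel ((+) ?t)) (\<lambda>y. \<phi> y * cube_bump e (x + ?t - y))"
        by (simp only: lborel_distr_plus)
      then have "integrable lborel (\<lambda>y. \<phi> (?t + y) * cube_bump e (x + ?t - (?t + y)))"
        by (subst (asm) integrable_distr_eq) auto
      then show ?thesis by (simp add: algebra_simps)
    qed
    have "(\<Phi> (x + ?t) - \<Phi> x) * real (Suc j) =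
        (LBINT y. \<phi> (y + ?t) * cube_bump e (x - y) - \<phi> y * cube_bump e (x - y)) * real (Suc j)"
      unfolding 1 \<Phi>[of x] by (subst Bochner_Integration.integral_diff[OF i2 int]) (rule refl)
    also have "\<dots> = (LBINT y. (\<phi> (y + ?t) * cube_bump e (x - y) - \<phi> y * cube_bump e (x - y)) * real (Suc j))"
      by (rule integral_mult_left_zero[symmetric])
    also have "\<dots> = (LBINT y. q j y * cube_bump e (x - y))"
      by (intro Bochner_Integration.integral_cong refl) (simp only: q_def algebra_simps)
    finally show ?thesis .
  qed
  have lim: "(\<lambda>j. \<integral>y. q j y * cube_bump e (x - y) \<partial>lborel) \<longlonglongrightarrow> (LBINT y. g y $ k * cube_bump e (x - y))"
  proof (rule integral_dominated_convergence[where w = "\<lambda>y. L * cube_bump e (x - y)"])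
    have "integrable lborel (\<lambda>y. cube_bump e (x - y))"
    proof (rule integrable_compact_support[of "cball x (e * real CARD('m))"])
      show "cube_bump e (x - y) = 0" if "y \<notin> cball x (e * real CARD('m))" for y
        using that e cube_bump_eq_0[of e "x - y"] by (auto simp: dist_norm)
      show "continuous_on (cball x (e * real CARD('m))) (\<lambda>y. cube_bump e (x - y))"
        by (intro continuous_intros continuous_on_compose2[OF continuous_cube_bump[of UNIV]]) auto
    qed simp
    then show "integrable lborel (\<lambda>y. L * cube_bump e (x - y))" by simp
    have "AE y in lborel. y \<notin> N" using N by (rule AE_not_in)
    then show "AE y in lborel. (\<lambda>j. q j y * cube_bump e (x - y)) \<longlonglongrightarrow> g y $ k * cube_bump e (x - y)"
    proof eventually_elim
      case (elim y)
      have "((\<lambda>t. \<phi> (y + t *\<^sub>R ?e)) has_derivative (\<lambda>t. g y \<bullet> (t *\<^sub>R ?e))) (at 0)"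
        by (rule has_derivative_compose[where f = "\<lambda>t. y + t *\<^sub>R ?e" and f' = "\<lambda>t. t *\<^sub>R ?e"])
           (use der[OF elim] in \<open>auto intro!: derivative_eq_intros\<close>)
      then have "((\<lambda>t. \<phi> (y + t *\<^sub>R ?e)) has_real_derivative g y $ k) (at 0)"
        by (simp add: has_field_derivative_def inner_axis mult_commute_abs)
      then have "((\<lambda>t. (\<phi> (y + t *\<^sub>R ?e) - \<phi> y) / t) \<longlongrightarrow> g y $ k) (at 0)" by (simp add: DERIV_def)
      moreover have "filterlim (\<lambda>j. 1 / real (Suc j)) (at 0) sequentially"
        unfolding filterlim_at using lim_inverse_n'[THEN LIMSEQ_Suc] by auto
      ultimately have "(\<lambda>j. (\<phi> (y + (1 / real (Suc j)) *\<^sub>R ?e) - \<phi> y) / (1 / real (Suc j))) \<longlonglongrightarrow> g y $ k"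
        by (rule filterlim_compose)
      then have "(\<lambda>j. q j y) \<longlonglongrightarrow> g y $ k" by (simp add: q_def)
      then show ?case by (intro tendsto_intros)
    qed
    show "AE y in lborel. norm (q j y * cube_bump e (x - y)) \<le> L * cube_bump e (x - y)" for j
    proof (rule AE_I2)
      fix y
      have "\<bar>q j y\<bar> \<le> L" using lip[of "y + (1 / real (Suc j)) *\<^sub>R ?e" y]
        by (simp add: q_def abs_mult pos_le_divide_eq del: of_nat_Suc)
      then show "norm (q j y * cube_bump e (x - y)) \<le> L * cube_bump e (x - y)"
        using cube_bump_nonneg[of e "x - y"] by (simp add: abs_mult mult_right_mono)
    qed
  qed measurable
  obtain G where dPhi: "(\<Phi> has_gradient G) (at x)"
    using conv_prodf_has_derivative[of "\<lambda>i. bump1 (- e) e" \<phi> l u x, OF smooth1_bump1 c\<phi>]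
    unfolding \<Phi>_def cube_bump_def by blast
  have "((\<lambda>t. \<Phi> (x + t *\<^sub>R ?e)) has_derivative (\<lambda>t. G \<bullet> (t *\<^sub>R ?e))) (at 0)"
    by (rule has_derivative_compose[where f = "\<lambda>t. x + t *\<^sub>R ?e" and f' = "\<lambda>t. t *\<^sub>R ?e"])
       (use dPhi in \<open>auto intro!: derivative_eq_intros\<close>)
  then have "((\<lambda>t. \<Phi> (x + t *\<^sub>R ?e)) has_real_derivative G $ k) (at 0)"
    by (simp add: has_field_derivative_def inner_axis mult_commute_abs del: vec_lambda_beta)
  then have "((\<lambda>t. (\<Phi> (x + t *\<^sub>R ?e) - \<Phi> x) / t) \<longlongrightarrow> G $ k) (at 0)" by (simp add: DERIV_def)
  moreover have "filterlim (\<lambda>j. 1 / real (Suc j)) (at 0) sequentially"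
    unfolding filterlim_at using lim_inverse_n'[THEN LIMSEQ_Suc] by auto
  ultimately have "(\<lambda>j. (\<Phi> (x + (1 / real (Suc j)) *\<^sub>R ?e) - \<Phi> x) / (1 / real (Suc j))) \<longlonglongrightarrow> G $ k"
    by (rule filterlim_compose)
  then have "(\<lambda>j. \<integral>y. q j y * cube_bump e (x - y) \<partial>lborel) \<longlonglongrightarrow> G $ k" unfolding quot[symmetric] by simp
  then have "G $ k = (LBINT y. g y $ k * cube_bump e (x - y))" using lim LIMSEQ_unique by blast
  moreover have "partial_on UNIV k \<Phi> x = G $ k" using dPhi by (rule partial_onI)
  ultimately show ?thesis unfolding \<Phi>_def by simp
qed

text \<open>Mollifications of \<open>\<phi>\<close> are admissible test functions, and their partial
  derivatives are mollifications of \<open>g\<close>. Fubini's theorem moves the kernel onto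
  \<open>F\<close>, and uniform continuity of \<open>F\<close> near \<open>K\<close> bounds the
  resulting error by \<open>\<delta> * L * measure lborel K\<close>. The kernel has mass
  \<open>c\<close> rather than 1; this factor is divided out.\<close>

lemma weak_eq_lipschitz:
  fixes F g :: "real ^ 'm::finite \<Rightarrow> real ^ 'm" and \<phi> :: "real ^ 'm \<Rightarrow> real"
  assumes U: "open U" and F: "continuous_on U F"
    and weak: "\<And>\<psi>. test_function U \<psi> \<Longrightarrow>
      (LINT x:U|lebesgue. \<Sum>i\<in>UNIV. F x $ i * partial_on UNIV i \<psi> x) = 0"
    and K: "compact K" "K \<subseteq> U"
    and lip: "\<And>x y. \<bar>\<phi> x - \<phi> y\<bar> \<le> L * norm (x - y)"
    and supp: "\<And>x. x \<notin> K \<Longrightarrow> \<phi> x = 0"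
    and N: "N \<in> null_sets lborel"
    and der: "\<And>x. x \<notin> N \<Longrightarrow> (\<phi> has_gradient g x) (at x)"
    and [measurable]: "g \<in> borel_measurable borel"
    and gL: "\<And>x. norm (g x) \<le> L" and gK: "\<And>x. x \<notin> K \<Longrightarrow> g x = 0"
  shows "(LBINT x. indicator K x *\<^sub>R (F x \<bullet> g x)) = 0"
proof (cases "K = {}")
  case False
  have L0: "L \<ge> 0" using gL[of 0] norm_ge_zero order_trans by blast
  obtain d where d: "d > 0" "{x. infdist x K \<le> d} \<subseteq> U"
    using compact_in_open_separated[OF False K(1) U K(2)] by blast
  define K' where "K' = {x. infdist x K \<le> d}"
  have K': "compact K'" "K' \<subseteq> U" "K \<subseteq> K'"
    using d K compact_infdist_le[OF False K(1) d(1)] by (auto simp: K'_def)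
  have far: "d < norm (x - y)" if "x \<notin> K'" "y \<in> K" for x y
    using that infdist_le[OF that(2), of x] by (auto simp: K'_def dist_norm)
  have FK': "continuous_on K' F" using F K' continuous_on_subset by blast
  obtain a where a: "K \<subseteq> cbox (-a) a"
    using bounded_subset_cbox_symmetric[OF compact_imp_bounded[OF K(1)]] by blast
  have [measurable]: "K \<in> sets borel" "K' \<in> sets borel" "U \<in> sets borel"
    using K(1) K'(1) U by (auto simp: compact_imp_closed)
  obtain C where C: "\<And>x. x \<in> K' \<Longrightarrow> norm (F x) \<le> C" "C > 0"
    using compact_imp_bounded[OF compact_continuous_image[OF FK' K'(1)]] by (auto simp: bounded_pos)
  define F' where "F' x = indicator K' x *\<^sub>R F x" for x
  have [measurable]: "F' \<in> borel_measurable borel"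
    unfolding F'_def by (rule borel_measurable_continuous_on_indicator) (use FK' in auto)
  have F'C: "norm (F' x) \<le> C" for x using C by (auto simp: F'_def indicator_def)
  have fin: "emeasure lborel K < \<infinity>" "emeasure lborel K' < \<infinity>" using K(1) K'(1) emeasure_compact_finite by auto
  have intK: "integrable lborel (\<lambda>x. indicator K x *\<^sub>R (F x \<bullet> g x))"
  proof (rule integrable_bounded_on[where A = K and B = "C * L"])
    have "(\<lambda>x. indicator K x *\<^sub>R (F x \<bullet> g x)) = (\<lambda>x. F' x \<bullet> g x)"
      using K'(3) gK by (auto simp: F'_def indicator_def fun_eq_iff)
    then show "(\<lambda>x. indicator K x *\<^sub>R (F x \<bullet> g x)) \<in> borel_measurable lborel" by simp
    have "\<bar>F x \<bullet> g x\<bar> \<le> C * L" if "x \<in> K" for x by (rule order_trans[OF Cauchy_Schwarz_ineq2 mult_mono])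
         (use that C K'(3) gL less_imp_le in auto)
    then show "\<bar>indicator K x *\<^sub>R (F x \<bullet> g x)\<bar> \<le> C * L" if "x \<in> K" for x using that by simp
  qed (use fin in auto)
  have main: "\<bar>\<integral>x. indicator K x *\<^sub>R (F x \<bullet> g x) \<partial>lborel\<bar> \<le> \<delta> * L * measure lborel K" if \<delta>: "\<delta> > 0" for \<delta>
  proof -
    obtain \<eta> where \<eta>: "\<eta> > 0" "\<And>x y. x \<in> K' \<Longrightarrow> y \<in> K' \<Longrightarrow> dist y x < \<eta> \<Longrightarrow> dist (F y) (F x) < \<delta>"
      using compact_uniformly_continuous[OF FK' K'(1)] \<delta> unfolding uniformly_continuous_on_def by metis
    \<comment> \<open>The kernel has radius \<open>e * real CARD('m)\<close>. Below \<open>d\<close>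
      it keeps the mollified support in \<open>K'\<close>; below \<open>\<eta>\<close> it keeps the
      oscillation of \<open>F\<close> across the kernel under \<open>\<delta>\<close>.\<close>
    define e where "e = min d \<eta> / (2 * real CARD('m))"
    have e: "e > 0" "e * real CARD('m) < d" "e * real CARD('m) < \<eta>" using d(1) \<eta>(1) by (auto simp: e_def)
    define b where "b = (cube_bump e :: real ^ 'm \<Rightarrow> real)"
    have b0: "b x = 0" if "norm x \<ge> e * real CARD('m)" for x
      unfolding b_def by (rule cube_bump_eq_0[OF that e(1)])
    have bnn: "0 \<le> b x" for x unfolding b_def by (rule cube_bump_nonneg)
    have bcont: "continuous_on S b" for S unfolding b_def by (rule continuous_cube_bump)
    have [measurable]: "b \<in> borel_measurable borel" by (rule borel_measurable_continuous_onI[OF bcont])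
    have b_int: "integrable lborel b" unfolding b_def by (rule cube_bump_integrable[OF e(1)])
    have b1: "b x \<le> 1" for x unfolding b_def by (rule cube_bump_le_1)
    define c where "c = (LBINT x. b x)"
    have c: "c > 0" unfolding c_def b_def by (rule cube_bump_integral_pos[OF e(1)])
    have shift: "(LBINT x. b (x - y)) = c" for y
      using integral_lborel_translate[of b "- y"] by (simp add: c_def)
    have b_int': "integrable lborel (\<lambda>x. b (x - y))" for y
    proof -
      have "integrable (distr lborel borel ((+) (- y))) b" using b_int by (simp only: lborel_distr_plus)
      then show ?thesis by (subst (asm) integrable_distr_eq) auto
    qed
    define \<psi> where "\<psi> x = integral (cbox (-a) a) (\<lambda>y. \<phi> y * b (x - y))" for x
    have c\<phi>: "continuous_on UNIV \<phi>"
    proof (rule lipschitz_on_continuous_on)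
      show "lipschitz_on L UNIV \<phi>" using lip L0 by (intro lipschitz_onI) (auto simp: dist_norm)
    qed
    have test: "test_function U \<psi>"
    proof -
      have "C_times k \<psi>" for k
        unfolding \<psi>_def b_def cube_bump_def by (rule C_times_conv_prodf[OF smooth1_bump1 c\<phi>])
      moreover have "{x. \<psi> x \<noteq> 0} \<subseteq> K'"
      proof (clarify, rule ccontr)
        fix x assume x: "\<psi> x \<noteq> 0" "x \<notin> K'"
        have "(\<lambda>y. \<phi> y * b (x - y)) = (\<lambda>y. 0)"
        proof
          fix y
          show "\<phi> y * b (x - y) = 0"
            using supp[of y] far[OF x(2), of y] b0[of "x - y"] e(2) by (cases "y \<in> K") auto
        qed
        then show False using x(1) by (simp add: \<psi>_def)
      qed
      then have "closure {x. \<psi> x \<noteq> 0} \<subseteq> K'" using K'(1) by (simp add: closure_minimal compact_imp_closed)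
      moreover from this have "compact (closure {x. \<psi> x \<noteq> 0})"
        using K'(1) compact_imp_bounded bounded_subset compact_eq_bounded_closed closed_closure by metis
      ultimately show ?thesis using K'(2) by (auto simp: test_function_def)
    qed
    have part: "partial_on UNIV k \<psi> x = (LBINT y. g y $ k * b (x - y))" for k x unfolding \<psi>_def b_def
      by (rule conv_cube_bump_gradient[OF e(1) lip _ N der]) (use supp a in auto)
    have gi_int: "integrable lborel (\<lambda>y. g y $ k * b (x - y))" for k x
    proof (rule integrable_bounded_on[where A = K and B = "L * 1"])
      show "\<bar>g y $ k * b (x - y)\<bar> \<le> L * 1" for y
        unfolding abs_mult using bnn b1 component_le_norm_cart[of "g y" k] gL[of y] L0
        by (intro mult_mono) auto
    qed (use fin gK in auto)
    have sum: "(\<Sum>i\<in>UNIV. F x $ i * partial_on UNIV i \<psi> x) = (LBINT y. (F x \<bullet> g y) * b (x - y))" for x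
    proof -
      have "(LBINT y. (F x \<bullet> g y) * b (x - y)) = (LBINT y. (\<Sum>i\<in>UNIV. F x $ i * (g y $ i * b (x - y))))"
        by (simp add: inner_vec_def sum_distrib_right mult.assoc)
      also have "\<dots> = (\<Sum>i\<in>UNIV. F x $ i * (LBINT y. g y $ i * b (x - y)))"
        by (subst Bochner_Integration.integral_sum) (auto intro: gi_int)
      finally show ?thesis by (simp add: part)
    qed
    have out: "(LBINT y. (F x \<bullet> g y) * b (x - y)) = 0" if "x \<notin> K'" for x
    proof -
      have "(\<lambda>y. (F x \<bullet> g y) * b (x - y)) = (\<lambda>y. 0)"
      proof
        fix y
        show "(F x \<bullet> g y) * b (x - y) = 0"
          using gK[of y] far[OF that, of y] b0[of "x - y"] e(2) by (cases "y \<in> K") auto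
      qed
      then show ?thesis by simp
    qed
    have bound: "\<bar>(F' x \<bullet> g y) * b (x - y)\<bar> \<le> (C * L) * 1" for x y
      unfolding abs_mult using bnn b1 gL[of y] L0 F'C[of x] C(2)
      by (intro mult_mono order_trans[OF Cauchy_Schwarz_ineq2]) auto
    have intpair: "integrable (lborel \<Otimes>\<^sub>M lborel) (\<lambda>(y, x). (F' x \<bullet> g y) * b (x - y))"
    proof (rule integrable_bounded_on[where A = "K \<times> K'" and B = "C * L * 1"])
      show "emeasure (lborel \<Otimes>\<^sub>M lborel) (K \<times> K') < \<infinity>"
        using fin by (simp add: lborel.emeasure_pair_measure_Times ennreal_mult_less_top)
      show "\<bar>case z of (y, x) \<Rightarrow> (F' x \<bullet> g y) * b (x - y)\<bar> \<le> C * L * 1" for z using bound by (cases z) auto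
      show "z \<notin> K \<times> K' \<Longrightarrow> (case z of (y, x) \<Rightarrow> (F' x \<bullet> g y) * b (x - y)) = 0" for z
        using gK by (cases z) (auto simp: F'_def indicator_def)
    qed measurable
    have "0 = (LINT x:U|lebesgue. \<integral>y. (F x \<bullet> g y) * b (x - y) \<partial>lborel)" using weak[OF test] unfolding sum ..
    also have "\<dots> = (\<integral>x. (LBINT y. (F' x \<bullet> g y) * b (x - y)) \<partial>lebesgue)" unfolding set_lebesgue_integral_def
      using K'(2) out by (intro Bochner_Integration.integral_cong refl) (auto simp: F'_def indicator_def)
    also have "\<dots> = (LBINT x. (LBINT y. (F' x \<bullet> g y) * b (x - y)))" by (rule integral_completion) measurable
    also have "\<dots> = (LBINT y. (LBINT x. (F' x \<bullet> g y) * b (x - y)))"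
      using lborel_pair.Fubini_integral[of "\<lambda>y x. (F' x \<bullet> g y) * b (x - y)"] intpair by simp
    finally have zero: "(LBINT y. (LBINT x. (F' x \<bullet> g y) * b (x - y))) = 0" ..
    have int1: "integrable lborel (\<lambda>y. \<integral>x. (F' x \<bullet> g y) * b (x - y) \<partial>lborel)"
      using lborel_pair.integrable_fst[OF intpair] by simp
    have est: "\<bar>c * (indicator K y *\<^sub>R (F y \<bullet> g y)) - (LBINT x. (F' x \<bullet> g y) * b (x - y))\<bar> \<le> indicator K y * (\<delta> * L * c)" for y
    proof (cases "y \<in> K")
      case True
      have i1: "integrable lborel (\<lambda>x. (F' x \<bullet> g y) * b (x - y))"
      proof (rule integrable_bounded_on[where A = "K'" and B = "C * L * 1"], measurable)
        show "\<bar>(F' x \<bullet> g y) * b (x - y)\<bar> \<le> C * L * 1" for x by (rule bound)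
      qed (use fin in \<open>auto simp: F'_def\<close>)
      have "c * (F y \<bullet> g y) = (LBINT x. (F y \<bullet> g y) * b (x - y))" by (simp add: shift)
      then have "c * (F y \<bullet> g y) - (LBINT x. (F' x \<bullet> g y) * b (x - y))
          = (LBINT x. (F y \<bullet> g y) * b (x - y) - (F' x \<bullet> g y) * b (x - y))"
        using i1 b_int' by (subst Bochner_Integration.integral_diff) auto
      also have "\<bar>\<dots>\<bar> \<le> (LBINT x. \<delta> * L * b (x - y))"
      proof (rule integral_abs_bound_integral)
        fix x
        show "\<bar>(F y \<bullet> g y) * b (x - y) - (F' x \<bullet> g y) * b (x - y)\<bar> \<le> \<delta> * L * b (x - y)"
        proof (cases "norm (x - y) \<ge> e * real CARD('m)")
          case False
          then have "x \<in> K'" using far[of x y] True e(2) by fastforce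
          then have "norm (F y - F' x) \<le> \<delta>"
            using \<eta>(2)[of x y] False e(3) True K'(3) by (auto simp: F'_def dist_norm norm_minus_commute)
          then have "\<bar>(F y - F' x) \<bullet> g y\<bar> \<le> \<delta> * L"
            using gL[of y] \<delta> by (intro order_trans[OF Cauchy_Schwarz_ineq2 mult_mono]) auto
          then have "\<bar>(F y - F' x) \<bullet> g y\<bar> * b (x - y) \<le> \<delta> * L * b (x - y)" using bnn by (rule mult_right_mono)
          then show ?thesis using bnn[of "x - y"]
            by (simp add: inner_diff_left left_diff_distrib[symmetric] abs_mult)
        qed (simp add: b0)
      qed (use i1 b_int' in auto)
      finally show ?thesis using True by (simp add: shift)
    next
      case False
      then show ?thesis using gK by simp
    qed
    have "c * (LBINT x. indicator K x *\<^sub>R (F x \<bullet> g x)) =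
        (LBINT y. c * (indicator K y *\<^sub>R (F y \<bullet> g y)) - (LBINT x. (F' x \<bullet> g y) * b (x - y)))"
      using intK int1 zero by (subst Bochner_Integration.integral_diff) auto
    also have "\<bar>\<dots>\<bar> \<le> (LBINT y. indicator K y * (\<delta> * L * c))"
    proof (rule integral_abs_bound_integral)
      show "integrable lborel (\<lambda>y. indicator K y * (\<delta> * L * c))"
        using fin by (intro integrable_mult_left) simp
    qed (use intK int1 est in auto)
    also have "\<dots> = \<delta> * L * c * measure lborel K" using fin by simp
    finally show ?thesis using c by (simp add: abs_mult mult_ac)
  qed
  show ?thesis
  proof (rule ccontr)
    \<comment> \<open>For a suitable \<open>\<delta>\<close> the estimate \<open>main\<close> bounds
      the absolute value of the integral by half of itself. The summand 1 in the denominator covers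
      the case \<open>?m = 0\<close>.\<close>
    assume ne: "(LBINT x. indicator K x *\<^sub>R (F x \<bullet> g x)) \<noteq> 0" (is "?I \<noteq> 0")
    let ?m = "L * measure lborel K"
    have m0: "?m \<ge> 0" using L0 by simp
    have "\<bar>?I\<bar> \<le> (\<bar>?I\<bar> / (2 * (?m + 1))) * ?m"
      using main[of "\<bar>?I\<bar> / (2 * (?m + 1))"] ne m0 by (simp add: mult.assoc)
    also have "\<dots> \<le> \<bar>?I\<bar> / 2"
    proof -
      have "?m / (2 * (?m + 1)) \<le> 1 / 2" using m0 by (simp add: divide_simps)
      from mult_left_mono[OF this, of "\<bar>?I\<bar>"] show ?thesis by simp
    qed
    finally show False using ne by simp
  qed
qed auto

section \<open>The weak equation tested up to the flat boundary\<close>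

lemma null_sets_coordinate_plane: "{x :: real ^ 'm::finite. x $ k = c} \<in> null_sets lborel"
proof -
  have "negligible {x :: real ^ 'm. x \<bullet> axis k 1 = c}" by (rule negligible_standard_hyperplane) simp
  then have "negligible {x :: real ^ 'm. x $ k = c}" by (simp add: inner_axis)
  moreover have "closed {x :: real ^ 'm. x $ k = c}" by (rule closed_Collect_eq) (intro continuous_intros)+
  ultimately show ?thesis using null_sets_completion_iff[of "{x :: real ^ 'm. x $ k = c}" lborel]
    by (simp add: negligible_iff_null_sets)
qed

lemma interior_half_ball:
  assumes "x $ None > 0" "norm x < 1"
  shows "x \<in> unit_half_ball_int"
proof -
  have "open ({x :: 'a point. x $ None > 0} \<inter> ball 0 1)"
    by (intro open_Int open_Collect_less continuous_intros open_ball)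
  moreover have "{x :: 'a point. x $ None > 0} \<inter> ball 0 1 \<subseteq> unit_half_ball"
    by (auto simp: unit_half_ball_def half_ball_def)
  ultimately have "{x :: 'a point. x $ None > 0} \<inter> ball 0 1 \<subseteq> interior unit_half_ball"
    by (intro interior_maximal)
  moreover have "x \<in> {x. x $ None > 0} \<inter> ball 0 1" using assms by simp
  ultimately show ?thesis unfolding unit_half_ball_int_def by blast
qed

text \<open>The layer fits into a box with \<open>CARD('n)\<close> sides of length 2 and one of
  length \<open>e\<close>. The linear dependence on \<open>e\<close> balances the slope
  \<open>1 / e\<close> of \<open>normal_cutoff\<close>, whose transition layer this is.\<close>

lemma measure_slab_le:
  fixes S :: "'n::finite point set"
  assumes "S \<subseteq> cball 0 1" "e > 0" "S \<in> sets borel"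
  shows "measure lborel (S \<inter> {x. e < x $ None \<and> x $ None < 2 * e}) \<le> 2 ^ CARD('n) * e"
proof -
  define l u :: "'n point" where "l = (\<chi> i. case i of None \<Rightarrow> e | Some _ \<Rightarrow> -1)"
    and "u = (\<chi> i. case i of None \<Rightarrow> 2 * e | Some _ \<Rightarrow> 1)"
  have "S \<inter> {x. e < x $ None \<and> x $ None < 2 * e} \<subseteq> cbox l u"
  proof
    fix x assume x: "x \<in> S \<inter> {x. e < x $ None \<and> x $ None < 2 * e}"
    have "\<bar>x $ i\<bar> \<le> 1" for i using component_le_norm_cart[of x i] x assms(1) by (force simp: dist_norm)
    then have "l $ i \<le> x $ i \<and> x $ i \<le> u $ i" for i
      using x by (cases i) (auto simp: l_def u_def abs_le_iff minus_le_iff)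
    then show "x \<in> cbox l u" by (simp add: mem_box_cart)
  qed
  then have "measure lborel (S \<inter> {x. e < x $ None \<and> x $ None < 2 * e}) \<le> measure lborel (cbox l u)"
    using assms(3) by (intro measure_mono_fmeasurable) (auto intro!: fmeasurable_cbox)
  also have "measure lborel (cbox l u) = (\<Prod>i\<in>UNIV. u $ i - l $ i)"
    using assms(2) by (intro content_cbox_cart) (auto simp: interval_ne_empty_cart l_def u_def split: option.split)
  also have "\<dots> = (u $ None - l $ None) * (\<Prod>i\<in>UNIV. u $ Some i - l $ Some i)"
    unfolding UNIV_option_conv by (subst prod.insert) (auto simp: prod.reindex)
  also have "\<dots> = 2 ^ CARD('n) * e" by (simp add: l_def u_def)
  finally show ?thesis .
qed

definition normal_cutoff :: "real \<Rightarrow> 'n::finite point \<Rightarrow> real" where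
  "normal_cutoff e x = min 1 (max 0 (x $ None / e - 1))"

lemma normal_cutoff_lipschitz:
  assumes "e > 0"
  shows "\<bar>normal_cutoff e x - normal_cutoff e y\<bar> \<le> norm (x - y) / e"
proof -
  have "\<bar>normal_cutoff e x - normal_cutoff e y\<bar> \<le> \<bar>x $ None / e - y $ None / e\<bar>"
    unfolding normal_cutoff_def by linarith
  also have "\<dots> = \<bar>(x - y) $ None\<bar> / e" using assms by (simp add: diff_divide_distrib[symmetric])
  also have "\<dots> \<le> norm (x - y) / e" using assms by (intro divide_right_mono component_le_norm_cart) auto
  finally show ?thesis .
qed

lemma normal_cutoff_has_derivative:
  assumes e: "e > 0" and "x $ None \<noteq> e" "x $ None \<noteq> 2 * e"
  shows "(normal_cutoff e has_derivative
    (\<lambda>h. (if e < x $ None \<and> x $ None < 2 * e then 1 / e else 0) * h $ None)) (at x)"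
proof -
  consider "x $ None < e" | "e < x $ None" "x $ None < 2 * e" | "2 * e < x $ None" using assms by linarith
  then show ?thesis
  proof cases
    case 1
    have "((\<lambda>y. 0) has_derivative (\<lambda>h. 0)) (at x)" by simp
    then have "(normal_cutoff e has_derivative (\<lambda>h. 0)) (at x)"
      by (rule has_derivative_transform_within_open[where s = "{y. y $ None < e}"])
         (use 1 e in \<open>auto simp: normal_cutoff_def field_simps intro!: open_Collect_less continuous_intros\<close>)
    then show ?thesis using 1 by simp
  next
    case 2
    have "((\<lambda>y. y $ None / e - 1) has_derivative (\<lambda>h. h $ None / e)) (at x)"
      using e by (auto intro!: derivative_eq_intros bounded_linear_imp_has_derivative bounded_linear_vec_nth)
    then have "(normal_cutoff e has_derivative (\<lambda>h. h $ None / e)) (at x)"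
      by (rule has_derivative_transform_within_open[where s = "{y. e < y $ None} \<inter> {y. y $ None < 2 * e}"])
         (use 2 e in \<open>auto simp: normal_cutoff_def field_simps intro!: open_Int open_Collect_less continuous_intros\<close>)
    then show ?thesis using 2 by simp
  next
    case 3
    have "((\<lambda>y. 1) has_derivative (\<lambda>h. 0)) (at x)" by simp
    then have "(normal_cutoff e has_derivative (\<lambda>h. 0)) (at x)"
      by (rule has_derivative_transform_within_open[where s = "{y. 2 * e < y $ None}"])
         (use 3 e in \<open>auto simp: normal_cutoff_def field_simps intro!: open_Collect_less continuous_intros\<close>)
    then show ?thesis using 3 by simp
  qed
qed

text \<open>The flux through the flat boundary appears by cutting off a test function in the layer
  where the normal coordinate is between \<open>\<epsilon>\<close> and \<open>2\<epsilon>\<close>.\<close>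

lemma weak_eq_flat_boundary:
  fixes F g :: "'n::finite point \<Rightarrow> 'n point" and \<phi> :: "'n point \<Rightarrow> real"
  assumes F: "continuous_on unit_half_ball F"
    and weak: "\<And>\<psi>. test_function unit_half_ball_int \<psi> \<Longrightarrow>
      (LINT x:unit_half_ball_int|lebesgue. \<Sum>i\<in>UNIV. F x $ i * partial_on UNIV i \<psi> x) = 0"
    and S: "compact S" "S \<subseteq> unit_half_ball"
    and lip: "\<And>x y. x $ None \<ge> 0 \<Longrightarrow> y $ None \<ge> 0 \<Longrightarrow> \<bar>\<phi> x - \<phi> y\<bar> \<le> L * norm (x - y)"
    and supp: "\<And>x. x $ None \<ge> 0 \<Longrightarrow> x \<notin> S \<Longrightarrow> \<phi> x = 0"
    and N: "N \<in> null_sets lborel"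
    and der: "\<And>x. x $ None > 0 \<Longrightarrow> x \<notin> N \<Longrightarrow> (\<phi> has_gradient g x) (at x)"
    and [measurable]: "g \<in> borel_measurable borel"
    and gL: "\<And>x. norm (g x) \<le> L" and gS: "\<And>x. x \<notin> S \<Longrightarrow> g x = 0"
    and sign: "\<And>x. x \<in> S \<Longrightarrow> x $ None = 0 \<Longrightarrow> F x $ None * \<phi> x \<le> 0"
  shows "0 \<le> (LBINT x. indicator S x *\<^sub>R (F x \<bullet> g x))"
proof -
  have L0: "L \<ge> 0" using gL[of 0] norm_ge_zero order_trans by blast
  have Snn: "x $ None \<ge> 0" "norm x < 1" if "x \<in> S" for x
    using that S(2) by (auto simp: unit_half_ball_def half_ball_def)
  have [measurable]: "S \<in> sets borel" using S(1) by (auto simp: compact_imp_closed)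
  have FS: "continuous_on S F" using F S(2) continuous_on_subset by blast
  have \<phi>S: "continuous_on S \<phi>"
  proof (rule lipschitz_on_continuous_on)
    show "lipschitz_on L S \<phi>" using lip Snn L0 by (intro lipschitz_onI) (auto simp: dist_norm)
  qed
  obtain C where C: "\<And>x. x \<in> S \<Longrightarrow> norm (F x) \<le> C" "C > 0"
    using compact_imp_bounded[OF compact_continuous_image[OF FS S(1)]] by (auto simp: bounded_pos)
  obtain B where B: "\<And>x. x \<in> S \<Longrightarrow> \<bar>\<phi> x\<bar> \<le> B" "B > 0"
    using compact_imp_bounded[OF compact_continuous_image[OF \<phi>S S(1)]] by (auto simp: bounded_pos)
  have B': "\<bar>\<phi> x\<bar> \<le> B" if "x $ None \<ge> 0" for x using B supp[OF that] by (cases "x \<in> S") auto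
  define F' where "F' x = indicator S x *\<^sub>R F x" for x
  have [measurable]: "F' \<in> borel_measurable borel"
    unfolding F'_def by (rule borel_measurable_continuous_on_indicator) (use FS in auto)
  define \<phi>' where "\<phi>' x = indicator S x *\<^sub>R \<phi> x" for x
  have [measurable]: "\<phi>' \<in> borel_measurable borel"
    unfolding \<phi>'_def by (rule borel_measurable_continuous_on_indicator) (use \<phi>S in auto)
  have finS: "emeasure lborel S < \<infinity>" using S(1) emeasure_compact_finite by auto
  have [measurable]: "(normal_cutoff e :: 'n point \<Rightarrow> real) \<in> borel_measurable borel" for e
    unfolding normal_cutoff_def[abs_def] by measurable
  have nc01: "0 \<le> normal_cutoff e x" "normal_cutoff e x \<le> 1" for e and x :: "'n point"
    by (auto simp: normal_cutoff_def)
  have int1: "integrable lborel (\<lambda>x. c x * (F' x \<bullet> g x))"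
    if [measurable]: "c \<in> borel_measurable borel" and c: "\<And>x. \<bar>c x\<bar> \<le> 1" for c
  proof (rule integrable_bounded_on[where A = S and B = "1 * (C * L)"], measurable)
    show "\<bar>c x * (F' x \<bullet> g x)\<bar> \<le> 1 * (C * L)" if "x \<in> S" for x
      unfolding abs_mult using c C(1)[OF that] C(2) L0 gL[of x] that
      by (intro mult_mono order_trans[OF Cauchy_Schwarz_ineq2]) (auto simp: F'_def)
  qed (use finS in \<open>auto simp: F'_def\<close>)
  define slab where "slab e = {x :: 'n point. e < x $ None \<and> x $ None < 2 * e}" for e
  have [measurable]: "slab e \<in> sets borel" for e unfolding slab_def by measurable
  have int2: "integrable lborel (\<lambda>x. indicator (slab e) x * ((1 / e) * (F' x $ None * \<phi>' x)))" for e
  proof (rule integrable_bounded_on[where A = S and B = "1 * (\<bar>1 / e\<bar> * (C * B))"], measurable)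
    show "\<bar>indicator (slab e) x * ((1 / e) * (F' x $ None * \<phi>' x))\<bar> \<le> 1 * (\<bar>1 / e\<bar> * (C * B))" if "x \<in> S" for x
      unfolding abs_mult using C(1)[OF that] C(2) B(1)[OF that] B(2) that component_le_norm_cart[of "F x" None]
      by (intro mult_mono) (auto simp: F'_def \<phi>'_def indicator_def)
  qed (use finS in \<open>auto simp: F'_def\<close>)
  have cut: "(LBINT x. normal_cutoff e x * (F' x \<bullet> g x)) =
      - (LBINT x. indicator (slab e) x * ((1 / e) * (F' x $ None * \<phi>' x)))" if e: "e > 0" for e
  proof -
    define \<phi>e where "\<phi>e x = normal_cutoff e x * \<phi> x" for x
    define K where "K = S \<inter> {x. e \<le> x $ None}"
    define ge where "ge x = normal_cutoff e x *\<^sub>R g x + (indicator (slab e) x * (1 / e) * \<phi>' x) *\<^sub>R axis None 1" for x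
    have nc0: "normal_cutoff e x = 0" if "x $ None \<le> e" for x :: "'n point"
      using that e by (simp add: normal_cutoff_def divide_le_eq)
    have K: "compact K" "K \<subseteq> S"
      unfolding K_def by (auto intro!: compact_Int_closed S closed_Collect_le continuous_intros)
    have KU: "K \<subseteq> unit_half_ball_int" using interior_half_ball Snn e by (fastforce simp: K_def)
    have lipe: "\<bar>\<phi>e x - \<phi>e y\<bar> \<le> (L + B / e) * norm (x - y)" for x y
    proof -
      \<comment> \<open>\<open>\<phi>\<close> is Lipschitz only on the closed half space, while the
        product with the cutoff is needed on the whole space. The nearest-point map to the half
        space is nonexpansive and leaves the values of the product unchanged, since the cutoff
        vanishes for normal coordinate up to \<open>e\<close>.\<close>
      define P :: "'n point \<Rightarrow> 'n point" where "P x = (\<chi> i. if i = None then max 0 (x $ None) else x $ i)" for x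
      have P1: "\<phi>e x = \<phi>e (P x)" for x
      proof (cases "x $ None \<ge> 0")
        case True
        then have "P x = x" by (simp add: P_def vec_eq_iff max_def)
        then show ?thesis by simp
      next
        case False
        then show ?thesis using nc0[of x] nc0[of "P x"] e by (simp add: \<phi>e_def P_def)
      qed
      have P2: "norm (P x - P y) \<le> norm (x - y)"
        unfolding norm_vec_def by (intro L2_set_mono) (auto simp: P_def)
      have P3: "P x $ None \<ge> 0" "P y $ None \<ge> 0" by (auto simp: P_def)
      have "\<bar>\<phi>e (P x) - \<phi>e (P y)\<bar> = \<bar>(normal_cutoff e (P x) - normal_cutoff e (P y)) * \<phi> (P x)
          + normal_cutoff e (P y) * (\<phi> (P x) - \<phi> (P y))\<bar>" by (simp add: \<phi>e_def algebra_simps)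
      also have "\<dots> \<le> (norm (P x - P y) / e) * B + 1 * (L * norm (P x - P y))"
      proof (rule order_trans[OF abs_triangle_ineq add_mono])
        show "\<bar>(normal_cutoff e (P x) - normal_cutoff e (P y)) * \<phi> (P x)\<bar> \<le> (norm (P x - P y) / e) * B"
          unfolding abs_mult using normal_cutoff_lipschitz[OF e, of "P x" "P y"] B'[OF P3(1)] e
          by (intro mult_mono) auto
        show "\<bar>normal_cutoff e (P y) * (\<phi> (P x) - \<phi> (P y))\<bar> \<le> 1 * (L * norm (P x - P y))"
          unfolding abs_mult using nc01[of e "P y"] lip[OF P3] by (intro mult_mono) auto
      qed
      also have "\<dots> = (L + B / e) * norm (P x - P y)" by (simp add: algebra_simps)
      also have "\<dots> \<le> (L + B / e) * norm (x - y)" using P2 L0 B(2) e by (intro mult_left_mono) auto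
      finally show ?thesis by (simp add: P1[of x] P1[of y])
    qed
    have "(LBINT x. indicator K x *\<^sub>R (F x \<bullet> ge x)) = 0"
    proof (rule weak_eq_lipschitz[OF _ _ weak K(1) KU lipe])
      show "open (unit_half_ball_int :: 'n point set)" by (simp add: unit_half_ball_int_def)
      show "continuous_on unit_half_ball_int F"
        using F interior_subset unfolding unit_half_ball_int_def by (rule continuous_on_subset)
      show "N \<union> {x. x $ None = e} \<union> {x. x $ None = 2 * e} \<in> null_sets lborel"
        by (intro null_sets.Un N null_sets_coordinate_plane)
      show "\<phi>e x = 0" if "x \<notin> K" for x using that supp[of x] nc0[of x] e unfolding K_def \<phi>e_def by force
      show geK: "ge x = 0" if "x \<notin> K" for x
      proof (cases "x \<in> S")
        case True
        then have "x $ None < e" using that by (simp add: K_def)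
        then show ?thesis using nc0[of x] by (simp add: ge_def slab_def)
      qed (simp add: ge_def gS \<phi>'_def)
      show "ge \<in> borel_measurable borel" unfolding ge_def[abs_def] by measurable
      show "norm (ge x) \<le> L + B / e" for x
      proof -
        have "norm (ge x) \<le> norm (normal_cutoff e x *\<^sub>R g x) + norm ((indicator (slab e) x * (1 / e) * \<phi>' x) *\<^sub>R (axis None 1 :: 'n point))"
          unfolding ge_def by (rule norm_triangle_ineq)
        also have "\<dots> \<le> 1 * L + 1 * (1 / e) * B * 1"
        proof (rule add_mono)
          show "norm (normal_cutoff e x *\<^sub>R g x) \<le> 1 * L"
            unfolding norm_scaleR using gL[of x] nc01[of e x] by (intro mult_mono) auto
          show "norm ((indicator (slab e) x * (1 / e) * \<phi>' x) *\<^sub>R (axis None 1 :: 'n point)) \<le> 1 * (1 / e) * B * 1"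
            unfolding norm_scaleR abs_mult using e B
            by (intro mult_mono) (auto simp: norm_axis_1 \<phi>'_def indicator_def)
        qed
        finally show ?thesis by simp
      qed
      show "(\<phi>e has_gradient ge x) (at x)" if "x \<notin> N \<union> {x. x $ None = e} \<union> {x. x $ None = 2 * e}" for x
      proof (cases "x $ None > 0")
        case True
        have "(\<phi>e has_derivative (\<lambda>h. normal_cutoff e x * (g x \<bullet> h) +
            ((if e < x $ None \<and> x $ None < 2 * e then 1 / e else 0) * h $ None) * \<phi> x)) (at x)"
          unfolding \<phi>e_def[abs_def] using that True
          by (intro has_derivative_mult normal_cutoff_has_derivative e der) auto
        moreover have "normal_cutoff e x * (g x \<bullet> h) +
            ((if e < x $ None \<and> x $ None < 2 * e then 1 / e else 0) * h $ None) * \<phi> x = ge x \<bullet> h" for h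
          using supp[of x] True
          by (auto simp: ge_def slab_def inner_add_left inner_axis' \<phi>'_def indicator_def)
        ultimately show ?thesis by simp
      next
        case False
        then have "x $ None < e" using e by simp
        have "((\<lambda>y. 0) has_derivative (\<lambda>h. 0)) (at x)" by simp
        then have "(\<phi>e has_derivative (\<lambda>h. 0)) (at x)"
          by (rule has_derivative_transform_within_open[where s = "{y. y $ None < e}"])
             (use \<open>x $ None < e\<close> nc0 in \<open>auto simp: \<phi>e_def intro!: open_Collect_less continuous_intros\<close>)
        moreover have "ge x = 0" using \<open>x $ None < e\<close> nc0[of x] by (simp add: ge_def slab_def)
        ultimately show ?thesis by simp
      qed
    qed
    moreover have "indicator K x *\<^sub>R (F x \<bullet> ge x) = normal_cutoff e x * (F' x \<bullet> g x) +
        indicator (slab e) x * ((1 / e) * (F' x $ None * \<phi>' x))" for x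
    proof (cases "x \<in> K")
      case True
      then show ?thesis using K(2) by (auto simp: ge_def F'_def inner_add_right inner_axis \<phi>'_def)
    next
      case False
      then have "x \<notin> S \<or> x $ None < e" by (auto simp: K_def)
      then show ?thesis using False nc0[of x] by (auto simp: F'_def slab_def)
    qed
    ultimately have "(LBINT x. normal_cutoff e x * (F' x \<bullet> g x) +
        indicator (slab e) x * ((1 / e) * (F' x $ None * \<phi>' x))) = 0" by simp
    then show ?thesis
      using int1[of "normal_cutoff e"] nc01[of e] int2[of e] by (simp add: eq_neg_iff_add_eq_0)
  qed
  have lower: "- (2 ^ CARD('n) * \<delta>) \<le> (LBINT x. F' x \<bullet> g x)" if \<delta>: "\<delta> > 0" for \<delta>
  proof -
    have fc: "continuous_on S (\<lambda>x. F x $ None * \<phi> x)" by (intro continuous_intros FS \<phi>S)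
    \<comment> \<open>Compactness: the part of \<open>S\<close> where the product is at least
      \<open>\<delta>\<close> avoids the flat boundary by \<open>sign\<close>, hence keeps a
      positive distance from it.\<close>
    obtain \<epsilon>0 where \<epsilon>0: "\<epsilon>0 > 0" "\<And>x. x \<in> S \<Longrightarrow> x $ None < \<epsilon>0 \<Longrightarrow> F x $ None * \<phi> x \<le> \<delta>"
    proof (cases "{x \<in> S. \<delta> \<le> F x $ None * \<phi> x} = {}")
      case True
      then show ?thesis using that[of 1] by force
    next
      case False
      have "compact (S \<inter> (\<lambda>x. F x $ None * \<phi> x) -` {\<delta>..})"
        using continuous_closed_preimage[OF fc compact_imp_closed[OF S(1)] closed_atLeast] S(1)
        by (metis bounded_Int compact_eq_bounded_closed)
      then have "compact {x \<in> S. \<delta> \<le> F x $ None * \<phi> x}" by (simp add: vimage_def Int_def)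
      moreover have "continuous_on {x \<in> S. \<delta> \<le> F x $ None * \<phi> x} (\<lambda>x. x $ None)" by (intro continuous_intros)
      ultimately have "\<exists>z\<in>{x \<in> S. \<delta> \<le> F x $ None * \<phi> x}. \<forall>y\<in>{x \<in> S. \<delta> \<le> F x $ None * \<phi> x}. z $ None \<le> y $ None"
        using False by (intro continuous_attains_inf)
      then obtain z where z: "z \<in> S" "\<delta> \<le> F z $ None * \<phi> z"
        "\<And>y. y \<in> S \<Longrightarrow> \<delta> \<le> F y $ None * \<phi> y \<Longrightarrow> z $ None \<le> y $ None" by blast
      have "z $ None \<noteq> 0" using sign[OF z(1)] z(2) \<delta> by auto
      then have "z $ None > 0" using Snn(1)[OF z(1)] by simp
      then show ?thesis using that[of "z $ None"] z(3) by force
    qed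
    have low: "- (2 ^ CARD('n) * \<delta>) \<le> (LBINT x. normal_cutoff e x * (F' x \<bullet> g x))"
      if e: "0 < e" "2 * e < \<epsilon>0" for e
    proof -
      have "(LBINT x. indicator (slab e) x * ((1 / e) * (F' x $ None * \<phi>' x)))
          \<le> (LBINT x. indicator (S \<inter> slab e) x * (\<delta> / e))"
      proof (rule integral_mono[OF int2])
        show "integrable lborel (\<lambda>x. indicator (S \<inter> slab e) x * (\<delta> / e))"
        proof (intro integrable_mult_left integrable_real_indicator)
          show "emeasure lborel (S \<inter> slab e) < \<infinity>"
            using finS emeasure_mono[of "S \<inter> slab e" S lborel] by (auto intro: le_less_trans)
        qed auto
        fix x
        show "indicator (slab e) x * ((1 / e) * (F' x $ None * \<phi>' x)) \<le> indicator (S \<inter> slab e) x * (\<delta> / e)"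
        proof (cases "x \<in> S \<inter> slab e")
          case True
          then have "F x $ None * \<phi> x \<le> \<delta>" using \<epsilon>0(2)[of x] e by (auto simp: slab_def)
          then show ?thesis using True e by (simp add: F'_def \<phi>'_def divide_right_mono)
        qed (auto simp: F'_def indicator_def)
      qed
      also have "\<dots> = measure lborel (S \<inter> slab e) * (\<delta> / e)" by simp
      also have "\<dots> \<le> 2 ^ CARD('n) * e * (\<delta> / e)"
      proof (intro mult_right_mono)
        show "measure lborel (S \<inter> slab e) \<le> 2 ^ CARD('n) * e" unfolding slab_def
        proof (rule measure_slab_le)
          show "S \<subseteq> cball 0 1" using Snn(2) by (force simp: dist_norm)
        qed (use e in auto)
      qed (use e \<delta> in auto)
      finally show ?thesis using cut[OF e(1)] e by simp
    qed
    have "(\<lambda>k. \<integral>x. normal_cutoff (1 / real (Suc k)) x * (F' x \<bullet> g x) \<partial>lborel) \<longlonglongrightarrow> (LBINT x. F' x \<bullet> g x)"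
    proof (rule integral_dominated_convergence[where w = "\<lambda>x. \<bar>F' x \<bullet> g x\<bar>"])
      show "integrable lborel (\<lambda>x. \<bar>F' x \<bullet> g x\<bar>)" using int1[of "\<lambda>x. 1"] by simp
      show "AE x in lborel. norm (normal_cutoff (1 / real (Suc k)) x * (F' x \<bullet> g x)) \<le> \<bar>F' x \<bullet> g x\<bar>" for k
        using nc01[of "1 / real (Suc k)"] by (auto simp: abs_mult mult_left_le_one_le simp del: of_nat_Suc)
      have "AE x in lborel. x \<notin> {x :: 'n point. x $ None = 0}"
        by (rule AE_not_in[OF null_sets_coordinate_plane])
      then show "AE x in lborel. (\<lambda>k. normal_cutoff (1 / real (Suc k)) x * (F' x \<bullet> g x)) \<longlonglongrightarrow> F' x \<bullet> g x"
      proof eventually_elim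
        case (elim x)
        show ?case
        proof (cases "x \<in> S")
          case True
          then have pos: "x $ None > 0" using elim Snn(1) by force
          have "(\<lambda>k. 1 / real (Suc k)) \<longlonglongrightarrow> 0" using lim_inverse_n'[THEN LIMSEQ_Suc] by simp
          then have "\<forall>\<^sub>F k in sequentially. 1 / real (Suc k) < x $ None / 2"
            by (rule order_tendstoD) (use pos in simp)
          then have "\<forall>\<^sub>F k in sequentially. F' x \<bullet> g x = normal_cutoff (1 / real (Suc k)) x * (F' x \<bullet> g x)"
          proof eventually_elim
            case (elim k)
            then have "normal_cutoff (1 / real (Suc k)) x = 1"
              unfolding normal_cutoff_def by (simp add: field_simps)
            then show ?case by simp
          qed
          then show ?thesis by (rule Lim_transform_eventually[OF tendsto_const])
        qed (simp add: F'_def)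
      qed
    qed (measurable)
    moreover have "\<forall>\<^sub>F k in sequentially. - (2 ^ CARD('n) * \<delta>) \<le> (LBINT x. normal_cutoff (1 / real (Suc k)) x * (F' x \<bullet> g x))"
    proof -
      have "(\<lambda>k. 1 / real (Suc k)) \<longlonglongrightarrow> 0" using lim_inverse_n'[THEN LIMSEQ_Suc] by simp
      then have "\<forall>\<^sub>F k in sequentially. 1 / real (Suc k) < \<epsilon>0 / 2" by (rule order_tendstoD) (use \<epsilon>0 in simp)
      then show ?thesis by eventually_elim (rule low, auto simp del: of_nat_Suc)
    qed
    ultimately show ?thesis by (rule tendsto_lowerbound) simp
  qed
  have "0 \<le> (LBINT x. F' x \<bullet> g x)"
  proof (rule field_le_epsilon)
    fix \<delta> :: real assume "\<delta> > 0"
    then show "0 \<le> (LBINT x. F' x \<bullet> g x) + \<delta>" using lower[of "\<delta> / 2 ^ CARD('n)"] by simp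
  qed
  then show ?thesis by (simp add: F'_def)
qed

section \<open>Eigenvalue bounds for quadratic forms\<close>

lemma linear_coefficient_zero:
  fixes b c :: real
  assumes "\<And>t. 0 \<le> 2 * t * b + t\<^sup>2 * c"
  shows "b = 0"
proof (rule ccontr)
  assume b: "b \<noteq> 0"
  define k where "k = \<bar>c\<bar> + 1"
  have k: "k > 0" "c < k" by (auto simp: k_def)
  have "0 \<le> (2 * (- b / k) * b + (- b / k)^2 * c) * k\<^sup>2"
    using assms[of "- b / k"] by (rule mult_nonneg_nonneg) simp
  also have "\<dots> = b\<^sup>2 * (c - 2 * k)" using k(1) by (simp add: power_divide field_simps power2_eq_square)
  finally show False using b k by (simp add: zero_le_mult_iff)
qed

text \<open>A minimiser \<open>v0\<close> of the form on the unit sphere is an eigenvector. The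
  first variation is taken in the direction of the residual \<open>u\<close> itself, so its
  coefficient is \<open>u \<bullet> u\<close>, and its vanishing gives the eigenvalue
  equation.\<close>

lemma quadratic_form_ge_least_eigenvalue:
  fixes A :: "real ^ 'k::finite ^ 'k"
  assumes sym: "transpose A = A" and ev: "\<And>l. matrix_eigenvalue A l \<Longrightarrow> lo \<le> l"
  shows "lo * (v \<bullet> v) \<le> v \<bullet> (A *v v)"
proof -
  define q where "q v = v \<bullet> (A *v v)" for v
  have bil: "x \<bullet> (A *v y) = y \<bullet> (A *v x)" for x y
    using dot_lmul_matrix[of x A y] by (simp add: sym transpose_matrix_vector[symmetric] inner_commute)
  have "continuous_on (sphere 0 1) q"
    unfolding q_def by (intro continuous_intros matrix_vector_mult_linear_continuous_on)
  then obtain v0 where v0: "norm v0 = 1" "\<And>v. norm v = 1 \<Longrightarrow> q v0 \<le> q v"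
    using continuous_attains_inf[of "sphere 0 1" q] by (auto simp: sphere_eq_empty)
  define l where "l = q v0"
  have ge: "l * (v \<bullet> v) \<le> q v" for v
  proof (cases "v = 0")
    case False
    have "l \<le> q (v /\<^sub>R norm v)" unfolding l_def using False by (intro v0) simp
    also have "\<dots> = q v / (norm v)^2"
      by (simp add: q_def matrix_vector_mult_scaleR power2_eq_square divide_inverse)
    finally show ?thesis using False by (simp add: le_divide_eq dot_square_norm)
  qed (simp add: q_def)
  define u where "u = A *v v0 - l *\<^sub>R v0"
  have "u \<bullet> u = 0"
  proof (rule linear_coefficient_zero)
    fix t :: real
    have "0 \<le> q (v0 + t *\<^sub>R u) - l * ((v0 + t *\<^sub>R u) \<bullet> (v0 + t *\<^sub>R u))" using ge by simp
    also have "\<dots> = (q v0 - l * (v0 \<bullet> v0)) + 2 * t * (u \<bullet> (A *v v0) - l * (u \<bullet> v0)) + t\<^sup>2 * (q u - l * (u \<bullet> u))"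
      using bil[of v0 u]
      by (simp add: q_def matrix_vector_right_distrib matrix_vector_mult_scaleR inner_add_left inner_add_right
          inner_commute[of v0 u] power2_eq_square algebra_simps)
    also have "u \<bullet> (A *v v0) - l * (u \<bullet> v0) = u \<bullet> u" by (simp add: u_def inner_diff_right algebra_simps)
    also have "q v0 - l * (v0 \<bullet> v0) = 0" using v0(1) by (simp add: l_def dot_square_norm)
    finally show "0 \<le> 2 * t * (u \<bullet> u) + t\<^sup>2 * (q u - l * (u \<bullet> u))" by simp
  qed
  then have "matrix_eigenvalue A l"
    using v0(1) by (auto simp: u_def matrix_eigenvalue_def intro!: exI[of _ v0])
  then have "lo * (v \<bullet> v) \<le> l * (v \<bullet> v)" using ev by (intro mult_right_mono) auto
  also have "\<dots> \<le> q v" by (rule ge)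
  finally show ?thesis by (simp add: q_def)
qed

lemma quadratic_form_le_greatest_eigenvalue:
  fixes A :: "real ^ 'k::finite ^ 'k"
  assumes sym: "transpose A = A" and ev: "\<And>l. matrix_eigenvalue A l \<Longrightarrow> l \<le> hi"
  shows "v \<bullet> (A *v v) \<le> hi * (v \<bullet> v)"
proof -
  have neg: "(- A) *v x = - (A *v x)" for x using matrix_vector_mult_diff_rdistrib[of 0 A x] by simp
  have "(- hi) * (v \<bullet> v) \<le> v \<bullet> ((- A) *v v)"
  proof (rule quadratic_form_ge_least_eigenvalue)
    show "transpose (- A) = - A" using sym by (simp add: transpose_def vec_eq_iff)
    fix l assume "matrix_eigenvalue (- A) l"
    then obtain w where "w \<noteq> 0" "- (A *v w) = l *\<^sub>R w" by (auto simp: matrix_eigenvalue_def neg)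
    then have "A *v w = (- l) *\<^sub>R w" by (metis minus_minus scaleR_minus_left)
    then have "matrix_eigenvalue A (- l)" using \<open>w \<noteq> 0\<close> by (auto simp: matrix_eigenvalue_def)
    then show "- hi \<le> l" using ev by fastforce
  qed
  then show ?thesis by (simp add: neg)
qed

section \<open>Translation estimates and the Faber-Krahn inequality in the half space\<close>

lemma power2_integral_le:
  fixes h :: "real \<Rightarrow> real"
  assumes "continuous_on {0..1} h"
  shows "(integral {0..1} h)^2 \<le> integral {0..1} (\<lambda>t. (h t)^2)"
proof -
  let ?c = "integral {0..1} h"
  have i: "h integrable_on {0..1}" "(\<lambda>t. (h t)^2) integrable_on {0..1}"
    using assms by (auto intro!: integrable_continuous_real continuous_intros)
  \<comment> \<open>The integrand is the square of \<open>h t - ?c\<close> expanded; its integral is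
    the variance of \<open>h\<close>.\<close>
  have 1: "((\<lambda>t. (h t)^2 - (2 * ?c) * h t + ?c\<^sup>2) has_integral
      (integral {0..1} (\<lambda>t. (h t)^2) - (2 * ?c) * ?c + (1 - 0) *\<^sub>R ?c\<^sup>2)) {0..1}"
  proof (rule has_integral_add[OF has_integral_diff[OF integrable_integral[OF i(2)]
          has_integral_mult_right[OF integrable_integral[OF i(1)]]]])
    show "((\<lambda>t::real. ?c\<^sup>2) has_integral (1 - 0) *\<^sub>R ?c\<^sup>2) {0..1}"
      using has_integral_const_real[of "?c\<^sup>2" 0 1] by simp
  qed
  have "0 \<le> (h t)^2 - (2 * ?c) * h t + ?c\<^sup>2" for t
    using zero_le_power2[of "h t - ?c"] by (simp add: power2_diff mult_ac)
  then have "0 \<le> integral {0..1} (\<lambda>t. (h t)^2) - (2 * ?c) * ?c + (1 - 0) *\<^sub>R ?c\<^sup>2"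
    by (intro has_integral_nonneg[OF 1])
  then show ?thesis by (simp add: power2_eq_square)
qed

definition upper :: "'n::finite point set" where
  "upper = {x. x $ None \<ge> 0}"

lemma closed_upper: "closed (upper :: 'n::finite point set)"
  unfolding upper_def by (intro closed_Collect_le continuous_intros)

lemma convex_upper: "convex (upper :: 'n::finite point set)"
  by (auto simp: upper_def convex_def)

lemma upper_measurable [measurable]: "(upper :: 'n::finite point set) \<in> sets borel"
  by (rule borel_closed[OF closed_upper])

abbreviation upper_int :: "('n::finite point \<Rightarrow> real) \<Rightarrow> ennreal" where
  "upper_int f \<equiv> (\<integral>\<^sup>+x. ennreal (indicator upper x * f x) \<partial>lborel)"

text \<open>The difference is the integral of the gradient along the segment from \<open>x\<close>
  to \<open>x + z\<close>; Jensen's inequality in \<open>t\<close> and exchanging the integrals give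
  the bound. The segments stay in the half space because \<open>z\<close> points into it.\<close>

lemma translation_difference_le:
  fixes f :: "'n::finite point \<Rightarrow> real"
  assumes z: "z \<in> upper"
    and der: "\<And>x. x \<in> upper \<Longrightarrow> (f has_gradient g x) (at x within upper)"
    and g: "continuous_on upper g"
  shows "upper_int (\<lambda>x. (f (x + z) - f x)^2)
     \<le> ennreal ((norm z)^2) * upper_int (\<lambda>x. (norm (g x))^2)"
proof -
  have up: "x + t *\<^sub>R z \<in> upper" if "x \<in> upper" "0 \<le> t" for x t using that z by (simp add: upper_def)
  define g' where "g' x = indicator upper x *\<^sub>R g x" for x
  have [measurable]: "g' \<in> borel_measurable borel"
    unfolding g'_def by (rule borel_measurable_continuous_on_indicator) (use g in auto)
  have line: "ennreal (indicator upper x * (f (x + z) - f x)^2) \<le>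
      (\<integral>\<^sup>+t. ennreal (indicator {0..1} t * (norm z)^2 * (indicator upper x * (norm (g' (x + t *\<^sub>R z)))^2)) \<partial>lborel)" for x
  proof (cases "x \<in> upper")
    case True
    let ?h = "\<lambda>t. g (x + t *\<^sub>R z) \<bullet> z"
    have gc: "continuous_on {0..1} (\<lambda>t. g (x + t *\<^sub>R z))"
      by (rule continuous_on_compose2[OF g]) (auto intro!: continuous_intros up True)
    have hc: "continuous_on {0..1} ?h" by (intro continuous_intros gc)
    have "(?h has_integral (f (x + 1 *\<^sub>R z) - f (x + 0 *\<^sub>R z))) {0..1}"
    proof (rule fundamental_theorem_of_calculus)
      fix t :: real assume t: "t \<in> {0..1}"
      have "((\<lambda>t. x + t *\<^sub>R z) has_derivative (\<lambda>t. t *\<^sub>R z)) (at t within {0..1})"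
        by (auto intro!: derivative_eq_intros)
      moreover have "(f has_gradient g (x + t *\<^sub>R z)) (at (x + t *\<^sub>R z) within (\<lambda>t. x + t *\<^sub>R z) ` {0..1})"
        by (rule has_derivative_subset[OF der]) (use t up True in auto)
      ultimately have "((\<lambda>t. f (x + t *\<^sub>R z)) has_derivative (\<lambda>t'. g (x + t *\<^sub>R z) \<bullet> (t' *\<^sub>R z))) (at t within {0..1})"
        by (rule has_derivative_in_compose)
      then show "((\<lambda>t. f (x + t *\<^sub>R z)) has_vector_derivative ?h t) (at t within {0..1})"
        by (simp add: has_vector_derivative_def)
    qed simp
    then have "f (x + z) - f x = integral {0..1} ?h" by (simp add: integral_unique)
    then have "(f (x + z) - f x)^2 \<le> integral {0..1} (\<lambda>t. (?h t)^2)" using power2_integral_le[OF hc] by simp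
    also have "\<dots> \<le> integral {0..1} (\<lambda>t. (norm z)^2 * (norm (g (x + t *\<^sub>R z)))^2)"
    proof (rule integral_le)
      show "(?h t)^2 \<le> (norm z)^2 * (norm (g (x + t *\<^sub>R z)))^2" for t
        using power_mono[OF Cauchy_Schwarz_ineq2[of "g (x + t *\<^sub>R z)" z] abs_ge_zero, of 2]
        by (simp add: power_mult_distrib mult.commute)
    qed (intro integrable_continuous_real continuous_intros hc gc)+
    also have "ennreal \<dots> = (\<integral>\<^sup>+t. ennreal (indicator {0..1} t * (norm z)^2 * (indicator upper x * (norm (g' (x + t *\<^sub>R z)))^2)) \<partial>lborel)"
    proof -
      have "continuous_on {0..1} (\<lambda>t. (norm z)^2 * (norm (g (x + t *\<^sub>R z)))^2)"
        by (intro continuous_intros gc)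
      from integrable_integral[OF integrable_continuous_real[OF this]]
      have "(\<integral>\<^sup>+t. ennreal (indicator {0..1} t * ((norm z)^2 * (norm (g (x + t *\<^sub>R z)))^2)) \<partial>lborel)
          = ennreal (integral {0..1} (\<lambda>t. (norm z)^2 * (norm (g (x + t *\<^sub>R z)))^2))"
        by (intro nn_integral_has_integral_lebesgue) auto
      moreover have "indicator {0..1} t * ((norm z)^2 * (norm (g (x + t *\<^sub>R z)))^2) =
          indicator {0..1} t * (norm z)^2 * (indicator upper x * (norm (g' (x + t *\<^sub>R z)))^2)" for t
        using True up[OF True] by (auto simp: indicator_def g'_def)
      ultimately show ?thesis by simp
    qed
    finally show ?thesis using True by (simp add: ennreal_leI)
  qed simp
  have "upper_int (\<lambda>x. (f (x + z) - f x)^2) \<le>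
      (\<integral>\<^sup>+x. (\<integral>\<^sup>+t. ennreal (indicator {0..1} t * (norm z)^2 * (indicator upper x * (norm (g' (x + t *\<^sub>R z)))^2)) \<partial>lborel) \<partial>lborel)"
    by (intro nn_integral_mono line)
  also have "\<dots> = (\<integral>\<^sup>+t. (\<integral>\<^sup>+x. ennreal (indicator {0..1} t * (norm z)^2 * (indicator upper x * (norm (g' (x + t *\<^sub>R z)))^2)) \<partial>lborel) \<partial>lborel)"
    by (rule lborel_pair.Fubini') measurable
  also have "\<dots> \<le> (\<integral>\<^sup>+t. indicator {0..1::real} t * (ennreal ((norm z)^2) * upper_int (\<lambda>x. (norm (g x))^2)) \<partial>lborel)"
  proof (rule nn_integral_mono)
    fix t :: real
    show "(\<integral>\<^sup>+x. ennreal (indicator {0..1} t * (norm z)^2 * (indicator upper x * (norm (g' (x + t *\<^sub>R z)))^2)) \<partial>lborel)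
      \<le> indicator {0..1::real} t * (ennreal ((norm z)^2) * upper_int (\<lambda>x. (norm (g x))^2))"
    proof (cases "t \<in> {0..1}")
      case True
      have "(\<integral>\<^sup>+x. ennreal (indicator {0..1} t * (norm z)^2 * (indicator upper x * (norm (g' (x + t *\<^sub>R z)))^2)) \<partial>lborel)
         \<le> (\<integral>\<^sup>+x. ennreal ((norm z)^2) * ennreal ((norm (g' (t *\<^sub>R z + 1 *\<^sub>R x)))^2) \<partial>lborel)"
        using True by (intro nn_integral_mono) (auto simp: indicator_def ennreal_mult[symmetric] add.commute)
      also have "\<dots> = ennreal ((norm z)^2) * (\<integral>\<^sup>+x. ennreal ((norm (g' (t *\<^sub>R z + 1 *\<^sub>R x)))^2) \<partial>lborel)"
        by (rule nn_integral_cmult) measurable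
      also have "(\<integral>\<^sup>+x. ennreal ((norm (g' (t *\<^sub>R z + 1 *\<^sub>R x)))^2) \<partial>lborel) = (\<integral>\<^sup>+x. ennreal ((norm (g' x))^2) \<partial>lborel)"
        by (subst (2) nn_integral_lborel_affine[of _ 1 "t *\<^sub>R z"]) auto
      also have "(\<lambda>x. ennreal ((norm (g' x))^2)) = (\<lambda>x. ennreal (indicator upper x * (norm (g x))^2))"
        by (auto simp: g'_def indicator_def)
      finally show ?thesis using True by simp
    qed simp
  qed
  also have "\<dots> = ennreal ((norm z)^2) * upper_int (\<lambda>x. (norm (g x))^2)"
    by (subst nn_integral_multc) auto
  finally show ?thesis .
qed

text \<open>A cube of twice the volume of the support contains, seen from any point, a set of zeros of
  \<open>f\<close> that has at least the volume of the support.\<close>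

lemma faber_krahn:
  fixes f :: "'n::finite point \<Rightarrow> real"
  defines "m \<equiv> CARD('n option)"
  assumes der: "\<And>x. x \<in> upper \<Longrightarrow> (f has_gradient g x) (at x within upper)"
    and g: "continuous_on upper g"
    and supp: "{x \<in> upper. f x \<noteq> 0} \<subseteq> Z" "Z \<in> sets borel" "emeasure lborel Z \<le> ennreal s"
    and \<rho>: "0 < \<rho>" "\<rho> ^ m = 2 * s"
  shows "upper_int (\<lambda>x. (f x)^2)
     \<le> ennreal (2 * (real m)^2 * \<rho>\<^sup>2) * upper_int (\<lambda>x. (norm (g x))^2)"
proof -
  have s: "s > 0" using zero_less_power[OF \<rho>(1), of m] \<rho>(2) by linarith
  define Q where "Q = cbox (0 :: 'n point) (\<chi> i. \<rho>)"
  have [measurable]: "Q \<in> sets borel" by (simp add: Q_def)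
  have Qm: "emeasure lborel Q = ennreal (2 * s)"
  proof -
    have "measure lborel Q = (\<Prod>i\<in>(UNIV :: 'n option set). \<rho> - 0)"
      unfolding Q_def using \<rho> by (subst content_cbox_cart) (auto simp: interval_ne_empty_cart)
    also have "\<dots> = 2 * s" using \<rho> by (simp add: m_def)
    finally show ?thesis by (simp add: Q_def emeasure_eq_measure2)
  qed
  \<comment> \<open>The cube has a corner at the origin and nonnegative coordinates, so that every
    \<open>z\<close> in it translates the half space into itself.\<close>
  have Qup: "z \<in> upper" if "z \<in> Q" for z using that by (auto simp: Q_def upper_def mem_box_cart)
  have Qnorm: "norm z \<le> real m * \<rho>" if "z \<in> Q" for z
  proof -
    have "norm z \<le> (\<Sum>i\<in>UNIV. \<bar>z $ i\<bar>)" by (rule norm_le_l1_cart)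
    also have "\<dots> \<le> (\<Sum>i\<in>(UNIV :: 'n option set). \<rho>)"
      using that by (intro sum_mono) (auto simp: Q_def mem_box_cart)
    finally show ?thesis by (simp add: m_def)
  qed
  have fc: "continuous_on upper f" by (rule has_derivative_continuous_on[OF der])
  define f' where "f' x = indicator upper x *\<^sub>R f x" for x
  have [measurable]: "f' \<in> borel_measurable borel"
    unfolding f'_def by (rule borel_measurable_continuous_on_indicator) (use fc in auto)
  have [measurable]: "Z \<in> sets borel" by fact
  define I J where "I = upper_int (\<lambda>x. (f x)^2)"
    and "J = upper_int (\<lambda>x. (norm (g x))^2)"
  have point: "ennreal s * ennreal (indicator upper x * (f x)^2) \<le>
      (\<integral>\<^sup>+z. ennreal (indicator Q z * (indicator upper x * (f' (x + z) - f' x)^2)) \<partial>lborel)" for x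
  proof (cases "x \<in> upper")
    case True
    define E where "E = {z. x + z \<in> Z}"
    have [measurable]: "E \<in> sets borel" unfolding E_def by measurable
    have "emeasure lborel E = (\<integral>\<^sup>+z. indicator E z \<partial>lborel)" by simp
    also have "\<dots> = (\<integral>\<^sup>+z. indicator Z (x + 1 *\<^sub>R z) \<partial>lborel)"
      by (intro nn_integral_cong) (simp add: E_def indicator_def)
    also have "\<dots> = (\<integral>\<^sup>+z. indicator Z z \<partial>lborel)" by (subst (2) nn_integral_lborel_affine[of _ 1 x]) auto
    finally have E: "emeasure lborel E \<le> ennreal s" using supp(3) by simp
    have "ennreal s + ennreal s = emeasure lborel Q"
      using s by (simp add: Qm ennreal_plus[symmetric] del: ennreal_plus)
    also have "\<dots> \<le> emeasure lborel ((Q - E) \<union> E)" by (rule emeasure_mono) auto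
    also have "\<dots> \<le> emeasure lborel (Q - E) + emeasure lborel E" by (rule emeasure_subadditive) auto
    also have "\<dots> \<le> emeasure lborel (Q - E) + ennreal s" using E by (intro add_left_mono)
    finally have "ennreal s + ennreal s \<le> ennreal s + emeasure lborel (Q - E)" by (simp only: add.commute)
    then have big: "ennreal s \<le> emeasure lborel (Q - E)" by (simp only: ennreal_add_left_cancel_le) simp
    have "ennreal s * ennreal (indicator upper x * (f x)^2) \<le> emeasure lborel (Q - E) * ennreal ((f x)^2)"
      using big True by (intro mult_mono) auto
    also have "\<dots> = (\<integral>\<^sup>+z. ennreal ((f x)^2) * indicator (Q - E) z \<partial>lborel)"
      by (subst nn_integral_cmult_indicator) (auto simp: mult.commute)
    also have "\<dots> \<le> (\<integral>\<^sup>+z. ennreal (indicator Q z * (indicator upper x * (f' (x + z) - f' x)^2)) \<partial>lborel)"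
    proof (rule nn_integral_mono)
      fix z
      show "ennreal ((f x)^2) * indicator (Q - E) z \<le> ennreal (indicator Q z * (indicator upper x * (f' (x + z) - f' x)^2))"
      proof (cases "z \<in> Q - E")
        case z: True
        have "f' (x + z) = 0" using z supp(1) by (auto simp: f'_def E_def indicator_def)
        moreover have "f' x = f x" using True by (simp add: f'_def)
        ultimately show ?thesis using z True by simp
      qed simp
    qed
    finally show ?thesis .
  qed simp
  have If': "I = (\<integral>\<^sup>+x. ennreal ((f' x)^2) \<partial>lborel)"
    unfolding I_def by (intro nn_integral_cong) (simp add: f'_def indicator_def)
  have "ennreal s * I = (\<integral>\<^sup>+x. ennreal s * ennreal ((f' x)^2) \<partial>lborel)"
    unfolding If' by (rule nn_integral_cmult[symmetric]) measurable
  also have "\<dots> = (\<integral>\<^sup>+x. ennreal s * ennreal (indicator upper x * (f x)^2) \<partial>lborel)"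
    by (intro nn_integral_cong) (simp add: f'_def indicator_def)
  also have "\<dots> \<le> (\<integral>\<^sup>+x. (\<integral>\<^sup>+z. ennreal (indicator Q z * (indicator upper x * (f' (x + z) - f' x)^2)) \<partial>lborel) \<partial>lborel)"
    by (intro nn_integral_mono point)
  also have "\<dots> = (\<integral>\<^sup>+z. (\<integral>\<^sup>+x. ennreal (indicator Q z * (indicator upper x * (f' (x + z) - f' x)^2)) \<partial>lborel) \<partial>lborel)"
    by (rule lborel_pair.Fubini') measurable
  also have "\<dots> \<le> (\<integral>\<^sup>+z. (ennreal ((real m * \<rho>)^2) * J) * indicator Q z \<partial>lborel)"
  proof (rule nn_integral_mono)
    fix z
    show "(\<integral>\<^sup>+x. ennreal (indicator Q z * (indicator upper x * (f' (x + z) - f' x)^2)) \<partial>lborel) \<le> (ennreal ((real m * \<rho>)^2) * J) * indicator Q z"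
    proof (cases "z \<in> Q")
      case True
      have eq: "indicator Q z * (indicator upper x * (f' (x + z) - f' x)^2) = indicator upper x * (f (x + z) - f x)^2" for x
        using True Qup[OF True] by (auto simp: f'_def indicator_def upper_def)
      have "(\<integral>\<^sup>+x. ennreal (indicator Q z * (indicator upper x * (f' (x + z) - f' x)^2)) \<partial>lborel) \<le> ennreal ((norm z)^2) * J"
        unfolding J_def eq by (rule translation_difference_le[OF Qup[OF True] der g])
      also have "\<dots> \<le> ennreal ((real m * \<rho>)^2) * J"
        using Qnorm[OF True] by (intro mult_right_mono ennreal_leI power_mono) auto
      finally show ?thesis using True by simp
    qed simp
  qed
  also have "\<dots> = ennreal s * (ennreal (2 * (real m)^2 * \<rho>\<^sup>2) * J)"
  proof -
    have "(\<integral>\<^sup>+z. (ennreal ((real m * \<rho>)^2) * J) * indicator Q z \<partial>lborel) = (ennreal ((real m * \<rho>)^2) * J) * ennreal (2 * s)"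
      by (subst nn_integral_cmult_indicator) (simp_all add: Qm)
    also have "\<dots> = (ennreal (2 * s) * ennreal ((real m * \<rho>)^2)) * J" by (simp only: mult_ac)
    also have "ennreal (2 * s) * ennreal ((real m * \<rho>)^2) = ennreal s * ennreal (2 * (real m)^2 * \<rho>\<^sup>2)"
      using s by (simp add: ennreal_mult[symmetric] power_mult_distrib mult_ac)
    finally show ?thesis by (simp only: mult.assoc)
  qed
  finally have "ennreal s * I \<le> ennreal s * (ennreal (2 * (real m)^2 * \<rho>\<^sup>2) * J)" .
  then show ?thesis unfolding I_def[symmetric] J_def[symmetric] using s
    by (subst (asm) ennreal_mult_le_mult_iff) auto
qed

section \<open>Polar coordinates of a gauge\<close>

locale gauge =
  fixes N :: "'a::euclidean_space \<Rightarrow> real"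
  assumes N_measurable [measurable]: "N \<in> borel_measurable borel"
    and N_pos: "x \<noteq> 0 \<Longrightarrow> N x > 0"
    and N_zero: "N 0 = 0"
    and N_scale: "c > 0 \<Longrightarrow> N (c *\<^sub>R x) = c * N x"
    and N_finite: "emeasure lborel {x. N x < r} < \<infinity>"
begin

lemma N_nonneg: "0 \<le> N x"
  using N_pos[of x] N_zero by (cases "x = 0") auto


lemma N_gt_0_iff: "0 < N x \<longleftrightarrow> x \<noteq> 0"
  using N_pos[of x] N_zero by (cases "x = 0") auto

lemma N_normalized: "x \<noteq> 0 \<Longrightarrow> N (x /\<^sub>R N x) = 1"
  using N_pos[of x] by (simp add: N_scale)

text \<open>Integration over the gauge sphere against its cone measure, which avoids surface
  measures: the function is extended constantly along rays and integrated over the gauge ball. The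
  factor \<open>DIM('a)\<close> is the one for which volume integrals become integrals of
  \<open>s ^ (DIM('a) - 1)\<close> times sphere integrals.\<close>

definition sphere_integral :: "('a \<Rightarrow> real) \<Rightarrow> real" where
  "sphere_integral f = real DIM('a) * (LBINT x. indicator {x. 0 < N x \<and> N x < 1} x * f (x /\<^sub>R N x))"

text \<open>Both sides become integrals of the same function after the substitutions \<open>s = t N x\<close> for
  fixed \<open>x\<close> and \<open>y = t x\<close> for fixed \<open>t\<close>.\<close>

lemma nn_integral_polar:
  fixes f :: "'a \<Rightarrow> ennreal"
  assumes [measurable]: "f \<in> borel_measurable borel"
  defines "m \<equiv> DIM('a)"
  shows "(\<integral>\<^sup>+x. f x * indicator {x. N x < r} x \<partial>lborel) =
    (\<integral>\<^sup>+s. (\<integral>\<^sup>+x. indicator {0<..<r} s * ennreal (s ^ (m - 1) * real m) *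
        (indicator {x. 0 < N x \<and> N x < 1} x * f (s *\<^sub>R (x /\<^sub>R N x))) \<partial>lborel) \<partial>lborel)"
proof -
  have m: "m > 0" by (simp add: m_def)
  \<comment> \<open>The same integrand in three sets of variables: \<open>k1\<close> in s and x,
    \<open>k2\<close> in t and x after \<open>s = t * N x\<close>, and \<open>k3\<close> in t and y
    after \<open>y = t *\<^sub>R x\<close>. In \<open>k3\<close> the function \<open>f\<close> no
    longer depends on t.\<close>
  define k1 where "k1 s x = indicator {0<..<r} s * ennreal (s ^ (m - 1) * real m) *
        (indicator {x. 0 < N x \<and> N x < 1} x * f (s *\<^sub>R (x /\<^sub>R N x)))" for s x
  define k2 where "k2 t x = (if 0 < t \<and> t * N x < r \<and> 0 < N x \<and> N x < 1
      then ennreal (real m * N x ^ m * t ^ (m - 1)) * f (t *\<^sub>R x) else 0)" for t x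
  define k3 where "k3 t y = (if 0 < N y \<and> N y < t \<and> N y < r
      then ennreal (real m * N y ^ m / t ^ (m + 1)) * f y else 0)" for t y
  have [measurable]: "(\<lambda>(s, x). k1 s x) \<in> borel_measurable (lborel \<Otimes>\<^sub>M lborel)"
    "(\<lambda>(s, x). k2 s x) \<in> borel_measurable (lborel \<Otimes>\<^sub>M lborel)"
    "(\<lambda>(s, x). k3 s x) \<in> borel_measurable (lborel \<Otimes>\<^sub>M lborel)" unfolding k1_def k2_def k3_def by measurable
  have [measurable]: "k1 s \<in> borel_measurable borel" "(\<lambda>s. k1 s x) \<in> borel_measurable borel"
    "k2 s \<in> borel_measurable borel" "(\<lambda>s. k2 s x) \<in> borel_measurable borel"
    "k3 s \<in> borel_measurable borel" "(\<lambda>s. k3 s x) \<in> borel_measurable borel" for s x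
    unfolding k1_def k2_def k3_def by measurable
  have k12: "(\<integral>\<^sup>+s. k1 s x \<partial>lborel) = (\<integral>\<^sup>+t. k2 t x \<partial>lborel)" for x
  proof (cases "0 < N x \<and> N x < 1")
    case True
    have "(\<integral>\<^sup>+s. k1 s x \<partial>lborel) = ennreal \<bar>N x\<bar> * (\<integral>\<^sup>+t. k1 (0 + N x * t) x \<partial>lborel)"
      using True by (intro nn_integral_real_affine) auto
    also have "\<dots> = (\<integral>\<^sup>+t. ennreal \<bar>N x\<bar> * k1 (0 + N x * t) x \<partial>lborel)"
      by (rule nn_integral_cmult[symmetric]) measurable
    also have "\<dots> = (\<integral>\<^sup>+t. k2 t x \<partial>lborel)"
    proof (intro nn_integral_cong)
      fix t
      show "ennreal \<bar>N x\<bar> * k1 (0 + N x * t) x = k2 t x"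
      proof (cases "0 < t \<and> t * N x < r")
        case t: True
        have "N x * ((N x * t) ^ (m - 1) * real m) = real m * N x ^ m * t ^ (m - 1)"
          using m by (cases m) (auto simp: power_mult_distrib)
        then have coef: "ennreal (N x) * ennreal ((N x * t) ^ (m - 1) * real m) = ennreal (real m * N x ^ m * t ^ (m - 1))"
          using True t by (simp add: ennreal_mult[symmetric])
        have arg: "(N x * t) *\<^sub>R (x /\<^sub>R N x) = t *\<^sub>R x" using True by simp
        have "0 < N x * t" "N x * t < r" using True t by (auto simp: mult.commute)
        then have "ennreal \<bar>N x\<bar> * k1 (0 + N x * t) x =
            (ennreal (N x) * ennreal ((N x * t) ^ (m - 1) * real m)) * f ((N x * t) *\<^sub>R (x /\<^sub>R N x))"
          using True by (simp add: k1_def mult.assoc del: scaleR_scaleR)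
        also have "\<dots> = k2 t x" unfolding coef arg using True t by (simp add: k2_def)
        finally show ?thesis .
      next
        case False
        then have "N x * t \<notin> {0<..<r}" using True by (auto simp: zero_less_mult_iff mult.commute)
        then show ?thesis using False by (auto simp: k1_def k2_def)
      qed
    qed
    finally show ?thesis .
  next
    case False
    then have "k1 s x = 0" "k2 s x = 0" for s by (auto simp: k1_def k2_def indicator_def)
    then show ?thesis by simp
  qed
  have k23: "(\<integral>\<^sup>+x. k2 t x \<partial>lborel) = (\<integral>\<^sup>+y. k3 t y \<partial>lborel)" for t
  proof (cases "0 < t")
    case True
    have "(\<integral>\<^sup>+y. k3 t y \<partial>lborel) = ennreal (\<bar>t\<bar> ^ m) * (\<integral>\<^sup>+x. k3 t (0 + t *\<^sub>R x) \<partial>lborel)"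
      unfolding m_def using True by (intro nn_integral_lborel_affine) auto
    also have "\<dots> = (\<integral>\<^sup>+x. ennreal (\<bar>t\<bar> ^ m) * k3 t (0 + t *\<^sub>R x) \<partial>lborel)"
      by (rule nn_integral_cmult[symmetric]) measurable
    also have "\<dots> = (\<integral>\<^sup>+x. k2 t x \<partial>lborel)"
    proof (intro nn_integral_cong)
      fix x
      have "t ^ m * (real m * (t * N x) ^ m / t ^ (m + 1)) = real m * N x ^ m * t ^ (m - 1)"
        using True m by (cases m) (auto simp: power_mult_distrib field_simps)
      then have e: "ennreal (t ^ m) * ennreal (real m * (t * N x) ^ m / t ^ (m + 1)) = ennreal (real m * N x ^ m * t ^ (m - 1))"
        using True N_nonneg[of x] by (simp add: ennreal_mult[symmetric])
      have c: "0 < t * N x \<and> t * N x < t \<and> t * N x < r \<longleftrightarrow> 0 < t \<and> t * N x < r \<and> 0 < N x \<and> N x < 1"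
        using True by (auto simp: zero_less_mult_iff)
      show "ennreal (\<bar>t\<bar> ^ m) * k3 t (0 + t *\<^sub>R x) = k2 t x" unfolding k2_def k3_def add_0 N_scale[OF True] c
        using True e by (simp add: mult.assoc[symmetric])
    qed
    finally show ?thesis by simp
  next
    case False
    have "k2 t x = 0" "k3 t x = 0" for x
      using False N_nonneg[of x] by (auto simp: k2_def k3_def indicator_def)
    then show ?thesis by simp
  qed
  \<comment> \<open>The condition \<open>N x < 1\<close> has become \<open>N y < t\<close>, and the
    weight \<open>real m * N y ^ m / t ^ (m + 1)\<close> has integral 1 over these t.\<close>
  have k3: "(\<integral>\<^sup>+t. k3 t y \<partial>lborel) = f y * indicator {x. 0 < N x \<and> N x < r} y" for y
  proof (cases "0 < N y \<and> N y < r")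
    case True
    have "(\<integral>\<^sup>+t. ennreal (real m * N y ^ m / t ^ (m + 1)) * indicator {N y..} t \<partial>lborel) = ennreal (0 - (- (N y ^ m / N y ^ m)))"
    proof (rule nn_integral_FTC_atLeast[where F = "\<lambda>t. - (N y ^ m / t ^ m)"])
      show "((\<lambda>t. - (N y ^ m / t ^ m)) has_real_derivative real m * N y ^ m / t ^ (m + 1)) (at t)" if "N y \<le> t" for t
      proof -
        have "t > 0" using that True by simp
        then have "((\<lambda>t. - (N y ^ m / t ^ m)) has_real_derivative
            - ((0 * t ^ m - N y ^ m * (real m * t ^ (m - Suc 0))) / (t ^ m * t ^ m))) (at t)"
          by (intro DERIV_minus DERIV_divide DERIV_const DERIV_pow) auto
        moreover have "- ((0 * t ^ m - N y ^ m * (real m * t ^ (m - Suc 0))) / (t ^ m * t ^ m)) = real m * N y ^ m / t ^ (m + 1)"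
          using m \<open>t > 0\<close> by (cases m) (auto simp: field_simps)
        ultimately show ?thesis by simp
      qed
      show "((\<lambda>t. - (N y ^ m / t ^ m)) \<longlongrightarrow> 0) at_top"
      proof -
        have "filterlim (\<lambda>t::real. t ^ m) at_top at_top"
          using m by (intro filterlim_pow_at_top filterlim_ident)
        then have "((\<lambda>t. N y ^ m / t ^ m) \<longlongrightarrow> 0) at_top"
          by (intro tendsto_divide_0[OF tendsto_const] filterlim_at_top_imp_at_infinity)
        then show ?thesis using tendsto_minus by fastforce
      qed
    qed (use True in auto)
    then have one: "(\<integral>\<^sup>+t. ennreal (real m * N y ^ m / t ^ (m + 1)) * indicator {N y..} t \<partial>lborel) = 1"
      using True by simp
    have "AE t in lborel. t \<noteq> N y" by (rule AE_lborel_singleton)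
    then have "AE t in lborel. k3 t y = (ennreal (real m * N y ^ m / t ^ (m + 1)) * indicator {N y..} t) * f y"
      by eventually_elim (use True in \<open>auto simp: k3_def indicator_def\<close>)
    then have "(\<integral>\<^sup>+t. k3 t y \<partial>lborel) = (\<integral>\<^sup>+t. (ennreal (real m * N y ^ m / t ^ (m + 1)) * indicator {N y..} t) * f y \<partial>lborel)"
      by (rule nn_integral_cong_AE)
    also have "\<dots> = (\<integral>\<^sup>+t. ennreal (real m * N y ^ m / t ^ (m + 1)) * indicator {N y..} t \<partial>lborel) * f y"
      by (rule nn_integral_multc) measurable
    finally show ?thesis using True unfolding one by simp
  next
    case False
    then have "k3 t y = 0" for t by (auto simp: k3_def)
    then show ?thesis using False by simp
  qed
  have "(\<integral>\<^sup>+s. (\<integral>\<^sup>+x. k1 s x \<partial>lborel) \<partial>lborel) = (\<integral>\<^sup>+x. (\<integral>\<^sup>+s. k1 s x \<partial>lborel) \<partial>lborel)"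
    by (rule lborel_pair.Fubini'[symmetric]) measurable
  also have "\<dots> = (\<integral>\<^sup>+t. (\<integral>\<^sup>+x. k2 t x \<partial>lborel) \<partial>lborel)"
    unfolding k12 by (rule lborel_pair.Fubini') measurable
  also have "\<dots> = (\<integral>\<^sup>+y. (\<integral>\<^sup>+t. k3 t y \<partial>lborel) \<partial>lborel)"
    unfolding k23 by (rule lborel_pair.Fubini'[symmetric]) measurable
  also have "\<dots> = (\<integral>\<^sup>+y. f y * indicator {x. N x < r} y \<partial>lborel)" unfolding k3
  proof (rule nn_integral_cong_AE)
    have "AE y in lborel. y \<noteq> (0 :: 'a)" by (rule AE_lborel_singleton)
    then show "AE y in lborel. f y * indicator {x. 0 < N x \<and> N x < r} y = f y * indicator {x. N x < r} y"
      by eventually_elim (auto simp: indicator_def N_gt_0_iff)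
  qed
  finally show ?thesis unfolding k1_def by simp
qed

lemma sphere_integrable:
  fixes f :: "'a \<Rightarrow> real" and B :: real
  assumes [measurable]: "f \<in> borel_measurable borel" and B: "\<And>q. N q = 1 \<Longrightarrow> \<bar>f q\<bar> \<le> B"
  shows "integrable lborel (\<lambda>x. indicator {x. 0 < N x \<and> N x < 1} x * f (x /\<^sub>R N x))"
proof (rule integrableI_bounded_set[where A = "{x. 0 < N x \<and> N x < 1}" and B = B])
  have "emeasure lborel {x. 0 < N x \<and> N x < 1} \<le> emeasure lborel {x. N x < 1}" by (rule emeasure_mono) auto
  then show "emeasure lborel {x. 0 < N x \<and> N x < 1} < \<infinity>" using N_finite le_less_trans by blast
qed (use B in \<open>auto simp: N_normalized N_gt_0_iff\<close>)

lemma sphere_integral_add: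
  assumes "f \<in> borel_measurable borel" "\<And>q. N q = 1 \<Longrightarrow> \<bar>f q\<bar> \<le> B"
    and "g \<in> borel_measurable borel" "\<And>q. N q = 1 \<Longrightarrow> \<bar>g q\<bar> \<le> B'"
  shows "sphere_integral (\<lambda>q. f q + g q) = sphere_integral f + sphere_integral g"
  unfolding sphere_integral_def
  by (simp add: distrib_left Bochner_Integration.integral_add[OF sphere_integrable[OF assms(1,2)] sphere_integrable[OF assms(3,4)]])

lemma sphere_integral_cmult: "sphere_integral (\<lambda>q. c * f q) = c * sphere_integral f"
  unfolding sphere_integral_def by (simp add: mult.left_commute[of _ c])

lemma sphere_integral_cong:
  assumes "\<And>q. N q = 1 \<Longrightarrow> f q = g q"
  shows "sphere_integral f = sphere_integral g"
proof -
  have "indicator {x. 0 < N x \<and> N x < 1} x * f (x /\<^sub>R N x) = indicator {x. 0 < N x \<and> N x < 1} x * g (x /\<^sub>R N x)" for x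
    using assms[of "x /\<^sub>R N x"] N_normalized[of x] by (auto simp: indicator_def N_gt_0_iff)
  then show ?thesis unfolding sphere_integral_def by presburger
qed

lemma sphere_integral_nonneg:
  assumes "\<And>q. N q = 1 \<Longrightarrow> 0 \<le> f q"
  shows "0 \<le> sphere_integral f" unfolding sphere_integral_def
proof (rule mult_nonneg_nonneg[OF _ Bochner_Integration.integral_nonneg])
  fix x
  show "0 \<le> indicator {x. 0 < N x \<and> N x < 1} x * f (x /\<^sub>R N x)"
    using assms[of "x /\<^sub>R N x"] N_normalized[of x] by (auto simp: indicator_def N_gt_0_iff)
qed auto

lemma polar_integral:
  fixes f :: "'a \<Rightarrow> real"
  assumes [measurable]: "f \<in> borel_measurable borel"
    and f: "\<And>x. N x < r \<Longrightarrow> 0 \<le> f x" "\<And>x. N x < r \<Longrightarrow> f x \<le> B"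
  defines "\<sigma> \<equiv> (\<lambda>s. s ^ (DIM('a) - 1) * sphere_integral (\<lambda>q. f (s *\<^sub>R q)))"
  shows "integrable lborel (\<lambda>s. indicator {0<..<r} s * \<sigma> s)" (is ?int)
    and "(LBINT x. indicator {x. N x < r} x * f x) = (LBINT s. indicator {0<..<r} s * \<sigma> s)" (is ?eq)
proof -
  have [measurable]: "(\<lambda>s. sphere_integral (\<lambda>q. f (s *\<^sub>R q))) \<in> borel_measurable borel"
    unfolding sphere_integral_def by measurable
  have [measurable]: "\<sigma> \<in> borel_measurable borel" unfolding \<sigma>_def by measurable
  have \<sigma>: "indicator {0<..<r} s * ennreal (\<sigma> s) =
      (\<integral>\<^sup>+x. indicator {0<..<r} s * ennreal (s ^ (DIM('a) - 1) * real DIM('a)) *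
        (indicator {x. 0 < N x \<and> N x < 1} x * ennreal (f (s *\<^sub>R (x /\<^sub>R N x)))) \<partial>lborel)" for s
  proof (cases "s \<in> {0<..<r}")
    case True
    have bd: "0 \<le> f (s *\<^sub>R q)" "\<bar>f (s *\<^sub>R q)\<bar> \<le> B" if "N q = 1" for q
      using f[of "s *\<^sub>R q"] that True by (auto simp: N_scale)
    have i: "integrable lborel (\<lambda>x. indicator {x. 0 < N x \<and> N x < 1} x * f (s *\<^sub>R (x /\<^sub>R N x)))"
      by (rule sphere_integrable) (use bd in auto)
    have nn: "0 \<le> indicator {x. 0 < N x \<and> N x < 1} x * f (s *\<^sub>R (x /\<^sub>R N x))" for x
      using bd(1)[of "x /\<^sub>R N x"] N_normalized[of x] by (auto simp: indicator_def N_gt_0_iff)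
    have "(\<integral>\<^sup>+x. indicator {0<..<r} s * ennreal (s ^ (DIM('a) - 1) * real DIM('a)) *
        (indicator {x. 0 < N x \<and> N x < 1} x * ennreal (f (s *\<^sub>R (x /\<^sub>R N x)))) \<partial>lborel) =
        (\<integral>\<^sup>+x. ennreal (s ^ (DIM('a) - 1) * real DIM('a)) *
        ennreal (indicator {x. 0 < N x \<and> N x < 1} x * f (s *\<^sub>R (x /\<^sub>R N x))) \<partial>lborel)"
      using True by (intro nn_integral_cong) (auto simp: indicator_def)
    also have "\<dots> = ennreal (s ^ (DIM('a) - 1) * real DIM('a)) *
        (\<integral>\<^sup>+x. ennreal (indicator {x. 0 < N x \<and> N x < 1} x * f (s *\<^sub>R (x /\<^sub>R N x))) \<partial>lborel)"
      by (rule nn_integral_cmult) measurable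
    also have "(\<integral>\<^sup>+x. ennreal (indicator {x. 0 < N x \<and> N x < 1} x * f (s *\<^sub>R (x /\<^sub>R N x))) \<partial>lborel) =
        ennreal (LBINT x. indicator {x. 0 < N x \<and> N x < 1} x * f (s *\<^sub>R (x /\<^sub>R N x)))"
      by (rule nn_integral_eq_integral[OF i]) (use nn in auto)
    finally show ?thesis using True nn
      by (simp add: \<sigma>_def sphere_integral_def ennreal_mult[symmetric] mult.assoc[symmetric] Bochner_Integration.integral_nonneg)
  qed simp
  have \<sigma>nn: "0 \<le> indicator {0<..<r} s * \<sigma> s" for s
    using f(1) by (auto simp: indicator_def \<sigma>_def N_scale intro!: mult_nonneg_nonneg sphere_integral_nonneg)
  have If: "integrable lborel (\<lambda>x. indicator {x. N x < r} x * f x)"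
  proof (rule integrableI_bounded_set[where A = "{x. N x < r}" and B = B])
    show "AE x in lborel. x \<in> {x. N x < r} \<longrightarrow> norm (indicator {x. N x < r} x * f x) \<le> B" using f by auto
  qed (use N_finite in auto)
  have fnn: "0 \<le> indicator {x. N x < r} x * f x" for x using f(1) by (auto simp: indicator_def)
  have "(\<integral>\<^sup>+s. ennreal (indicator {0<..<r} s * \<sigma> s) \<partial>lborel) = (\<integral>\<^sup>+s. indicator {0<..<r} s * ennreal (\<sigma> s) \<partial>lborel)"
    by (intro nn_integral_cong) (auto simp: indicator_def)
  also have "\<dots> = (\<integral>\<^sup>+x. ennreal (f x) * indicator {x. N x < r} x \<partial>lborel)"
    unfolding \<sigma> by (rule nn_integral_polar[symmetric]) measurable
  also have "\<dots> = (\<integral>\<^sup>+x. ennreal (indicator {x. N x < r} x * f x) \<partial>lborel)"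
    by (intro nn_integral_cong) (auto simp: indicator_def)
  also have "\<dots> = ennreal (LBINT x. indicator {x. N x < r} x * f x)"
    by (rule nn_integral_eq_integral[OF If]) (use fnn in auto)
  finally have eq: "(\<integral>\<^sup>+s. ennreal (indicator {0<..<r} s * \<sigma> s) \<partial>lborel) = ennreal (LBINT x. indicator {x. N x < r} x * f x)" .
  show ?int by (rule integrableI_nn_integral_finite[OF _ _ eq]) (use \<sigma>nn fnn in \<open>auto intro!: Bochner_Integration.integral_nonneg\<close>)
  show ?eq using integral_eq_nn_integral[of "\<lambda>s. indicator {0<..<r} s * \<sigma> s" lborel] \<sigma>nn
    by (simp add: eq Bochner_Integration.integral_nonneg fnn)
qed

text \<open>Continuity is asked for along rays only, since the integrands to come are extended by
  zero across the flat boundary and may jump there. Dominated convergence does the rest.\<close>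

lemma continuous_on_sphere_integral:
  assumes [measurable]: "f \<in> borel_measurable borel"
    and f: "\<And>x. N x < R \<Longrightarrow> \<bar>f x\<bar> \<le> B"
    and c: "\<And>q. N q = 1 \<Longrightarrow> continuous_on {0<..<R} (\<lambda>s. f (s *\<^sub>R q))"
  shows "continuous_on {0<..<R} (\<lambda>s. sphere_integral (\<lambda>q. f (s *\<^sub>R q)))"
  unfolding continuous_on_sequentially comp_def
proof (intro allI ballI impI, elim conjE)
  fix X :: "nat \<Rightarrow> real" and a
  assume a: "a \<in> {0<..<R}" and X: "\<forall>n. X n \<in> {0<..<R}" "X \<longlonglongrightarrow> a"
  define A where "A = {x. 0 < N x \<and> N x < 1}"
  have [measurable]: "A \<in> sets borel" unfolding A_def by measurable
  have fin: "emeasure lborel A < \<infinity>"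
    using emeasure_mono[of A "{x. N x < 1}" lborel] N_finite[of 1] by (auto simp: A_def intro: le_less_trans)
  show "(\<lambda>n. sphere_integral (\<lambda>q. f (X n *\<^sub>R q))) \<longlonglongrightarrow> sphere_integral (\<lambda>q. f (a *\<^sub>R q))"
    unfolding sphere_integral_def A_def[symmetric]
  proof (intro tendsto_intros integral_dominated_convergence[where w = "\<lambda>x. indicator A x * B"])
    show "integrable lborel (\<lambda>x. indicator A x * B)" using fin by (intro integrable_mult_left) simp
    show "AE x in lborel. norm (indicator A x * f (X n *\<^sub>R (x /\<^sub>R N x))) \<le> indicator A x * B" for n
    proof (intro AE_I2)
      fix x show "norm (indicator A x * f (X n *\<^sub>R (x /\<^sub>R N x))) \<le> indicator A x * B"
        using f[of "X n *\<^sub>R (x /\<^sub>R N x)"] X(1) N_normalized[of x]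
        by (auto simp: A_def indicator_def N_scale N_gt_0_iff simp del: scaleR_scaleR)
    qed
    show "AE x in lborel. (\<lambda>n. indicator A x * f (X n *\<^sub>R (x /\<^sub>R N x))) \<longlonglongrightarrow> indicator A x * f (a *\<^sub>R (x /\<^sub>R N x))"
    proof (intro AE_I2)
      fix x
      show "(\<lambda>n. indicator A x * f (X n *\<^sub>R (x /\<^sub>R N x))) \<longlonglongrightarrow> indicator A x * f (a *\<^sub>R (x /\<^sub>R N x))"
      proof (cases "x \<in> A")
        case True
        then have "N (x /\<^sub>R N x) = 1" by (intro N_normalized) (auto simp: A_def N_gt_0_iff)
        from c[OF this] have "(\<lambda>n. f (X n *\<^sub>R (x /\<^sub>R N x))) \<longlonglongrightarrow> f (a *\<^sub>R (x /\<^sub>R N x))"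
          using X a by (auto simp: continuous_on_sequentially comp_def simp del: scaleR_scaleR)
        then show ?thesis by (intro tendsto_intros)
      qed simp
    qed
  qed measurable
qed

text \<open>In polar coordinates the volume integral is a one-dimensional integral with continuous
  integrand, so the fundamental theorem of calculus applies. Starting at \<open>r0 > 0\<close> stays
  away from the origin, where continuity is not assumed.\<close>

lemma polar_has_derivative:
  assumes f: "f \<in> borel_measurable borel" "\<And>x. N x < R \<Longrightarrow> 0 \<le> f x" "\<And>x. N x < R \<Longrightarrow> f x \<le> B"
    and c: "\<And>q. N q = 1 \<Longrightarrow> continuous_on {0<..<R} (\<lambda>s. f (s *\<^sub>R q))"
    and r: "0 < r" "r < R"
  shows "((\<lambda>r. \<integral>x. indicator {x. N x < r} x * f x \<partial>lborel) has_real_derivative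
    r ^ (DIM('a) - 1) * sphere_integral (\<lambda>q. f (r *\<^sub>R q))) (at r)"
proof -
  define \<sigma> where "\<sigma> s = s ^ (DIM('a) - 1) * sphere_integral (\<lambda>q. f (s *\<^sub>R q))" for s
  define D where "D r = (LBINT x. indicator {x. N x < r} x * f x)" for r
  have \<sigma>c: "continuous_on {0<..<R} \<sigma>" unfolding \<sigma>_def
  proof (intro continuous_intros continuous_on_sphere_integral[OF f(1) _ c])
    show "\<bar>f x\<bar> \<le> B" if "N x < R" for x using f(2,3)[OF that] by simp
  qed auto
  have pol: "integrable lborel (\<lambda>s. indicator {0<..<t} s * \<sigma> s)" "D t = (LBINT s. indicator {0<..<t} s * \<sigma> s)"
    if "t < R" for t using polar_integral[OF f(1), of t B] f that unfolding D_def \<sigma>_def by auto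
  define r0 r1 where "r0 = r / 2" and "r1 = (r + R) / 2"
  have r01: "0 < r0" "r0 < r" "r < r1" "r1 < R" using r by (auto simp: r0_def r1_def)
  have sub: "{r0..r1} \<subseteq> {0<..<R}" using r01 by auto
  have "((\<lambda>t. integral {r0..t} \<sigma>) has_real_derivative \<sigma> r) (at r within {r0..r1})"
    by (rule integral_has_real_derivative) (use r01 continuous_on_subset[OF \<sigma>c sub] in auto)
  then have "((\<lambda>t. D r0 + integral {r0..t} \<sigma>) has_real_derivative \<sigma> r) (at r)"
    unfolding at_within_Icc_at[OF r01(2,3)] by (auto intro!: derivative_eq_intros)
  then have "(D has_real_derivative \<sigma> r) (at r)"
  proof (rule has_field_derivative_transform_within_open[where S = "{r0<..<r1}"])
    fix t assume t: "t \<in> {r0<..<r1}"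
    have ci: "continuous_on {r0..t} \<sigma>" by (rule continuous_on_subset[OF \<sigma>c]) (use t r01 in auto)
    have "integrable lborel (\<lambda>s. indicator {r0..t} s *\<^sub>R \<sigma> s)"
      by (rule borel_integrable_compact[OF _ ci]) simp
    then have si: "set_integrable lborel {r0..t} \<sigma>" by (simp add: set_integrable_def)
    have "D t - D r0 = (LBINT s. indicator {0<..<t} s * \<sigma> s - indicator {0<..<r0} s * \<sigma> s)"
      using pol[of t] pol[of r0] t r01 by simp
    also have "\<dots> = (LBINT s. indicator {r0..t} s *\<^sub>R \<sigma> s)"
    proof (rule integral_cong_AE)
      have "AE s in lborel. s \<noteq> t" by (rule AE_lborel_singleton)
      then show "AE s in lborel. indicator {0<..<t} s * \<sigma> s - indicator {0<..<r0} s * \<sigma> s = indicator {r0..t} s *\<^sub>R \<sigma> s"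
        by eventually_elim (use t r01 in \<open>auto simp: indicator_def\<close>)
      show "(\<lambda>s. indicator {0<..<t} s * \<sigma> s - indicator {0<..<r0} s * \<sigma> s) \<in> borel_measurable lborel"
        using pol(1)[of t] pol(1)[of r0] t r01 by (intro borel_measurable_diff) auto
    qed (use si in \<open>auto simp: set_integrable_def\<close>)
    also have "\<dots> = integral {r0..t} \<sigma>"
      using set_borel_integral_eq_integral(2)[OF si] by (simp add: set_lebesgue_integral_def)
    finally show "D r0 + integral {r0..t} \<sigma> = D t" by simp
  qed (use r01 in auto)
  then show ?thesis unfolding D_def \<sigma>_def .
qed

end

section \<open>Morrey's inequality\<close>

lemma smooth1_add: "smooth1 f \<Longrightarrow> smooth1 g \<Longrightarrow> smooth1 (\<lambda>x. f x + g x)"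
  by (simp add: smooth1_def D_times_add)

text \<open>The half-width is a quarter divided by the dimension, which puts the support into
  \<open>bump_ball\<close>.\<close>

definition unit_bump :: "'n::finite point \<Rightarrow> real" where
  "unit_bump = cube_bump (1 / (4 * real CARD('n option)))"

definition unit_bump_grad :: "'n::finite point \<Rightarrow> 'n point" where
  "unit_bump_grad = prodf_grad (\<lambda>i. bump1 (- (1 / (4 * real CARD('n option)))) (1 / (4 * real CARD('n option))))"

abbreviation bump_ball :: "'n::finite point set" where
  "bump_ball \<equiv> cball 0 (1/4)"

lemma unit_bump_nonneg: "0 \<le> unit_bump z"
  by (simp add: unit_bump_def cube_bump_nonneg)

lemma unit_bump_abs: "\<bar>unit_bump z\<bar> \<le> 1"
  by (simp add: unit_bump_def cube_bump_nonneg cube_bump_le_1)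

lemma continuous_unit_bump: "continuous_on S unit_bump" "continuous_on S unit_bump_grad"
  unfolding unit_bump_def unit_bump_grad_def
  by (intro continuous_cube_bump continuous_prodf_grad smooth1_bump1)+

lemma unit_bump_has_derivative: "(unit_bump has_gradient unit_bump_grad z) (at z)"
  unfolding unit_bump_def unit_bump_grad_def cube_bump_def by (intro prodf_has_derivative smooth1_bump1)

text \<open>Where the bump vanishes it attains its minimum, so its gradient is zero there
  too.\<close>

lemma unit_bump_outside:
  fixes z :: "'n::finite point"
  assumes "z \<notin> bump_ball"
  shows "unit_bump z = 0" "unit_bump_grad z = 0"
proof -
  have "c > 0 \<Longrightarrow> 1 / (4 * c) * c = 1/4" for c :: real by simp
  from this[of "real CARD('n option)"] have r: "1 / (4 * real CARD('n option)) * real CARD('n option) = 1/4" by (simp only: of_nat_0_less_iff zero_less_card_finite)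
  show z: "unit_bump z = 0" unfolding unit_bump_def by (rule cube_bump_eq_0, unfold r) (use assms in auto)
  have "(\<lambda>h. unit_bump_grad z \<bullet> h) = (\<lambda>h. 0)"
    by (rule differential_zero_maxmin[OF _ open_UNIV unit_bump_has_derivative]) (auto simp: z unit_bump_nonneg)
  then show "unit_bump_grad z = 0" by (metis inner_eq_zero_iff)
qed

lemma unit_bump_integrable: "integrable lborel unit_bump"
  and unit_bump_integral_pos: "0 < (LBINT z. unit_bump (z :: 'n::finite point))"
  unfolding unit_bump_def by (auto intro!: cube_bump_integrable cube_bump_integral_pos)

text \<open>The averages of \<open>f\<close> along \<open>q \<mapsto> (x + q v, q d)\<close> (centre, scale) have \<open>q\<close>-derivative
  \<open>\<Sum>\<^sub>k \<integral> \<partial>\<^sub>kf \<psi>\<^sub>k\<close> with explicit test functions \<open>\<psi>\<^sub>k\<close>; they tend to a multiple of \<open>f x\<close>.\<close>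

context
  fixes f :: "'n::finite point \<Rightarrow> real" and g :: "'n option \<Rightarrow> 'n point \<Rightarrow> real"
    and K \<gamma> :: real and x v :: "'n point" and d :: real
  assumes fc: "continuous_on unit_half_ball f"
    and wp: "\<And>k. is_weak_partial unit_half_ball_int k f (g k)"
    and \<gamma>: "0 < \<gamma>" and K: "0 \<le> K"
    and gK: "\<And>k s. 0 < s \<Longrightarrow> s < 1 \<Longrightarrow>
      set_integrable lebesgue (unit_half_ball_int \<inter> ball x s) (g k) \<and>
      (LINT y:unit_half_ball_int \<inter> ball x s|lebesgue. \<bar>g k y\<bar>) \<le> K * s powr (real CARD('n option) - 1 + \<gamma>)"
    and xv: "x \<in> upper" "d / 2 \<le> v $ None" "norm v \<le> 3 / 2 * d" "0 < d" "norm x + 4 * d < 1"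
begin

private definition "m = CARD('n option)"
private definition "S = cball x (4 * d) \<inter> upper"
private definition "F y = indicator S y *\<^sub>R f y"
text \<open>\<open>zz q\<close> rescales the ball with centre \<open>x + q *\<^sub>R v\<close> and
  radius \<open>q * d\<close> to the unit ball. \<open>W q\<close> is the bump transported to that
  ball with its mass preserved, \<open>W'\<close> its derivative in \<open>q\<close>, and
  \<open>A q\<close> the resulting average of \<open>f\<close>.\<close>

private definition "zz q y = (1 / (q * d)) *\<^sub>R (y - x - q *\<^sub>R v)"
private definition "W q y = inverse ((q * d) ^ m) * unit_bump (zz q y)"
private definition "W' q y = - (inverse ((q * d) ^ m) / (q * d)) *
  (real m * d * unit_bump (zz q y) + unit_bump_grad (zz q y) \<bullet> (v + d *\<^sub>R zz q y))"
private definition "A q = (LBINT y. F y * W q y)"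

private lemma S_compact: "compact S"
  unfolding S_def by (intro compact_Int_closed compact_cball closed_upper)

private lemma S_sub: "S \<subseteq> unit_half_ball"
proof
  fix y assume y: "y \<in> S"
  then have "norm (y - x) \<le> 4 * d" by (simp add: S_def dist_norm norm_minus_commute)
  then have "norm y < 1" using xv norm_triangle_sub[of y x] by linarith
  then show "y \<in> unit_half_ball" using y by (auto simp: S_def upper_def unit_half_ball_def half_ball_def)
qed

private lemma F_measurable [measurable]: "F \<in> borel_measurable borel"
  unfolding F_def by (rule borel_measurable_continuous_on_indicator)
     (use S_compact continuous_on_subset[OF fc S_sub] in \<open>auto simp: compact_imp_closed\<close>)

text \<open>The normal component of \<open>v\<close> is at least \<open>d / 2\<close>, while the
  bump extends only \<open>d / 4\<close> from its centre; so the supports lie in the open half space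
  even if \<open>x\<close> is on the flat boundary. This is what makes the averaging functions
  admissible.\<close>

private lemma zz_box:
  assumes "0 < q" "q < 2" "zz q y \<in> bump_ball"
  shows "y \<in> S" "y \<in> unit_half_ball_int" "y \<in> ball x (4 * d)" "norm (y - x) \<le> 2 * q * d"
proof -
  have y: "y = x + q *\<^sub>R v + (q * d) *\<^sub>R zz q y" using assms xv by (simp add: zz_def)
  have "norm (y - x) \<le> norm (q *\<^sub>R v) + norm ((q * d) *\<^sub>R zz q y)"
    by (subst y) (metis add.assoc add_diff_cancel_left' norm_triangle_ineq)
  also have "\<dots> \<le> q * (3 / 2 * d) + (q * d) * (1 / 2)"
    unfolding norm_scaleR using assms xv by (intro add_mono mult_mono) auto
  finally show n: "norm (y - x) \<le> 2 * q * d" by (simp add: mult_ac)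
  also have "2 * q * d < 2 * 2 * d" using assms xv by (intro mult_strict_right_mono) auto
  finally have n4: "norm (y - x) < 4 * d" by simp
  then show "y \<in> ball x (4 * d)" by (simp add: dist_norm norm_minus_commute)
  have "\<bar>zz q y $ None\<bar> \<le> 1/4" using component_le_norm_cart[of "zz q y" None] assms(3) by simp
  then have "- (d * (1/4)) \<le> d * zz q y $ None" using xv mult_left_mono[of "- (1/4)" "zz q y $ None" d] by simp
  then have "0 < q * (v $ None + d * zz q y $ None)" using xv assms(1) by (intro mult_pos_pos) auto
  moreover have "y $ None = x $ None + q * (v $ None + d * zz q y $ None)"
    by (subst y) (simp add: algebra_simps)
  ultimately have pos: "y $ None > 0" using xv(1) by (simp add: upper_def)
  then show "y \<in> S" using n4 by (simp add: S_def dist_norm norm_minus_commute upper_def)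
  have "norm y < 1" using n4 xv norm_triangle_sub[of y x] by linarith
  then show "y \<in> unit_half_ball_int" using pos by (intro interior_half_ball)
qed

private lemma W_has_derivative:
  assumes q: "0 < q"
  shows "((\<lambda>q. W q y) has_real_derivative W' q y) (at q)"
proof -
  have td: "q * d > 0" using q xv by simp
  have m: "m > 0" by (simp add: m_def)
  have dz: "((\<lambda>q. zz q y) has_derivative (\<lambda>h. (- (h / (q * d))) *\<^sub>R (v + d *\<^sub>R zz q y))) (at q)"
  proof -
    have "((\<lambda>q. 1 / (q * d)) has_real_derivative - (1 / (q\<^sup>2 * d))) (at q)"
      using td q by (auto intro!: derivative_eq_intros simp: power2_eq_square field_simps)
    then have 1: "((\<lambda>q. 1 / (q * d)) has_derivative (\<lambda>h. - (1 / (q\<^sup>2 * d)) * h)) (at q)"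
      unfolding has_field_derivative_def .
    have 2: "((\<lambda>q. y - x - q *\<^sub>R v) has_derivative (\<lambda>h. - (h *\<^sub>R v))) (at q)"
      by (auto intro!: derivative_eq_intros)
    have 3: "((\<lambda>q. zz q y) has_derivative
       (\<lambda>h. (1 / (q * d)) *\<^sub>R (- (h *\<^sub>R v)) + (- (1 / (q\<^sup>2 * d)) * h) *\<^sub>R (y - x - q *\<^sub>R v))) (at q)"
      unfolding zz_def by (rule has_derivative_scaleR[OF 1 2])
    have "(1 / (q * d)) *\<^sub>R (- (h *\<^sub>R v)) + (- (1 / (q\<^sup>2 * d)) * h) *\<^sub>R (y - x - q *\<^sub>R v) =
        (- (h / (q * d))) *\<^sub>R (v + d *\<^sub>R zz q y)" for h
      using td by (simp add: zz_def scaleR_add_right power2_eq_square)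
    then show ?thesis using 3 by simp
  qed
  have "((\<lambda>q. unit_bump (zz q y)) has_derivative
      (\<lambda>h. unit_bump_grad (zz q y) \<bullet> ((- (h / (q * d))) *\<^sub>R (v + d *\<^sub>R zz q y)))) (at q)"
    by (rule has_derivative_compose[OF dz unit_bump_has_derivative])
  then have "((\<lambda>q. unit_bump (zz q y)) has_real_derivative
      - (1 / (q * d)) * (unit_bump_grad (zz q y) \<bullet> (v + d *\<^sub>R zz q y))) (at q)"
    unfolding has_field_derivative_def by (rule has_derivative_eq_rhs) (auto simp: fun_eq_iff)
  moreover have "((\<lambda>q. inverse ((q * d) ^ m)) has_real_derivative - (inverse ((q * d) ^ m) * (real m / q))) (at q)"
  proof -
    have "((\<lambda>q. (q * d) ^ m) has_real_derivative real m * (q * d) ^ (m - 1) * d) (at q)"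
      by (auto intro!: derivative_eq_intros)
    moreover have "(q * d) ^ m \<noteq> 0" using q xv by simp
    ultimately have "((\<lambda>q. inverse ((q * d) ^ m)) has_real_derivative
       - (inverse ((q * d) ^ m) * (real m * (q * d) ^ (m - 1) * d) * inverse ((q * d) ^ m))) (at q)"
      by (rule DERIV_inverse_fun[THEN DERIV_cong]) simp
    moreover have "real m * (q * d) ^ (m - 1) * d * inverse ((q * d) ^ m) = real m / q"
    proof -
      have Q: "(q * d) ^ m = (q * d) * (q * d) ^ (m - 1)" "(q * d) ^ (m - 1) \<noteq> 0"
        using m q xv by (cases m; simp)+
      have "c * Q * d * inverse ((q * d) * Q) = c / q" if "Q \<noteq> 0" for c Q :: real
        using that q xv by (simp add: field_simps)
      from this[OF Q(2)] show ?thesis by (simp only: Q(1))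
    qed
    ultimately show ?thesis by (simp add: mult.assoc)
  qed
  ultimately have "((\<lambda>q. inverse ((q * d) ^ m) * unit_bump (zz q y)) has_real_derivative
     - (inverse ((q * d) ^ m) * (real m / q)) * unit_bump (zz q y) +
     (- (1 / (q * d)) * (unit_bump_grad (zz q y) \<bullet> (v + d *\<^sub>R zz q y))) * inverse ((q * d) ^ m)) (at q)"
    by (intro DERIV_mult)
  moreover have "- (inverse ((q * d) ^ m) * (real m / q)) * unit_bump (zz q y) +
     (- (1 / (q * d)) * (unit_bump_grad (zz q y) \<bullet> (v + d *\<^sub>R zz q y))) * inverse ((q * d) ^ m) = W' q y"
    using td q xv(4) by (simp add: W'_def field_simps)
  ultimately show ?thesis unfolding W_def by simp
qed

private lemma A_has_derivative:
  assumes q: "0 < q" "q < 2"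
  shows "(A has_real_derivative (LBINT y. F y * W' q y)) (at q)"
proof -
  \<comment> \<open>A compact interval of parameters away from 0, on which kernel and derivative are
    uniformly bounded.\<close>
  define I where "I = {q / 2..2}"
  have Ipos: "t > 0" if "t \<in> I" for t using that q by (auto simp: I_def)
  have zc: "continuous_on (I \<times> T) (\<lambda>p. zz (fst p) (snd p))" for T
    unfolding zz_def by (intro continuous_intros) (use Ipos xv in force)
  have cW': "continuous_on (I \<times> S) (\<lambda>p. W' (fst p) (snd p))" unfolding W'_def
    by (intro continuous_intros continuous_on_compose2[OF continuous_unit_bump(1)[of UNIV] zc]
        continuous_on_compose2[OF continuous_unit_bump(2)[of UNIV] zc] zc) (use Ipos xv in force)+
  have cW: "continuous_on (I \<times> S) (\<lambda>p. W (fst p) (snd p))" unfolding W_def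
    by (intro continuous_intros continuous_on_compose2[OF continuous_unit_bump(1)[of UNIV] zc]) (use Ipos xv in force)+
  have cF: "continuous_on S f" by (rule continuous_on_subset[OF fc S_sub])
  have compIS: "compact (I \<times> S)" by (intro compact_Times S_compact) (simp add: I_def)
  obtain B1 where B1: "\<And>t y. t \<in> I \<Longrightarrow> y \<in> S \<Longrightarrow> \<bar>W' t y\<bar> \<le> B1"
    using compact_imp_bounded[OF compact_continuous_image[OF cW' compIS]] by (auto simp: bounded_iff)
  obtain B2 where B2: "\<And>t y. t \<in> I \<Longrightarrow> y \<in> S \<Longrightarrow> \<bar>W t y\<bar> \<le> B2"
    using compact_imp_bounded[OF compact_continuous_image[OF cW compIS]] by (auto simp: bounded_iff)
  obtain B3 where B3: "\<And>y. y \<in> S \<Longrightarrow> \<bar>f y\<bar> \<le> B3" "B3 > 0"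
    using compact_imp_bounded[OF compact_continuous_image[OF cF S_compact]] unfolding bounded_pos by auto
  have [measurable]: "(unit_bump :: 'n point \<Rightarrow> real) \<in> borel_measurable borel" "(unit_bump_grad :: 'n point \<Rightarrow> 'n point) \<in> borel_measurable borel"
    by (intro borel_measurable_continuous_onI continuous_unit_bump)+
  have [measurable]: "zz t \<in> borel_measurable borel" for t unfolding zz_def[abs_def] by measurable
  have [measurable]: "W t \<in> borel_measurable borel" "W' t \<in> borel_measurable borel" for t
    unfolding W_def[abs_def] W'_def[abs_def] by measurable
  have [measurable]: "S \<in> sets borel" using S_compact by (simp add: compact_imp_closed)
  have finS: "emeasure lborel S < \<infinity>" using S_compact emeasure_compact_finite by auto
  show ?thesis unfolding A_def[abs_def]
  proof (rule has_derivative_integral_param[of q "q / 2" 2 lborel _ _ "\<lambda>y. indicator S y * (B3 * B1)"])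
    show "q \<in> {q / 2<..<2}" using q by simp
    show "integrable lborel (\<lambda>y. indicator S y * (B3 * B1))" using finS by (intro integrable_mult_left) simp
    fix t assume t: "t \<in> {q / 2<..<2}"
    then have tI: "t \<in> I" by (simp add: I_def)
    show "integrable lborel (\<lambda>y. F y * W t y)"
    proof (rule integrable_bounded_on[where A = S and B = "B3 * B2"], measurable)
      show "\<bar>F y * W t y\<bar> \<le> B3 * B2" if "y \<in> S" for y
        unfolding abs_mult using B2[OF tI that] B3(1)[OF that] B3(2) that by (intro mult_mono) (auto simp: F_def)
    qed (use finS in \<open>auto simp: F_def\<close>)
    fix y
    show "((\<lambda>r. F y * W r y) has_real_derivative F y * W' t y) (at t)"
      using W_has_derivative[OF Ipos[OF tI], of y] by (rule DERIV_cmult)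
    show "\<bar>F y * W' t y\<bar> \<le> indicator S y * (B3 * B1)"
    proof (cases "y \<in> S")
      case True
      then show ?thesis
        unfolding abs_mult using B1[OF tI True] B3(1)[OF True] B3(2) by (auto simp: F_def intro!: mult_mono)
    qed (simp add: F_def)
  qed measurable
qed

text \<open>As \<open>q\<close> varies, the mass of the bump moves with velocity
  \<open>v + d *\<^sub>R zz q y\<close>. These are the components of density times velocity, and
  \<open>sum_\<psi>'\<close> is the continuity equation: their divergence is
  \<open>- W' q y\<close>. It turns the \<open>q\<close>-derivative of the average into weak
  derivatives of \<open>f\<close>.\<close>

private definition "\<psi> q k y = inverse ((q * d) ^ m) * (v $ k + d * zz q y $ k) * unit_bump (zz q y)"
private definition "\<psi>' q k y = inverse ((q * d) ^ m) / (q * d) *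
  (d * unit_bump (zz q y) + (v $ k + d * zz q y $ k) * unit_bump_grad (zz q y) $ k)"

private lemma sum_\<psi>': "(\<Sum>k\<in>UNIV. \<psi>' q k y) = - W' q y"
proof -
  have "(\<Sum>k\<in>UNIV. d * unit_bump (zz q y) + (v $ k + d * zz q y $ k) * unit_bump_grad (zz q y) $ k) =
     real m * d * unit_bump (zz q y) + unit_bump_grad (zz q y) \<bullet> (v + d *\<^sub>R zz q y)"
    by (simp add: sum.distrib inner_vec_def m_def mult_ac)
  then show ?thesis unfolding \<psi>'_def W'_def sum_distrib_left[symmetric] by simp
qed

private lemma partial_\<psi>:
  assumes q: "0 < q"
  shows "partial_on UNIV k (\<psi> q k) y = \<psi>' q k y"
proof -
  have td: "q * d > 0" using q xv by simp
  let ?C = "inverse ((q * d) ^ m)" and ?z = "zz q y"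
  let ?G = "(?C / (q * d)) *\<^sub>R ((d * unit_bump ?z) *\<^sub>R axis k 1 + (v $ k + d * ?z $ k) *\<^sub>R unit_bump_grad ?z)"
  have dz: "(zz q has_derivative (\<lambda>h. (1 / (q * d)) *\<^sub>R h)) (at y)"
    unfolding zz_def[abs_def] by (auto intro!: derivative_eq_intros)
  have 1: "((\<lambda>y. unit_bump (zz q y)) has_derivative (\<lambda>h. unit_bump_grad ?z \<bullet> ((1 / (q * d)) *\<^sub>R h))) (at y)"
    by (rule has_derivative_compose[OF dz unit_bump_has_derivative])
  have "((\<lambda>y. zz q y $ k) has_derivative (\<lambda>h. ((1 / (q * d)) *\<^sub>R h) $ k)) (at y)"
    by (rule bounded_linear.has_derivative[OF bounded_linear_vec_nth dz])
  then have 2: "((\<lambda>y. ?C * (v $ k + d * zz q y $ k)) has_derivative (\<lambda>h. ?C * (d * ((1 / (q * d)) * h $ k)))) (at y)"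
    by (auto intro!: derivative_eq_intros)
  have "(\<psi> q k has_derivative (\<lambda>h. (?C * (v $ k + d * ?z $ k)) * (unit_bump_grad ?z \<bullet> ((1 / (q * d)) *\<^sub>R h)) +
      (?C * (d * ((1 / (q * d)) * h $ k))) * unit_bump ?z)) (at y)"
    unfolding \<psi>_def[abs_def] by (rule has_derivative_mult[OF 2 1])
  moreover have "(?C * (v $ k + d * ?z $ k)) * (unit_bump_grad ?z \<bullet> ((1 / (q * d)) *\<^sub>R h)) +
      (?C * (d * ((1 / (q * d)) * h $ k))) * unit_bump ?z = ?G \<bullet> h" for h
    by (simp add: inner_add_left inner_axis' distrib_left algebra_simps divide_inverse)
  ultimately have "(\<psi> q k has_gradient ?G) (at y)" by simp
  then have "partial_on UNIV k (\<psi> q k) y = ?G $ k" by (rule partial_onI)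
  also have "\<dots> = \<psi>' q k y" by (simp add: \<psi>'_def axis_def)
  finally show ?thesis .
qed

private lemma \<psi>_outside:
  assumes "zz q y \<notin> bump_ball"
  shows "\<psi> q k y = 0" "\<psi>' q k y = 0" using unit_bump_outside[OF assms] by (simp_all add: \<psi>_def \<psi>'_def)

text \<open>The affine factor involves only coordinate \<open>k\<close>, so it can be merged into
  the \<open>k\<close>-th factor of the product bump, and smoothness reduces to
  \<open>C_times_prodf\<close>.\<close>

private lemma test_\<psi>:
  assumes q: "0 < q" "q < 2"
  shows "test_function unit_half_ball_int (\<psi> q k)"
proof -
  have td: "q * d > 0" using q xv by simp
  define a where "a i = - ((x $ i + q * v $ i) / (q * d))" for i
  define tent where "tent = bump1 (- (1 / (4 * real CARD('n option)))) (1 / (4 * real CARD('n option)))"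
  have smooth1_tent: "smooth1 tent" unfolding tent_def by (rule smooth1_bump1)
  define b where "b i = (if i = k then (\<lambda>s. (\<lambda>\<xi>. inverse ((q * d) ^ m) * (v $ k + d * \<xi>) * tent \<xi>) (1 / (q * d) * s + a k))
     else (\<lambda>s. tent (1 / (q * d) * s + a i)))" for i
  have zi: "zz q y $ i = 1 / (q * d) * y $ i + a i" for y i
    using td by (simp add: zz_def a_def diff_divide_distrib add_divide_distrib)
  have "smooth1 (b i)" for i
  proof -
    have "smooth1 (\<lambda>\<xi>. inverse ((q * d) ^ m) * (v $ k + d * \<xi>) * tent \<xi>)"
      by (intro smooth1_mult smooth1_add smooth1_const smooth1_ident smooth1_tent)
    from smooth1_affine[OF this, of "1 / (q * d)" "a k"] show ?thesis
      using smooth1_affine[OF smooth1_tent, of "1 / (q * d)" "a i"] unfolding b_def by simp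
  qed
  moreover have "prodf b = \<psi> q k"
  proof
    fix y
    have "prodf b y = b k (y $ k) * (\<Prod>i\<in>UNIV - {k}. b i (y $ i))"
      unfolding prodf_def by (rule prod.remove) auto
    also have "(\<Prod>i\<in>UNIV - {k}. b i (y $ i)) = (\<Prod>i\<in>UNIV - {k}. tent (zz q y $ i))"
      by (intro prod.cong) (auto simp: b_def zi)
    also have "b k (y $ k) = inverse ((q * d) ^ m) * (v $ k + d * zz q y $ k) * tent (zz q y $ k)"
      by (simp add: b_def zi)
    also have "\<dots> * (\<Prod>i\<in>UNIV - {k}. tent (zz q y $ i)) =
       inverse ((q * d) ^ m) * (v $ k + d * zz q y $ k) * unit_bump (zz q y)"
      unfolding unit_bump_def cube_bump_def prodf_def tent_def[symmetric] by (subst (2) prod.remove[of _ k]) (auto simp: mult.assoc)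
    finally show "prodf b y = \<psi> q k y" by (simp add: \<psi>_def)
  qed
  ultimately have ct: "C_times j (\<psi> q k)" for j using C_times_prodf[of b j] by simp
  define T where "T = {y. zz q y \<in> bump_ball}"
  have "closed T"
  proof -
    have "continuous_on UNIV (zz q)" unfolding zz_def[abs_def] by (intro continuous_intros)
    then have "closed (zz q -` bump_ball)"
      by (intro continuous_closed_vimage) (auto simp: continuous_on_eq_continuous_at)
    then show ?thesis by (simp add: T_def vimage_def)
  qed
  moreover have "bounded T"
    using S_compact zz_box(1)[OF q] by (intro bounded_subset[of S T]) (auto simp: T_def compact_imp_bounded)
  ultimately have T: "compact T" by (simp add: compact_eq_bounded_closed)
  have "{y. \<psi> q k y \<noteq> 0} \<subseteq> T" using \<psi>_outside by (auto simp: T_def)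
  then have cl: "closure {y. \<psi> q k y \<noteq> 0} \<subseteq> T" using T by (simp add: closure_minimal compact_imp_closed)
  have "compact (closure {y. \<psi> q k y \<noteq> 0})"
    using bounded_subset[OF compact_imp_bounded[OF T] cl] by (simp add: compact_eq_bounded_closed)
  moreover have "T \<subseteq> unit_half_ball_int" using zz_box(2)[OF q] by (auto simp: T_def)
  ultimately show ?thesis using ct cl by (auto simp: test_function_def)
qed

text \<open>Each \<open>\<psi>\<close> is at most \<open>2 * d\<close> times the inverse volume
  factor \<open>(q * d) ^ m\<close> and lives in a ball about \<open>x\<close> of radius comparable
  to \<open>q * d\<close>. The growth assumption on \<open>g\<close> there leaves
  \<open>q powr (\<gamma> - 1)\<close>, which is integrable at 0.\<close>

private lemma W'_integral_bound:
  assumes q: "0 < q" "q \<le> 1"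
  shows "\<bar>\<integral>y. F y * W' q y \<partial>lborel\<bar> \<le>
    2 * real m * K * 3 powr (real m - 1 + \<gamma>) * d powr \<gamma> * q powr (\<gamma> - 1)"
proof -
  have q2: "q < 2" using q by simp
  have td: "q * d > 0" using q xv by simp
  have [measurable]: "(unit_bump :: 'n point \<Rightarrow> real) \<in> borel_measurable borel" "(unit_bump_grad :: 'n point \<Rightarrow> 'n point) \<in> borel_measurable borel"
    by (intro borel_measurable_continuous_onI continuous_unit_bump)+
  have [measurable]: "zz t \<in> borel_measurable borel" for t unfolding zz_def[abs_def] by measurable
  have [measurable]: "\<psi>' t k \<in> borel_measurable borel" for t k unfolding \<psi>'_def[abs_def] by measurable
  have eqF: "indicator unit_half_ball_int y *\<^sub>R (f y * \<psi>' q k y) = F y * \<psi>' q k y" for y k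
    using \<psi>_outside(2)[of q y k] zz_box(1,2)[OF q(1) q2, of y]
    by (cases "zz q y \<in> bump_ball") (auto simp: F_def)
  \<comment> \<open>The supports have distance at most \<open>2 * q * d\<close> from
    \<open>x\<close>; the larger factor 3 makes the inclusion in the open ball strict.\<close>
  define s where "s = 3 * (q * d)"
  have s: "0 < s" "s < 1"
  proof -
    have "q * d \<le> 1 * d" using q xv by (intro mult_right_mono) auto
    then show "s < 1" using xv norm_ge_zero[of x] unfolding s_def by linarith
    show "0 < s" using td by (simp add: s_def)
  qed
  have in_ball: "y \<in> unit_half_ball_int \<inter> ball x s" if "zz q y \<in> bump_ball" for y
    using zz_box(2,4)[OF q(1) q2 that] td by (auto simp: s_def dist_norm norm_minus_commute)
  have \<psi>b: "\<bar>\<psi> q k y\<bar> \<le> inverse ((q * d) ^ m) * (2 * d)" for k y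
  proof (cases "zz q y \<in> bump_ball")
    case True
    have "\<bar>v $ k + d * zz q y $ k\<bar> \<le> \<bar>v $ k\<bar> + d * \<bar>zz q y $ k\<bar>"
      using xv abs_triangle_ineq[of "v $ k" "d * zz q y $ k"] by (simp add: abs_mult)
    also have "\<dots> \<le> 3 / 2 * d + d * (1 / 2)"
      using component_le_norm_cart[of v k] component_le_norm_cart[of "zz q y" k] True xv
      by (intro add_mono mult_left_mono) auto
    finally have "\<bar>v $ k + d * zz q y $ k\<bar> \<le> 2 * d" by simp
    then have "\<bar>\<psi> q k y\<bar> \<le> inverse ((q * d) ^ m) * (2 * d) * 1"
      unfolding \<psi>_def abs_mult using unit_bump_abs xv td by (intro mult_mono) auto
    then show ?thesis by simp
  next
    case False
    then show ?thesis using \<psi>_outside(1)[OF False, of k] xv td by (auto intro!: mult_nonneg_nonneg)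
  qed
  have part: "(LBINT y. F y * \<psi>' q k y) = - (LINT y:unit_half_ball_int|lebesgue. g k y * \<psi> q k y)" for k
  proof -
    have "(LBINT y. F y * \<psi>' q k y) = (\<integral>y. F y * \<psi>' q k y \<partial>lebesgue)"
      by (rule integral_completion[symmetric]) measurable
    also have "\<dots> = (LINT y:unit_half_ball_int|lebesgue. f y * partial_on UNIV k (\<psi> q k) y)"
      unfolding set_lebesgue_integral_def partial_\<psi>[OF q(1)] eqF ..
    finally show ?thesis using wp[of k] test_\<psi>[OF q(1) q2, of k] by (simp add: is_weak_partial_def)
  qed
  have one: "\<bar>\<integral>y. F y * \<psi>' q k y \<partial>lborel\<bar> \<le> inverse ((q * d) ^ m) * (2 * d) * (K * s powr (real m - 1 + \<gamma>))" for k
  proof -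
    let ?c = "inverse ((q * d) ^ m) * (2 * d)"
    have c0: "0 \<le> ?c" using xv td by (intro mult_nonneg_nonneg) auto
    let ?h = "\<lambda>y. indicator unit_half_ball_int y *\<^sub>R (g k y * \<psi> q k y)"
    let ?w = "\<lambda>y. ?c * (indicator (unit_half_ball_int \<inter> ball x s) y *\<^sub>R \<bar>g k y\<bar>)"
    have wi: "integrable lebesgue ?w"
      using gK[OF s, of k] set_integrable_abs[of lebesgue "unit_half_ball_int \<inter> ball x s" "g k"] by (simp add: set_integrable_def)
    have hw: "\<bar>?h y\<bar> \<le> ?w y" for y
    proof (cases "zz q y \<in> bump_ball")
      case True
      then show ?thesis using in_ball[OF True] mult_left_mono[OF \<psi>b[of k y] abs_ge_zero[of "g k y"]]
        by (simp add: abs_mult mult_ac)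
    qed (use c0 in \<open>simp add: \<psi>_outside(1)\<close>)
    have "\<bar>LINT y:unit_half_ball_int|lebesgue. g k y * \<psi> q k y\<bar> \<le> (\<integral>y. ?w y \<partial>lebesgue)"
    proof (cases "integrable lebesgue ?h")
      case True
      then show ?thesis unfolding set_lebesgue_integral_def by (rule integral_abs_bound_integral[OF _ wi hw])
    next
      \<comment> \<open>The Bochner integral of a nonintegrable function is 0 by default, so the
        bound is trivial in this case.\<close>
      case False
      then have "(LINT y:unit_half_ball_int|lebesgue. g k y * \<psi> q k y) = 0"
        unfolding set_lebesgue_integral_def by (rule not_integrable_integral_eq)
      moreover have "0 \<le> (\<integral>y. ?w y \<partial>lebesgue)"
        by (intro Bochner_Integration.integral_nonneg mult_nonneg_nonneg c0) simp
      ultimately show ?thesis by simp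
    qed
    also have "(\<integral>y. ?w y \<partial>lebesgue) = ?c * (LINT y:unit_half_ball_int \<inter> ball x s|lebesgue. \<bar>g k y\<bar>)"
      by (simp add: set_lebesgue_integral_def)
    also have "\<dots> \<le> ?c * (K * s powr (real m - 1 + \<gamma>))"
      using gK[OF s, of k] c0 unfolding m_def by (intro mult_left_mono) auto
    finally show ?thesis unfolding part by simp
  qed
  have intk: "integrable lborel (\<lambda>y. F y * \<psi>' q k y)" for k
  proof -
    have cF: "continuous_on S f" by (rule continuous_on_subset[OF fc S_sub])
    have cz: "continuous_on S (zz q)" unfolding zz_def[abs_def] by (intro continuous_intros)
    have "continuous_on S (\<lambda>y. f y * \<psi>' q k y)" unfolding \<psi>'_def
      by (intro continuous_intros cF cz continuous_on_compose2[OF continuous_unit_bump(1)[of UNIV] cz]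
          continuous_on_compose2[OF continuous_unit_bump(2)[of UNIV] cz]) auto
    from borel_integrable_compact[OF S_compact this] show ?thesis by (simp add: F_def mult.assoc)
  qed
  have "(LBINT y. F y * W' q y) = - (\<Sum>k\<in>UNIV. \<integral>y. F y * \<psi>' q k y \<partial>lborel)"
  proof -
    have "(LBINT y. F y * W' q y) = (LBINT y. - (\<Sum>k\<in>UNIV. F y * \<psi>' q k y))"
      unfolding sum_distrib_left[symmetric] sum_\<psi>' by simp
    then show ?thesis by (simp add: intk)
  qed
  also have "\<bar>\<dots>\<bar> \<le> (\<Sum>k\<in>UNIV. \<bar>\<integral>y. F y * \<psi>' q k y \<partial>lborel\<bar>)" by simp
  also have "\<dots> \<le> (\<Sum>k\<in>(UNIV :: 'n option set). inverse ((q * d) ^ m) * (2 * d) * (K * s powr (real m - 1 + \<gamma>)))"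
    by (intro sum_mono one)
  also have "\<dots> = real m * (inverse ((q * d) ^ m) * (2 * d) * (K * s powr (real m - 1 + \<gamma>)))"
    by (simp add: m_def)
  also have "s powr (real m - 1 + \<gamma>) = 3 powr (real m - 1 + \<gamma>) * ((q * d) ^ m * (q * d) powr (\<gamma> - 1))"
  proof -
    have "(q * d) powr (real m - 1 + \<gamma>) = (q * d) powr (real m) * (q * d) powr (\<gamma> - 1)"
      by (subst powr_add[symmetric]) (simp add: algebra_simps)
    moreover have "s powr (real m - 1 + \<gamma>) = 3 powr (real m - 1 + \<gamma>) * (q * d) powr (real m - 1 + \<gamma>)"
      unfolding s_def using td by (intro powr_mult)
    ultimately show ?thesis using td by (simp only: powr_realpow)
  qed
  also have "(q * d) powr (\<gamma> - 1) = q powr (\<gamma> - 1) * (d powr \<gamma> / d)"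
    using q xv by (simp add: powr_mult powr_diff)
  also have "real m * (inverse ((q * d) ^ m) * (2 * d) * (K * (3 powr (real m - 1 + \<gamma>) *
      ((q * d) ^ m * (q powr (\<gamma> - 1) * (d powr \<gamma> / d)))))) =
      2 * real m * K * 3 powr (real m - 1 + \<gamma>) * d powr \<gamma> * q powr (\<gamma> - 1)"
  proof -
    have "M * (inverse P * (2 * d) * (K * (a * (P * (b * (c / d)))))) = 2 * M * K * a * c * b"
      if "P \<noteq> 0" for P M a b c :: real using that xv by (simp add: field_simps)
    then show ?thesis using q xv by simp
  qed
  finally show ?thesis .
qed

text \<open>After the affine substitution the average is an integral of \<open>f\<close> at points
  tending to \<open>x\<close> against the fixed bump, so continuity of \<open>f\<close> at
  \<open>x\<close> decides. The limit carries the mass of the bump as a factor.\<close>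

private lemma A_limit:
  assumes \<epsilon>: "\<epsilon> > 0"
  shows "\<exists>q0>0. \<forall>q. 0 < q \<and> q < q0 \<and> q < 1 \<longrightarrow>
    \<bar>A q - (LBINT z. unit_bump (z :: 'n point)) * f x\<bar> \<le> \<epsilon> * (LBINT z. unit_bump (z :: 'n point))"
proof -
  have xU: "x \<in> unit_half_ball" using S_sub xv by (auto simp: S_def)
  obtain \<delta> where \<delta>: "\<delta> > 0" "\<And>y. y \<in> unit_half_ball \<Longrightarrow> dist y x < \<delta> \<Longrightarrow> dist (f y) (f x) < \<epsilon>"
    using fc xU \<epsilon> unfolding continuous_on_iff by metis
  have main: "\<bar>A q - (LBINT z. unit_bump (z :: 'n point)) * f x\<bar> \<le> \<epsilon> * (LBINT z. unit_bump (z :: 'n point))"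
    if q: "0 < q" "q < \<delta> / (2 * d)" "q < 1" for q
  proof -
    have td: "q * d > 0" using q xv by simp
    have [measurable]: "(unit_bump :: 'n point \<Rightarrow> real) \<in> borel_measurable borel"
      by (intro borel_measurable_continuous_onI continuous_unit_bump)
    have [measurable]: "zz t \<in> borel_measurable borel" for t unfolding zz_def[abs_def] by measurable
    have [measurable]: "W t \<in> borel_measurable borel" for t unfolding W_def[abs_def] by measurable
    let ?Y = "\<lambda>z. (x + q *\<^sub>R v) + (q * d) *\<^sub>R z"
    have zY: "zz q (?Y z) = z" for z using td xv q by (simp add: zz_def)
    have dens: "(lborel :: 'n point measure) = density (distr lborel borel ?Y) (\<lambda>_. ennreal ((q * d) ^ m))"
    proof -
      have "q * d \<noteq> 0" using td by linarith
      from lborel_affine[OF this, of "x + q *\<^sub>R v"] show ?thesis using td by (simp only: m_def abs_of_pos DIM_cart DIM_real mult_1_right)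
    qed
    have "A q = (\<integral>y. F y * W q y \<partial>density (distr lborel borel ?Y) (\<lambda>_. ennreal ((q * d) ^ m)))"
      unfolding A_def using dens by simp
    also have "\<dots> = (\<integral>y. (q * d) ^ m *\<^sub>R (F y * W q y) \<partial>distr lborel borel ?Y)"
      using td by (intro integral_density) auto
    also have "\<dots> = (LBINT z. (q * d) ^ m *\<^sub>R (F (?Y z) * W q (?Y z)))" by (rule integral_distr) measurable
    also have "\<dots> = (LBINT z. F (?Y z) * unit_bump z)"
    proof -
      have "(q * d) ^ m * inverse ((q * d) ^ m) = 1" using q xv by (intro right_inverse) simp
      then have "(q * d) ^ m * (c * (inverse ((q * d) ^ m) * e)) = c * e" for c e
        by (metis mult.assoc mult.commute mult_1)
      then show ?thesis unfolding W_def zY real_scaleR_def by (simp only: refl)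
    qed
    finally have A: "A q = (LBINT z. F (?Y z) * unit_bump z)" .
    have diff: "\<bar>F (?Y z) * unit_bump z - f x * unit_bump z\<bar> \<le> \<epsilon> * unit_bump z" for z
    proof (cases "z \<in> bump_ball")
      case True
      then have zb: "zz q (?Y z) \<in> bump_ball" by (simp add: zY)
      have q2: "q < 2" using q by simp
      have S: "?Y z \<in> S" by (rule zz_box(1)[OF q(1) q2 zb])
      have "norm (?Y z - x) \<le> 2 * q * d" by (rule zz_box(4)[OF q(1) q2 zb])
      also have "\<dots> < \<delta>" using q(2) xv by (simp add: field_simps)
      finally have "\<bar>f (?Y z) - f x\<bar> \<le> \<epsilon>" using \<delta>(2)[of "?Y z"] S S_sub by (auto simp: dist_norm)
      then have "\<bar>f (?Y z) - f x\<bar> * unit_bump z \<le> \<epsilon> * unit_bump z"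
        by (rule mult_right_mono) (rule unit_bump_nonneg)
      then show ?thesis using S unit_bump_nonneg[of z] by (simp add: F_def left_diff_distrib[symmetric] abs_mult)
    qed (simp add: unit_bump_outside)
    have i1: "integrable lborel (\<lambda>z. F (?Y z) * unit_bump z - f x * unit_bump z)"
    proof (rule Bochner_Integration.integrable_bound[of _ "\<lambda>z. \<epsilon> * unit_bump z"])
      show "integrable lborel (\<lambda>z. \<epsilon> * unit_bump (z :: 'n point))" by (intro integrable_mult_right unit_bump_integrable)
      show "AE z in lborel. norm (F (?Y z) * unit_bump z - f x * unit_bump z) \<le> norm (\<epsilon> * unit_bump z)"
        using diff abs_ge_self order_trans by (intro AE_I2) (simp, blast)
    qed measurable
    have i2: "integrable lborel (\<lambda>z. f x * unit_bump (z :: 'n point))" by (intro integrable_mult_right unit_bump_integrable)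
    have "A q = (LBINT z. (F (?Y z) * unit_bump z - f x * unit_bump z) + f x * unit_bump z)"
      unfolding A by simp
    also have "\<dots> = (LBINT z. F (?Y z) * unit_bump z - f x * unit_bump z) + (LBINT z. f x * unit_bump (z :: 'n point))"
      by (rule Bochner_Integration.integral_add[OF i1 i2])
    finally have "A q - (LBINT z. unit_bump (z :: 'n point)) * f x = (LBINT z. F (?Y z) * unit_bump z - f x * unit_bump z)"
      by simp
    also have "\<bar>\<dots>\<bar> \<le> (LBINT z. \<epsilon> * unit_bump (z :: 'n point))"
      by (rule integral_abs_bound_integral[OF i1 _ diff]) (intro integrable_mult_right unit_bump_integrable)
    finally show ?thesis by simp
  qed
  show ?thesis
  proof (intro exI conjI allI impI)
    show "0 < \<delta> / (2 * d)" using \<delta> xv by simp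
  qed (use main in auto)
qed

text \<open>The derivative bound is integrated by comparing \<open>A\<close> with multiples of
  \<open>t powr \<gamma>\<close> on the interval from \<open>q\<close> to 1; then \<open>q\<close>
  tends to 0.\<close>

private lemma A_estimate:
  "\<bar>A 1 - (LBINT z. unit_bump (z :: 'n point)) * f x\<bar> \<le>
    2 * real m * K * 3 powr (real m - 1 + \<gamma>) / \<gamma> * d powr \<gamma>"
proof (rule field_le_epsilon)
  fix e :: real assume e: "e > 0"
  define c0 where "c0 = (LBINT z. unit_bump (z :: 'n point))"
  have c0: "c0 > 0" unfolding c0_def by (rule unit_bump_integral_pos)
  define C where "C = 2 * real m * K * 3 powr (real m - 1 + \<gamma>) * d powr \<gamma>"
  have C0: "C \<ge> 0" using K by (auto simp: C_def)
  obtain q0 where q0: "q0 > 0" "\<And>q. 0 < q \<Longrightarrow> q < q0 \<Longrightarrow> q < 1 \<Longrightarrow> \<bar>A q - c0 * f x\<bar> \<le> (e / c0) * c0"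
    using A_limit[of "e / c0"] e c0 unfolding c0_def by auto
  define q where "q = min q0 1 / 2"
  have q: "0 < q" "q < q0" "q < 1" using q0(1) by (auto simp: q_def)
  have near: "\<bar>A q - c0 * f x\<bar> \<le> e" using q0(2)[OF q] c0 by simp
  have der: "((\<lambda>t. C / \<gamma> * t powr \<gamma>) has_real_derivative C * t powr (\<gamma> - 1)) (at t)" if "t > 0" for t
    using that \<gamma> by (auto intro!: derivative_eq_intros)
  have up: "A 1 - C / \<gamma> * 1 powr \<gamma> \<le> A q - C / \<gamma> * q powr \<gamma>"
  proof (rule DERIV_nonpos_imp_nonincreasing[of q 1 "\<lambda>t. A t - C / \<gamma> * t powr \<gamma>"])
    fix t assume t: "q \<le> t" "t \<le> 1"
    then have "0 < t" "t < 2" using q by auto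
    then have "((\<lambda>t. A t - C / \<gamma> * t powr \<gamma>) has_real_derivative (LBINT y. F y * W' t y) - C * t powr (\<gamma> - 1)) (at t)"
      by (intro DERIV_diff A_has_derivative der)
    moreover have "(LBINT y. F y * W' t y) - C * t powr (\<gamma> - 1) \<le> 0"
      using W'_integral_bound[OF \<open>0 < t\<close> t(2)] by (simp add: C_def)
    ultimately show "\<exists>y. ((\<lambda>t. A t - C / \<gamma> * t powr \<gamma>) has_real_derivative y) (at t) \<and> y \<le> 0" by blast
  qed (use q in simp)
  have low: "A q + C / \<gamma> * q powr \<gamma> \<le> A 1 + C / \<gamma> * 1 powr \<gamma>"
  proof (rule DERIV_nonneg_imp_nondecreasing[of q 1 "\<lambda>t. A t + C / \<gamma> * t powr \<gamma>"])
    fix t assume t: "q \<le> t" "t \<le> 1"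
    then have "0 < t" "t < 2" using q by auto
    then have "((\<lambda>t. A t + C / \<gamma> * t powr \<gamma>) has_real_derivative (LBINT y. F y * W' t y) + C * t powr (\<gamma> - 1)) (at t)"
      by (intro DERIV_add A_has_derivative der)
    moreover have "(LBINT y. F y * W' t y) + C * t powr (\<gamma> - 1) \<ge> 0"
      using W'_integral_bound[OF \<open>0 < t\<close> t(2)] by (simp add: C_def)
    ultimately show "\<exists>y. ((\<lambda>t. A t + C / \<gamma> * t powr \<gamma>) has_real_derivative y) (at t) \<and> 0 \<le> y" by blast
  qed (use q in simp)
  have "0 \<le> C / \<gamma> * q powr \<gamma>" using C0 \<gamma> by simp
  then have "\<bar>A 1 - A q\<bar> \<le> C / \<gamma>" using up low by simp
  then show "\<bar>A 1 - (LBINT z. unit_bump (z :: 'n point)) * f x\<bar> \<le>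
    2 * real m * K * 3 powr (real m - 1 + \<gamma>) / \<gamma> * d powr \<gamma> + e"
    using near unfolding c0_def[symmetric] by (simp add: C_def)
qed

text \<open>At the end of the path the average depends only on the centre \<open>x + v\<close> and
  the scale \<open>d\<close>, no longer on the starting point. Two starting points can thus be
  compared through one common average.\<close>

lemma mean_value_path:
  "\<bar>(LBINT y. indicator unit_half_ball y * f y * (inverse (d ^ CARD('n option)) * unit_bump ((1 / d) *\<^sub>R (y - (x + v)))))
      - (LBINT z. unit_bump (z :: 'n point)) * f x\<bar> \<le>
    2 * real CARD('n option) * K * 3 powr (real CARD('n option) - 1 + \<gamma>) / \<gamma> * d powr \<gamma>"
proof -
  have "A 1 = (LBINT y. indicator unit_half_ball y * f y * (inverse (d ^ CARD('n option)) * unit_bump ((1 / d) *\<^sub>R (y - (x + v)))))"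
    unfolding A_def
  proof (rule Bochner_Integration.integral_cong[OF refl])
    fix y
    have z: "zz 1 y = (1 / d) *\<^sub>R (y - (x + v))" by (simp add: zz_def diff_diff_eq)
    show "F y * W 1 y = indicator unit_half_ball y * f y * (inverse (d ^ CARD('n option)) * unit_bump ((1 / d) *\<^sub>R (y - (x + v))))"
    proof (cases "zz 1 y \<in> bump_ball")
      case True
      then have "y \<in> S" by (intro zz_box(1)) auto
      then show ?thesis using S_sub by (auto simp: F_def W_def z m_def)
    next
      case False
      then show ?thesis using unit_bump_outside(1)[OF False] by (simp add: W_def z)
    qed
  qed
  then show ?thesis using A_estimate by (simp only: m_def)
qed

end

text \<open>Both \<open>x\<close> and \<open>y\<close> are joined to the average centred at
  \<open>y + e\<close> with scale \<open>d = norm (y - x)\<close>. The upward shift \<open>e\<close>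
  of length \<open>d / 2\<close> gives both paths the normal component that keeps their bumps inside
  the half space.\<close>

lemma hoelder_of_gradient_bound:
  fixes f :: "'n::finite point \<Rightarrow> real" and g :: "'n option \<Rightarrow> 'n point \<Rightarrow> real"
  assumes \<gamma>: "0 < \<gamma>"
    and f: "continuous_on unit_half_ball f" "\<And>k. is_weak_partial unit_half_ball_int k f (g k)"
    and K: "0 \<le> K"
    and gK: "\<And>k z s. 0 < s \<Longrightarrow> s < 1 \<Longrightarrow> set_integrable lebesgue (unit_half_ball_int \<inter> ball z s) (g k) \<and>
      (LINT y:unit_half_ball_int \<inter> ball z s|lebesgue. \<bar>g k y\<bar>) \<le> K * s powr (real CARD('n option) - 1 + \<gamma>)"
    and x: "x $ None = 0" "norm x < 1 / 2" and y: "y \<in> upper" "norm (y - x) < 1 / 10"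
  shows "\<bar>f y - f x\<bar> \<le> 4 * real CARD('n option) * 3 powr (real CARD('n option) - 1 + \<gamma>) / \<gamma> /
    (LBINT z. unit_bump (z :: 'n point)) * K * norm (y - x) powr \<gamma>"
proof (cases "y = x")
  case False
  define c0 where "c0 = (LBINT z. unit_bump (z :: 'n point))"
  have c0: "c0 > 0" unfolding c0_def by (rule unit_bump_integral_pos)
  define C1 where "C1 = 2 * real CARD('n option) * 3 powr (real CARD('n option) - 1 + \<gamma>) / \<gamma>"
  define d where "d = norm (y - x)"
  have d: "0 < d" "d < 1 / 10" using False y by (auto simp: d_def)
  define e where "e = (d / 2) *\<^sub>R (axis None 1 :: 'n point)"
  have e: "norm e = d / 2" using d by (simp add: e_def)
  have eN: "e $ None = d / 2" by (simp add: e_def axis_def)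
  have xu: "x \<in> upper" "d / 2 \<le> (y - x + e) $ None" "norm (y - x + e) \<le> 3 / 2 * d" "d / 2 \<le> e $ None" "norm e \<le> 3 / 2 * d"
    using x y e eN d norm_triangle_ineq[of "y - x" e] by (simp_all add: upper_def d_def)
  have ny: "norm y \<le> norm x + d" unfolding d_def by (metis add.commute diff_add_cancel norm_triangle_ineq)
  let ?J = "\<integral>z. indicator unit_half_ball z * f z * (inverse (d ^ CARD('n option)) * unit_bump ((1 / d) *\<^sub>R (z - (y + e)))) \<partial>lborel"
  have "\<bar>?J - c0 * f x\<bar> \<le> C1 * K * d powr \<gamma>" using mean_value_path[OF f \<gamma> K gK xu(1-3) d(1)] x d
    by (simp add: c0_def C1_def mult_ac)
  moreover have "\<bar>?J - c0 * f y\<bar> \<le> C1 * K * d powr \<gamma>"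
    using mean_value_path[OF f \<gamma> K gK y(1) xu(4,5) d(1)] x d ny by (simp add: c0_def C1_def mult_ac)
  ultimately have "\<bar>c0 * f y - c0 * f x\<bar> \<le> 2 * (C1 * K * d powr \<gamma>)" by linarith
  then have "c0 * \<bar>f y - f x\<bar> \<le> 2 * (C1 * K * d powr \<gamma>)"
    using c0 by (simp add: right_diff_distrib[symmetric] abs_mult)
  then have "\<bar>f y - f x\<bar> \<le> 2 * (C1 * K * d powr \<gamma>) / c0" using c0 by (simp add: pos_le_divide_eq mult.commute)
  then show ?thesis by (simp add: d_def C1_def c0_def algebra_simps)
qed simp

section \<open>The thin obstacle problem at a boundary point\<close>

definition flux :: "'n::finite coeff \<Rightarrow> ('n point \<Rightarrow> 'n point) \<Rightarrow> 'n point \<Rightarrow> 'n point" where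
  "flux b gu x = b x *v gu x"

text \<open>The thin obstacle problem near a point of the flat boundary, translated to the origin. The
  last assumption is the variational inequality; its test functions need not be smooth.\<close>

locale thin_problem =
  fixes b :: "'n::finite coeff" and u :: "'n point \<Rightarrow> real" and gu :: "'n point \<Rightarrow> 'n point"
    and H \<gamma> :: real
  assumes u_derivative: "\<And>x. x \<in> half_ball 0 (1/10) \<Longrightarrow> (u has_gradient gu x) (at x within upper)"
    and gu_continuous: "continuous_on (half_ball 0 (1/10)) gu"
    and b_continuous: "continuous_on (half_ball 0 (1/10)) b"
    and b_symmetric: "\<And>x. x \<in> half_ball 0 (1/10) \<Longrightarrow> transpose (b x) = b x"
    and b_lower: "\<And>x v. x \<in> half_ball 0 (1/10) \<Longrightarrow> 1 / 2 * (v \<bullet> v) \<le> v \<bullet> (b x *v v)"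
    and b_upper: "\<And>x v. x \<in> half_ball 0 (1/10) \<Longrightarrow> v \<bullet> (b x *v v) \<le> 2 * (v \<bullet> v)"
    and b_hoelder: "\<And>x i j. x \<in> half_ball 0 (1/10) \<Longrightarrow> \<bar>b x $ i $ j - b 0 $ i $ j\<bar> \<le> H * norm x powr \<gamma>"
    and \<gamma>_pos: "0 < \<gamma>" and H_nonneg: "0 \<le> H"
    and signorini: "\<And>x. x \<in> half_ball 0 (1/10) \<Longrightarrow> x $ None = 0 \<Longrightarrow>
      0 \<le> u x \<and> flux b gu x $ None \<le> 0 \<and> u x * flux b gu x $ None = 0"
    and variational: "\<And>S \<phi> g L N. compact S \<Longrightarrow> S \<subseteq> half_ball 0 (1/10) \<Longrightarrow>
      (\<And>x y. x \<in> upper \<Longrightarrow> y \<in> upper \<Longrightarrow> \<bar>\<phi> x - \<phi> y\<bar> \<le> L * norm (x - y)) \<Longrightarrow>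
      (\<And>x. x \<in> upper \<Longrightarrow> x \<notin> S \<Longrightarrow> \<phi> x = 0) \<Longrightarrow> N \<in> null_sets lborel \<Longrightarrow>
      (\<And>x. x $ None > 0 \<Longrightarrow> x \<notin> N \<Longrightarrow> (\<phi> has_gradient g x) (at x)) \<Longrightarrow>
      g \<in> borel_measurable borel \<Longrightarrow> (\<And>x. norm (g x) \<le> L) \<Longrightarrow> (\<And>x. x \<notin> S \<Longrightarrow> g x = 0) \<Longrightarrow>
      (\<And>x. x \<in> S \<Longrightarrow> x $ None = 0 \<Longrightarrow> flux b gu x $ None * \<phi> x \<le> 0) \<Longrightarrow>
      0 \<le> (LBINT x. indicator S x *\<^sub>R (flux b gu x \<bullet> g x))"

section \<open>Half discs, truncations and cutoffs\<close>

definition half_disc :: "real \<Rightarrow> 'n::finite point set" where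
  "half_disc \<rho> = cball 0 \<rho> \<inter> upper"

lemma compact_half_disc: "compact (half_disc \<rho> :: 'n::finite point set)"
  unfolding half_disc_def by (intro compact_Int_closed compact_cball closed_upper)

lemma half_disc_measurable [measurable]: "(half_disc \<rho> :: 'n::finite point set) \<in> sets borel"
  by (rule borel_closed[OF compact_imp_closed[OF compact_half_disc]])

lemma half_disc_sub: "\<rho> < 1/10 \<Longrightarrow> half_disc \<rho> \<subseteq> half_ball 0 (1/10)"
  by (auto simp: half_disc_def half_ball_def upper_def)

lemma half_disc_mono: "\<rho> \<le> \<rho>' \<Longrightarrow> half_disc \<rho> \<subseteq> half_disc \<rho>'"
  by (auto simp: half_disc_def)

lemma half_disc_emeasure:
  "0 \<le> \<rho> \<Longrightarrow> emeasure lborel (half_disc \<rho> :: 'n::finite point set) \<le> ennreal ((2 * \<rho>) ^ CARD('n option))"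
proof -
  assume \<rho>: "0 \<le> \<rho>"
  define l r :: "'n point" where "l = (\<chi> i. - \<rho>)" and "r = (\<chi> i. \<rho>)"
  have "half_disc \<rho> \<subseteq> cbox l r"
  proof
    fix x :: "'n point" assume "x \<in> half_disc \<rho>"
    then have "norm x \<le> \<rho>" by (simp add: half_disc_def)
    then have "\<bar>x $ i\<bar> \<le> \<rho>" for i using component_le_norm_cart[of x i] by linarith
    then have "- \<rho> \<le> x $ i \<and> x $ i \<le> \<rho>" for i by (simp add: abs_le_iff minus_le_iff)
    then show "x \<in> cbox l r" by (simp add: mem_box_cart l_def r_def)
  qed
  then have "emeasure lborel (half_disc \<rho> :: 'n point set) \<le> emeasure lborel (cbox l r)" by (intro emeasure_mono) auto
  also have "\<dots> = ennreal (measure lborel (cbox l r))" by (simp add: emeasure_eq_measure2)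
  also have "measure lborel (cbox l r) = (2 * \<rho>) ^ CARD('n option)"
    using \<rho> by (subst content_cbox_cart) (auto simp: l_def r_def interval_ne_empty_cart)
  finally show ?thesis .
qed

abbreviation disc_int :: "real \<Rightarrow> ('n::finite point \<Rightarrow> real) \<Rightarrow> real" where
  "disc_int \<rho> f \<equiv> (LBINT x. indicator (half_disc \<rho>) x * f x)"

abbreviation disc_integrable :: "real \<Rightarrow> ('n::finite point \<Rightarrow> real) \<Rightarrow> bool" where
  "disc_integrable \<rho> f \<equiv> integrable lborel (\<lambda>x. indicator (half_disc \<rho>) x * f x)"

lemma integrable_on_half_disc:
  fixes f :: "'n::finite point \<Rightarrow> real"
  shows "continuous_on (half_disc \<rho>) f \<Longrightarrow> disc_integrable \<rho> f"
  using borel_integrable_compact[OF compact_half_disc, of \<rho> f] by simp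

text \<open>The squared positive part is continuously differentiable. Truncations assembled from it
  have classical gradients after composition with \<open>u\<close>.\<close>

definition pos2 :: "real \<Rightarrow> real" where
  "pos2 t = (max 0 t)^2"

lemma pos2_has_derivative: "(pos2 has_real_derivative 2 * max 0 t) (at t)"
proof -
  consider "t < 0" | "t = 0" | "t > 0" by linarith
  then show ?thesis
  proof cases
    case 1
    have "((\<lambda>t::real. 0) has_real_derivative 0) (at t)" by simp
    then have "(pos2 has_real_derivative 0) (at t)"
      by (rule has_field_derivative_transform_within_open[where S = "{..<0}"]) (use 1 in \<open>auto simp: pos2_def\<close>)
    then show ?thesis using 1 by simp
  next
    case 2
    have "((\<lambda>h. max 0 h * max 0 h / h) \<longlongrightarrow> 0) (at (0::real))"
    proof (rule Lim_null_comparison)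
      show "\<forall>\<^sub>F h in at (0::real). norm (max 0 h * max 0 h / h) \<le> \<bar>h\<bar>"
        by (intro always_eventually allI) (auto simp: max_def)
      show "((\<lambda>h::real. \<bar>h\<bar>) \<longlongrightarrow> 0) (at 0)" using tendsto_rabs[OF tendsto_ident_at[of "0::real" UNIV]] by simp
    qed
    then show ?thesis using 2 by (simp add: DERIV_def pos2_def power2_eq_square)
  next
    case 3
    have "((\<lambda>t::real. t\<^sup>2) has_real_derivative 2 * t) (at t)" by (auto intro!: derivative_eq_intros)
    then have "(pos2 has_real_derivative 2 * t) (at t)"
      by (rule has_field_derivative_transform_within_open[where S = "{0<..}"]) (use 3 in \<open>auto simp: pos2_def\<close>)
    then show ?thesis using 3 by simp
  qed
qed

lemma pos2_shift_has_derivative: "((\<lambda>t. pos2 (t - c)) has_real_derivative 2 * max 0 (t - c)) (at t)"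
proof -
  have "((\<lambda>t. t - c) has_real_derivative 1) (at t)" by (auto intro!: derivative_eq_intros)
  from DERIV_chain2[OF pos2_has_derivative this] show ?thesis by simp
qed

text \<open>The quadratic spline with values 1 for \<open>s \<le> 0\<close> and 0 for \<open>s \<ge> 1\<close>.\<close>

definition step1 :: "real \<Rightarrow> real" where
  "step1 s = 1 - 2 * pos2 (s - 0) + 4 * pos2 (s - 1/2) - 2 * pos2 (s - 1)"

definition step1' :: "real \<Rightarrow> real" where
  "step1' s = - 2 * (2 * max 0 (s - 0)) + 4 * (2 * max 0 (s - 1/2)) - 2 * (2 * max 0 (s - 1))"

lemma step1_has_derivative: "(step1 has_real_derivative step1' s) (at s)"
proof -
  have "((\<lambda>s. 1 - 2 * pos2 (s - 0) + 4 * pos2 (s - 1/2) - 2 * pos2 (s - 1)) has_real_derivative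
     0 - 2 * (2 * max 0 (s - 0)) + 4 * (2 * max 0 (s - 1/2)) - 2 * (2 * max 0 (s - 1))) (at s)"
    by (intro DERIV_diff DERIV_add DERIV_cmult pos2_shift_has_derivative DERIV_const)
  then show ?thesis by (simp add: step1_def[abs_def] step1'_def)
qed

lemma step1_eq:
  "s \<le> 0 \<Longrightarrow> step1 s = 1" "s \<ge> 1 \<Longrightarrow> step1 s = 0"
  "0 \<le> s \<Longrightarrow> s \<le> 1/2 \<Longrightarrow> step1 s = 1 - 2 * s\<^sup>2" "1/2 \<le> s \<Longrightarrow> s \<le> 1 \<Longrightarrow> step1 s = 2 * (1 - s)^2"
  by (auto simp: step1_def pos2_def power2_eq_square algebra_simps)

lemma step1_bounds: "0 \<le> step1 s" "step1 s \<le> 1"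
proof -
  consider "s \<le> 0" | "0 \<le> s" "s \<le> 1/2" | "1/2 \<le> s" "s \<le> 1" | "1 \<le> s" by linarith
  then have "0 \<le> step1 s \<and> step1 s \<le> 1"
  proof cases
    case 2
    have "s\<^sup>2 \<le> (1/2)^2" using 2 by (intro power_mono) auto
    then show ?thesis using 2 by (simp add: step1_eq power2_eq_square)
  next
    case 3
    have "(1 - s)^2 \<le> (1/2)^2" using 3 by (intro power_mono) auto
    then show ?thesis using 3 by (simp add: step1_eq power2_eq_square)
  qed (simp_all add: step1_eq)
  then show "0 \<le> step1 s" "step1 s \<le> 1" by auto
qed

lemma step1'_bound: "\<bar>step1' s\<bar> \<le> 2"
  unfolding step1'_def by (auto simp: max_def)

lemma step1'_eq_0: "s \<le> 0 \<or> s \<ge> 1 \<Longrightarrow> step1' s = 0"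
  unfolding step1'_def by (auto simp: max_def)

text \<open>Written through \<open>x \<bullet> x\<close> rather than the norm, so that it is
  differentiable at the origin as well.\<close>

definition cutoff :: "real \<Rightarrow> real \<Rightarrow> 'n::finite point \<Rightarrow> real" where
  "cutoff \<rho>1 \<rho>2 x = step1 ((x \<bullet> x - \<rho>1\<^sup>2) / (\<rho>2\<^sup>2 - \<rho>1\<^sup>2))"

definition cutoff_grad :: "real \<Rightarrow> real \<Rightarrow> 'n::finite point \<Rightarrow> 'n point" where
  "cutoff_grad \<rho>1 \<rho>2 x = (step1' ((x \<bullet> x - \<rho>1\<^sup>2) / (\<rho>2\<^sup>2 - \<rho>1\<^sup>2)) * 2 / (\<rho>2\<^sup>2 - \<rho>1\<^sup>2)) *\<^sub>R x"

lemma cutoff_has_derivative: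
  "(cutoff \<rho>1 \<rho>2 has_gradient cutoff_grad \<rho>1 \<rho>2 x) (at x)"
proof -
  let ?d = "\<rho>2\<^sup>2 - \<rho>1\<^sup>2"
  have 1: "((\<lambda>x. (x \<bullet> x - \<rho>1\<^sup>2) / ?d) has_derivative (\<lambda>h. (2 / ?d) * (x \<bullet> h))) (at x)"
  proof -
    have "((\<lambda>x. x \<bullet> x - \<rho>1\<^sup>2) has_derivative (\<lambda>h. 2 * (x \<bullet> h))) (at x)"
      by (auto intro!: derivative_eq_intros simp: inner_commute)
    from has_derivative_mult_left[OF this, of "inverse ?d"] show ?thesis
      by (simp only: divide_inverse mult_ac)
  qed
  have 2: "(step1 has_derivative (\<lambda>h. step1' ((x \<bullet> x - \<rho>1\<^sup>2) / ?d) * h)) (at ((x \<bullet> x - \<rho>1\<^sup>2) / ?d))"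
    using step1_has_derivative by (simp add: has_field_derivative_def)
  show ?thesis using has_derivative_compose[OF 1 2] unfolding cutoff_def[abs_def] cutoff_grad_def
    by (rule has_derivative_eq_rhs) (auto simp: fun_eq_iff)
qed

lemma continuous_cutoff: "continuous_on S (cutoff \<rho>1 \<rho>2)" "continuous_on S (cutoff_grad \<rho>1 \<rho>2)"
proof -
  show "continuous_on S (cutoff \<rho>1 \<rho>2)"
    by (intro continuous_at_imp_continuous_on ballI has_derivative_continuous[OF cutoff_has_derivative])
  show "continuous_on S (cutoff_grad \<rho>1 \<rho>2)"
    unfolding cutoff_grad_def step1'_def divide_inverse by (intro continuous_intros)
qed

lemma cutoff_props:
  fixes x :: "'n::finite point"
  assumes \<rho>: "0 \<le> \<rho>1" "\<rho>1 < \<rho>2"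
  shows "0 \<le> cutoff \<rho>1 \<rho>2 x" "cutoff \<rho>1 \<rho>2 x \<le> 1"
    "norm x \<le> \<rho>1 \<Longrightarrow> cutoff \<rho>1 \<rho>2 x = 1" "norm x \<ge> \<rho>2 \<Longrightarrow> cutoff \<rho>1 \<rho>2 x = 0"
    "norm x \<le> \<rho>1 \<or> norm x \<ge> \<rho>2 \<Longrightarrow> cutoff_grad \<rho>1 \<rho>2 x = 0"
    "norm (cutoff_grad \<rho>1 \<rho>2 x) \<le> 4 / (\<rho>2 - \<rho>1)"
proof -
  have d: "\<rho>2\<^sup>2 - \<rho>1\<^sup>2 > 0" using \<rho> by (simp add: power_strict_mono)
  show "0 \<le> cutoff \<rho>1 \<rho>2 x" "cutoff \<rho>1 \<rho>2 x \<le> 1" unfolding cutoff_def by (rule step1_bounds)+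
  have a: "(x \<bullet> x - \<rho>1\<^sup>2) / (\<rho>2\<^sup>2 - \<rho>1\<^sup>2) \<le> 0" if "norm x \<le> \<rho>1"
    using that d power_mono[OF that norm_ge_zero, of 2] by (simp add: dot_square_norm divide_le_0_iff)
  have c: "(x \<bullet> x - \<rho>1\<^sup>2) / (\<rho>2\<^sup>2 - \<rho>1\<^sup>2) \<ge> 1" if "norm x \<ge> \<rho>2"
    using that d power_mono[OF that, of 2] \<rho> by (simp add: dot_square_norm le_divide_eq)
  show "norm x \<le> \<rho>1 \<Longrightarrow> cutoff \<rho>1 \<rho>2 x = 1" using a by (simp add: cutoff_def step1_eq)
  show "norm x \<ge> \<rho>2 \<Longrightarrow> cutoff \<rho>1 \<rho>2 x = 0" using c by (simp add: cutoff_def step1_eq)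
  show z: "norm x \<le> \<rho>1 \<or> norm x \<ge> \<rho>2 \<Longrightarrow> cutoff_grad \<rho>1 \<rho>2 x = 0"
    using a c step1'_eq_0[of "(x \<bullet> x - \<rho>1\<^sup>2) / (\<rho>2\<^sup>2 - \<rho>1\<^sup>2)"] by (auto simp: cutoff_grad_def)
  show "norm (cutoff_grad \<rho>1 \<rho>2 x) \<le> 4 / (\<rho>2 - \<rho>1)"
  proof (cases "norm x < \<rho>2")
    case True
    have "norm (cutoff_grad \<rho>1 \<rho>2 x) = \<bar>step1' ((x \<bullet> x - \<rho>1\<^sup>2) / (\<rho>2\<^sup>2 - \<rho>1\<^sup>2))\<bar> * (2 * norm x / (\<rho>2\<^sup>2 - \<rho>1\<^sup>2))"
      using d by (simp add: cutoff_grad_def abs_mult)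
    also have "\<dots> \<le> 2 * (2 * (\<rho>2 + \<rho>1) / (\<rho>2\<^sup>2 - \<rho>1\<^sup>2))"
      using True d \<rho> by (intro mult_mono step1'_bound divide_right_mono) auto
    also have "\<dots> = 4 / (\<rho>2 - \<rho>1)"
    proof -
      have "\<rho>2\<^sup>2 - \<rho>1\<^sup>2 = (\<rho>2 + \<rho>1) * (\<rho>2 - \<rho>1)" by (simp add: power2_eq_square algebra_simps)
      then show ?thesis using \<rho> by (simp add: divide_simps)
    qed
    finally show ?thesis .
  next
    case False
    then show ?thesis using z \<rho> by simp
  qed
qed

section \<open>Test functions and Caccioppoli's inequality\<close>

context thin_problem
begin

definition "m = CARD('n option)"

lemma u_continuous: "continuous_on (half_ball 0 (1/10)) u"
proof (rule has_derivative_continuous_on)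
  fix x assume "x \<in> half_ball (0 :: 'n point) (1/10)"
  then show "(u has_gradient gu x) (at x within half_ball 0 (1/10))"
    by (rule has_derivative_subset[OF u_derivative]) (auto simp: half_ball_def upper_def)
qed

lemma flux_continuous: "continuous_on (half_ball 0 (1/10)) (flux b gu)"
  unfolding flux_def[abs_def] matrix_vector_mult_def by (intro continuous_intros b_continuous gu_continuous)

lemmas u_cont' = continuous_on_subset[OF u_continuous half_disc_sub]
lemmas gu_cont' = continuous_on_subset[OF gu_continuous half_disc_sub]
lemmas flux_cont' = continuous_on_subset[OF flux_continuous half_disc_sub]

lemma b_bilinear: "x \<in> half_ball 0 (1/10) \<Longrightarrow> v \<bullet> (b x *v w) = w \<bullet> (b x *v v)"
  using dot_lmul_matrix[of v "b x" w] b_symmetric[of x]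
  by (simp flip: transpose_matrix_vector add: inner_commute)

text \<open>The form is nonnegative at \<open>s *\<^sub>R p + t *\<^sub>R r\<close> and at
  \<open>s *\<^sub>R p - t *\<^sub>R r\<close>.\<close>

lemma b_cauchy_schwarz:
  assumes x: "x \<in> half_ball 0 (1/10)"
  shows "2 * \<bar>s * t * ((b x *v p) \<bullet> r)\<bar> \<le> s\<^sup>2 * (p \<bullet> (b x *v p)) + t\<^sup>2 * (r \<bullet> (b x *v r))"
proof -
  have q: "0 \<le> v \<bullet> (b x *v v)" for v using order_trans[OF _ b_lower[OF x]] by simp
  have e: "(s *\<^sub>R p + c *\<^sub>R r) \<bullet> (b x *v (s *\<^sub>R p + c *\<^sub>R r)) =
      s\<^sup>2 * (p \<bullet> (b x *v p)) + c\<^sup>2 * (r \<bullet> (b x *v r)) + 2 * (s * c * ((b x *v p) \<bullet> r))" for c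
    using b_bilinear[OF x, of r p] b_bilinear[OF x, of p r]
    by (simp add: matrix_vector_right_distrib matrix_vector_mult_scaleR inner_add_left inner_add_right
        power2_eq_square algebra_simps inner_commute)
  from q[of "s *\<^sub>R p + t *\<^sub>R r"] q[of "s *\<^sub>R p + (- t) *\<^sub>R r"] show ?thesis
    unfolding e by (simp add: abs_le_iff)
qed

text \<open>If the boundary term vanishes, both \<open>\<phi>\<close> and its negative are
  admissible, and the two inequalities give equality.\<close>

lemma C1_test:
  assumes \<rho>: "\<rho> < 1/10"
    and der: "\<And>x. x \<in> upper \<Longrightarrow> (\<phi> has_gradient g x) (at x within upper)"
    and g: "continuous_on upper g"
    and supp: "\<And>x. x \<in> upper \<Longrightarrow> x \<notin> half_disc \<rho> \<Longrightarrow> \<phi> x = 0 \<and> g x = 0"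
    and flat: "\<And>x. x \<in> half_disc \<rho> \<Longrightarrow> x $ None = 0 \<Longrightarrow> flux b gu x $ None * \<phi> x = 0"
  shows "disc_int \<rho> (\<lambda>x. (flux b gu x \<bullet> g x)) = 0"
proof -
  obtain L where L: "\<And>x. x \<in> half_disc \<rho> \<Longrightarrow> norm (g x) \<le> L" "L > 0"
    using compact_imp_bounded[OF compact_continuous_image[OF continuous_on_subset[OF g] compact_half_disc[of \<rho>]]]
    unfolding bounded_pos half_disc_def by blast
  have L': "norm (g x) \<le> L" if "x \<in> upper" for x using L supp[OF that] by (cases "x \<in> half_disc \<rho>") auto
  define g' where "g' x = indicator upper x *\<^sub>R g x" for x
  have [measurable]: "g' \<in> borel_measurable borel"
    unfolding g'_def by (rule borel_measurable_continuous_on_indicator) (use g in auto)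
  have lip: "\<bar>\<phi> x - \<phi> y\<bar> \<le> L * norm (x - y)" if "x \<in> upper" "y \<in> upper" for x y
  proof -
    have "norm (\<phi> x - \<phi> y) \<le> L * norm (x - y)"
    proof (rule differentiable_bound[OF convex_upper der])
      fix z :: "'n point" assume "z \<in> upper"
      have "norm (g z \<bullet> h) \<le> L * norm h" for h
        using order_trans[OF Cauchy_Schwarz_ineq2 mult_right_mono[OF L'[OF \<open>z \<in> upper\<close>] norm_ge_zero[of h]]] by simp
      then show "onorm (\<lambda>h. g z \<bullet> h) \<le> L" by (rule onorm_le)
    qed (use that in auto)
    then show ?thesis by simp
  qed
  have at: "(\<phi> has_gradient g' x) (at x)" if "x $ None > 0" for x
  proof -
    have "open {x :: 'n point. x $ None > 0}" by (intro open_Collect_less continuous_intros)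
    then have "at x within upper = at x"
      using that by (intro at_within_interior) (auto simp: interior_def upper_def intro!: exI[of _ "{x. x $ None > 0}"])
    then show ?thesis using der[of x] that by (simp add: g'_def upper_def)
  qed
  have eq: "indicator (half_disc \<rho>) x *\<^sub>R (flux b gu x \<bullet> (c *\<^sub>R g' x)) = c * (indicator (half_disc \<rho>) x * (flux b gu x \<bullet> g x))" for x c
    by (auto simp: g'_def half_disc_def indicator_def)
  have ineq: "0 \<le> (LBINT x. indicator (half_disc \<rho>) x *\<^sub>R (flux b gu x \<bullet> (c *\<^sub>R g' x)))"
    if c: "c = 1 \<or> c = -1" for c
  proof (rule variational[where \<phi> = "\<lambda>x. c * \<phi> x" and L = L and N = "{}"])
    show "compact (half_disc \<rho>)" by (rule compact_half_disc)
    show "half_disc \<rho> \<subseteq> half_ball 0 (1/10)" by (rule half_disc_sub[OF \<rho>])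
    show "\<bar>c * \<phi> x - c * \<phi> y\<bar> \<le> L * norm (x - y)" if "x \<in> upper" "y \<in> upper" for x y
      using lip[OF that] c by (auto simp: abs_minus_commute)
    show "((\<lambda>x. c * \<phi> x) has_gradient (c *\<^sub>R g' x)) (at x)" if "x $ None > 0" for x
      using has_derivative_mult_right[OF at[OF that], of c] by simp
    show "norm (c *\<^sub>R g' x) \<le> L" for x using L' L(2) c by (auto simp: g'_def indicator_def)
    show "c *\<^sub>R g' x = 0" if "x \<notin> half_disc \<rho>" for x
      using supp[of x] that by (auto simp: g'_def indicator_def)
    show "flux b gu x $ None * (c * \<phi> x) \<le> 0" if "x \<in> half_disc \<rho>" "x $ None = 0" for x
      using flat[OF that] by auto
  qed (use supp in auto)
  from ineq[of 1] ineq[of "-1"] show ?thesis unfolding eq by simp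
qed

text \<open>\<open>u\<close> is controlled only near the origin, whereas test functions live on the
  whole half space. Since \<open>\<psi>\<close> vanishes together with its gradient beyond
  \<open>\<rho>2\<close>, extending the product by zero keeps it continuously
  differentiable.\<close>

lemma composite_test:
  assumes \<rho>: "0 < \<rho>1" "\<rho>1 < \<rho>2" "\<rho>2 < 1/10"
    and G: "\<And>t. (G has_real_derivative G' t) (at t)" "continuous_on UNIV G'"
    and \<psi>: "\<And>x. (\<psi> has_gradient g\<psi> x) (at x)" "continuous_on UNIV g\<psi>"
      "\<And>x. norm x \<ge> \<rho>2 \<Longrightarrow> \<psi> x = 0 \<and> g\<psi> x = 0"
  defines "\<phi> \<equiv> (\<lambda>x. if x \<in> half_disc \<rho>2 then G (u x) * \<psi> x else 0)"
    and "g \<equiv> (\<lambda>x. if x \<in> half_disc \<rho>2 then (G' (u x) * \<psi> x) *\<^sub>R gu x + G (u x) *\<^sub>R g\<psi> x else 0)"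
  shows "x \<in> upper \<Longrightarrow> (\<phi> has_gradient g x) (at x within upper)"
    and "continuous_on upper g"
    and "x \<in> upper \<Longrightarrow> x \<notin> half_disc \<rho>2 \<Longrightarrow> \<phi> x = 0 \<and> g x = 0"
proof -
  define O1 where "O1 = ball (0 :: 'n point) (1/10)"
  define O2 where "O2 = - cball (0 :: 'n point) \<rho>2"
  have op: "open O1" "open O2" unfolding O1_def O2_def by auto
  have cover: "x \<in> O1 \<or> x \<in> O2" for x using \<rho> by (auto simp: O1_def O2_def)
  have up1: "x \<in> half_ball 0 (1/10)" if "x \<in> upper" "x \<in> O1" for x
    using that by (simp add: half_ball_def upper_def O1_def)
  have \<phi>1: "\<phi> x = G (u x) * \<psi> x" if "x \<in> upper" for x
    using that \<psi>(3)[of x] by (auto simp: \<phi>_def half_disc_def)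
  have g1: "g x = (G' (u x) * \<psi> x) *\<^sub>R gu x + G (u x) *\<^sub>R g\<psi> x" if "x \<in> upper" for x
    using that \<psi>(3)[of x] by (auto simp: g_def half_disc_def)
  have out: "\<phi> x = 0" "g x = 0" if "x \<in> O2" for x using that by (auto simp: \<phi>_def g_def half_disc_def O2_def)
  show "(\<phi> has_gradient g x) (at x within upper)" if x: "x \<in> upper" for x
  proof (cases "x \<in> O1")
    case True
    have "(u has_gradient gu x) (at x within upper)" using u_derivative up1 x True by blast
    from has_derivative_compose[OF this G(1)[unfolded has_field_derivative_def]]
    have "((\<lambda>x. G (u x)) has_derivative (\<lambda>h. G' (u x) * (gu x \<bullet> h))) (at x within upper)" by simp
    from has_derivative_mult[OF this has_derivative_at_withinI[OF \<psi>(1)]]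
    have "((\<lambda>x. G (u x) * \<psi> x) has_derivative (\<lambda>h. G (u x) * (g\<psi> x \<bullet> h) + G' (u x) * (gu x \<bullet> h) * \<psi> x)) (at x within upper)" .
    then have "((\<lambda>x. G (u x) * \<psi> x) has_gradient g x) (at x within upper)"
      by (rule has_derivative_eq_rhs) (auto simp: g1[OF x] inner_add_left fun_eq_iff)
    then show ?thesis by (rule has_derivative_transform[rotated 2]) (use x \<phi>1 in auto)
  next
    case False
    then have x2: "x \<in> O2" using cover by blast
    have "((\<lambda>x. 0) has_derivative (\<lambda>h. 0)) (at x within upper)" by simp
    then have "(\<phi> has_derivative (\<lambda>h. 0)) (at x within upper)"
      by (rule has_derivative_transform_within_open[OF _ op(2) x2]) (use out in auto)
    then show ?thesis using out(2)[OF x2] by simp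
  qed
  show "continuous_on upper g"
  proof -
    have c1: "continuous_on (half_disc \<rho>2) g"
    proof (rule continuous_on_eq)
      have Gc: "continuous_on UNIV G" using DERIV_isCont[OF G(1)] by (simp add: continuous_at_imp_continuous_on)
      have uc: "continuous_on (half_disc \<rho>2) u" by (rule u_cont'[OF \<rho>(3)])
      have \<psi>c: "continuous_on (half_disc \<rho>2) \<psi>"
        by (intro continuous_at_imp_continuous_on ballI has_derivative_continuous[OF \<psi>(1)])
      show "continuous_on (half_disc \<rho>2) (\<lambda>x. (G' (u x) * \<psi> x) *\<^sub>R gu x + G (u x) *\<^sub>R g\<psi> x)"
        by (intro continuous_intros \<psi>c continuous_on_compose2[OF Gc uc] continuous_on_compose2[OF G(2) uc]
            gu_cont'[OF \<rho>(3)] continuous_on_subset[OF \<psi>(2)]) auto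
    qed (use g1 in \<open>auto simp: half_disc_def\<close>)
    define T where "T = upper \<inter> - ball (0 :: 'n point) \<rho>2"
    have c2: "continuous_on T g"
    proof (rule continuous_on_eq[of _ "\<lambda>x. 0"])
      fix x :: "'n point" assume "x \<in> T"
      then show "0 = g x" using g1[of x] \<psi>(3)[of x] by (auto simp: T_def)
    qed simp
    have "closed T" unfolding T_def by (intro closed_Int closed_upper) (simp add: closed_Compl)
    then have "continuous_on (half_disc \<rho>2 \<union> T) g"
      by (intro continuous_on_closed_Un c1 c2 compact_imp_closed[OF compact_half_disc])
    moreover have "half_disc \<rho>2 \<union> T = upper" by (auto simp: half_disc_def T_def)
    ultimately show ?thesis by simp
  qed
  show "x \<notin> half_disc \<rho>2 \<Longrightarrow> \<phi> x = 0 \<and> g x = 0" by (simp add: \<phi>_def g_def)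
qed

text \<open>The test function is \<open>G (u x)\<close> times the squared cutoff. It makes no
  boundary contribution: by complementarity the flux vanishes where \<open>u\<close> is positive,
  and elsewhere \<open>u = 0\<close> and \<open>G 0 = 0\<close>. The bound of \<open>G\<close> by
  \<open>U\<close> times \<open>G'\<close> lets the cross term be absorbed by the energy weighted
  with \<open>G'\<close>.\<close>

lemma caccioppoli:
  assumes \<rho>: "0 < \<rho>1" "\<rho>1 < \<rho>2" "\<rho>2 < 1/10"
    and G: "\<And>t. (G has_real_derivative G' t) (at t)" "continuous_on UNIV G'"
    and G0: "G 0 = 0" and G'01: "\<And>t. 0 \<le> G' t" "\<And>t. G' t \<le> 1"
    and U: "continuous_on UNIV U" "\<And>t. 0 \<le> U t" "\<And>t. \<bar>G t\<bar> \<le> U t * G' t"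
  shows "(LBINT x. indicator (half_disc \<rho>2) x *
        (norm ((G' (u x) * cutoff \<rho>1 \<rho>2 x) *\<^sub>R gu x + G (u x) *\<^sub>R cutoff_grad \<rho>1 \<rho>2 x))\<^sup>2)
    \<le> 34 * disc_int \<rho>2 (\<lambda>x. (G' (u x) * (U (u x))^2 * (norm (cutoff_grad \<rho>1 \<rho>2 x))^2))"
proof -
  let ?\<psi> = "cutoff \<rho>1 \<rho>2" and ?g\<psi> = "cutoff_grad \<rho>1 \<rho>2"
  have \<rho>0: "0 \<le> \<rho>1" using \<rho> by simp
  have d\<psi>: "((\<lambda>x. (?\<psi> x)^2) has_gradient ((2 * ?\<psi> x) *\<^sub>R ?g\<psi> x)) (at x)" for x :: "'n point"
    by (rule has_derivative_eq_rhs[OF has_derivative_power[OF cutoff_has_derivative]]) (auto simp: fun_eq_iff)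
  have c\<psi>: "continuous_on UNIV (\<lambda>x. (2 * ?\<psi> x) *\<^sub>R ?g\<psi> x)" by (intro continuous_intros continuous_cutoff)
  have z\<psi>: "(?\<psi> x)^2 = 0 \<and> (2 * ?\<psi> x) *\<^sub>R ?g\<psi> x = 0" if "norm x \<ge> \<rho>2" for x :: "'n point"
    using cutoff_props(4)[OF \<rho>0 \<rho>(2) that] by simp
  define \<phi> where "\<phi> x = (if x \<in> half_disc \<rho>2 then G (u x) * (?\<psi> x)^2 else 0)" for x
  define g where "g x = (if x \<in> half_disc \<rho>2 then (G' (u x) * (?\<psi> x)^2) *\<^sub>R gu x + G (u x) *\<^sub>R ((2 * ?\<psi> x) *\<^sub>R ?g\<psi> x) else 0)" for x
  note ct = composite_test[OF \<rho> G d\<psi> c\<psi> z\<psi>, folded \<phi>_def g_def]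
  have zero: "disc_int \<rho>2 (\<lambda>x. (flux b gu x \<bullet> g x)) = 0"
  proof (rule C1_test[OF \<rho>(3)])
    show "flux b gu x $ None * \<phi> x = 0" if "x \<in> half_disc \<rho>2" "x $ None = 0" for x
      using signorini[of x] that half_disc_sub[OF \<rho>(3)] G0 by (auto simp: \<phi>_def)
  qed (use ct in \<open>auto simp: \<phi>_def[abs_def] g_def[abs_def]\<close>)
  let ?g1 = "\<lambda>x. (G' (u x) * ?\<psi> x) *\<^sub>R gu x + G (u x) *\<^sub>R ?g\<psi> x"
  have pt: "(norm (?g1 x))^2 \<le> 8 * (flux b gu x \<bullet> g x) + 34 * (G' (u x) * (U (u x))^2 * (norm (?g\<psi> x))^2)"
    if x: "x \<in> half_disc \<rho>2" for x
  proof -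
    have xb: "x \<in> half_ball 0 (1/10)" using x half_disc_sub[OF \<rho>(3)] by blast
    define p r a c d v where "p = gu x" and "r = ?g\<psi> x" and "a = G' (u x)" and "c = G (u x)" and "d = ?\<psi> x" and "v = U (u x)"
    define qp qr where "qp = p \<bullet> (b x *v p)" and "qr = r \<bullet> (b x *v r)"
    define e where "e = (b x *v p) \<bullet> r"
    have a: "0 \<le> a" "a \<le> 1" and v: "0 \<le> v" "\<bar>c\<bar> \<le> v * a" using G'01 U by (auto simp: a_def v_def c_def)
    have pp: "(norm p)^2 \<le> 2 * qp" using b_lower[OF xb, of p] by (simp add: qp_def dot_square_norm)
    have rr: "qr \<le> 2 * (norm r)^2" using b_upper[OF xb, of r] by (simp add: qr_def dot_square_norm)
    have Fg: "flux b gu x \<bullet> g x = a * d\<^sup>2 * qp + 2 * c * d * e"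
      using x by (simp add: g_def flux_def p_def r_def a_def c_def d_def qp_def e_def inner_add_right inner_commute)
    \<comment> \<open>The weight \<open>2 * v\<close> leaves half of
      \<open>a * d\<^sup>2 * qp\<close> after the cross term has been absorbed.\<close>
    have "2 * \<bar>d * (2 * v) * e\<bar> \<le> d\<^sup>2 * qp + (2 * v)^2 * qr"
      using b_cauchy_schwarz[OF xb, of d "2 * v" p r] by (simp add: e_def qp_def qr_def)
    then have "a * (2 * \<bar>d * (2 * v) * e\<bar>) \<le> a * (d\<^sup>2 * qp + (2 * v)^2 * qr)" using a by (intro mult_left_mono)
    moreover have "\<bar>2 * c * d * e\<bar> * 2 \<le> a * (2 * \<bar>d * (2 * v) * e\<bar>)"
      using mult_right_mono[OF v(2), of "4 * \<bar>d * e\<bar>"] v by (simp add: abs_mult mult_ac)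
    ultimately have "2 * (a * d\<^sup>2 * qp) - a * d\<^sup>2 * qp - 4 * (a * v\<^sup>2 * qr) \<le> 2 * (flux b gu x \<bullet> g x)"
      unfolding Fg by (simp add: algebra_simps power2_eq_square)
    then have 1: "a * d\<^sup>2 * qp \<le> 2 * (flux b gu x \<bullet> g x) + 4 * (a * v\<^sup>2 * qr)" by linarith
    have 2: "a * v\<^sup>2 * qr \<le> 2 * (a * v\<^sup>2 * (norm r)^2)" using mult_left_mono[OF rr, of "a * v\<^sup>2"] a by simp
    have "(norm (?g1 x))^2 \<le> 2 * ((norm ((a * d) *\<^sub>R p))^2 + (norm (c *\<^sub>R r))^2)"
    proof -
      have "norm (?g1 x) \<le> norm ((a * d) *\<^sub>R p) + norm (c *\<^sub>R r)"
        unfolding a_def d_def p_def c_def r_def by (rule norm_triangle_ineq)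
      then have "(norm (?g1 x))^2 \<le> (norm ((a * d) *\<^sub>R p) + norm (c *\<^sub>R r))^2" by (intro power_mono) auto
      also have "\<dots> \<le> 2 * ((norm ((a * d) *\<^sub>R p))^2 + (norm (c *\<^sub>R r))^2)"
        using sum_squares_bound[of "norm ((a * d) *\<^sub>R p)" "norm (c *\<^sub>R r)"] by (simp add: power2_sum)
      finally show ?thesis .
    qed
    also have "(norm ((a * d) *\<^sub>R p))^2 = a * (a * d\<^sup>2 * (norm p)^2)" by (simp add: power_mult_distrib power2_eq_square)
    also have "\<dots> \<le> 1 * (a * d\<^sup>2 * (norm p)^2)" using a by (intro mult_right_mono) auto
    also have "a * d\<^sup>2 * (norm p)^2 \<le> a * d\<^sup>2 * (2 * qp)" using a pp by (intro mult_left_mono) auto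
    also have "(norm (c *\<^sub>R r))^2 = \<bar>c\<bar>\<^sup>2 * (norm r)^2" by (simp add: power_mult_distrib)
    also have "\<bar>c\<bar>\<^sup>2 * (norm r)^2 \<le> a * v\<^sup>2 * (norm r)^2"
    proof (rule mult_right_mono)
      have "\<bar>c\<bar>\<^sup>2 \<le> (v * a)^2" using v by (intro power_mono) auto
      also have "\<dots> = a * (a * v\<^sup>2)" by (simp add: power2_eq_square)
      also have "\<dots> \<le> 1 * (a * v\<^sup>2)" using a by (intro mult_right_mono) auto
      finally show "\<bar>c\<bar>\<^sup>2 \<le> a * v\<^sup>2" by simp
    qed simp
    finally have "(norm (?g1 x))^2 \<le> 2 * (1 * (a * d\<^sup>2 * (2 * qp)) + a * v\<^sup>2 * (norm r)^2)" by simp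
    \<comment> \<open>Four times fact 1 contributes the factor 8 of the flux term and, with fact 2,
      the number 32; the second summand adds 2.\<close>
    also have "\<dots> \<le> 8 * (flux b gu x \<bullet> g x) + 34 * (a * v\<^sup>2 * (norm r)^2)" using 1 2 by (simp add: algebra_simps)
    finally show ?thesis by (simp add: a_def v_def r_def)
  qed
  have sub: "half_disc \<rho>2 \<subseteq> upper" by (simp add: half_disc_def)
  have uc: "continuous_on (half_disc \<rho>2) u" by (rule u_cont'[OF \<rho>(3)])
  have Gc: "continuous_on UNIV G" using DERIV_isCont[OF G(1)] by (simp add: continuous_at_imp_continuous_on)
  have cs: "continuous_on (half_disc \<rho>2) (\<lambda>x. G (u x))" "continuous_on (half_disc \<rho>2) (\<lambda>x. G' (u x))" "continuous_on (half_disc \<rho>2) (\<lambda>x. U (u x))"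
    by (rule continuous_on_compose2[OF Gc uc] continuous_on_compose2[OF G(2) uc] continuous_on_compose2[OF U(1) uc], simp)+
  have I1: "disc_integrable \<rho>2 (\<lambda>x. (norm (?g1 x))^2)"
    by (intro integrable_on_half_disc continuous_intros cs continuous_cutoff gu_cont'[OF \<rho>(3)])
  have I2: "disc_integrable \<rho>2 (\<lambda>x. (flux b gu x \<bullet> g x))"
    by (intro integrable_on_half_disc continuous_intros flux_cont'[OF \<rho>(3)] continuous_on_subset[OF ct(2) sub])
  have I3: "disc_integrable \<rho>2 (\<lambda>x. (G' (u x) * (U (u x))^2 * (norm (?g\<psi> x))^2))"
    by (intro integrable_on_half_disc continuous_intros cs continuous_cutoff)
  have "disc_int \<rho>2 (\<lambda>x. (norm (?g1 x))^2) \<le>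
     (LBINT x. 8 * (indicator (half_disc \<rho>2) x * (flux b gu x \<bullet> g x)) +
        34 * (indicator (half_disc \<rho>2) x * (G' (u x) * (U (u x))^2 * (norm (?g\<psi> x))^2)))"
    using pt by (intro integral_mono I1 Bochner_Integration.integrable_add integrable_mult_right I2 I3)
      (auto simp: indicator_def)
  also have "\<dots> = 8 * 0 + 34 * disc_int \<rho>2 (\<lambda>x. (G' (u x) * (U (u x))^2 * (norm (?g\<psi> x))^2))"
    using I2 I3 by (subst Bochner_Integration.integral_add) (auto simp: zero)
  finally show ?thesis by simp
qed

text \<open>A cube of volume \<open>2 * s\<close> has side \<open>(2 * s) powr (1 / real m)\<close>;
  the square of the side is the constant of the inequality.\<close>

lemma faber_krahn_half_disc:
  fixes \<phi> :: "'n point \<Rightarrow> real"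
  assumes der: "\<And>x. x \<in> upper \<Longrightarrow> (\<phi> has_gradient g x) (at x within upper)"
    and g: "continuous_on upper g"
    and supp: "\<And>x. x \<in> upper \<Longrightarrow> x \<notin> half_disc \<rho> \<Longrightarrow> \<phi> x = 0 \<and> g x = 0"
    and Z: "{x \<in> upper. \<phi> x \<noteq> 0} \<subseteq> Z" "Z \<in> sets borel" "emeasure lborel Z \<le> ennreal s" "0 < s"
  shows "disc_int \<rho> (\<lambda>x. (\<phi> x)^2) \<le>
    2 * (real m)^2 * (2 * s) powr (2 / real m) * disc_int \<rho> (\<lambda>x. (norm (g x))^2)"
proof -
  have m0: "m > 0" by (simp add: m_def)
  define \<rho>' where "\<rho>' = (2 * s) powr (1 / real m)"
  have \<rho>': "0 < \<rho>'" "\<rho>' ^ m = 2 * s" "\<rho>'\<^sup>2 = (2 * s) powr (2 / real m)"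
    using Z(4) m0 by (auto simp: \<rho>'_def powr_realpow[symmetric] powr_powr powr_numeral[symmetric] simp del: powr_numeral)
  have \<phi>c: "continuous_on upper \<phi>" by (rule has_derivative_continuous_on[OF der])
  have sub: "half_disc \<rho> \<subseteq> upper" by (simp add: half_disc_def)
  have I: "disc_integrable \<rho> (\<lambda>x. (\<phi> x)^2)" "disc_integrable \<rho> (\<lambda>x. (norm (g x))^2)"
    by (intro integrable_on_half_disc continuous_intros continuous_on_subset[OF \<phi>c sub] continuous_on_subset[OF g sub])+
  have eq: "indicator upper x * (\<phi> x)^2 = indicator (half_disc \<rho>) x * (\<phi> x)^2"
    "indicator upper x * (norm (g x))^2 = indicator (half_disc \<rho>) x * (norm (g x))^2" for x
    using supp[of x] sub by (auto simp: indicator_def)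
  have n: "upper_int (\<lambda>x. (\<phi> x)^2) = ennreal (disc_int \<rho> (\<lambda>x. (\<phi> x)^2))"
    "upper_int (\<lambda>x. (norm (g x))^2) = ennreal (disc_int \<rho> (\<lambda>x. (norm (g x))^2))"
    unfolding eq by (intro nn_integral_eq_integral I; simp)+
  have nn: "0 \<le> disc_int \<rho> (\<lambda>x. (norm (g x))^2)" by (intro Bochner_Integration.integral_nonneg) simp
  have "ennreal (disc_int \<rho> (\<lambda>x. (\<phi> x)^2)) \<le>
      ennreal (2 * (real m)^2 * \<rho>'\<^sup>2 * disc_int \<rho> (\<lambda>x. (norm (g x))^2))"
    using faber_krahn[OF der g Z(1-3) \<rho>'(1), folded m_def, OF _ \<rho>'(2)]
    unfolding n using nn by (simp add: ennreal_mult)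
  then show ?thesis using nn by (simp add: \<rho>'(3) ennreal_le_iff)
qed

section \<open>De Giorgi's iteration for the supremum\<close>

definition excess :: "real \<Rightarrow> real \<Rightarrow> real \<Rightarrow> real" where
  "excess \<sigma> k r = disc_int r (\<lambda>x. pos2 (\<sigma> * u x - k))"

lemma continuous_pos2: "continuous_on S pos2"
  by (intro continuous_at_imp_continuous_on ballI DERIV_isCont[OF pos2_has_derivative])

lemma excess_integrable: "r < 1/10 \<Longrightarrow> disc_integrable r (\<lambda>x. pos2 (\<sigma> * u x - k))"
  by (intro integrable_on_half_disc continuous_on_compose2[OF continuous_pos2[of UNIV]] continuous_intros u_cont') auto

lemma pos2_mono: "s \<le> t \<Longrightarrow> pos2 s \<le> pos2 t"
  unfolding pos2_def by (intro power_mono) auto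

lemma excess_mono: "k1 \<le> k2 \<Longrightarrow> r1 \<le> r2 \<Longrightarrow> r2 < 1/10 \<Longrightarrow> excess \<sigma> k2 r1 \<le> excess \<sigma> k1 r2"
proof -
  assume k: "k1 \<le> k2" "r1 \<le> r2" "r2 < 1/10"
  show ?thesis unfolding excess_def
  proof (intro integral_mono excess_integrable)
    fix x
    have "pos2 (\<sigma> * u x - k2) \<le> pos2 (\<sigma> * u x - k1)" using k by (intro pos2_mono) simp
    moreover have "0 \<le> pos2 (\<sigma> * u x - k1)" by (simp add: pos2_def)
    ultimately show "indicator (half_disc r1) x * pos2 (\<sigma> * u x - k2) \<le> indicator (half_disc r2) x * pos2 (\<sigma> * u x - k1)"
      using half_disc_mono[OF k(2)] by (auto simp: indicator_def)
  qed (use k in auto)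
qed

lemma excess_nonneg: "0 \<le> excess \<sigma> k r"
  unfolding excess_def by (intro Bochner_Integration.integral_nonneg) (simp add: pos2_def)

text \<open>A level \<open>k\<close> halfway between \<open>k1\<close> and \<open>k2\<close>
  separates two tasks: Chebyshev's inequality from \<open>k1\<close> to \<open>k\<close> bounds the
  volume where \<open>\<sigma> * u x\<close> exceeds \<open>k\<close>, and the Faber-Krahn
  inequality on that set, followed by Caccioppoli's, bounds the excess over \<open>k2\<close>. The
  power of the volume makes the recursion superlinear. The sign \<open>\<sigma>\<close> treats
  \<open>u\<close> and \<open>-u\<close> alike.\<close>

lemma excess_step:
  assumes \<sigma>: "\<sigma> = 1 \<or> \<sigma> = -1" and k: "0 \<le> k1" "k1 < k2" and r: "0 < r1" "r1 < r2" "r2 < 1/10"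
  shows "excess \<sigma> k2 r1 \<le> 2 * (real m)^2 * (2 * ((2 / (k2 - k1))^2 * excess \<sigma> k1 r2)) powr (2 / real m) *
    (34 * ((4 / (r2 - r1))^2 * excess \<sigma> k1 r2))"
proof (cases "excess \<sigma> k1 r2 = 0")
  case True
  then show ?thesis using excess_mono[of k1 k2 r1 r2 \<sigma>] k r by simp
next
  case False
  then have Y: "excess \<sigma> k1 r2 > 0" using excess_nonneg[of \<sigma> k1 r2] by simp
  define e where "e = (k2 - k1) / 2"
  define k where "k = (k1 + k2) / 2"
  have k1: "0 \<le> k1" "k1 < k2" by fact+
  have ek: "e > 0" "k = k1 + e" "k2 = k + e" using k1 by (auto simp: e_def k_def field_simps)
  \<comment> \<open>The derivative rises linearly from 0 at level \<open>k\<close> to 1 at level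
    \<open>k2\<close>. Hence \<open>G\<close> vanishes below \<open>k\<close> and its absolute value
    dominates the excess over \<open>k2\<close>, while \<open>G\<close> stays continuously
    differentiable.\<close>
  define G where "G t = \<sigma> * ((pos2 (\<sigma> * t - k) - pos2 (\<sigma> * t - k2)) / (2 * e))" for t
  define G' where "G' t = (2 * max 0 (\<sigma> * t - k) - 2 * max 0 (\<sigma> * t - k2)) / (2 * e)" for t
  define U where "U t = max 0 (\<sigma> * t - k)" for t
  have \<sigma>2: "\<sigma> * \<sigma> = 1" using \<sigma> by auto
  have G_der: "(G has_real_derivative G' t) (at t)" for t
  proof -
    have l: "((\<lambda>t. \<sigma> * t) has_real_derivative \<sigma>) (at t)" by (auto intro!: derivative_eq_intros)
    have "((\<lambda>t. pos2 (\<sigma> * t - c)) has_real_derivative (2 * max 0 (\<sigma> * t - c)) * \<sigma>) (at t)" for c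
      using DERIV_chain2[OF pos2_shift_has_derivative l] .
    then have "(G has_real_derivative \<sigma> * (((2 * max 0 (\<sigma> * t - k)) * \<sigma> - (2 * max 0 (\<sigma> * t - k2)) * \<sigma>) / (2 * e))) (at t)"
      unfolding G_def[abs_def] by (intro DERIV_cmult DERIV_cdivide DERIV_diff)
    moreover have "\<sigma> * (((2 * max 0 (\<sigma> * t - k)) * \<sigma> - (2 * max 0 (\<sigma> * t - k2)) * \<sigma>) / (2 * e)) = G' t"
      using \<sigma> by (auto simp: G'_def left_diff_distrib)
    ultimately show ?thesis by simp
  qed
  have G'_cont: "continuous_on UNIV G'" unfolding G'_def using ek by (intro continuous_intros) auto
  have U_cont: "continuous_on UNIV U" unfolding U_def by (intro continuous_intros)
  have G'01: "0 \<le> G' t" "G' t \<le> 1" for t using ek by (auto simp: G'_def divide_simps max_def)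
  have G0: "G 0 = 0" using ek k1 by (simp add: G_def pos2_def)
  have GU: "\<bar>G t\<bar> \<le> U t * G' t" for t
  proof -
    have "\<bar>\<sigma>\<bar> = 1" using \<sigma> by auto
    then have "\<bar>G t\<bar> = \<bar>pos2 (\<sigma> * t - k) - pos2 (\<sigma> * t - k2)\<bar> / (2 * e)" using ek by (simp add: G_def abs_mult)
    also have "\<dots> \<le> (U t * (2 * max 0 (\<sigma> * t - k) - 2 * max 0 (\<sigma> * t - k2))) / (2 * e)"
    proof (rule divide_right_mono)
      define s where "s = \<sigma> * t - k"
      have "\<bar>(max 0 s)^2 - (max 0 (s - e))\<^sup>2\<bar> \<le> max 0 s * (2 * max 0 s - 2 * max 0 (s - e))"
      proof -
        have "0 \<le> max 0 (s - e)" "max 0 (s - e) \<le> max 0 s" using ek by auto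
        then have "(max 0 (s - e))^2 \<le> (max 0 s)^2" "0 \<le> (max 0 s - max 0 (s - e))^2" by (auto intro: power_mono)
        then show ?thesis by (simp add: power2_eq_square algebra_simps)
      qed
      then show "\<bar>pos2 (\<sigma> * t - k) - pos2 (\<sigma> * t - k2)\<bar> \<le> U t * (2 * max 0 (\<sigma> * t - k) - 2 * max 0 (\<sigma> * t - k2))"
        using ek by (simp add: pos2_def U_def s_def algebra_simps)
    qed (use ek in simp)
    finally show ?thesis by (simp add: G'_def)
  qed
  let ?\<psi> = "cutoff r1 r2" and ?g\<psi> = "cutoff_grad r1 r2"
  have r0: "0 \<le> r1" using r by simp
  have zc: "?\<psi> x = 0 \<and> ?g\<psi> x = 0" if "norm x \<ge> r2" for x :: "'n point"
    using cutoff_props(4,5)[OF r0 r(2)] that by auto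
  define \<phi> where "\<phi> x = (if x \<in> half_disc r2 then G (u x) * ?\<psi> x else 0)" for x
  define g where "g x = (if x \<in> half_disc r2 then (G' (u x) * ?\<psi> x) *\<^sub>R gu x + G (u x) *\<^sub>R ?g\<psi> x else 0)" for x
  note ct = composite_test[OF r G_der G'_cont cutoff_has_derivative continuous_cutoff(2) zc, folded \<phi>_def g_def]
  define Z where "Z = half_disc r2 \<inter> {x. k < \<sigma> * (indicator (half_disc r2) x * u x)}"
  have [measurable]: "(\<lambda>x. indicator (half_disc r2) x * u x) \<in> borel_measurable borel"
    using borel_measurable_continuous_on_indicator[OF half_disc_measurable u_cont'[OF r(3)]] by simp
  have Zm [measurable]: "Z \<in> sets borel" unfolding Z_def by measurable
  define s where "s = (2 / (k2 - k1))^2 * excess \<sigma> k1 r2"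
  have s: "s > 0" using Y k1 by (simp add: s_def)
  have Zs: "emeasure lborel Z \<le> ennreal s"
  proof -
    have "emeasure lborel Z = (\<integral>\<^sup>+x. indicator Z x \<partial>lborel)" by simp
    also have "\<dots> \<le> (\<integral>\<^sup>+x. ennreal ((1 / e)^2 * (indicator (half_disc r2) x * pos2 (\<sigma> * u x - k1))) \<partial>lborel)"
    proof (rule nn_integral_mono)
      fix x
      show "indicator Z x \<le> ennreal ((1 / e)^2 * (indicator (half_disc r2) x * pos2 (\<sigma> * u x - k1)))"
      proof (cases "x \<in> Z")
        case True
        then have x: "x \<in> half_disc r2" "k < \<sigma> * u x" by (auto simp: Z_def)
        have "e\<^sup>2 \<le> pos2 (\<sigma> * u x - k1)" unfolding pos2_def using x ek by (intro power_mono) auto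
        then have "1 \<le> (1 / e)^2 * pos2 (\<sigma> * u x - k1)" using ek by (simp add: power_divide field_simps)
        then show ?thesis using x True by simp
      qed simp
    qed
    also have "\<dots> = ennreal (LBINT x. (1 / e)^2 * (indicator (half_disc r2) x * pos2 (\<sigma> * u x - k1)))"
      by (rule nn_integral_eq_integral) (use excess_integrable[OF r(3)] in \<open>auto simp: pos2_def\<close>)
    also have "(LBINT x. (1 / e)^2 * (indicator (half_disc r2) x * pos2 (\<sigma> * u x - k1))) = s"
      by (simp add: s_def excess_def e_def)
    finally show ?thesis .
  qed
  have Z1: "{x \<in> upper. \<phi> x \<noteq> 0} \<subseteq> Z"
  proof
    fix x assume x: "x \<in> {x \<in> upper. \<phi> x \<noteq> 0}"
    then have xd: "x \<in> half_disc r2" "G (u x) \<noteq> 0" by (auto simp: \<phi>_def split: if_splits)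
    have "k < \<sigma> * u x"
    proof (rule ccontr)
      assume "\<not> k < \<sigma> * u x"
      then show False using xd ek by (simp add: G_def pos2_def)
    qed
    then show "x \<in> Z" using xd by (simp add: Z_def)
  qed
  have "excess \<sigma> k2 r1 \<le> disc_int r2 (\<lambda>x. (\<phi> x)^2)" unfolding excess_def
  proof (intro integral_mono)
    show "disc_integrable r1 (\<lambda>x. pos2 (\<sigma> * u x - k2))" using r by (intro excess_integrable) simp
    have "continuous_on upper \<phi>" by (rule has_derivative_continuous_on[OF ct(1)])
    then show "disc_integrable r2 (\<lambda>x. (\<phi> x)^2)"
      by (intro integrable_on_half_disc continuous_on_power) (erule continuous_on_subset, simp add: half_disc_def)
    fix x
    show "indicator (half_disc r1) x * pos2 (\<sigma> * u x - k2) \<le> indicator (half_disc r2) x * (\<phi> x)^2"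
    proof (cases "x \<in> half_disc r1 \<and> \<sigma> * u x > k2")
      case True
      then have x2: "x \<in> half_disc r2" and n: "norm x \<le> r1" using half_disc_mono[of r1 r2] r by (auto simp: half_disc_def)
      have "\<phi> x = G (u x)" using x2 cutoff_props(3)[OF r0 r(2) n] by (simp add: \<phi>_def)
      moreover have "(G (u x))^2 = ((pos2 (\<sigma> * u x - k) - pos2 (\<sigma> * u x - k2)) / (2 * e))^2"
      proof -
        have "(\<sigma> * q)^2 = q\<^sup>2" for q using \<sigma> by auto
        then show ?thesis unfolding G_def .
      qed
      moreover have "(\<sigma> * u x - k2) \<le> (pos2 (\<sigma> * u x - k) - pos2 (\<sigma> * u x - k2)) / (2 * e)"
      proof -
        define t where "t = \<sigma> * u x - k2"
        have t: "t > 0" "\<sigma> * u x - k = t + e" using True ek by (auto simp: t_def)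
        have "t * (2 * e) \<le> (t + e)^2 - t\<^sup>2" using ek by (simp add: power2_eq_square algebra_simps)
        then show ?thesis using t ek unfolding t_def[symmetric] t(2) pos2_def by (simp add: le_divide_eq)
      qed
      ultimately have "pos2 (\<sigma> * u x - k2) \<le> (\<phi> x)^2"
        using True by (simp add: pos2_def[of "\<sigma> * u x - k2"] power_mono)
      then show ?thesis using True x2 by simp
    next
      case False
      then show ?thesis by (auto simp: pos2_def indicator_def)
    qed
  qed
  also have "\<dots> \<le> 2 * (real m)^2 * (2 * s) powr (2 / real m) * disc_int r2 (\<lambda>x. (norm (g x))^2)"
    by (rule faber_krahn_half_disc[OF ct Z1 Zm Zs s])
  also have "disc_int r2 (\<lambda>x. (norm (g x))^2) \<le> 34 * ((4 / (r2 - r1))^2 * excess \<sigma> k1 r2)"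
  proof -
    have "disc_int r2 (\<lambda>x. (norm (g x))^2) =
        (disc_int r2 (\<lambda>x. (norm ((G' (u x) * ?\<psi> x) *\<^sub>R gu x + G (u x) *\<^sub>R ?g\<psi> x))^2))"
      by (intro Bochner_Integration.integral_cong) (auto simp: g_def indicator_def)
    also have "\<dots> \<le> 34 * disc_int r2 (\<lambda>x. (G' (u x) * (U (u x))^2 * (norm (?g\<psi> x))^2))"
      by (rule caccioppoli[OF r G_der G'_cont G0 G'01 U_cont _ GU]) (simp add: U_def)
    also have "disc_int r2 (\<lambda>x. (G' (u x) * (U (u x))^2 * (norm (?g\<psi> x))^2)) \<le>
        (LBINT x. (4 / (r2 - r1))^2 * (indicator (half_disc r2) x * pos2 (\<sigma> * u x - k1)))"
    proof (rule integral_mono')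
      show "integrable lborel (\<lambda>x. (4 / (r2 - r1))^2 * (indicator (half_disc r2) x * pos2 (\<sigma> * u x - k1)))"
        using excess_integrable[OF r(3)] by simp
      fix x
      show "0 \<le> (4 / (r2 - r1))^2 * (indicator (half_disc r2) x * pos2 (\<sigma> * u x - k1))" by (simp add: pos2_def)
      have "G' (u x) * (U (u x))^2 * (norm (?g\<psi> x))^2 \<le> 1 * pos2 (\<sigma> * u x - k1) * (4 / (r2 - r1))^2"
      proof (intro mult_mono)
        show "(U (u x))^2 \<le> pos2 (\<sigma> * u x - k1)" unfolding U_def pos2_def using ek by (intro power_mono) auto
        show "(norm (?g\<psi> x))^2 \<le> (4 / (r2 - r1))^2" using cutoff_props(6)[OF r0 r(2)] by (intro power_mono) auto
      qed (use G'01 in \<open>auto simp: pos2_def\<close>)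
      then show "indicator (half_disc r2) x * (G' (u x) * (U (u x))^2 * (norm (?g\<psi> x))^2) \<le>
          (4 / (r2 - r1))\<^sup>2 * (indicator (half_disc r2) x * pos2 (\<sigma> * u x - k1))"
        by (auto simp: indicator_def mult_ac)
    qed
    also have "\<dots> = (4 / (r2 - r1))^2 * excess \<sigma> k1 r2" by (simp add: excess_def)
    finally show ?thesis by simp
  qed
  finally show ?thesis unfolding s_def by (simp add: mult_left_mono)
qed

end

text \<open>Under the induction hypothesis the recursion produces the factors \<open>4 ^ j\<close>,
  \<open>(4 powr \<beta>) ^ j\<close> and \<open>(\<theta> powr \<beta>) ^ j\<close>; the equation
  for \<open>\<theta>\<close> makes them cancel, so the initial smallness yields the ratio
  \<open>\<theta>\<close> at every step.\<close>

lemma fast_geometric_decay: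
  fixes Y :: "nat \<Rightarrow> real"
  assumes Y: "\<And>j. 0 \<le> Y j" and A: "0 \<le> A" and c: "0 \<le> c" and \<beta>: "0 < \<beta>"
    and step: "\<And>j. Y (Suc j) \<le> A * 4 ^ j * (c * 4 ^ j * Y j) powr \<beta> * Y j"
    and \<theta>: "0 < \<theta>" "4 powr (1 + \<beta>) * \<theta> powr \<beta> = 1"
    and init: "A * (c * Y 0) powr \<beta> \<le> \<theta>"
  shows "Y j \<le> Y 0 * \<theta> ^ j"
proof (induction j)
  case (Suc j)
  have "Y (Suc j) \<le> A * 4 ^ j * (c * 4 ^ j * Y j) powr \<beta> * Y j" by (rule step)
  also have "\<dots> \<le> A * 4 ^ j * (c * 4 ^ j * (Y 0 * \<theta> ^ j)) powr \<beta> * (Y 0 * \<theta> ^ j)"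
    using Suc.IH Y A c \<theta> \<beta> by (intro mult_mono mult_left_mono powr_mono2) (auto intro!: mult_nonneg_nonneg)
  also have "(c * 4 ^ j * (Y 0 * \<theta> ^ j)) powr \<beta> = (c * Y 0) powr \<beta> * ((4 powr \<beta>) ^ j * (\<theta> powr \<beta>) ^ j)"
  proof -
    have "c * 4 ^ j * (Y 0 * \<theta> ^ j) = (c * Y 0) * (4 ^ j * \<theta> ^ j)" by simp
    then have "(c * 4 ^ j * (Y 0 * \<theta> ^ j)) powr \<beta> = (c * Y 0) powr \<beta> * ((4 ^ j) powr \<beta> * (\<theta> ^ j) powr \<beta>)"
      using c Y[of 0] \<theta> by (simp add: powr_mult)
    also have "(4 ^ j) powr \<beta> = (4 powr \<beta>) ^ j" by (simp add: powr_realpow[symmetric] powr_powr mult.commute)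
    also have "(\<theta> ^ j) powr \<beta> = (\<theta> powr \<beta>) ^ j" using \<theta> by (simp add: powr_realpow[symmetric] powr_powr mult.commute)
    finally show ?thesis .
  qed
  also have "A * 4 ^ j * ((c * Y 0) powr \<beta> * ((4 powr \<beta>) ^ j * (\<theta> powr \<beta>) ^ j)) * (Y 0 * \<theta> ^ j) =
     (A * (c * Y 0) powr \<beta>) * (4 * 4 powr \<beta> * \<theta> powr \<beta>) ^ j * (Y 0 * \<theta> ^ j)"
    by (simp add: power_mult_distrib mult_ac)
  also have "4 * 4 powr \<beta> * \<theta> powr \<beta> = 1" using \<theta>(2) by (simp add: powr_add)
  also have "(A * (c * Y 0) powr \<beta>) * 1 ^ j * (Y 0 * \<theta> ^ j) \<le> \<theta> * (Y 0 * \<theta> ^ j)"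
    using init Y[of 0] \<theta> by (simp add: mult_right_mono)
  finally show ?case by (simp add: mult_ac)
qed simp

text \<open>The solution \<open>\<theta>\<close> of
  \<open>4 powr (1 + \<beta>) * \<theta> powr \<beta> = 1\<close> for the exponent
  \<open>\<beta> = 2 / m\<close> of the Faber-Krahn inequality.\<close>

definition decay_rate :: "nat \<Rightarrow> real" where
  "decay_rate m = 4 powr (- (1 + 2 / real m) / (2 / real m))"

text \<open>The initial smallness condition of the iteration solved for the ratio of excess and
  squared level. Here 17408 = 2 * 34 * 256 collects the Faber-Krahn, Caccioppoli and cutoff factors,
  and 32 comes from Chebyshev's inequality.\<close>

definition sup_const :: "nat \<Rightarrow> real" where
  "sup_const m = 32 * (17408 * (real m)^2 / decay_rate m) powr (real m / 2)"

lemma decay_rate: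
  assumes "m > 0"
  shows "0 < decay_rate m" "decay_rate m < 1" "4 powr (1 + 2 / real m) * decay_rate m powr (2 / real m) = 1"
proof -
  show "0 < decay_rate m" by (simp add: decay_rate_def)
  have "0 < 2 / real m" using assms by simp
  moreover from this have "- (1 + 2 / real m) < 0" by linarith
  ultimately have "- (1 + 2 / real m) / (2 / real m) < 0" by (intro divide_neg_pos)
  then show "decay_rate m < 1" unfolding decay_rate_def by (subst powr_less_one) auto
  show "4 powr (1 + 2 / real m) * decay_rate m powr (2 / real m) = 1"
    unfolding decay_rate_def powr_powr using assms by (subst powr_add[symmetric]) simp
qed

lemma sup_const_pos: "m > 0 \<Longrightarrow> 0 < sup_const m"
  using decay_rate(1)[of m] by (simp add: sup_const_def)

context thin_problem
begin

lemma m_pos: "m > 0"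
  by (simp add: m_def)

text \<open>Levels increase to \<open>\<Lambda>\<close> and radii decrease to \<open>R / 2\<close>,
  both with geometric increments, which produces the powers of 4 in the recursion. The decay forces
  the excess over \<open>\<Lambda>\<close> on the half disc of radius \<open>R / 2\<close> to be
  zero, and continuity makes this pointwise.\<close>

lemma one_sided_sup_bound:
  assumes \<sigma>: "\<sigma> = 1 \<or> \<sigma> = -1" and R: "0 < R" "R < 1/10" and \<Lambda>: "0 < \<Lambda>"
    and big: "sup_const m * excess \<sigma> 0 R \<le> \<Lambda>\<^sup>2 * R ^ m"
    and x: "x \<in> upper" "norm x < R / 2"
  shows "\<sigma> * u x \<le> \<Lambda>"
proof -
  define \<beta> where "\<beta> = 2 / real m"
  define k where "k j = \<Lambda> * (1 - (1/2) ^ j)" for j :: nat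
  define r where "r j = R * (1/2 + (1/2) ^ (j + 1))" for j :: nat
  define Y where "Y j = excess \<sigma> (k j) (r j)" for j
  define A where "A = 17408 * (real m)^2 / R\<^sup>2"
  define c where "c = 32 / \<Lambda>\<^sup>2"
  have \<beta>: "\<beta> > 0" using m_pos by (simp add: \<beta>_def)
  have kk: "0 \<le> k j" "k j < k (Suc j)" "k j \<le> \<Lambda>" "k (Suc j) - k j = \<Lambda> * (1/2) ^ j / 2" for j
    using \<Lambda> by (auto simp: k_def power_le_one algebra_simps)
  have rr: "0 < r (Suc j)" "r (Suc j) < r j" "r j \<le> R" "R / 2 \<le> r j" "r j - r (Suc j) = R * (1/2) ^ j / 4" for j
  proof -
    have p: "0 < (1/2 :: real) ^ j" "(1/2 :: real) ^ j \<le> 1" by (auto simp: power_le_one)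
    show "0 < r (Suc j)" "R / 2 \<le> r j" using R by (auto simp: r_def intro!: mult_pos_pos add_pos_pos)
    show "r j - r (Suc j) = R * (1/2) ^ j / 4" by (simp add: r_def algebra_simps)
    then show "r (Suc j) < r j" using R p by (smt (verit) divide_pos_pos mult_pos_pos)
    show "r j \<le> R" using R p by (simp add: r_def mult_left_le)
  qed
  have p2: "((2 :: real) ^ j)^2 = 4 ^ j" for j by (simp add: power2_eq_square power_mult_distrib[symmetric])
  have p4: "((1/2 :: real) ^ j)^2 = 1 / 4 ^ j" for j
    by (simp add: power_mult[symmetric] mult.commute[of j] power_divide) (simp add: power_mult)
  have step: "Y (Suc j) \<le> A * 4 ^ j * (c * 4 ^ j * Y j) powr \<beta> * Y j" for j
  proof -
    have "Y (Suc j) \<le> 2 * (real m)^2 * (2 * ((2 / (k (Suc j) - k j))^2 * Y j)) powr (2 / real m) *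
        (34 * ((4 / (r j - r (Suc j)))^2 * Y j))"
      unfolding Y_def using rr(3)[of j] R by (intro excess_step \<sigma> kk rr) auto
    also have "2 * ((2 / (k (Suc j) - k j))^2 * Y j) = c * 4 ^ j * Y j"
      unfolding kk(4) c_def by (simp add: power_divide power_mult_distrib p4 p2)
    also have "(4 / (r j - r (Suc j)))^2 = 256 / R\<^sup>2 * 4 ^ j"
      unfolding rr(5) by (simp add: power_divide power_mult_distrib p4 p2)
    finally show ?thesis by (simp add: A_def \<beta>_def mult_ac)
  qed
  have Y0: "Y 0 = excess \<sigma> 0 R" by (simp add: Y_def k_def r_def)
  have init: "A * (c * Y 0) powr \<beta> \<le> decay_rate m"
  proof -
    let ?B = "17408 * (real m)^2 / decay_rate m"
    have B: "?B > 0" using decay_rate(1)[OF m_pos] m_pos by simp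
    have "32 * ?B powr (real m / 2) * Y 0 \<le> \<Lambda>\<^sup>2 * R ^ m" using big by (simp add: Y0 sup_const_def)
    then have "c * Y 0 \<le> R ^ m / ?B powr (real m / 2)"
    proof -
      have "32 / L * y \<le> r / b" if "32 * b * y \<le> L * r" "b > 0" "L > 0" for b y L r :: real
        using that by (simp add: field_simps)
      moreover have "0 < ?B powr (real m / 2)" "0 < \<Lambda>\<^sup>2" using B \<Lambda> m_pos decay_rate(1)[OF m_pos] by auto
      ultimately show ?thesis using \<open>32 * ?B powr (real m / 2) * Y 0 \<le> \<Lambda>\<^sup>2 * R ^ m\<close> unfolding c_def by blast
    qed
    then have "(c * Y 0) powr \<beta> \<le> (R ^ m / ?B powr (real m / 2)) powr \<beta>"
      using excess_nonneg \<beta> by (intro powr_mono2) (auto simp: Y_def c_def)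
    also have "\<dots> = (R ^ m) powr \<beta> / (?B powr (real m / 2)) powr \<beta>" by (rule powr_divide)
    also have "(?B powr (real m / 2)) powr \<beta> = ?B" using B m_pos decay_rate(1)[OF m_pos] by (simp add: powr_powr \<beta>_def)
    also have "(R ^ m) powr \<beta> = R\<^sup>2" using R m_pos
      by (simp add: powr_realpow[symmetric] powr_powr \<beta>_def powr_numeral[symmetric] del: powr_numeral)
    finally have "A * (c * Y 0) powr \<beta> \<le> A * (R\<^sup>2 / ?B)" by (intro mult_left_mono) (auto simp: A_def)
    also have "\<dots> = decay_rate m" using R m_pos decay_rate(1)[OF m_pos] by (simp add: A_def)
    finally show ?thesis .
  qed
  have Yj: "Y j \<le> Y 0 * decay_rate m ^ j" for j by (rule fast_geometric_decay[OF _ _ _ \<beta> step _ _ init])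
       (use decay_rate[OF m_pos] excess_nonneg in \<open>auto simp: Y_def A_def c_def \<beta>_def\<close>)
  have "excess \<sigma> \<Lambda> (R / 2) \<le> Y 0 * decay_rate m ^ j" for j
  proof -
    have "excess \<sigma> \<Lambda> (R / 2) \<le> Y j" unfolding Y_def
      using kk(3)[of j] rr(3,4)[of j] R by (intro excess_mono) auto
    then show ?thesis using Yj[of j] by linarith
  qed
  moreover have "(\<lambda>j. Y 0 * decay_rate m ^ j) \<longlonglongrightarrow> Y 0 * 0"
    using decay_rate[OF m_pos] by (intro tendsto_intros LIMSEQ_power_zero) auto
  ultimately have "excess \<sigma> \<Lambda> (R / 2) \<le> 0"
    using LIMSEQ_le_const[of "\<lambda>j. Y 0 * decay_rate m ^ j" 0 "excess \<sigma> \<Lambda> (R / 2)"] by auto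
  then have ex0: "excess \<sigma> \<Lambda> (R / 2) = 0" using excess_nonneg[of \<sigma> \<Lambda> "R/2"] by simp
  have R2: "R / 2 < 1/10" using R by simp
  have "AE x in lborel. indicator (half_disc (R / 2)) x * pos2 (\<sigma> * u x - \<Lambda>) = 0"
    using integral_nonneg_eq_0_iff_AE[OF excess_integrable[OF R2]] ex0 by (auto simp: excess_def pos2_def)
  then have ae: "AE x in lborel. x \<in> {x. x $ None > 0} \<inter> ball 0 (R/2) \<longrightarrow> pos2 (\<sigma> * u x - \<Lambda>) = 0"
    by eventually_elim (auto simp: half_disc_def upper_def indicator_def)
  have cp: "continuous_on (half_disc (R/2)) (\<lambda>x. pos2 (\<sigma> * u x - \<Lambda>))"
    by (intro continuous_on_compose2[OF continuous_pos2[of UNIV]] continuous_intros u_cont'[OF R2]) auto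
  have int: "pos2 (\<sigma> * u y - \<Lambda>) = 0" if "y $ None > 0" "norm y < R/2" for y
  proof (rule AE_zero_continuous_on_open[OF _ _ ae])
    show "open ({x :: 'n point. x $ None > 0} \<inter> ball 0 (R/2))"
      by (intro open_Int open_Collect_less continuous_intros open_ball)
    show "continuous_on ({x. x $ None > 0} \<inter> ball 0 (R/2)) (\<lambda>x. pos2 (\<sigma> * u x - \<Lambda>))"
      by (rule continuous_on_subset[OF cp]) (auto simp: half_disc_def upper_def)
  qed (use that in auto)
  \<comment> \<open>The almost everywhere statement gives all interior points; points of the flat
    boundary are reached from above.\<close>
  define z where "z j = x + (1 / real (Suc j)) *\<^sub>R (axis None 1 :: 'n point)" for j
  have z: "z \<longlonglongrightarrow> x"
  proof -
    have "(\<lambda>j. x + (1 / real (Suc j)) *\<^sub>R (axis None 1 :: 'n point)) \<longlonglongrightarrow> x + 0 *\<^sub>R axis None 1"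
      using lim_inverse_n'[THEN LIMSEQ_Suc] by (intro tendsto_intros) auto
    then show ?thesis by (simp add: z_def[abs_def])
  qed
  have "\<forall>\<^sub>F j in sequentially. norm (z j) < R/2" using tendsto_norm[OF z] x(2) by (rule order_tendstoD)
  then have ev: "\<forall>\<^sub>F j in sequentially. z j \<in> half_disc (R/2) \<and> pos2 (\<sigma> * u (z j) - \<Lambda>) = 0"
  proof eventually_elim
    case (elim j)
    have "z j $ None > 0" using x(1) by (auto simp: z_def upper_def axis_def add_nonneg_pos)
    then show ?case using elim int[of "z j"] by (auto simp: half_disc_def upper_def)
  qed
  have xd: "x \<in> half_disc (R/2)" using x by (simp add: half_disc_def)
  have "(\<lambda>j. pos2 (\<sigma> * u (z j) - \<Lambda>)) \<longlonglongrightarrow> pos2 (\<sigma> * u x - \<Lambda>)"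
    by (rule continuous_on_tendsto_compose[OF cp z xd]) (use ev in \<open>auto elim: eventually_mono\<close>)
  moreover have "(\<lambda>j. pos2 (\<sigma> * u (z j) - \<Lambda>)) \<longlonglongrightarrow> 0"
    by (rule tendsto_eventually) (use ev in \<open>auto elim: eventually_mono\<close>)
  ultimately have "pos2 (\<sigma> * u x - \<Lambda>) = 0" using LIMSEQ_unique by blast
  then show ?thesis by (simp add: pos2_def max_def split: if_splits)
qed

lemma sup_bound:
  assumes R: "0 < R" "R < 1/10" and x: "x \<in> upper" "norm x < R / 2"
  shows "(u x)^2 \<le> sup_const m / R ^ m * disc_int R (\<lambda>x. (u x)^2)"
proof (rule field_le_epsilon)
  fix e :: real assume e: "e > 0"
  define I where "I = disc_int R (\<lambda>x. (u x)^2)"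
  have I0: "0 \<le> I" unfolding I_def by (intro Bochner_Integration.integral_nonneg) simp
  have C: "sup_const m > 0" by (rule sup_const_pos[OF m_pos])
  \<comment> \<open>The summand \<open>e\<close> keeps the level positive when the integral is
    zero.\<close>
  define \<Lambda> where "\<Lambda> = sqrt (sup_const m / R ^ m * I + e)"
  have L2: "\<Lambda>\<^sup>2 = sup_const m / R ^ m * I + e" using I0 C R e by (simp add: \<Lambda>_def add_nonneg_nonneg)
  have L: "\<Lambda> > 0" using I0 C R e by (simp add: \<Lambda>_def add_nonneg_pos)
  have bound: "\<sigma> * u x \<le> \<Lambda>" if \<sigma>: "\<sigma> = 1 \<or> \<sigma> = -1" for \<sigma>
  proof (rule one_sided_sup_bound[OF \<sigma> R L _ x])
    have "excess \<sigma> 0 R \<le> I" unfolding excess_def I_def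
    proof (intro integral_mono excess_integrable[OF R(2)] integrable_on_half_disc continuous_intros u_cont'[OF R(2)])
      fix y
      have "pos2 (\<sigma> * u y - 0) \<le> (u y)^2" using \<sigma> by (auto simp: pos2_def max_def)
      then show "indicator (half_disc R) y * pos2 (\<sigma> * u y - 0) \<le> indicator (half_disc R) y * (u y)^2"
        by (intro mult_left_mono) auto
    qed
    then have "sup_const m * excess \<sigma> 0 R \<le> sup_const m * I" using C by (intro mult_left_mono) auto
    also have "\<dots> \<le> \<Lambda>\<^sup>2 * R ^ m" unfolding L2 using R e by (simp add: field_simps)
    finally show "sup_const m * excess \<sigma> 0 R \<le> \<Lambda>\<^sup>2 * R ^ m" .
  qed
  have "\<bar>u x\<bar> \<le> \<Lambda>" using bound[of 1] bound[of "-1"] by (simp add: abs_le_iff)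
  then have "\<bar>u x\<bar>\<^sup>2 \<le> \<Lambda>\<^sup>2" by (intro power_mono) auto
  then show "(u x)^2 \<le> sup_const m / R ^ m * disc_int R (\<lambda>x. (u x)^2) + e"
    by (simp add: L2 I_def)
qed

section \<open>Energy estimates and the passage from discs to annuli\<close>

lemma caccioppoli_linear:
  assumes \<rho>: "0 < \<rho>1" "\<rho>1 < \<rho>2" "\<rho>2 < 1/10"
  shows "disc_int \<rho>2 (\<lambda>x. (norm (cutoff \<rho>1 \<rho>2 x *\<^sub>R gu x + u x *\<^sub>R cutoff_grad \<rho>1 \<rho>2 x))^2)
    \<le> 34 * disc_int \<rho>2 (\<lambda>x. ((u x)^2 * (norm (cutoff_grad \<rho>1 \<rho>2 x))^2))"
proof -
  have "continuous_on UNIV (\<lambda>t::real. \<bar>t\<bar>)" by (intro continuous_intros)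
  then show ?thesis using caccioppoli[OF \<rho>, of "\<lambda>t. t" "\<lambda>t. 1" "\<lambda>t. \<bar>t\<bar>"] by simp
qed

lemma energy_bound:
  assumes \<rho>: "0 < \<rho>1" "\<rho>1 < \<rho>2" "\<rho>2 < 1/10"
  shows "disc_int \<rho>1 (\<lambda>x. (norm (gu x))^2)
    \<le> 34 * (4 / (\<rho>2 - \<rho>1))^2 * disc_int \<rho>2 (\<lambda>x. (u x)^2)"
proof -
  have \<rho>0: "0 \<le> \<rho>1" using \<rho> by simp
  let ?F = "\<lambda>x. cutoff \<rho>1 \<rho>2 x *\<^sub>R gu x + u x *\<^sub>R cutoff_grad \<rho>1 \<rho>2 x"
  have i1: "disc_integrable \<rho>2 (\<lambda>x. (norm (?F x))^2)"
    by (intro integrable_on_half_disc continuous_intros continuous_cutoff gu_cont'[OF \<rho>(3)] u_cont'[OF \<rho>(3)])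
  have i2: "disc_integrable \<rho>2 (\<lambda>x. (u x)^2)"
    by (intro integrable_on_half_disc continuous_intros u_cont'[OF \<rho>(3)])
  have "disc_int \<rho>1 (\<lambda>x. (norm (gu x))^2) \<le> disc_int \<rho>2 (\<lambda>x. (norm (?F x))^2)"
  proof (rule integral_mono'[OF i1])
    fix x
    show "indicator (half_disc \<rho>1) x * (norm (gu x))^2 \<le> indicator (half_disc \<rho>2) x * (norm (?F x))^2"
      using cutoff_props(3,5)[OF \<rho>0 \<rho>(2), of x] half_disc_mono[of \<rho>1 \<rho>2] \<rho>
      by (cases "x \<in> half_disc \<rho>1") (auto simp: half_disc_def)
  qed simp
  also have "\<dots> \<le> 34 * disc_int \<rho>2 (\<lambda>x. ((u x)^2 * (norm (cutoff_grad \<rho>1 \<rho>2 x))^2))"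
    by (rule caccioppoli_linear[OF \<rho>])
  also have "disc_int \<rho>2 (\<lambda>x. ((u x)^2 * (norm (cutoff_grad \<rho>1 \<rho>2 x))^2)) \<le>
      (LBINT x. (4 / (\<rho>2 - \<rho>1))^2 * (indicator (half_disc \<rho>2) x * (u x)^2))"
  proof (rule integral_mono')
    fix x :: "'n point"
    have "(norm (cutoff_grad \<rho>1 \<rho>2 x))^2 \<le> (4 / (\<rho>2 - \<rho>1))^2"
      using cutoff_props(6)[OF \<rho>0 \<rho>(2)] by (intro power_mono) auto
    then have "(indicator (half_disc \<rho>2) x * (u x)^2) * (norm (cutoff_grad \<rho>1 \<rho>2 x))^2 \<le> (indicator (half_disc \<rho>2) x * (u x)^2) * (4 / (\<rho>2 - \<rho>1))^2"
      by (intro mult_left_mono) auto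
    then show "indicator (half_disc \<rho>2) x * ((u x)^2 * (norm (cutoff_grad \<rho>1 \<rho>2 x))^2) \<le> (4 / (\<rho>2 - \<rho>1))^2 * (indicator (half_disc \<rho>2) x * (u x)^2)"
      by (simp add: mult_ac)
  qed (use i2 in auto)
  finally show ?thesis by simp
qed

text \<open>Only the layer where the cutoff varies contributes to the right-hand side.\<close>

lemma disc_le_annulus:
  assumes r: "0 < r" "r < 1/10"
  shows "disc_int (3 / 4 * r) (\<lambda>x. (u x)^2) \<le>
    2000000 * (real m)^2 * (LBINT x. indicator (half_annulus 0 (r / 2) r) x * (u x)^2)"
proof -
  \<comment> \<open>The layer between these radii lies inside the annulus from \<open>r / 2\<close>
    to \<open>r\<close>, and the smaller radius is the one of the left-hand side.\<close>
  define \<rho>1 \<rho>2 where "\<rho>1 = 3 / 4 * r" and "\<rho>2 = 7 / 8 * r"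
  have \<rho>: "0 < \<rho>1" "\<rho>1 < \<rho>2" "\<rho>2 < 1/10" "0 \<le> \<rho>1" using r by (auto simp: \<rho>1_def \<rho>2_def)
  let ?\<psi> = "cutoff \<rho>1 \<rho>2" and ?g\<psi> = "cutoff_grad \<rho>1 \<rho>2"
  have zc: "?\<psi> x = 0 \<and> ?g\<psi> x = 0" if "norm x \<ge> \<rho>2" for x :: "'n point"
    using cutoff_props(4,5)[OF \<rho>(4,2)] that by auto
  define \<phi> where "\<phi> x = (if x \<in> half_disc \<rho>2 then u x * ?\<psi> x else 0)" for x
  define g where "g x = (if x \<in> half_disc \<rho>2 then (1 * ?\<psi> x) *\<^sub>R gu x + u x *\<^sub>R ?g\<psi> x else 0)" for x
  have Gd: "((\<lambda>t. t) has_real_derivative 1) (at t)" for t :: real by simp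
  have Gc: "continuous_on UNIV (\<lambda>t::real. 1::real)" by simp
  note ct = composite_test[OF \<rho>(1-3) Gd Gc cutoff_has_derivative continuous_cutoff(2) zc, folded \<phi>_def g_def]
  have sub: "half_disc \<rho>2 \<subseteq> upper" by (simp add: half_disc_def)
  have \<phi>c: "continuous_on (half_disc \<rho>2) \<phi>"
    by (rule continuous_on_subset[OF has_derivative_continuous_on[OF ct(1)] sub])
  define s where "s = (2 * \<rho>2) ^ m"
  have s: "s > 0" using \<rho> by (simp add: s_def)
  \<comment> \<open>\<open>s\<close> bounds the volume of the half disc by that of a cube. Since
    \<open>m \<ge> 1\<close>, the factor \<open>2 powr (2 / real m)\<close> is at most 4, and the
    squared side is at most \<open>(2 * r)^2\<close>.\<close>
  have s2: "(2 * s) powr (2 / real m) \<le> 16 * r\<^sup>2"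
  proof -
    have "(2 * s) powr (2 / real m) = 2 powr (2 / real m) * (2 * \<rho>2)^2"
    proof -
      have "s powr (2 / real m) = (2 * \<rho>2)^2"
      proof -
        have "(t ^ m) powr (2 / real m) = t\<^sup>2" if "t > 0" for t :: real
          using that m_pos by (simp add: powr_realpow[symmetric] powr_powr powr_numeral[symmetric] del: powr_numeral)
        from this[of "2 * \<rho>2"] show ?thesis unfolding s_def using \<rho> by simp
      qed
      then show ?thesis using s by (simp add: powr_mult)
    qed
    also have "\<dots> \<le> 2 powr 2 * (2 * r)^2"
      using m_pos r \<rho> by (intro mult_mono powr_mono power_mono) (auto simp: \<rho>2_def field_simps)
    finally show ?thesis by (simp add: power2_eq_square)
  qed
  let ?A = "half_annulus 0 (r / 2) r :: 'n point set"
  have [measurable]: "?A \<in> sets borel" unfolding half_annulus_def half_ball_def by measurable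
  have iA: "integrable lborel (\<lambda>x. indicator ?A x * (u x)^2)"
  proof (rule Bochner_Integration.integrable_bound[of _ "\<lambda>x. indicator (half_disc r) x * (u x)^2"])
    show i: "disc_integrable r (\<lambda>x. (u x)^2)"
      by (intro integrable_on_half_disc continuous_intros u_cont'[OF r(2)])
    have eq: "indicator ?A x * (u x)^2 = indicator ?A x * (indicator (half_disc r) x * (u x)^2)" for x
      by (auto simp: half_annulus_def half_ball_def half_disc_def upper_def indicator_def)
    show "(\<lambda>x. indicator ?A x * (u x)^2) \<in> borel_measurable lborel" unfolding eq using i by measurable
    show "AE x in lborel. norm (indicator ?A x * (u x)^2) \<le> norm (indicator (half_disc r) x * (u x)^2)"
      by (intro AE_I2) (auto simp: half_annulus_def half_ball_def half_disc_def upper_def indicator_def)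
  qed
  have "disc_int (3 / 4 * r) (\<lambda>x. (u x)^2) \<le> disc_int \<rho>2 (\<lambda>x. (\<phi> x)^2)"
  proof (rule integral_mono')
    show "disc_integrable \<rho>2 (\<lambda>x. (\<phi> x)^2)"
      by (intro integrable_on_half_disc continuous_intros \<phi>c)
    fix x
    show "indicator (half_disc (3 / 4 * r)) x * (u x)^2 \<le> indicator (half_disc \<rho>2) x * (\<phi> x)^2"
      unfolding \<rho>1_def[symmetric] using cutoff_props(3)[OF \<rho>(4,2), of x] half_disc_mono[of \<rho>1 \<rho>2] \<rho>
      by (cases "x \<in> half_disc \<rho>1") (auto simp: half_disc_def \<phi>_def)
  qed simp
  also have "\<dots> \<le> 2 * (real m)^2 * (2 * s) powr (2 / real m) * disc_int \<rho>2 (\<lambda>x. (norm (g x))^2)"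
  proof (rule faber_krahn_half_disc[OF ct, where Z = "half_disc \<rho>2"])
    show "{x \<in> upper. \<phi> x \<noteq> 0} \<subseteq> half_disc \<rho>2" by (auto simp: \<phi>_def)
    show "emeasure lborel (half_disc \<rho>2 :: 'n point set) \<le> ennreal s"
      unfolding s_def m_def using \<rho> by (intro half_disc_emeasure) simp
  qed (use s in auto)
  also have "disc_int \<rho>2 (\<lambda>x. (norm (g x))^2) \<le> 34 * (1024 / r\<^sup>2 * (LBINT x. indicator ?A x * (u x)^2))"
  proof -
    have "disc_int \<rho>2 (\<lambda>x. (norm (g x))^2) =
        (disc_int \<rho>2 (\<lambda>x. (norm (?\<psi> x *\<^sub>R gu x + u x *\<^sub>R ?g\<psi> x))^2))"
      by (intro Bochner_Integration.integral_cong) (auto simp: g_def indicator_def)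
    also have "\<dots> \<le> 34 * disc_int \<rho>2 (\<lambda>x. ((u x)^2 * (norm (?g\<psi> x))^2))"
      by (rule caccioppoli_linear[OF \<rho>(1-3)])
    also have "disc_int \<rho>2 (\<lambda>x. ((u x)^2 * (norm (?g\<psi> x))^2)) \<le>
        (LBINT x. 1024 / r\<^sup>2 * (indicator ?A x * (u x)^2))"
    proof (rule integral_mono')
      show "integrable lborel (\<lambda>x. 1024 / r\<^sup>2 * (indicator ?A x * (u x)^2))" using iA by simp
      fix x
      show "indicator (half_disc \<rho>2) x * ((u x)^2 * (norm (?g\<psi> x))^2) \<le> 1024 / r\<^sup>2 * (indicator ?A x * (u x)^2)"
      proof (cases "x \<in> half_disc \<rho>2 \<and> \<rho>1 < norm x")
        case True
        then have xA: "x \<in> ?A" using r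
          by (auto simp: half_annulus_def half_ball_def half_disc_def upper_def \<rho>1_def \<rho>2_def)
        have "(norm (?g\<psi> x))^2 \<le> (4 / (\<rho>2 - \<rho>1))^2"
          using cutoff_props(6)[OF \<rho>(4,2)] by (intro power_mono) auto
        also have "4 / (\<rho>2 - \<rho>1) = 32 / r" using r by (simp add: \<rho>1_def \<rho>2_def field_simps)
        also have "(32 / r)^2 = 1024 / r\<^sup>2" by (simp add: power_divide)
        finally have "(u x)^2 * (norm (?g\<psi> x))^2 \<le> (u x)^2 * (1024 / r\<^sup>2)" by (intro mult_left_mono) auto
        then show ?thesis using True xA by (simp add: mult_ac)
      next
        case False
        then show ?thesis using cutoff_props(5)[OF \<rho>(4,2), of x] by (auto simp: indicator_def)
      qed
    qed simp
    finally show ?thesis by simp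
  qed
  finally have "disc_int (3 / 4 * r) (\<lambda>x. (u x)^2) \<le>
      2 * (real m)^2 * (2 * s) powr (2 / real m) * (34 * (1024 / r\<^sup>2 * (LBINT x. indicator ?A x * (u x)^2)))"
    by (simp add: mult_left_mono)
  also have "\<dots> \<le> 2 * (real m)^2 * (16 * r\<^sup>2) * (34 * (1024 / r\<^sup>2 * (LBINT x. indicator ?A x * (u x)^2)))"
    using s2 by (intro mult_right_mono mult_left_mono mult_nonneg_nonneg Bochner_Integration.integral_nonneg) auto
  \<comment> \<open>1114112 = 2 * 16 * 34 * 1024. The powers of \<open>r\<close> cancel, so the
    estimate is scale invariant.\<close>
  also have "\<dots> = 1114112 * (real m)^2 * (LBINT x. indicator ?A x * (u x)^2)" using r by (simp add: field_simps)
  also have "\<dots> \<le> 2000000 * (real m)^2 * (LBINT x. indicator ?A x * (u x)^2)"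
    by (intro mult_right_mono Bochner_Integration.integral_nonneg) auto
  finally show ?thesis .
qed

end

section \<open>Energy and sphere mass\<close>

lemma matrix_vector_mult_measurable [measurable (raw)]:
  fixes C :: "real ^ 'k::finite ^ 'l::finite"
  assumes "f \<in> borel_measurable M"
  shows "(\<lambda>x. C *v f x) \<in> borel_measurable M"
proof -
  have "(\<lambda>y. C *v y) \<in> borel_measurable borel"
    by (intro borel_measurable_continuous_onI matrix_vector_mult_linear_continuous_on)
  from measurable_compose[OF assms this] show ?thesis .
qed

context thin_problem
begin

definition "A = b 0"
definition "B = (SOME B. A ** B = mat 1)"
definition "N x = sqrt (x \<bullet> (B *v x))"

lemma zero_in: "(0 :: 'n point) \<in> half_ball 0 (1/10)"
  by (simp add: half_ball_def)

lemma A_lower: "1 / 2 * (v \<bullet> v) \<le> v \<bullet> (A *v v)"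
  unfolding A_def by (rule b_lower[OF zero_in])

lemma A_upper: "v \<bullet> (A *v v) \<le> 2 * (v \<bullet> v)"
  unfolding A_def by (rule b_upper[OF zero_in])

lemma A_nonneg: "0 \<le> v \<bullet> (A *v v)"
  using A_lower[of v] by (meson inner_ge_zero mult_nonneg_nonneg order_trans zero_le_divide_1_iff zero_le_numeral)

lemma A_bilinear: "v \<bullet> (A *v w) = w \<bullet> (A *v v)"
  unfolding A_def by (rule b_bilinear[OF zero_in])

lemma A_invertible: "invertible A"
proof -
  have "x = 0" if "A *v x = 0" for x using A_lower[of x] that inner_ge_zero[of x] by simp
  then have "inj ((*v) A)" using matrix_left_invertible_ker matrix_left_invertible_injective by blast
  then show ?thesis using invertible_left_inverse matrix_left_invertible_injective by blast
qed

lemma A_B: "A *v (B *v x) = x"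
proof -
  have "A ** B = mat 1" unfolding B_def by (rule someI_ex) (use A_invertible in \<open>auto simp: invertible_def\<close>)
  then show ?thesis by (simp add: matrix_vector_mul_assoc)
qed

lemma B_form: "x \<bullet> (B *v y) = (B *v x) \<bullet> (A *v (B *v y))"
  by (metis A_B A_bilinear inner_commute)

lemma B_bilinear: "x \<bullet> (B *v y) = y \<bullet> (B *v x)"
  by (metis B_form A_bilinear)

lemma B_nonneg: "0 \<le> x \<bullet> (B *v x)"
  unfolding B_form by (rule A_nonneg)

text \<open>Cauchy-Schwarz for the form of \<open>A\<close> between \<open>B *v x\<close> and
  \<open>x\<close>; the weights 2 and 1 let the upper bound of \<open>A\<close> absorb the last
  term.\<close>

lemma B_lower: "x \<bullet> x \<le> 2 * (x \<bullet> (B *v x))"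
proof -
  define y where "y = B *v x"
  have x: "A *v y = x" by (simp add: y_def A_B)
  have "2 * \<bar>2 * 1 * ((A *v y) \<bullet> x)\<bar> \<le> 2\<^sup>2 * (y \<bullet> (A *v y)) + 1\<^sup>2 * (x \<bullet> (A *v x))"
    unfolding A_def by (rule b_cauchy_schwarz[OF zero_in])
  then have "4 * (x \<bullet> x) \<le> 4 * (y \<bullet> x) + 2 * (x \<bullet> x)" using A_upper[of x] by (simp add: x)
  then show ?thesis by (simp add: y_def inner_commute)
qed

lemma B_upper: "x \<bullet> (B *v x) \<le> 2 * (x \<bullet> x)"
proof -
  define y where "y = B *v x"
  have x: "A *v y = x" by (simp add: y_def A_B)
  have "0 \<le> (y - 2 *\<^sub>R x) \<bullet> (y - 2 *\<^sub>R x)" by (rule inner_ge_zero)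
  then have "4 * (y \<bullet> x) \<le> y \<bullet> y + 4 * (x \<bullet> x)" by (simp add: inner_diff_left inner_diff_right inner_commute)
  moreover have "y \<bullet> y \<le> 2 * (y \<bullet> x)" using A_lower[of y] by (simp add: x)
  ultimately show ?thesis by (simp add: y_def inner_commute)
qed

lemma N_power2: "(N x)^2 = x \<bullet> (B *v x)"
  by (simp add: N_def B_nonneg)

lemma N_ge_0: "0 \<le> N x"
  by (simp add: N_def B_nonneg)

text \<open>The eigenvalue bounds give the square root of 2; \<open>3/2\<close> is a rational number
  above it.\<close>

lemma norm_le_N: "norm x \<le> 3 / 2 * N x"
proof (rule power2_le_imp_le)
  have "(norm x)^2 \<le> 2 * (N x)^2" using B_lower[of x] by (simp add: N_power2 dot_square_norm)
  also have "\<dots> \<le> (3 / 2 * N x)^2" by (simp add: power_mult_distrib power_divide)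
  finally show "(norm x)^2 \<le> (3 / 2 * N x)^2" .
qed (use N_ge_0 in simp)

lemma N_le_norm: "N x \<le> 3 / 2 * norm x"
proof (rule power2_le_imp_le)
  have "(N x)^2 \<le> 2 * (norm x)^2" using B_upper[of x] by (simp add: N_power2 dot_square_norm)
  also have "\<dots> \<le> (3 / 2 * norm x)^2" by (simp add: power_mult_distrib power_divide)
  finally show "(N x)^2 \<le> (3 / 2 * norm x)^2" .
qed simp

lemma continuous_N: "continuous_on S N"
  unfolding N_def by (intro continuous_intros matrix_vector_mult_linear_continuous_on)

lemma N_scaleR: "N (c *\<^sub>R x) = \<bar>c\<bar> * N x"
  by (simp add: N_def matrix_vector_mult_scaleR real_sqrt_mult mult.assoc[symmetric])

text \<open>By \<open>B_form\<close> the form of \<open>B\<close> inherits the weighted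
  Cauchy-Schwarz inequality of \<open>A\<close>; the weights \<open>N y\<close> and
  \<open>N x\<close> turn it into the product form.\<close>

lemma N_triangle: "N (x + y) \<le> N x + N y"
proof (rule power2_le_imp_le)
  have "x \<bullet> (B *v y) \<le> N x * N y"
  proof -
    have "2 * \<bar>s * t * ((A *v (B *v x)) \<bullet> (B *v y))\<bar> \<le> s\<^sup>2 * (N x)^2 + t\<^sup>2 * (N y)^2" for s t
      using b_cauchy_schwarz[OF zero_in, of s t "B *v x" "B *v y"]
      unfolding A_def[symmetric] N_power2 B_form .
    then have *: "2 * \<bar>s * t * (x \<bullet> (B *v y))\<bar> \<le> s\<^sup>2 * (N x)^2 + t\<^sup>2 * (N y)^2" for s t by (simp add: A_B)
    show ?thesis
    proof (cases "N x = 0 \<or> N y = 0")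
      case True
      then have "x = 0 \<or> y = 0" using norm_le_N[of x] norm_le_N[of y] by auto
      then show ?thesis using N_ge_0 by auto
    next
      case False
      then have p: "N x > 0" "N y > 0" using N_ge_0[of x] N_ge_0[of y] by auto
      have "2 * (N y * N x * \<bar>x \<bullet> (B *v y)\<bar>) \<le> 2 * (N y * N x * (N x * N y))"
        using *[of "N y" "N x"] p by (simp add: abs_mult power2_eq_square mult_ac)
      then have "\<bar>x \<bullet> (B *v y)\<bar> \<le> N x * N y" using p by simp
      then show ?thesis by simp
    qed
  qed
  then show "(N (x + y))^2 \<le> (N x + N y)^2" using B_bilinear[of x y]
    by (simp add: N_power2 power2_sum matrix_vector_right_distrib inner_add_left inner_add_right)
qed (use N_ge_0 in \<open>simp add: add_nonneg_nonneg\<close>)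

lemma N_has_derivative:
  assumes "x \<noteq> 0"
  shows "(N has_gradient (B *v (x /\<^sub>R N x))) (at x)"
proof -
  have pos: "N x > 0" using assms norm_le_N[of x] N_ge_0[of x] by (cases "N x = 0") auto
  have "((\<lambda>x. B *v x) has_derivative (\<lambda>h. B *v h)) (at x)"
    by (rule bounded_linear_imp_has_derivative) (rule matrix_vector_mul_bounded_linear)
  then have "((\<lambda>x. x \<bullet> (B *v x)) has_derivative (\<lambda>h. x \<bullet> (B *v h) + h \<bullet> (B *v x))) (at x)"
    by (intro has_derivative_inner has_derivative_ident)
  moreover have "(sqrt has_real_derivative inverse (sqrt (x \<bullet> (B *v x))) / 2) (at (x \<bullet> (B *v x)))"
    using pos by (intro DERIV_real_sqrt) (simp add: N_def)
  ultimately have "((\<lambda>x. sqrt (x \<bullet> (B *v x))) has_derivative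
     (\<lambda>h. inverse (sqrt (x \<bullet> (B *v x))) / 2 * (x \<bullet> (B *v h) + h \<bullet> (B *v x)))) (at x)"
    unfolding has_field_derivative_def by (rule has_derivative_compose)
  then show ?thesis unfolding N_def[abs_def, symmetric] N_def[symmetric] by (rule has_derivative_eq_rhs)
       (auto simp: fun_eq_iff B_bilinear[of x] matrix_vector_mult_scaleR inner_commute)
qed

sublocale gauge N
proof
  show "N \<in> borel_measurable borel" by (rule borel_measurable_continuous_onI[OF continuous_N])
  show "x \<noteq> 0 \<Longrightarrow> N x > 0" for x using norm_le_N[of x] N_ge_0[of x] by (cases "N x = 0") auto
  show "N 0 = 0" by (simp add: N_def)
  show "c > 0 \<Longrightarrow> N (c *\<^sub>R x) = c * N x" for c x by (simp add: N_scaleR)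
  show "emeasure lborel {x. N x < r} < \<infinity>" for r
  proof -
    have "{x. N x < r} \<subseteq> cball 0 (3 / 2 * r)"
    proof
      fix x assume "x \<in> {x. N x < r}"
      then show "x \<in> cball 0 (3 / 2 * r)" using norm_le_N[of x] by simp
    qed
    then have "emeasure lborel {x. N x < r} \<le> emeasure lborel (cball (0 :: 'n point) (3 / 2 * r))"
      by (intro emeasure_mono) auto
    also have "\<dots> < \<infinity>" by (rule emeasure_lborel_cball_finite)
    finally show ?thesis .
  qed
qed

text \<open>Since \<open>3/32 = 3/2 * 1/16\<close>, this half disc contains the upper part of the
  gauge ball of radius \<open>1/16\<close>. The extension by zero gives bounded Borel functions on
  the whole space, and integrals over full gauge balls and spheres then see only the half
  space.\<close>

definition "ub x = indicator (half_disc (3/32)) x * u x"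
definition "gb x = indicator (half_disc (3/32)) x *\<^sub>R gu x"

lemma ub_measurable [measurable]: "ub \<in> borel_measurable borel"
  using borel_measurable_continuous_on_indicator[OF half_disc_measurable u_cont', of "3/32"] by (simp add: ub_def[abs_def])

lemma gb_measurable [measurable]: "gb \<in> borel_measurable borel"
  using borel_measurable_continuous_on_indicator[OF half_disc_measurable gu_cont', of "3/32"] by (simp add: gb_def[abs_def])

lemma gauge_disc: "x \<in> upper \<Longrightarrow> N x \<le> 1/16 \<Longrightarrow> x \<in> half_disc (3/32)"
  using norm_le_N[of x] by (simp add: half_disc_def)

lemma ub_eq: "x \<in> upper \<Longrightarrow> N x \<le> 1/16 \<Longrightarrow> ub x = u x"
  and gb_eq: "x \<in> upper \<Longrightarrow> N x \<le> 1/16 \<Longrightarrow> gb x = gu x" using gauge_disc[of x] by (simp_all add: ub_def gb_def)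

lemma ub_outside: "x \<notin> upper \<Longrightarrow> ub x = 0" and gb_outside: "x \<notin> upper \<Longrightarrow> gb x = 0"
  by (simp_all add: ub_def gb_def half_disc_def)

text \<open>A qualitative bound that depends on the solution. It provides integrability and
  Lipschitz constants and does not enter the final constants.\<close>

definition "bound = (SOME M. 0 < M \<and> (\<forall>x. \<bar>ub x\<bar> \<le> M \<and> norm (gb x) \<le> M))"

lemma bound: "0 < bound" "\<bar>ub x\<bar> \<le> bound" "norm (gb x) \<le> bound"
proof -
  have "compact (half_disc (3/32) :: 'n point set)" by (rule compact_half_disc)
  from compact_imp_bounded[OF compact_continuous_image[OF u_cont' this]]
  obtain M1 where M1: "M1 > 0" "\<And>x. x \<in> half_disc (3/32) \<Longrightarrow> \<bar>u x\<bar> \<le> M1" unfolding bounded_pos by auto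
  from compact_imp_bounded[OF compact_continuous_image[OF gu_cont' compact_half_disc[of "3/32"]]]
  obtain M2 where M2: "M2 > 0" "\<And>x. x \<in> half_disc (3/32) \<Longrightarrow> norm (gu x) \<le> M2" unfolding bounded_pos by auto
  have "0 < max M1 M2 \<and> (\<forall>x. \<bar>ub x\<bar> \<le> max M1 M2 \<and> norm (gb x) \<le> max M1 M2)"
    using M1 M2 by (auto simp: ub_def gb_def indicator_def le_max_iff_disj)
  then have "0 < bound \<and> (\<forall>x. \<bar>ub x\<bar> \<le> bound \<and> norm (gb x) \<le> bound)" unfolding bound_def by (rule someI)
  then show "0 < bound" "\<bar>ub x\<bar> \<le> bound" "norm (gb x) \<le> bound" by auto
qed

definition "energy x = gb x \<bullet> (A *v gb x)"

lemma energy_measurable [measurable]: "energy \<in> borel_measurable borel"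
  unfolding energy_def[abs_def] by measurable

lemma energy_bounds: "0 \<le> energy x" "energy x \<le> 2 * bound\<^sup>2"
proof -
  show "0 \<le> energy x" unfolding energy_def by (rule A_nonneg)
  have "energy x \<le> 2 * (norm (gb x))^2" unfolding energy_def using A_upper[of "gb x"] by (simp add: dot_square_norm)
  also have "\<dots> \<le> 2 * bound\<^sup>2" using bound by (intro mult_left_mono power_mono) auto
  finally show "energy x \<le> 2 * bound\<^sup>2" .
qed

lemma ray_continuous:
  assumes "N q = 1"
  shows "continuous_on {0<..<1/16} (\<lambda>s. ub (s *\<^sub>R q))" "continuous_on {0<..<1/16} (\<lambda>s. gb (s *\<^sub>R q))"
proof -
  have *: "continuous_on {0<..<1/16} (\<lambda>s. ub (s *\<^sub>R q)) \<and> continuous_on {0<..<1/16} (\<lambda>s. gb (s *\<^sub>R q))"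
  proof (cases "q \<in> upper")
    case True
    have up: "s *\<^sub>R q \<in> upper \<and> N (s *\<^sub>R q) \<le> 1/16 \<and> s *\<^sub>R q \<in> half_disc (3/32)" if "s \<in> {0<..<1/16}" for s
      using True that assms gauge_disc[of "s *\<^sub>R q"] by (auto simp: upper_def N_scale)
    have "continuous_on {0<..<1/16} (\<lambda>s. u (s *\<^sub>R q))" "continuous_on {0<..<1/16} (\<lambda>s. gu (s *\<^sub>R q))"
      by (rule continuous_on_compose2[OF u_cont'[of "3/32"]], use up in \<open>auto intro!: continuous_intros\<close>)
         (rule continuous_on_compose2[OF gu_cont'[of "3/32"]], use up in \<open>auto intro!: continuous_intros\<close>)
    moreover have "u (s *\<^sub>R q) = ub (s *\<^sub>R q)" "gu (s *\<^sub>R q) = gb (s *\<^sub>R q)" if "s \<in> {0<..<1/16}" for s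
      using up[OF that] ub_eq gb_eq by auto
    ultimately show ?thesis by (auto intro: continuous_on_eq)
  next
    case False
    then have "ub (s *\<^sub>R q) = 0" "gb (s *\<^sub>R q) = 0" if "s \<in> {0<..<1/16}" for s
      using that by (auto intro!: ub_outside gb_outside simp: upper_def zero_le_mult_iff)
    then show ?thesis by (auto intro: continuous_on_eq[of _ "\<lambda>s. 0", OF continuous_on_const])
  qed
  then show "continuous_on {0<..<1/16} (\<lambda>s. ub (s *\<^sub>R q))" "continuous_on {0<..<1/16} (\<lambda>s. gb (s *\<^sub>R q))" by auto
qed

text \<open>Apart from \<open>D\<close>, the quantities are pulled back to the unit gauge sphere, so
  they carry no powers of \<open>r\<close> from the surface measure. The product
  \<open>gb (r *\<^sub>R q) \<bullet> q\<close> in \<open>mass'\<close> and \<open>radial\<close> is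
  the derivative of \<open>u\<close> along the ray through \<open>q\<close>.\<close>

definition "D r = (LBINT x. indicator {x. N x < r} x * energy x)"
definition "mass r = sphere_integral (\<lambda>q. (ub (r *\<^sub>R q))^2)"
definition "mass' r = sphere_integral (\<lambda>q. ub (r *\<^sub>R q) * (gb (r *\<^sub>R q) \<bullet> q))"
definition "sphere_energy r = sphere_integral (\<lambda>q. energy (r *\<^sub>R q))"
definition "radial r = sphere_integral (\<lambda>q. (gb (r *\<^sub>R q) \<bullet> q)^2)"

lemma D_nonneg: "0 \<le> D r"
  unfolding D_def by (intro Bochner_Integration.integral_nonneg) (simp add: energy_bounds)

lemma mass_nonneg: "0 \<le> mass r"
  unfolding mass_def by (intro sphere_integral_nonneg) simp

lemma D_has_derivative:
  assumes "0 < r" "r < 1/16"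
  shows "(D has_real_derivative r ^ (m - 1) * sphere_energy r) (at r)"
proof -
  have "continuous_on {0<..<1/16} (\<lambda>s. energy (s *\<^sub>R q))" if "N q = 1" for q
    unfolding energy_def by (intro continuous_intros ray_continuous[OF that]
      bounded_linear.continuous_on[OF matrix_vector_mul_bounded_linear])
  from polar_has_derivative[OF energy_measurable energy_bounds this assms]
  show ?thesis unfolding D_def[abs_def] sphere_energy_def m_def by simp
qed

text \<open>On the fixed unit sphere only the integrand depends on \<open>r\<close>, so
  differentiation along each ray under the integral suffices. Rays outside the half space contribute
  zero.\<close>

lemma mass_has_derivative:
  assumes r: "0 < r" "r < 1/16"
  shows "(mass has_real_derivative 2 * mass' r) (at r)"
proof -
  define Z where "Z = {x. 0 < N x \<and> N x < 1}"
  have [measurable]: "Z \<in> sets borel" unfolding Z_def by measurable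
  have fin: "emeasure lborel Z < \<infinity>"
    using emeasure_mono[of Z "{x. N x < 1}" lborel] N_finite[of 1] by (auto simp: Z_def intro: le_less_trans)
  have n1: "norm q \<le> 3/2" if "N q = 1" for q using norm_le_N[of q] that by simp
  have der: "((\<lambda>r. (ub (r *\<^sub>R q))^2) has_real_derivative 2 * (ub (t *\<^sub>R q) * (gb (t *\<^sub>R q) \<bullet> q))) (at t)"
    if q: "N q = 1" and t: "t \<in> {0<..<1/16}" for q t
  proof (cases "q \<in> upper")
    case True
    have up: "s *\<^sub>R q \<in> upper" "N (s *\<^sub>R q) \<le> 1/16" if "s \<in> {0<..<1/16}" for s
      using True that q by (auto simp: upper_def N_scale)
    have xb: "t *\<^sub>R q \<in> half_ball 0 (1/10)" using half_disc_sub[of "3/32"] gauge_disc[OF up[OF t]] by auto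
    have "(u has_gradient gu (t *\<^sub>R q)) (at (t *\<^sub>R q) within (\<lambda>s. s *\<^sub>R q) ` {0<..<1/16})"
      by (rule has_derivative_subset[OF u_derivative[OF xb]]) (use up in auto)
    moreover have "((\<lambda>s. s *\<^sub>R q) has_derivative (\<lambda>h. h *\<^sub>R q)) (at t within {0<..<1/16})"
      by (auto intro!: derivative_eq_intros)
    ultimately have "((\<lambda>s. u (s *\<^sub>R q)) has_derivative (\<lambda>h. gu (t *\<^sub>R q) \<bullet> (h *\<^sub>R q))) (at t within {0<..<1/16})"
      by (rule has_derivative_in_compose[rotated])
    then have "((\<lambda>s. u (s *\<^sub>R q)) has_real_derivative gu (t *\<^sub>R q) \<bullet> q) (at t)"
      using t at_within_open[OF t open_greaterThanLessThan]
      by (simp add: has_field_derivative_def mult_commute_abs)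
    then have "((\<lambda>s. (u (s *\<^sub>R q))^2) has_real_derivative 2 * (u (t *\<^sub>R q) * (gu (t *\<^sub>R q) \<bullet> q))) (at t)"
      by (auto intro!: derivative_eq_intros)
    then have "((\<lambda>s. (ub (s *\<^sub>R q))^2) has_real_derivative 2 * (u (t *\<^sub>R q) * (gu (t *\<^sub>R q) \<bullet> q))) (at t)"
      by (rule has_field_derivative_transform_within_open[OF _ open_greaterThanLessThan t]) (use up ub_eq in auto)
    then show ?thesis using up[OF t] by (simp add: ub_eq gb_eq)
  next
    case False
    have z: "ub (s *\<^sub>R q) = 0" if "s \<in> {0<..<1/16}" for s
      using that False by (auto intro!: ub_outside simp: upper_def zero_le_mult_iff)
    have "((\<lambda>s. 0) has_real_derivative 0) (at t)" by simp
    then have "((\<lambda>s. (ub (s *\<^sub>R q))^2) has_real_derivative 0) (at t)"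
      by (rule has_field_derivative_transform_within_open[OF _ open_greaterThanLessThan t]) (use z in auto)
    then show ?thesis using z[OF t] by simp
  qed
  have cs: "\<bar>ub y * (gb y \<bullet> q)\<bar> \<le> bound * (bound * (3/2))" if "N q = 1" for y q
    unfolding abs_mult using bound n1[OF that]
    by (intro mult_mono order_trans[OF Cauchy_Schwarz_ineq2]) (auto simp: less_imp_le)
  have "((\<lambda>r. \<integral>x. indicator Z x * (ub (r *\<^sub>R (x /\<^sub>R N x)))^2 \<partial>lborel) has_real_derivative
     (LBINT x. indicator Z x * (2 * (ub (r *\<^sub>R (x /\<^sub>R N x)) * (gb (r *\<^sub>R (x /\<^sub>R N x)) \<bullet> (x /\<^sub>R N x)))))) (at r)"
  proof (rule has_derivative_integral_param[where a = 0 and b = "1/16" and w = "\<lambda>x. indicator Z x * (2 * (bound * (bound * (3/2))))"])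
    show "integrable lborel (\<lambda>x. indicator Z x * (2 * (bound * (bound * (3/2)))))"
      using fin by (intro integrable_mult_left) simp
    fix t :: real assume t: "t \<in> {0<..<1/16}"
    show "integrable lborel (\<lambda>x. indicator Z x * (ub (t *\<^sub>R (x /\<^sub>R N x)))^2)" unfolding Z_def
    proof (rule sphere_integrable)
      show "\<bar>(ub (t *\<^sub>R q))^2\<bar> \<le> bound\<^sup>2" for q using power_mono[OF bound(2)[of "t *\<^sub>R q"], of 2] by simp
    qed measurable
    fix x
    show "((\<lambda>r. indicator Z x * (ub (r *\<^sub>R (x /\<^sub>R N x)))^2) has_real_derivative
       indicator Z x * (2 * (ub (t *\<^sub>R (x /\<^sub>R N x)) * (gb (t *\<^sub>R (x /\<^sub>R N x)) \<bullet> (x /\<^sub>R N x))))) (at t)"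
    proof (cases "x \<in> Z")
      case True
      then show ?thesis using DERIV_cmult[OF der[OF N_normalized t, of x], of 1] by (simp add: Z_def N_gt_0_iff)
    qed simp
    show "\<bar>indicator Z x * (2 * (ub (t *\<^sub>R (x /\<^sub>R N x)) * (gb (t *\<^sub>R (x /\<^sub>R N x)) \<bullet> (x /\<^sub>R N x))))\<bar> \<le> indicator Z x * (2 * (bound * (bound * (3/2))))"
    proof (cases "x \<in> Z")
      case True
      then have "\<bar>ub (t *\<^sub>R (x /\<^sub>R N x)) * (gb (t *\<^sub>R (x /\<^sub>R N x)) \<bullet> (x /\<^sub>R N x))\<bar> \<le> bound * (bound * (3/2))"
        by (intro cs N_normalized) (simp add: Z_def N_gt_0_iff)
      then show ?thesis using True by (simp add: abs_mult)
    qed simp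
  qed (use r in \<open>auto, measurable\<close>)
  from DERIV_cmult[OF this, of "real DIM('n point)"]
  have "(mass has_real_derivative sphere_integral (\<lambda>q. 2 * (ub (r *\<^sub>R q) * (gb (r *\<^sub>R q) \<bullet> q)))) (at r)"
    unfolding mass_def[abs_def] sphere_integral_def Z_def[symmetric] .
  then show ?thesis by (simp only: sphere_integral_cmult mass'_def)
qed

end

section \<open>Comparison with the homogeneous extension\<close>

context thin_problem
begin

text \<open>Relative oscillation of the coefficients on the gauge ball of radius \<open>r\<close>:
  each entry moves by at most \<open>H * (2 * r) powr \<gamma>\<close> because
  \<open>norm x \<le> 2 * r\<close> there, the sum over entries gives the squared dimension, and
  ellipticity of \<open>A\<close> the factor 2.\<close>

definition "om r = 2 * (real m)^2 * H * (2 * r) powr \<gamma>"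

lemma frozen_form:
  assumes x: "x \<in> upper" "N x \<le> r" and r: "0 < r" "r < 1/16"
  shows "\<bar>p \<bullet> (b x *v p) - p \<bullet> (A *v p)\<bar> \<le> om r * (p \<bullet> (A *v p))"
proof -
  have xb: "x \<in> half_ball 0 (1/10)" using gauge_disc[of x] x r half_disc_sub[of "3/32"] by auto
  have nx: "norm x \<le> 2 * r" using norm_le_N[of x] x r by linarith
  have h: "\<bar>b x $ i $ j - A $ i $ j\<bar> \<le> H * (2 * r) powr \<gamma>" for i j
  proof -
    have "\<bar>b x $ i $ j - A $ i $ j\<bar> \<le> H * norm x powr \<gamma>" unfolding A_def by (rule b_hoelder[OF xb])
    also have "\<dots> \<le> H * (2 * r) powr \<gamma>" using H_nonneg \<gamma>_pos nx by (intro mult_left_mono powr_mono2) auto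
    finally show ?thesis .
  qed
  have "p \<bullet> (b x *v p) - p \<bullet> (A *v p) = (\<Sum>i\<in>UNIV. \<Sum>j\<in>UNIV. p $ i * ((b x $ i $ j - A $ i $ j) * p $ j))"
    by (simp add: inner_vec_def matrix_vector_mult_def sum_distrib_left sum_subtractf[symmetric] algebra_simps)
  also have "\<bar>\<dots>\<bar> \<le> (\<Sum>i\<in>UNIV. \<Sum>j\<in>UNIV. \<bar>p $ i * ((b x $ i $ j - A $ i $ j) * p $ j)\<bar>)"
    by (intro order_trans[OF sum_abs] sum_mono sum_abs)
  also have "\<dots> \<le> (\<Sum>i\<in>(UNIV :: 'n option set). \<Sum>j\<in>(UNIV :: 'n option set). norm p * ((H * (2 * r) powr \<gamma>) * norm p))"
    unfolding abs_mult using h H_nonneg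
    by (intro sum_mono mult_mono component_le_norm_cart) (auto intro!: mult_nonneg_nonneg)
  also have "\<dots> = (real m)^2 * H * (2 * r) powr \<gamma> * (p \<bullet> p)"
    by (simp add: m_def power2_eq_square dot_square_norm)
  also have "\<dots> \<le> (real m)^2 * H * (2 * r) powr \<gamma> * (2 * (p \<bullet> (A *v p)))"
    using A_lower[of p] H_nonneg by (intro mult_left_mono) auto
  finally show ?thesis by (simp add: om_def mult_ac)
qed

text \<open>In polar coordinates the sphere occupies a single radius.\<close>

lemma null_gauge_sphere: "{x. N x = r} \<in> null_sets lborel"
proof (rule null_setsI)
  have [measurable]: "{x. N x = r} \<in> sets borel" by measurable
  then show "{x. N x = r} \<in> sets lborel" by simp
  have "emeasure lborel {x. N x = r} = (\<integral>\<^sup>+x. indicator {x. N x = r} x * indicator {x. N x < r + 1} x \<partial>lborel)"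
  proof -
    have "(\<integral>\<^sup>+x. indicator {x. N x = r} x * indicator {x. N x < r + 1} x \<partial>lborel) = (\<integral>\<^sup>+x. indicator {x. N x = r} x \<partial>lborel)"
      by (intro nn_integral_cong) (auto simp: indicator_def)
    then show ?thesis by simp
  qed
  also have "\<dots> = (\<integral>\<^sup>+s. (\<integral>\<^sup>+x. indicator {0<..<r + 1} s * ennreal (s ^ (DIM('n point) - 1) * real DIM('n point)) *
        (indicator {x. 0 < N x \<and> N x < 1} x * indicator {x. N x = r} (s *\<^sub>R (x /\<^sub>R N x))) \<partial>lborel) \<partial>lborel)"
    by (rule nn_integral_polar) measurable
  also have "\<dots> = (\<integral>\<^sup>+s. 0 \<partial>(lborel :: real measure))"
  proof (rule nn_integral_cong_AE)
    have "AE s in lborel. s \<noteq> r" by (rule AE_lborel_singleton)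
    then show "AE s in lborel. (\<integral>\<^sup>+x. indicator {0<..<r + 1} s * ennreal (s ^ (DIM('n point) - 1) * real DIM('n point)) *
        (indicator {x. 0 < N x \<and> N x < 1} x * indicator {x. N x = r} (s *\<^sub>R (x /\<^sub>R N x))) \<partial>lborel) = 0"
    proof eventually_elim
      case (elim s)
      have "indicator {0<..<r + 1} s * ennreal (s ^ (DIM('n point) - 1) * real DIM('n point)) *
        (indicator {x. 0 < N x \<and> N x < 1} x * indicator {x. N x = r} (s *\<^sub>R (x /\<^sub>R N x))) = (0 :: ennreal)" for x
        using elim N_normalized[of x] by (auto simp: indicator_def N_gt_0_iff N_scale simp del: scaleR_scaleR)
      then show ?case by (simp only: nn_integral_const mult_zero_left)
    qed
  qed
  finally show "emeasure lborel {x. N x = r} = 0" by simp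
qed

lemma u_lipschitz:
  assumes "x \<in> half_disc (3/32)" "y \<in> half_disc (3/32)"
  shows "\<bar>u x - u y\<bar> \<le> bound * norm (x - y)"
proof -
  have "norm (u x - u y) \<le> bound * norm (x - y)"
  proof (rule differentiable_bound)
    show "convex (half_disc (3/32) :: 'n point set)" unfolding half_disc_def by (intro convex_Int convex_cball convex_upper)
    fix z :: "'n point" assume z: "z \<in> half_disc (3/32)"
    then have zb: "z \<in> half_ball 0 (1/10)" using half_disc_sub[of "3/32"] by auto
    show "(u has_gradient gu z) (at z within half_disc (3/32))"
      by (rule has_derivative_subset[OF u_derivative[OF zb]]) (auto simp: half_disc_def)
    have "norm (gu z) \<le> bound" using bound(3)[of z] z by (simp add: gb_def)
    then have "norm (gu z \<bullet> h) \<le> bound * norm h" for h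
      using order_trans[OF Cauchy_Schwarz_ineq2 mult_right_mono[OF _ norm_ge_zero[of h]]] by simp
    then show "onorm (\<lambda>h. gu z \<bullet> h) \<le> bound" by (rule onorm_le)
  qed (use assms in auto)
  then show ?thesis by simp
qed

lemma B_norm: "N q = 1 \<Longrightarrow> norm (B *v q) \<le> 2"
proof -
  assume "N q = 1"
  then have "q \<bullet> (B *v q) = 1" using N_power2[of q] by simp
  then have "1 / 2 * (norm (B *v q))^2 \<le> 1"
    using A_lower[of "B *v q"] by (simp add: A_B dot_square_norm inner_commute)
  then have "(norm (B *v q))^2 \<le> 2\<^sup>2" by simp
  then show ?thesis by (rule power2_le_imp_le) simp
qed

context
  fixes r \<kappa> :: real
  assumes r: "0 < r" "r < 1/16" and \<kappa>: "1 \<le> \<kappa>"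
begin

text \<open>The \<open>\<kappa>\<close>-homogeneous extension of the values of \<open>u\<close> on the gauge sphere of radius \<open>r\<close>.\<close>

private definition "vv x = (N x / r) powr \<kappa> * ub (r *\<^sub>R (x /\<^sub>R N x))"
text \<open>The gradient of the extension on the gauge sphere: directions tangent to the sphere see
  the gradient of \<open>u\<close>, and the component along \<open>q\<close> is replaced by
  \<open>\<kappa> / r\<close> times the value, as Euler's identity for homogeneous functions
  demands. \<open>gv\<close> is its extension of degree \<open>\<kappa> - 1\<close>.\<close>

private definition "pv q = ((\<kappa> / r) * ub (r *\<^sub>R q) - gb (r *\<^sub>R q) \<bullet> q) *\<^sub>R (B *v q) + gb (r *\<^sub>R q)"
private definition "gv x = (N x / r) powr (\<kappa> - 1) *\<^sub>R pv (x /\<^sub>R N x)"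
private definition "CP = ((\<kappa> / r) * bound + bound * (3/2)) * 2 + bound"
private definition "LL = CP + 3/2 * bound / r + bound"

private lemma norm_unit: "N q = 1 \<Longrightarrow> norm q \<le> 3/2"
  using norm_le_N[of q] by simp

private lemma CP_pos: "0 < CP"
  using bound(1) r \<kappa> by (auto simp: CP_def intro!: add_pos_pos mult_pos_pos)

private lemma pv_bound: "N q = 1 \<Longrightarrow> norm (pv q) \<le> CP"
proof -
  assume q: "N q = 1"
  have "\<bar>(\<kappa> / r) * ub (r *\<^sub>R q) - gb (r *\<^sub>R q) \<bullet> q\<bar> \<le> \<bar>(\<kappa> / r) * ub (r *\<^sub>R q)\<bar> + \<bar>gb (r *\<^sub>R q) \<bullet> q\<bar>"
    by (rule abs_triangle_ineq4)
  also have "\<dots> \<le> (\<kappa> / r) * bound + bound * (3/2)"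
  proof (rule add_mono)
    show "\<bar>(\<kappa> / r) * ub (r *\<^sub>R q)\<bar> \<le> (\<kappa> / r) * bound"
      using r \<kappa> bound(2)[of "r *\<^sub>R q"] by (simp add: abs_mult divide_right_mono mult_left_mono)
    show "\<bar>gb (r *\<^sub>R q) \<bullet> q\<bar> \<le> bound * (3/2)"
      using bound norm_unit[OF q] by (intro order_trans[OF Cauchy_Schwarz_ineq2] mult_mono) (auto simp: less_imp_le)
  qed
  finally have 1: "\<bar>(\<kappa> / r) * ub (r *\<^sub>R q) - gb (r *\<^sub>R q) \<bullet> q\<bar> \<le> (\<kappa> / r) * bound + bound * (3/2)" .
  have "norm (pv q) \<le> \<bar>(\<kappa> / r) * ub (r *\<^sub>R q) - gb (r *\<^sub>R q) \<bullet> q\<bar> * norm (B *v q) + norm (gb (r *\<^sub>R q))"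
    unfolding pv_def by (rule order_trans[OF norm_triangle_ineq]) simp
  also have "\<dots> \<le> CP" unfolding CP_def using 1 B_norm[OF q] bound(3) by (intro add_mono mult_mono) auto
  finally show ?thesis .
qed

text \<open>Here \<open>\<kappa> \<ge> 1\<close> enters: the power
  \<open>(N x / r) powr (\<kappa> - 1)\<close> is at most 1 inside the ball.\<close>

private lemma gv_bound: "N x \<le> r \<Longrightarrow> norm (gv x) \<le> CP"
proof (cases "x = 0")
  case True
  then show ?thesis using CP_pos by (simp add: gv_def N_zero)
next
  case False
  assume "N x \<le> r"
  then have "(N x / r) powr (\<kappa> - 1) \<le> 1 powr (\<kappa> - 1)" using r \<kappa> N_ge_0[of x] by (intro powr_mono2) auto
  then have "norm (gv x) \<le> 1 * CP"
    unfolding gv_def norm_scaleR using pv_bound[OF N_normalized[OF False]] by (intro mult_mono) auto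
  then show ?thesis by simp
qed

private lemma gv_outside: "x \<notin> upper \<Longrightarrow> gv x = 0"
proof -
  assume x: "x \<notin> upper"
  then have "x \<noteq> 0" by (auto simp: upper_def)
  then have "0 < r / N x" using r N_pos[of x] by simp
  moreover have "(r *\<^sub>R (x /\<^sub>R N x)) $ None = (r / N x) * x $ None" by (simp add: divide_inverse)
  moreover have "x $ None < 0" using x by (simp add: upper_def)
  ultimately have "(r *\<^sub>R (x /\<^sub>R N x)) $ None < 0" using mult_pos_neg[of "r / N x" "x $ None"] by presburger
  then have "r *\<^sub>R (x /\<^sub>R N x) \<notin> upper" unfolding upper_def mem_Collect_eq by linarith
  then show ?thesis by (simp add: gv_def pv_def ub_outside gb_outside)
qed

private lemma gv_measurable [measurable]: "gv \<in> borel_measurable borel"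
  unfolding gv_def[abs_def] pv_def by measurable

private lemma vv_has_derivative:
  assumes x: "x \<in> upper" "x \<noteq> 0"
  shows "(vv has_gradient gv x) (at x within upper)"
proof -
  define q where "q = x /\<^sub>R N x"
  have Np: "N x > 0" by (rule N_pos[OF x(2)])
  have q: "N q = 1" unfolding q_def by (rule N_normalized[OF x(2)])
  let ?T = "\<lambda>x. r *\<^sub>R (x /\<^sub>R N x)"
  have Tup: "?T y \<in> upper" "N (?T y) \<le> 1/16" if "y \<in> upper" for y
  proof -
    show "?T y \<in> upper" using that r N_ge_0[of y] by (auto simp: upper_def)
    show "N (?T y) \<le> 1/16"
    proof (cases "y = 0")
      case True then show ?thesis by (simp add: N_zero)
    next
      case False
      then show ?thesis using N_scaleR[of r "y /\<^sub>R N y"] N_normalized[OF False] r by simp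
    qed
  qed
  have dN: "(N has_gradient (B *v q)) (at x within upper)"
    unfolding q_def by (rule has_derivative_at_withinI[OF N_has_derivative[OF x(2)]])
  have dT: "(?T has_derivative (\<lambda>h. (r / N x) *\<^sub>R (h - ((B *v q) \<bullet> h) *\<^sub>R q))) (at x within upper)"
  proof -
    have "((\<lambda>x. inverse (N x)) has_derivative (\<lambda>h. - (inverse (N x) * ((B *v q) \<bullet> h) * inverse (N x)))) (at x within upper)"
      by (rule Deriv.has_derivative_inverse[OF less_imp_neq[OF Np, symmetric] dN])
    then have "((\<lambda>x. inverse (N x) *\<^sub>R x) has_derivative
       (\<lambda>h. inverse (N x) *\<^sub>R h + (- (inverse (N x) * ((B *v q) \<bullet> h) * inverse (N x))) *\<^sub>R x)) (at x within upper)"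
      by (intro has_derivative_scaleR has_derivative_ident)
    then have "(?T has_derivative
       (\<lambda>h. r *\<^sub>R (inverse (N x) *\<^sub>R h + (- (inverse (N x) * ((B *v q) \<bullet> h) * inverse (N x))) *\<^sub>R x))) (at x within upper)"
      by (intro has_derivative_scaleR_right)
    moreover have "r *\<^sub>R (inverse (N x) *\<^sub>R h + (- (inverse (N x) * ((B *v q) \<bullet> h) * inverse (N x))) *\<^sub>R x) =
       (r / N x) *\<^sub>R (h - ((B *v q) \<bullet> h) *\<^sub>R q)" for h
      by (simp add: q_def scaleR_add_right scaleR_diff_right divide_inverse mult_ac)
    ultimately show ?thesis by simp
  qed
  have xb: "?T x \<in> half_ball 0 (1/10)" using gauge_disc[OF Tup[OF x(1)]] half_disc_sub[of "3/32"] by auto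
  have "(u has_gradient gu (?T x)) (at (?T x) within ?T ` upper)"
    by (rule has_derivative_subset[OF u_derivative[OF xb]]) (use Tup in auto)
  from has_derivative_in_compose[OF dT this]
  have du: "((\<lambda>x. u (?T x)) has_derivative (\<lambda>h. gu (?T x) \<bullet> ((r / N x) *\<^sub>R (h - ((B *v q) \<bullet> h) *\<^sub>R q)))) (at x within upper)" .
  have dp: "((\<lambda>x. (N x / r) powr \<kappa>) has_derivative (\<lambda>h. (\<kappa> * (N x / r) powr (\<kappa> - 1)) * (((B *v q) \<bullet> h) / r))) (at x within upper)"
  proof -
    have s: "((\<lambda>s. s powr \<kappa>) has_real_derivative \<kappa> * (N x / r) powr (\<kappa> - 1)) (at (N x / r))"
      using Np r by (intro has_real_derivative_powr) simp
    have n: "((\<lambda>x. N x / r) has_derivative (\<lambda>h. ((B *v q) \<bullet> h) / r)) (at x within upper)"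
      using has_derivative_mult_left[OF dN, of "inverse r"] unfolding divide_inverse .
    show ?thesis by (rule has_derivative_compose[OF n s[unfolded has_field_derivative_def]])
  qed
  have "((\<lambda>x. (N x / r) powr \<kappa> * u (?T x)) has_derivative
      (\<lambda>h. (N x / r) powr \<kappa> * (gu (?T x) \<bullet> ((r / N x) *\<^sub>R (h - ((B *v q) \<bullet> h) *\<^sub>R q))) +
         ((\<kappa> * (N x / r) powr (\<kappa> - 1)) * (((B *v q) \<bullet> h) / r)) * u (?T x))) (at x within upper)"
    by (rule has_derivative_mult[OF dp du])
  moreover have "(N x / r) powr \<kappa> * (gu (?T x) \<bullet> ((r / N x) *\<^sub>R (h - ((B *v q) \<bullet> h) *\<^sub>R q))) +
         ((\<kappa> * (N x / r) powr (\<kappa> - 1)) * (((B *v q) \<bullet> h) / r)) * u (?T x) = gv x \<bullet> h" for h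
  proof -
    have p: "(N x / r) powr \<kappa> * (r / N x) = (N x / r) powr (\<kappa> - 1)" using Np r by (simp add: powr_diff)
    have "(N x / r) powr \<kappa> * (gu (?T x) \<bullet> ((r / N x) *\<^sub>R (h - ((B *v q) \<bullet> h) *\<^sub>R q))) =
       ((N x / r) powr \<kappa> * (r / N x)) * (gu (?T x) \<bullet> (h - ((B *v q) \<bullet> h) *\<^sub>R q))" by simp
    also have "\<dots> = (N x / r) powr (\<kappa> - 1) * (gu (?T x) \<bullet> h - ((B *v q) \<bullet> h) * (gu (?T x) \<bullet> q))"
      unfolding p by (simp add: inner_diff_right)
    finally show ?thesis using ub_eq[OF Tup[OF x(1)]] gb_eq[OF Tup[OF x(1)]]
      by (simp add: gv_def pv_def q_def[symmetric] inner_add_left algebra_simps)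
  qed
  ultimately have "((\<lambda>x. (N x / r) powr \<kappa> * u (?T x)) has_gradient gv x) (at x within upper)" by simp
  then show ?thesis by (rule has_derivative_transform[rotated 2]) (use x Tup ub_eq in \<open>simp_all add: vv_def\<close>)
qed

private lemma vv_on_sphere: "x \<in> upper \<Longrightarrow> N x = r \<Longrightarrow> vv x = u x"
  using r ub_eq[of x] by (simp add: vv_def)

private lemma vv_linear_bound: "N x \<le> r \<Longrightarrow> \<bar>vv x\<bar> \<le> 3/2 * bound / r * norm x"
proof -
  assume x: "N x \<le> r"
  have "(N x / r) powr \<kappa> \<le> N x / r"
  proof (cases "N x = 0")
    case False
    then have "0 < N x / r" "N x / r \<le> 1" using x r N_ge_0[of x] by auto
    then show ?thesis using \<kappa> powr_mono'[of 1 \<kappa> "N x / r"] by simp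
  qed simp
  also have "\<dots> \<le> 3/2 * norm x / r" using N_le_norm[of x] r by (intro divide_right_mono) auto
  finally have "\<bar>vv x\<bar> \<le> (3/2 * norm x / r) * bound"
    unfolding vv_def abs_mult using bound(1,2) r by (intro mult_mono) auto
  then show ?thesis by (simp add: mult_ac)
qed

text \<open>The derivative formula is available only away from the origin. If the segment avoids the
  origin, the mean value inequality applies; if it meets the origin, the norms of the endpoints add
  up to its length and \<open>vv_linear_bound\<close> is used at both ends.\<close>

private lemma vv_lipschitz:
  assumes x: "x \<in> upper" "N x \<le> r" and y: "y \<in> upper" "N y \<le> r"
  shows "\<bar>vv x - vv y\<bar> \<le> (CP + 3/2 * bound / r) * norm (x - y)"
proof (cases "0 \<in> closed_segment x y")
  case True
  have "\<bar>vv x - vv y\<bar> \<le> \<bar>vv x\<bar> + \<bar>vv y\<bar>" by simp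
  also have "\<dots> \<le> 3/2 * bound / r * norm x + 3/2 * bound / r * norm y" by (intro add_mono vv_linear_bound x y)
  also have "\<dots> = 3/2 * bound / r * (norm x + norm y)" by (simp only: distrib_left)
  also have "norm x + norm y = norm (x - y)"
    using True between_mem_segment[of x y 0] between[of x y 0] by (simp add: dist_norm)
  also have "3/2 * bound / r * norm (x - y) \<le> (CP + 3/2 * bound / r) * norm (x - y)"
    by (rule mult_right_mono) (use CP_pos in linarith, rule norm_ge_zero)
  finally show ?thesis .
next
  case False
  have seg: "z \<in> upper \<and> N z \<le> r \<and> z \<noteq> 0" if zs: "z \<in> closed_segment x y" for z
  proof -
    obtain t where t: "0 \<le> t" "t \<le> 1" "z = (1 - t) *\<^sub>R x + t *\<^sub>R y" using zs unfolding in_segment by blast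
    have "N z \<le> N ((1 - t) *\<^sub>R x) + N (t *\<^sub>R y)" unfolding t(3) by (rule N_triangle)
    also have "\<dots> \<le> (1 - t) * r + t * r" using t x y by (intro add_mono) (auto simp: N_scaleR intro: mult_left_mono)
    finally have "N z \<le> r" by (simp add: algebra_simps)
    moreover have "z \<in> upper" using t x y by (auto simp: upper_def)
    ultimately show ?thesis using False that by auto
  qed
  have "norm (vv x - vv y) \<le> CP * norm (x - y)"
  proof (rule differentiable_bound[of "closed_segment x y"])
    fix z assume z: "z \<in> closed_segment x y"
    show "(vv has_gradient gv z) (at z within closed_segment x y)"
      by (rule has_derivative_subset[OF vv_has_derivative]) (use seg z in auto)
    have "norm (gv z \<bullet> h) \<le> CP * norm h" for h
      using order_trans[OF Cauchy_Schwarz_ineq2 mult_right_mono[OF gv_bound norm_ge_zero[of h]]] seg[OF z] by simp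
    then show "onorm (\<lambda>h. gv z \<bullet> h) \<le> CP" by (rule onorm_le)
  qed auto
  also have "\<dots> \<le> (CP + 3/2 * bound / r) * norm (x - y)" using bound(1) r by (intro mult_right_mono) auto
  finally show ?thesis by simp
qed

private definition "\<phi> x = (if N x < r then vv x - u x else 0)"
private definition "g\<phi> x = indicator {x. N x < r} x *\<^sub>R (gv x - gb x)"

private lemma \<phi>_closed: "x \<in> upper \<Longrightarrow> N x \<le> r \<Longrightarrow> \<phi> x = vv x - u x"
  using vv_on_sphere[of x] by (auto simp: \<phi>_def)

private lemma \<phi>_lipschitz_inside:
  assumes x: "x \<in> upper" "N x \<le> r" and y: "y \<in> upper" "N y \<le> r"
  shows "\<bar>\<phi> x - \<phi> y\<bar> \<le> LL * norm (x - y)"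
proof -
  have "\<bar>\<phi> x - \<phi> y\<bar> \<le> \<bar>vv x - vv y\<bar> + \<bar>u x - u y\<bar>" unfolding \<phi>_closed[OF x] \<phi>_closed[OF y] by linarith
  also have "\<dots> \<le> (CP + 3/2 * bound / r) * norm (x - y) + bound * norm (x - y)"
    using x y r by (intro add_mono vv_lipschitz u_lipschitz gauge_disc) auto
  finally show ?thesis by (simp add: LL_def algebra_simps)
qed

text \<open>The segment meets the gauge sphere by the intermediate value theorem. There
  \<open>\<phi>\<close> is already zero, as it is at \<open>y\<close>, so only the inner piece of
  the segment matters.\<close>

private lemma \<phi>_lipschitz_crossing:
  assumes x: "x \<in> upper" "N x \<le> r" and y: "y \<in> upper" "\<not> N y \<le> r"
  shows "\<bar>\<phi> x - \<phi> y\<bar> \<le> LL * norm (x - y)"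
proof -
  have LL0: "LL \<ge> 0" using CP_pos bound(1) r by (simp add: LL_def)
  have "\<exists>t. 0 \<le> t \<and> t \<le> 1 \<and> N (x + t *\<^sub>R (y - x)) = r"
    by (rule IVT') (use x y in \<open>auto intro!: continuous_on_compose2[OF continuous_N[of UNIV]] continuous_intros\<close>)
  then obtain t where t: "0 \<le> t" "t \<le> 1" "N (x + t *\<^sub>R (y - x)) = r" by blast
  let ?z = "x + t *\<^sub>R (y - x)"
  have zu: "?z \<in> upper" using convexD_alt[OF convex_upper x(1) y(1) t(1,2)] by (simp add: algebra_simps)
  have "\<phi> y = \<phi> ?z" using y t by (simp add: \<phi>_def)
  then have "\<bar>\<phi> x - \<phi> y\<bar> \<le> LL * norm (x - ?z)" using \<phi>_lipschitz_inside[OF x zu] t(3) by simp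
  also have "norm (x - ?z) = t * norm (x - y)" using t by (simp add: norm_minus_commute)
  also have "LL * (t * norm (x - y)) \<le> LL * (1 * norm (x - y))"
    using LL0 t by (intro mult_left_mono mult_right_mono) auto
  finally show ?thesis by simp
qed

private lemma \<phi>_lipschitz:
  assumes x: "x \<in> upper" and y: "y \<in> upper"
  shows "\<bar>\<phi> x - \<phi> y\<bar> \<le> LL * norm (x - y)"
proof -
  have LL0: "LL \<ge> 0" using CP_pos bound(1) r by (simp add: LL_def)
  consider "N x \<le> r" "N y \<le> r" | "N x \<le> r" "\<not> N y \<le> r" | "\<not> N x \<le> r" "N y \<le> r" | "\<not> N x \<le> r" "\<not> N y \<le> r" by blast
  then show ?thesis
  proof cases
    case 1 then show ?thesis using \<phi>_lipschitz_inside x y by blast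
  next
    case 2 then show ?thesis using \<phi>_lipschitz_crossing x y by blast
  next
    case 3 then show ?thesis using \<phi>_lipschitz_crossing[OF y _ x] by (simp add: abs_minus_commute norm_minus_commute)
  next
    case 4 then show ?thesis using LL0 by (simp add: \<phi>_def)
  qed
qed

text \<open>The extension respects the obstacle: on the flat boundary it is a nonnegative multiple
  of a value of \<open>ub\<close> there, and these are nonnegative. As the flux is nonpositive and
  complementary to \<open>u\<close>, its product with the difference of extension and
  \<open>u\<close> is nonpositive, so this difference is an admissible variation.\<close>

private lemma comparison: "0 \<le> (LBINT x. indicator (half_disc (3/32)) x *\<^sub>R (flux b gu x \<bullet> g\<phi> x))"
proof (rule variational[where \<phi> = \<phi> and L = LL and N = "{x. N x = 0} \<union> {x. N x = r}"])
  show "compact (half_disc (3/32) :: 'n point set)" by (rule compact_half_disc)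
  show "half_disc (3/32) \<subseteq> half_ball 0 (1/10)" by (rule half_disc_sub) simp
  show "\<bar>\<phi> x - \<phi> y\<bar> \<le> LL * norm (x - y)" if "x \<in> upper" "y \<in> upper" for x y by (rule \<phi>_lipschitz[OF that])
  show "\<phi> x = 0" if "x \<in> upper" "x \<notin> half_disc (3/32)" for x
    using gauge_disc[of x] that r by (auto simp: \<phi>_def)
  show "{x. N x = 0} \<union> {x. N x = r} \<in> null_sets lborel" by (intro null_sets.Un null_gauge_sphere)
  show "g\<phi> \<in> borel_measurable borel" unfolding g\<phi>_def[abs_def] by measurable
  show "norm (g\<phi> x) \<le> LL" for x
  proof (cases "N x < r")
    case True
    then have "norm (g\<phi> x) \<le> norm (gv x) + norm (gb x)" by (simp add: g\<phi>_def norm_triangle_ineq4)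
    also have "\<dots> \<le> CP + bound" using gv_bound[of x] bound(3)[of x] True by (intro add_mono) auto
    also have "\<dots> \<le> LL" using bound(1) r by (simp add: LL_def)
    finally show ?thesis .
  qed (use CP_pos bound(1) r in \<open>simp add: g\<phi>_def LL_def\<close>)
  show "g\<phi> x = 0" if "x \<notin> half_disc (3/32)" for x
  proof (cases "x \<in> upper")
    case True
    then have "\<not> N x < r" using gauge_disc[of x] that r by linarith
    then show ?thesis by (simp add: g\<phi>_def)
  qed (simp add: g\<phi>_def gv_outside gb_outside)
  show "(\<phi> has_gradient g\<phi> x) (at x)" if x: "x $ None > 0" "x \<notin> {x. N x = 0} \<union> {x. N x = r}" for x
  proof -
    have xu: "x \<in> upper" using x by (simp add: upper_def)
    have x0: "x \<noteq> 0" using x by auto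
    have op: "open {x :: 'n point. x $ None > 0}" by (intro open_Collect_less continuous_intros)
    have at: "at x within upper = at x"
      using x(1) op by (intro at_within_interior) (auto simp: interior_def upper_def intro!: exI[of _ "{x. x $ None > 0}"])
    consider "N x < r" | "r < N x" using x by force
    then show ?thesis
    proof cases
      case 1
      then have xb: "x \<in> half_ball 0 (1/10)" using gauge_disc[of x] xu r half_disc_sub[of "3/32"] by auto
      have "((\<lambda>x. vv x - u x) has_derivative (\<lambda>h. gv x \<bullet> h - gu x \<bullet> h)) (at x)"
        using has_derivative_diff[OF vv_has_derivative[OF xu x0] u_derivative[OF xb]] unfolding at .
      then have "(\<phi> has_derivative (\<lambda>h. gv x \<bullet> h - gu x \<bullet> h)) (at x)"
        by (rule has_derivative_transform_within_open[where s = "{x. N x < r}"])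
           (use 1 in \<open>auto simp: \<phi>_def intro!: open_Collect_less continuous_N continuous_intros\<close>)
      moreover have "gb x = gu x" using 1 r xu by (intro gb_eq) auto
      ultimately show ?thesis using 1 by (simp add: g\<phi>_def inner_diff_left)
    next
      case 2
      have "((\<lambda>x. 0) has_derivative (\<lambda>h. 0)) (at x)" by simp
      then have "(\<phi> has_derivative (\<lambda>h. 0)) (at x)"
        by (rule has_derivative_transform_within_open[where s = "{x. r < N x}"])
           (use 2 in \<open>auto simp: \<phi>_def intro!: open_Collect_less continuous_N continuous_intros\<close>)
      then show ?thesis using 2 by (simp add: g\<phi>_def)
    qed
  qed
  show "flux b gu x $ None * \<phi> x \<le> 0" if x: "x \<in> half_disc (3/32)" "x $ None = 0" for x
  proof (cases "N x < r")
    case True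
    have xb: "x \<in> half_ball 0 (1/10)" using x half_disc_sub[of "3/32"] by auto
    have s: "flux b gu x $ None \<le> 0" "u x * flux b gu x $ None = 0" using signorini[OF xb x(2)] by auto
    have "0 \<le> ub (r *\<^sub>R (x /\<^sub>R N x))"
    proof (cases "r *\<^sub>R (x /\<^sub>R N x) \<in> half_disc (3/32)")
      case in_disc: True
      have "0 \<le> u (r *\<^sub>R (x /\<^sub>R N x))"
        using signorini[of "r *\<^sub>R (x /\<^sub>R N x)"] in_disc half_disc_sub[of "3/32"] x(2) by auto
      then show ?thesis by (simp add: ub_def)
    qed (simp add: ub_def)
    then have "0 \<le> vv x" by (simp add: vv_def)
    then have "flux b gu x $ None * vv x \<le> 0" using s(1) by (simp add: mult_nonpos_nonneg)
    moreover have "\<phi> x = vv x - u x" using True by (simp add: \<phi>_def)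
    moreover have "flux b gu x $ None * (vv x - u x) = flux b gu x $ None * vv x"
      using s(2) by (simp add: right_diff_distrib mult.commute)
    ultimately show ?thesis by (simp only:)
  qed (simp add: \<phi>_def)
qed

private definition "gA x = gv x \<bullet> (A *v gv x)"
private definition "Qf q = (\<kappa> / r)^2 * (ub (r *\<^sub>R q))^2 + (energy (r *\<^sub>R q) + (- 1) * (gb (r *\<^sub>R q) \<bullet> q)^2)"

private lemma gA_measurable [measurable]: "gA \<in> borel_measurable borel"
  unfolding gA_def[abs_def] by measurable

private lemma gA_bounds: "0 \<le> gA x" "N x < r \<Longrightarrow> gA x \<le> 2 * CP\<^sup>2"
proof -
  show "0 \<le> gA x" unfolding gA_def by (rule A_nonneg)
  assume "N x < r"
  then have "norm (gv x) \<le> CP" by (intro gv_bound) simp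
  then have "(norm (gv x))^2 \<le> CP\<^sup>2" by (intro power_mono) auto
  then show "gA x \<le> 2 * CP\<^sup>2" unfolding gA_def using A_upper[of "gv x"] by (simp add: dot_square_norm)
qed

text \<open>Because \<open>A\<close> maps \<open>B *v q\<close> to \<open>q\<close>, the form is
  \<open>c\<^sup>2\<close> plus \<open>2 * c * (g \<bullet> q)\<close> plus the energy of
  \<open>g\<close>. Completing the square replaces the radial energy
  \<open>(g \<bullet> q)^2\<close> by the square of \<open>\<kappa> / r\<close> times the value of
  \<open>u\<close>; with another gauge a cross term would remain.\<close>

private lemma pv_form:
  assumes q: "N q = 1"
  shows "pv q \<bullet> (A *v pv q) = Qf q"
proof -
  define c g where "c = (\<kappa> / r) * ub (r *\<^sub>R q) - gb (r *\<^sub>R q) \<bullet> q" and "g = gb (r *\<^sub>R q)"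
  have pv: "pv q = c *\<^sub>R (B *v q) + g" by (simp add: pv_def c_def g_def)
  have 1: "q \<bullet> (B *v q) = 1" using N_power2[of q] q by simp
  have "pv q \<bullet> (A *v pv q) = c\<^sup>2 * ((B *v q) \<bullet> (A *v (B *v q))) + 2 * c * (g \<bullet> (A *v (B *v q))) + g \<bullet> (A *v g)"
    unfolding pv using A_bilinear[of "B *v q" g]
    by (simp add: matrix_vector_right_distrib matrix_vector_mult_scaleR
        inner_add_left inner_add_right power2_eq_square algebra_simps)
  also have "\<dots> = c\<^sup>2 + 2 * c * (g \<bullet> q) + g \<bullet> (A *v g)" using 1 by (simp add: A_B inner_commute)
  also have "\<dots> = Qf q" by (simp add: Qf_def c_def energy_def g_def[symmetric] power2_eq_square algebra_simps)
  finally show ?thesis .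
qed

private lemma gA_homogeneous:
  assumes "N q = 1" "0 < s"
  shows "gA (s *\<^sub>R q) = (s / r) powr (2 * \<kappa> - 2) * Qf q"
proof -
  have "N (s *\<^sub>R q) = s" using assms by (simp add: N_scale)
  moreover have "(s *\<^sub>R q) /\<^sub>R s = q" using assms by simp
  ultimately have "gv (s *\<^sub>R q) = (s / r) powr (\<kappa> - 1) *\<^sub>R pv q" by (simp add: gv_def)
  then have "gA (s *\<^sub>R q) = ((s / r) powr (\<kappa> - 1) * (s / r) powr (\<kappa> - 1)) * (pv q \<bullet> (A *v pv q))"
    by (simp add: gA_def matrix_vector_mult_scaleR)
  also have "(s / r) powr (\<kappa> - 1) * (s / r) powr (\<kappa> - 1) = (s / r) powr (2 * \<kappa> - 2)"
    by (simp add: powr_add[symmetric])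
  finally show ?thesis by (simp add: pv_form[OF assms(1)])
qed

private lemma Qf_integral:
  "sphere_integral Qf = (\<kappa> / r)^2 * mass r + (sphere_energy r - radial r)"
proof -
  have b1: "\<bar>(\<kappa> / r)^2 * (ub (r *\<^sub>R q))^2\<bar> \<le> (\<kappa> / r)^2 * bound\<^sup>2" for q
    using power_mono[OF bound(2)[of "r *\<^sub>R q"] abs_ge_zero, of 2] by (simp add: abs_mult mult_left_mono)
  have b2: "\<bar>energy (r *\<^sub>R q)\<bar> \<le> 2 * bound\<^sup>2" for q using energy_bounds by simp
  have b3: "\<bar>(- 1) * (gb (r *\<^sub>R q) \<bullet> q)^2\<bar> \<le> (bound * (3/2))^2" if "N q = 1" for q
  proof -
    have "\<bar>gb (r *\<^sub>R q) \<bullet> q\<bar> \<le> bound * (3/2)"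
      using bound norm_unit[OF that] by (intro order_trans[OF Cauchy_Schwarz_ineq2] mult_mono) (auto simp: less_imp_le)
    from power_mono[OF this abs_ge_zero, of 2] show ?thesis by simp
  qed
  have b4: "\<bar>energy (r *\<^sub>R q) + (- 1) * (gb (r *\<^sub>R q) \<bullet> q)^2\<bar> \<le> 2 * bound\<^sup>2 + (bound * (3/2))^2" if "N q = 1" for q
    using order_trans[OF abs_triangle_ineq add_mono[OF b2 b3[OF that]]] .
  have "sphere_integral Qf = sphere_integral (\<lambda>q. (\<kappa> / r)^2 * (ub (r *\<^sub>R q))^2) +
      sphere_integral (\<lambda>q. energy (r *\<^sub>R q) + (- 1) * (gb (r *\<^sub>R q) \<bullet> q)^2)"
    unfolding Qf_def[abs_def] by (rule sphere_integral_add[OF _ b1 _ b4]) measurable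
  also have "sphere_integral (\<lambda>q. energy (r *\<^sub>R q) + (- 1) * (gb (r *\<^sub>R q) \<bullet> q)^2) =
     sphere_integral (\<lambda>q. energy (r *\<^sub>R q)) + sphere_integral (\<lambda>q. (- 1) * (gb (r *\<^sub>R q) \<bullet> q)^2)"
    by (rule sphere_integral_add[OF _ b2 _ b3]) measurable
  finally show ?thesis unfolding sphere_integral_cmult by (simp add: mass_def sphere_energy_def radial_def)
qed

text \<open>The energy density of the extension is homogeneous of degree
  \<open>2 * \<kappa> - 2\<close>, so the radial integral is that of a pure power with exponent
  \<open>real m - 3 + 2 * \<kappa>\<close>; this is the origin of the denominator.\<close>

private lemma gA_integral:
  "(LBINT x. indicator {x. N x < r} x * gA x) = r ^ m / (real m - 2 + 2 * \<kappa>) * sphere_integral Qf"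
proof -
  have m1: "m \<ge> 1" using m_pos by simp
  have e: "real m - 2 + 2 * \<kappa> > 0" using m1 \<kappa> by linarith
  define a where "a = real m - 1 + (2 * \<kappa> - 2)"
  have a: "a > -1" "a + 1 = real m - 2 + 2 * \<kappa>" using e by (auto simp: a_def)
  have "(LBINT x. indicator {x. N x < r} x * gA x) =
     (LBINT s. indicator {0<..<r} s * (s ^ (DIM('n point) - 1) * sphere_integral (\<lambda>q. gA (s *\<^sub>R q))))"
    by (rule polar_integral(2)[OF gA_measurable gA_bounds])
  also have "\<dots> = (LBINT s. indicator {0..r} s *\<^sub>R (s powr a) * (r powr (2 - 2 * \<kappa>) * sphere_integral Qf))"
  proof (rule integral_cong_AE)
    have "AE s in lborel. s \<noteq> 0 \<and> s \<noteq> r" using AE_lborel_singleton[of 0] AE_lborel_singleton[of r] by eventually_elim simp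
    then show "AE s in lborel. indicator {0<..<r} s * (s ^ (DIM('n point) - 1) * sphere_integral (\<lambda>q. gA (s *\<^sub>R q))) =
       indicator {0..r} s *\<^sub>R (s powr a) * (r powr (2 - 2 * \<kappa>) * sphere_integral Qf)"
    proof eventually_elim
      case (elim s)
      show ?case
      proof (cases "s \<in> {0<..<r}")
        case True
        then have s: "0 < s" by simp
        have "sphere_integral (\<lambda>q. gA (s *\<^sub>R q)) = sphere_integral (\<lambda>q. (s / r) powr (2 * \<kappa> - 2) * Qf q)"
          by (rule sphere_integral_cong) (rule gA_homogeneous[OF _ s])
        then have "sphere_integral (\<lambda>q. gA (s *\<^sub>R q)) = (s / r) powr (2 * \<kappa> - 2) * sphere_integral Qf"
          by (simp only: sphere_integral_cmult)
        moreover have "s ^ (DIM('n point) - 1) * (s / r) powr (2 * \<kappa> - 2) = s powr a * r powr (2 - 2 * \<kappa>)"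
        proof -
          have "s ^ (DIM('n point) - 1) = s powr (real m - 1)"
            using s m1 by (simp add: powr_realpow[symmetric] m_def)
          moreover have "(s / r) powr (2 * \<kappa> - 2) = s powr (2 * \<kappa> - 2) * r powr (2 - 2 * \<kappa>)"
            using s r by (simp add: powr_divide powr_minus_divide[symmetric] divide_powr_uminus)
          moreover have "s powr a = s powr (real m - 1) * s powr (2 * \<kappa> - 2)" unfolding a_def by (rule powr_add)
          ultimately show ?thesis by (simp only: mult.assoc)
        qed
        ultimately show ?thesis using True by (simp add: mult.assoc[symmetric])
      next
        case False
        then show ?thesis using elim by (auto simp: indicator_def)
      qed
    qed
    show "(\<lambda>s. indicator {0<..<r} s * (s ^ (DIM('n point) - 1) * sphere_integral (\<lambda>q. gA (s *\<^sub>R q)))) \<in> borel_measurable lborel"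
      using polar_integral(1)[OF gA_measurable gA_bounds] by (rule borel_measurable_integrable)
  qed measurable
  also have "\<dots> = (LBINT s. indicator {0..r} s *\<^sub>R (s powr a)) * (r powr (2 - 2 * \<kappa>) * sphere_integral Qf)"
    by (rule integral_mult_left_zero)
  also have "(LBINT s. indicator {0..r} s *\<^sub>R (s powr a)) = r powr (a + 1) / (a + 1)"
  proof -
    have hi: "((\<lambda>s. s powr a) has_integral (r powr (a + 1) / (a + 1))) {0..r}"
      by (rule has_integral_powr_from_0) (use a r in auto)
    have "(\<integral>\<^sup>+s. ennreal (indicator {0..r} s * s powr a) \<partial>lborel) = ennreal (r powr (a + 1) / (a + 1))"
      using nn_integral_has_integral_lebesgue[OF _ hi] by simp
    then show ?thesis
      using integral_eq_nn_integral[of "\<lambda>s. indicator {0..r} s * s powr a" lborel] a(1) r by simp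
  qed
  also have "r powr (a + 1) / (a + 1) * (r powr (2 - 2 * \<kappa>) * sphere_integral Qf) = r ^ m / (real m - 2 + 2 * \<kappa>) * sphere_integral Qf"
  proof -
    have "r powr (a + 1) * r powr (2 - 2 * \<kappa>) = r ^ m"
      using r by (simp add: powr_add[symmetric] a(2) powr_realpow)
    then show ?thesis by (simp add: a(2))
  qed
  finally show ?thesis .
qed

lemma weiss_comparison:
  assumes om: "om r \<le> 1/2"
  shows "(real m - 2 + 2 * \<kappa>) * D r \<le> (1 + 4 * om r) * (r ^ m * ((\<kappa> / r)^2 * mass r + (sphere_energy r - radial r)))"
proof -
  have om0: "0 \<le> om r" using H_nonneg by (simp add: om_def)
  have e: "real m - 2 + 2 * \<kappa> > 0" using m_pos \<kappa> by linarith
  define I where "I = (LBINT x. indicator {x. N x < r} x * gA x)"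
  have int1: "integrable lborel (\<lambda>x. indicator {x. N x < r} x * gA x)"
    by (rule integrableI_bounded_set[where A = "{x. N x < r}" and B = "2 * CP\<^sup>2"])
       (use N_finite gA_bounds in \<open>auto simp: indicator_def\<close>)
  have int2: "integrable lborel (\<lambda>x. indicator {x. N x < r} x * energy x)"
    by (rule integrableI_bounded_set[where A = "{x. N x < r}" and B = "2 * bound\<^sup>2"])
       (use N_finite energy_bounds in \<open>auto simp: indicator_def\<close>)
  have pt: "indicator (half_disc (3/32)) x *\<^sub>R (flux b gu x \<bullet> g\<phi> x) \<le>
     (1 + om r) / 2 * (indicator {x. N x < r} x * gA x) + (- ((1 - om r) / 2)) * (indicator {x. N x < r} x * energy x)" for x
  proof (cases "x \<in> upper \<and> N x < r")
    case True
    then have x: "x \<in> upper" "N x \<le> r" by auto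
    have xd: "x \<in> half_disc (3/32)" using gauge_disc[of x] x r by auto
    have xb: "x \<in> half_ball 0 (1/10)" using xd half_disc_sub[of "3/32"] by auto
    have g: "gb x = gu x" using gb_eq[of x] x r by auto
    have "2 * ((b x *v gu x) \<bullet> gv x) \<le> gu x \<bullet> (b x *v gu x) + gv x \<bullet> (b x *v gv x)"
      using b_cauchy_schwarz[OF xb, of 1 1 "gu x" "gv x"] by simp
    moreover have "flux b gu x \<bullet> (gv x - gu x) = (b x *v gu x) \<bullet> gv x - gu x \<bullet> (b x *v gu x)"
      by (simp add: flux_def inner_diff_right inner_commute)
    ultimately have "2 * (flux b gu x \<bullet> (gv x - gu x)) \<le> gv x \<bullet> (b x *v gv x) - gu x \<bullet> (b x *v gu x)" by simp
    moreover have "gv x \<bullet> (b x *v gv x) \<le> (1 + om r) * gA x"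
      using frozen_form[OF x r, of "gv x"] by (simp add: gA_def algebra_simps)
    moreover have "(1 - om r) * energy x \<le> gu x \<bullet> (b x *v gu x)"
      using frozen_form[OF x r, of "gu x"] by (simp add: energy_def g algebra_simps)
    ultimately have "2 * (flux b gu x \<bullet> (gv x - gu x)) \<le> (1 + om r) * gA x - (1 - om r) * energy x" by linarith
    then show ?thesis using True xd by (simp add: g\<phi>_def g field_simps)
  next
    case False
    have z: "g\<phi> x = 0" "indicator {x. N x < r} x * gA x = 0" "indicator {x. N x < r} x * energy x = 0"
      using False gv_outside[of x] gb_outside[of x] by (auto simp: g\<phi>_def gA_def energy_def indicator_def)
    show ?thesis unfolding z by simp
  qed
  have m1: "(\<lambda>x. indicator (half_disc (3/32)) x *\<^sub>R flux b gu x) \<in> borel_measurable borel"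
    by (rule borel_measurable_continuous_on_indicator) (auto intro: flux_cont')
  have g\<phi>m: "g\<phi> \<in> borel_measurable borel" unfolding g\<phi>_def[abs_def] by measurable
  obtain CF where CF: "\<And>x. x \<in> half_disc (3/32) \<Longrightarrow> norm (flux b gu x) \<le> CF" "CF > 0"
    using compact_imp_bounded[OF compact_continuous_image[OF flux_cont' compact_half_disc[of "3/32"]]]
    unfolding bounded_pos by auto
  have int0: "integrable lborel (\<lambda>x. indicator (half_disc (3/32)) x *\<^sub>R (flux b gu x \<bullet> g\<phi> x))"
  proof (rule integrable_bounded_on[where A = "half_disc (3/32)" and B = "CF * (CP + bound)"])
    have "(\<lambda>x. (indicator (half_disc (3/32)) x *\<^sub>R flux b gu x) \<bullet> g\<phi> x) \<in> borel_measurable lborel"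
      using m1 g\<phi>m by measurable
    then show "(\<lambda>x. indicator (half_disc (3/32)) x *\<^sub>R (flux b gu x \<bullet> g\<phi> x)) \<in> borel_measurable lborel" by simp
    show "emeasure lborel (half_disc (3/32) :: 'n point set) < \<infinity>"
      using compact_half_disc emeasure_compact_finite by auto
    have "norm (g\<phi> x) \<le> CP + bound" for x
    proof (cases "N x < r")
      case True
      then have "norm (g\<phi> x) \<le> norm (gv x) + norm (gb x)" by (simp add: g\<phi>_def norm_triangle_ineq4)
      also have "\<dots> \<le> CP + bound" using gv_bound[of x] bound(3)[of x] True by (intro add_mono) auto
      finally show ?thesis .
    qed (use CP_pos bound(1) in \<open>simp add: g\<phi>_def\<close>)
    then have "\<bar>flux b gu x \<bullet> g\<phi> x\<bar> \<le> CF * (CP + bound)" if "x \<in> half_disc (3/32)" for x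
      using CF that by (intro order_trans[OF Cauchy_Schwarz_ineq2] mult_mono) (auto simp: less_imp_le)
    then show "\<bar>indicator (half_disc (3/32)) x *\<^sub>R (flux b gu x \<bullet> g\<phi> x)\<bar> \<le> CF * (CP + bound)" if "x \<in> half_disc (3/32)" for x
      using that by simp
  qed auto
  have "0 \<le> (LBINT x. indicator (half_disc (3/32)) x *\<^sub>R (flux b gu x \<bullet> g\<phi> x))" by (rule comparison)
  also have "\<dots> \<le> (LBINT x. (1 + om r) / 2 * (indicator {x. N x < r} x * gA x) + (- ((1 - om r) / 2)) * (indicator {x. N x < r} x * energy x))"
    using pt int0 int1 int2 by (intro integral_mono) auto
  also have "\<dots> = (1 + om r) / 2 * I + (- ((1 - om r) / 2)) * D r"
    unfolding I_def D_def using int1 int2 by (subst Bochner_Integration.integral_add) auto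
  finally have "(1 - om r) * D r \<le> (1 + om r) * I" by (simp add: field_simps)
  moreover have I0: "0 \<le> I" unfolding I_def by (intro Bochner_Integration.integral_nonneg) (simp add: gA_bounds)
  \<comment> \<open>The quotient of the two freezing factors is replaced by one factor linear in
    \<open>om r\<close>; the difference of the two sides is
    \<open>om r * (2 - 4 * om r)\<close>.\<close>
  moreover have "(1 + om r) \<le> (1 + 4 * om r) * (1 - om r)"
  proof -
    have "0 \<le> om r * (2 - 4 * om r)" using om om0 by (intro mult_nonneg_nonneg) auto
    then show ?thesis by (simp add: algebra_simps)
  qed
  ultimately have "(1 - om r) * D r \<le> (1 - om r) * ((1 + 4 * om r) * I)"
    using mult_right_mono[of "1 + om r" "(1 + 4 * om r) * (1 - om r)" I] by (simp add: mult_ac)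
  then have "D r \<le> (1 + 4 * om r) * I" using om by (simp add: mult_le_cancel_left)
  then have "(real m - 2 + 2 * \<kappa>) * D r \<le> (real m - 2 + 2 * \<kappa>) * ((1 + 4 * om r) * I)"
    using e by (intro mult_left_mono) auto
  also have "\<dots> = (1 + 4 * om r) * (r ^ m * sphere_integral Qf)" using e unfolding I_def gA_integral by simp
  finally show ?thesis unfolding Qf_integral .
qed

end

end

section \<open>The Weiss energy\<close>

text \<open>The data abstract the quantities of the Weiss formula: \<open>M\<close> and \<open>D\<close> are the sphere mass and the
  Dirichlet energy, \<open>Y\<close> is half the derivative of \<open>M\<close>, \<open>E\<close> and \<open>X\<close> are the full and the radial energy on
  the sphere.\<close>

definition weiss_bound :: "nat \<Rightarrow> real \<Rightarrow> real \<Rightarrow> real \<Rightarrow> real \<Rightarrow> real \<Rightarrow> real" where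
  "weiss_bound m k \<gamma> h r1 K = exp (4 * (real m + 2 * k) * h / \<gamma>) *
     (r1 powr (- (real m - 2 + 2 * k)) * K + 8 * (real m + 2 * k) * h * k / \<gamma> * (r1 powr (- 2 * k) * K))"

locale weiss_system =
  fixes M D Y E X :: "real \<Rightarrow> real" and m :: nat and \<kappa> k \<gamma> h r1 :: real
  assumes M_derivative: "\<And>r. 0 < r \<Longrightarrow> r \<le> r1 \<Longrightarrow> (M has_real_derivative 2 * Y r) (at r)"
    and D_derivative: "\<And>r. 0 < r \<Longrightarrow> r \<le> r1 \<Longrightarrow> (D has_real_derivative r ^ (m - 1) * E r) (at r)"
    and M_nonneg: "\<And>r. 0 \<le> M r" and D_nonneg: "\<And>r. 0 \<le> D r"
    and square: "\<And>r t. 0 < r \<Longrightarrow> r \<le> r1 \<Longrightarrow> 0 \<le> X r - 2 * t * Y r + t\<^sup>2 * M r"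
    and energy_comparison: "\<And>r. 0 < r \<Longrightarrow> r \<le> r1 \<Longrightarrow>
      (real m - 2 + 2 * \<kappa>) * D r \<le> (1 + 4 * (h * r powr \<gamma>)) * (r ^ m * ((\<kappa> / r)^2 * M r + (E r - X r)))"
    and m: "1 \<le> m" and \<kappa>: "1 \<le> \<kappa>" "\<kappa> \<le> k" and \<gamma>: "0 < \<gamma>" and h: "0 \<le> h"
    and r1: "0 < r1" "r1 < 1" and small: "4 * (8 * (real m + 2 * k) * h * k / \<gamma>) * r1 powr \<gamma> \<le> \<gamma>"
begin

text \<open>\<open>c\<close> bounds four times the comparison error times the scaling exponent
  \<open>a\<close>; the exponential factor in \<open>P\<close> compensates the part of this error
  proportional to \<open>W\<close>. The rest is a multiple of \<open>\<kappa> * g\<close>,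
  compensated by the term with \<open>\<beta>\<close>. The relation
  \<open>\<beta> * \<gamma> = 2 * c * k\<close> is twice what this rest needs: the other half pays
  for differentiating \<open>g\<close> in the correction itself.\<close>

definition "c = 4 * (real m + 2 * k) * h"
definition "\<beta> = 8 * (real m + 2 * k) * h * k / \<gamma>"
definition "a = real m - 2 + 2 * \<kappa>"
definition "g r = r powr (- 2 * \<kappa>) * M r"
definition "g' r = 2 * r powr (- 2 * \<kappa>) * (Y r - \<kappa> / r * M r)"
definition "W r = r powr (- a) * D r - \<kappa> * g r"
text \<open>In the application this is, up to the power of \<open>r\<close>, the sphere integral of
  the square of the radial derivative of \<open>u\<close> minus \<open>\<kappa> / r\<close> times
  \<open>u\<close>; it measures the deviation from homogeneity of degree
  \<open>\<kappa>\<close>.\<close>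

definition "Q r = r powr (2 - 2 * \<kappa>) * (X r - 2 * (\<kappa> / r) * Y r + (\<kappa> / r)^2 * M r)"
definition "W' r = r powr (- a) * (r ^ (m - 1) * E r) - a * r powr (- a - 1) * D r - \<kappa> * g' r"
definition "V r = W r + \<beta> * r powr \<gamma> * g r"
definition "V' r = W' r + (\<beta> * (\<gamma> * r powr (\<gamma> - 1)) * g r + \<beta> * r powr \<gamma> * g' r)"
definition "P r = exp (c / \<gamma> * r powr \<gamma>) * V r"
definition "P' r = exp (c / \<gamma> * r powr \<gamma>) * (c * r powr (\<gamma> - 1) * V r + V' r)"

lemma constants: "0 \<le> c" "0 \<le> \<beta>" "0 < a" "\<beta> * \<gamma> = 2 * c * k" "a * h * 4 \<le> c" "a \<le> real m - 2 + 2 * k"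
proof -
  have k: "1 \<le> k" using \<kappa> by simp
  show "0 \<le> c" unfolding c_def using k h by (intro mult_nonneg_nonneg) auto
  show "0 \<le> \<beta>" unfolding \<beta>_def using k h \<gamma> by (intro divide_nonneg_nonneg mult_nonneg_nonneg) auto
  show "0 < a" unfolding a_def using m \<kappa> by linarith
  show "\<beta> * \<gamma> = 2 * c * k" using \<gamma> by (simp add: \<beta>_def c_def)
  have "a \<le> real m + 2 * k" using \<kappa> by (simp add: a_def)
  from mult_right_mono[OF this h] show "a * h * 4 \<le> c" by (simp add: c_def algebra_simps)
  show "a \<le> real m - 2 + 2 * k" using \<kappa> by (simp add: a_def)
qed

context
  fixes r :: real assumes r: "0 < r" "r \<le> r1"
begin

lemma g_derivative: "(g has_real_derivative g' r) (at r)"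
proof -
  have "((\<lambda>r. r powr (- 2 * \<kappa>) * M r) has_real_derivative
      (- 2 * \<kappa> * r powr (- 2 * \<kappa> - 1)) * M r + 2 * Y r * r powr (- 2 * \<kappa>)) (at r)"
    by (rule DERIV_mult[OF has_real_derivative_powr[OF r(1)] M_derivative[OF r]])
  moreover have "r powr (- 2 * \<kappa> - 1) = r powr (- 2 * \<kappa>) / r" using r by (simp add: powr_diff)
  ultimately show ?thesis unfolding g_def[abs_def] g'_def by (simp add: algebra_simps)
qed

lemma W_derivative: "(W has_real_derivative W' r) (at r)"
proof -
  have "((\<lambda>r. r powr (- a) * D r) has_real_derivative
      (- a * r powr (- a - 1)) * D r + (r ^ (m - 1) * E r) * r powr (- a)) (at r)"
    by (rule DERIV_mult[OF has_real_derivative_powr[OF r(1)] D_derivative[OF r]])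
  from DERIV_diff[OF this DERIV_cmult[OF g_derivative, of \<kappa>]]
  show ?thesis unfolding W_def[abs_def] W'_def by (simp add: algebra_simps)
qed

lemma V_derivative: "(V has_real_derivative V' r) (at r)"
proof -
  have "((\<lambda>r. \<beta> * r powr \<gamma> * g r) has_real_derivative
      (\<beta> * (\<gamma> * r powr (\<gamma> - 1))) * g r + g' r * (\<beta> * r powr \<gamma>)) (at r)"
    by (rule DERIV_mult[OF DERIV_cmult[OF has_real_derivative_powr[OF r(1)]] g_derivative])
  from DERIV_add[OF W_derivative this]
  show ?thesis unfolding V_def[abs_def] V'_def by (simp add: mult_ac)
qed

lemma P_derivative: "(P has_real_derivative P' r) (at r)"
proof -
  have "((\<lambda>r. c / \<gamma> * r powr \<gamma>) has_real_derivative c / \<gamma> * (\<gamma> * r powr (\<gamma> - 1))) (at r)"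
    by (rule DERIV_cmult[OF has_real_derivative_powr[OF r(1)]])
  then have "((\<lambda>r. c / \<gamma> * r powr \<gamma>) has_real_derivative c * r powr (\<gamma> - 1)) (at r)" using \<gamma> by simp
  from DERIV_mult[OF DERIV_fun_exp[OF this] V_derivative]
  show ?thesis unfolding P_def[abs_def] P'_def by (simp add: algebra_simps)
qed

lemma Q_nonneg: "0 \<le> Q r"
  unfolding Q_def using square[OF r, of "\<kappa> / r"] by (simp add: zero_le_mult_iff)

lemma g_nonneg: "0 \<le> g r"
  unfolding g_def using M_nonneg[of r] by (simp add: zero_le_mult_iff)

lemma W_lower: "- (\<kappa> * g r) \<le> W r"
  unfolding W_def using D_nonneg[of r] by (simp add: zero_le_mult_iff)

text \<open>The derivative of \<open>g\<close> pairs \<open>u\<close> with its deviation from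
  homogeneity. The assumption \<open>square\<close> at the two points
  \<open>(\<kappa> + e) / r\<close> and \<open>(\<kappa> - e) / r\<close> is the weighted
  Cauchy-Schwarz inequality for this pairing.\<close>

lemma g'_bound:
  assumes e: "0 < e"
  shows "r * \<bar>g' r\<bar> \<le> e * g r + Q r / e"
proof -
  define q where "q = X r - 2 * (\<kappa> / r) * Y r + (\<kappa> / r)^2 * M r"
  have 1: "r * g' r = r powr (- 2 * \<kappa>) * (2 * r * Y r - 2 * \<kappa> * M r)"
  proof -
    have "r * (Y r - \<kappa> / r * M r) = r * Y r - \<kappa> * M r" using r by (simp add: right_diff_distrib)
    moreover have "r * (2 * p * z) = 2 * p * (r * z)" for p z :: real by simp
    ultimately have "r * g' r = 2 * r powr (- 2 * \<kappa>) * (r * Y r - \<kappa> * M r)" unfolding g'_def by simp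
    moreover have "2 * p * (r * Y r - \<kappa> * M r) = p * (2 * r * Y r - 2 * \<kappa> * M r)" for p by (simp add: algebra_simps)
    ultimately show ?thesis by simp
  qed
  have Q: "Q r = r powr (- 2 * \<kappa>) * (r\<^sup>2 * q)"
  proof -
    have "r powr (2 - 2 * \<kappa>) = r powr (- 2 * \<kappa>) * r\<^sup>2" using powr_add[of r 2 "- 2 * \<kappa>"] r by simp
    then show ?thesis by (simp add: Q_def q_def)
  qed
  have "0 \<le> r\<^sup>2 * (X r - 2 * ((\<kappa> + s * e) / r) * Y r + ((\<kappa> + s * e) / r)^2 * M r)" for s
    by (rule mult_nonneg_nonneg[OF zero_le_power2 square[OF r]])
  moreover have "r\<^sup>2 * (X r - 2 * ((\<kappa> + s * e) / r) * Y r + ((\<kappa> + s * e) / r)^2 * M r) =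
      r\<^sup>2 * q - s * e * (2 * r * Y r - 2 * \<kappa> * M r) + s\<^sup>2 * e\<^sup>2 * M r" for s
    using r by (simp add: q_def power2_eq_square field_simps)
  ultimately have "0 \<le> r\<^sup>2 * q - s * e * (2 * r * Y r - 2 * \<kappa> * M r) + s\<^sup>2 * e\<^sup>2 * M r" for s by metis
  from this[of 1] this[of "-1"]
  have "e * \<bar>2 * r * Y r - 2 * \<kappa> * M r\<bar> \<le> r\<^sup>2 * q + e\<^sup>2 * M r"
    by (cases "0 \<le> 2 * r * Y r - 2 * \<kappa> * M r") (simp_all add: abs_if mult_less_0_iff algebra_simps)
  then have "\<bar>2 * r * Y r - 2 * \<kappa> * M r\<bar> \<le> (r\<^sup>2 * q + e\<^sup>2 * M r) / e" using e by (simp add: pos_le_divide_eq mult.commute)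
  also have "\<dots> = e * M r + r\<^sup>2 * q / e" using e by (simp add: field_simps power2_eq_square)
  finally have "r powr (- 2 * \<kappa>) * \<bar>2 * r * Y r - 2 * \<kappa> * M r\<bar> \<le> r powr (- 2 * \<kappa>) * (e * M r + r\<^sup>2 * q / e)"
    by (intro mult_left_mono) auto
  moreover have "r * \<bar>g' r\<bar> = \<bar>r * g' r\<bar>" using r by (simp add: abs_mult)
  ultimately show ?thesis unfolding 1 Q g_def by (simp add: abs_mult distrib_left mult_ac)
qed

text \<open>With \<open>x\<close> the energy of the extension and \<open>y\<close> that of
  \<open>u\<close>, both suitably scaled, the derivative formula reads
  \<open>r * W' r = x - y + Q r\<close>. The comparison gives nonnegativity of \<open>x - y\<close>
  up to \<open>4 * w * y\<close>, and \<open>y\<close> is \<open>a\<close> times the Dirichlet part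
  \<open>W r + \<kappa> * g r\<close>.\<close>

lemma W'_lower: "Q r - c * r powr \<gamma> * (W r + \<kappa> * g r) \<le> r * W' r"
proof -
  define x y where "x = r powr (2 - 2 * \<kappa>) * ((\<kappa> / r)^2 * M r + (E r - X r))" and "y = a * (r powr (- a) * D r)"
  define w where "w = h * r powr \<gamma>"
  have w: "0 \<le> w" using h by (simp add: w_def)
  have y0: "0 \<le> y" unfolding y_def using constants(3) D_nonneg[of r] by (intro mult_nonneg_nonneg) auto
  have rm: "r powr (- a) * r ^ m = r powr (2 - 2 * \<kappa>)"
    using powr_add[of r "- a" "real m"] r by (simp add: a_def powr_realpow)
  have rm1: "r * (r powr (- a) * r ^ (m - 1)) = r powr (2 - 2 * \<kappa>)"
    using rm m by (cases m) (auto simp: mult_ac)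
  have "r powr (- a) * (a * D r) \<le> r powr (- a) * ((1 + 4 * w) * (r ^ m * ((\<kappa> / r)^2 * M r + (E r - X r))))"
    using energy_comparison[OF r] by (intro mult_left_mono) (auto simp: a_def w_def)
  also have "\<dots> = (1 + 4 * w) * ((r powr (- a) * r ^ m) * ((\<kappa> / r)^2 * M r + (E r - X r)))" by (simp only: mult_ac)
  finally have 1: "y \<le> (1 + 4 * w) * x" unfolding rm by (simp add: y_def x_def mult_ac)
  \<comment> \<open>For every nonnegative \<open>w\<close> the product of \<open>1 + 4 * w\<close>
    and \<open>1 - 4 * w\<close> is at most 1, which replaces division by
    \<open>1 + 4 * w\<close>.\<close>
  have 2: "y - 4 * w * y \<le> x"
  proof (rule ccontr)
    assume "\<not> y - 4 * w * y \<le> x"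
    then have "(1 + 4 * w) * x < (1 + 4 * w) * (y - 4 * w * y)" using w by (intro mult_strict_left_mono) auto
    with 1 have "y < y - 16 * (w * w * y)" by (simp add: algebra_simps)
    moreover have "0 \<le> w * w * y" using w y0 by simp
    ultimately show False by linarith
  qed
  have "r * W' r = x - y + Q r"
  proof -
    have "r * W' r = r * (r powr (- a) * r ^ (m - 1)) * E r - a * (r * r powr (- a - 1)) * D r - \<kappa> * (r * g' r)"
      by (simp add: W'_def algebra_simps)
    also have "r * r powr (- a - 1) = r powr (- a)" using r by (simp add: powr_diff)
    finally have 3: "r * W' r = r powr (2 - 2 * \<kappa>) * E r - y - \<kappa> * (r * g' r)" unfolding rm1 by (simp add: y_def)
    have "r powr (2 - 2 * \<kappa>) = r\<^sup>2 * r powr (- 2 * \<kappa>)" using powr_add[of r 2 "- 2 * \<kappa>"] r by simp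
    then have s: "r powr (- 2 * \<kappa>) = r powr (2 - 2 * \<kappa>) / r\<^sup>2" using r by simp
    have "\<kappa> * (r * (2 * (p / r\<^sup>2) * (Y r - \<kappa> / r * M r))) = p * (2 * (\<kappa> / r) * Y r - 2 * (\<kappa> / r)^2 * M r)" for p
      using r by (simp add: power2_eq_square field_simps)
    then have 4: "\<kappa> * (r * g' r) = r powr (2 - 2 * \<kappa>) * (2 * (\<kappa> / r) * Y r - 2 * (\<kappa> / r)^2 * M r)"
      unfolding g'_def s .
    show ?thesis unfolding 3 4 x_def Q_def by (simp add: algebra_simps)
  qed
  moreover have "4 * w * y \<le> c * r powr \<gamma> * (W r + \<kappa> * g r)"
  proof -
    have "4 * w * y = (a * h * 4) * (r powr \<gamma> * (r powr (- a) * D r))" by (simp add: w_def y_def)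
    also have "\<dots> \<le> c * (r powr \<gamma> * (r powr (- a) * D r))"
      using constants(5) D_nonneg[of r] by (intro mult_right_mono) auto
    finally show ?thesis by (simp add: W_def mult_ac)
  qed
  ultimately show ?thesis using 2 by linarith
qed

text \<open>The derivative of the correction supplies \<open>\<beta> * \<gamma> * p * g r\<close>.
  One half absorbs the coefficient error \<open>c * p * (\<kappa> * g r)\<close>, the other the
  \<open>g\<close>-part of \<open>g'_bound\<close> with \<open>e = \<gamma> / 2\<close>. The
  \<open>Q\<close>-part of that bound costs at most half of \<open>Q r\<close>, by the smallness of
  \<open>r1\<close>.\<close>

lemma P'_lower: "Q r / 2 \<le> r * P' r"
proof -
  have g0: "0 \<le> g r" by (rule g_nonneg)
  have Q0: "0 \<le> Q r" by (rule Q_nonneg)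
  define p where "p = r powr \<gamma>"
  have p0: "0 \<le> p" by (simp add: p_def)
  have rp: "r * r powr (\<gamma> - 1) = p" using r by (simp add: p_def powr_diff)
  have "p \<le> r1 powr \<gamma>" unfolding p_def using r \<gamma> by (intro powr_mono2) auto
  then have "4 * \<beta> * p \<le> 4 * \<beta> * r1 powr \<gamma>" using constants(2) by (intro mult_left_mono) auto
  then have bp: "4 * (\<beta> * p) \<le> \<gamma>" using small by (simp add: \<beta>_def)
  have "\<beta> * p * (r * \<bar>g' r\<bar>) \<le> \<beta> * p * (\<gamma> / 2 * g r + Q r / (\<gamma> / 2))"
    using g'_bound[of "\<gamma> / 2"] \<gamma> p0 constants(2) by (intro mult_left_mono mult_nonneg_nonneg) auto
  moreover have "\<beta> * p * (Q r / (\<gamma> / 2)) \<le> Q r / 2"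
  proof -
    have "4 * (\<beta> * p) * Q r \<le> \<gamma> * Q r" using bp Q0 by (rule mult_right_mono)
    then show ?thesis using \<gamma> by (simp add: field_simps)
  qed
  moreover have "- (\<beta> * p * (r * \<bar>g' r\<bar>)) \<le> \<beta> * p * (r * g' r)"
  proof -
    have "\<beta> * p * (- (r * \<bar>g' r\<bar>)) \<le> \<beta> * p * (r * g' r)"
      using r p0 constants(2) by (intro mult_left_mono mult_nonneg_nonneg) (auto simp: abs_if)
    then show ?thesis by simp
  qed
  ultimately have 1: "- (\<beta> * p * (\<gamma> / 2 * g r)) - Q r / 2 \<le> \<beta> * p * (r * g' r)" by (simp add: distrib_left)
  have rV': "r * V' r = r * W' r + \<beta> * \<gamma> * p * g r + \<beta> * p * (r * g' r)"
    unfolding V'_def rp[symmetric] by (simp add: p_def rp algebra_simps)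
  have rV: "c * p * W r = c * p * V r - c * p * (\<beta> * p * g r)" by (simp add: V_def p_def algebra_simps)
  have 2: "0 \<le> c * p * (\<beta> * p * g r)" using constants p0 g0 by (intro mult_nonneg_nonneg) auto
  have 3: "c * p * (\<kappa> * g r) \<le> \<beta> * p * (\<gamma> / 2 * g r)"
  proof -
    have "c * p * (\<kappa> * g r) \<le> c * p * (k * g r)"
      using constants(1) p0 g0 \<kappa> by (intro mult_left_mono mult_right_mono mult_nonneg_nonneg) auto
    also have "\<dots> = (\<beta> * \<gamma>) * (p * g r) / 2" unfolding constants(4) by simp
    finally show ?thesis by (simp add: mult_ac)
  qed
  have 4: "Q r - c * p * W r - c * p * (\<kappa> * g r) \<le> r * W' r" using W'_lower by (simp add: p_def algebra_simps)
  have 5: "\<beta> * p * (\<gamma> / 2 * g r) = \<beta> * \<gamma> * p * g r / 2" by simp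
  have "Q r / 2 \<le> c * p * V r + r * V' r" using 1 2 3 4 unfolding rV' 5 rV by linarith
  also have "\<dots> \<le> exp (c / \<gamma> * r powr \<gamma>) * (c * p * V r + r * V' r)"
  proof -
    have "0 \<le> c * p * V r + r * V' r" using Q0 calculation by linarith
    moreover have "1 \<le> exp (c / \<gamma> * r powr \<gamma>)" using constants(1) \<gamma> by simp
    ultimately show ?thesis using mult_right_mono[of 1] by fastforce
  qed
  also have "\<dots> = r * P' r" unfolding P'_def rp[symmetric] by (simp add: algebra_simps)
  finally show ?thesis .
qed

end

lemma P_mono:
  assumes "0 < s" "s \<le> r" "r \<le> r1"
  shows "P s \<le> P r"
proof (rule DERIV_nonneg_imp_nondecreasing[OF assms(2)])
  fix x assume x: "s \<le> x" "x \<le> r"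
  then have x': "0 < x" "x \<le> r1" using assms by auto
  have "0 \<le> x * P' x" using P'_lower[OF x'] Q_nonneg[OF x'] by linarith
  then have "0 \<le> P' x" using x' by (simp add: zero_le_mult_iff)
  then show "\<exists>y. (P has_real_derivative y) (at x) \<and> 0 \<le> y" using P_derivative[OF x'] by blast
qed

text \<open>Monotonicity keeps \<open>P\<close> below its negative value at \<open>r0\<close>, and
  \<open>V r \<ge> - \<kappa> * g r\<close> converts this into a positive lower bound for
  \<open>g\<close>. Bounding the exponential factor by its value at \<open>r1\<close> makes
  \<open>d\<close> independent of \<open>r\<close>.\<close>

lemma mass_lower:
  assumes "0 < r0" "r0 \<le> r1" "P r0 < 0"
  shows "\<exists>d>0. \<forall>r. 0 < r \<and> r \<le> r0 \<longrightarrow> d * r powr (2 * \<kappa>) \<le> M r"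
proof (intro exI conjI allI impI)
  define d where "d = - P r0 / exp (c / \<gamma> * r1 powr \<gamma>) / \<kappa>"
  show "0 < d" using assms(3) \<kappa> by (simp add: d_def divide_less_0_iff)
  fix r assume "0 < r \<and> r \<le> r0"
  then have r: "0 < r" "r \<le> r1" "r \<le> r0" using assms by auto
  have e: "exp (c / \<gamma> * r powr \<gamma>) \<le> exp (c / \<gamma> * r1 powr \<gamma>)"
    using r \<gamma> constants(1) by (intro exp_mono mult_left_mono powr_mono2) auto
  have Pr: "P r \<le> P r0" using P_mono[OF r(1,3) assms(2)] .
  have "- V r = - P r / exp (c / \<gamma> * r powr \<gamma>)" by (simp add: P_def)
  also have "- P r / exp (c / \<gamma> * r powr \<gamma>) \<ge> - P r0 / exp (c / \<gamma> * r1 powr \<gamma>)"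
    using Pr assms(3) e by (intro frac_le) auto
  finally have "d * \<kappa> \<le> - V r" using \<kappa> by (simp add: d_def)
  also have "- V r \<le> \<kappa> * g r"
    using W_lower[OF r(1,2)] mult_nonneg_nonneg[OF mult_nonneg_nonneg[OF constants(2) powr_ge_zero] g_nonneg[OF r(1,2)], of r \<gamma>]
    by (simp add: V_def)
  finally have "d * \<kappa> \<le> g r * \<kappa>" by (simp add: mult.commute)
  then have "d \<le> g r" using \<kappa> by simp
  then have "d * r powr (2 * \<kappa>) \<le> g r * r powr (2 * \<kappa>)" by (intro mult_right_mono) auto
  also have "\<dots> = M r" using r by (simp add: g_def powr_minus)
  finally show "d * r powr (2 * \<kappa>) \<le> M r" .
qed

text \<open>With \<open>T = - ln r\<close> the multiplier \<open>x powr (1 / T)\<close> has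
  logarithmic derivative \<open>1 / (T * x)\<close>, yet lies between \<open>exp (- 1)\<close> and 1
  on the interval from \<open>r\<close> to 1. Its growth absorbs the \<open>g\<close>-part of
  \<open>g'_bound\<close> with \<open>e = 1 / T\<close>, and \<open>2 * T * P\<close> absorbs the
  \<open>Q\<close>-part. This weighting is what costs only one factor of the logarithm.\<close>

lemma mass_upper:
  assumes P: "\<And>r. 0 < r \<Longrightarrow> r \<le> r1 \<Longrightarrow> 0 \<le> P r" and r: "0 < r" "r \<le> r1"
  shows "M r \<le> exp 1 * (g r1 + 2 * \<bar>ln r\<bar> * P r1) * r powr (2 * \<kappa>)"
proof -
  define T where "T = - ln r"
  have T: "0 < T" using r r1 by (simp add: T_def)
  have "r powr (1 / T) * g r + 2 * T * P r \<le> r1 powr (1 / T) * g r1 + 2 * T * P r1"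
  proof (rule DERIV_nonneg_imp_nondecreasing[OF r(2)])
    fix x assume x: "r \<le> x" "x \<le> r1"
    then have x': "0 < x" "x \<le> r1" "x \<le> 1" using r r1 by auto
    have d: "((\<lambda>x. x powr (1 / T) * g x + 2 * T * P x) has_real_derivative
       (1 / T * x powr (1 / T - 1)) * g x + g' x * x powr (1 / T) + 2 * T * P' x) (at x)"
      by (intro DERIV_add DERIV_mult DERIV_cmult has_real_derivative_powr P_derivative g_derivative x')
    define p where "p = x powr (1 / T)"
    have p: "0 \<le> p" "p \<le> 1" using x' T powr_mono2[of "1 / T" x 1] by (auto simp: p_def)
    have "x * ((1 / T * x powr (1 / T - 1)) * g x + g' x * x powr (1 / T) + 2 * T * P' x) =
       p * (1 / T * g x + x * g' x) + 2 * T * (x * P' x)"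
      using x' by (simp add: p_def powr_diff algebra_simps)
    also have "\<dots> \<ge> p * (- (T * Q x)) + 2 * T * (Q x / 2)"
    proof (rule add_mono)
      have "- (x * \<bar>g' x\<bar>) \<le> x * g' x" using x' by (simp add: abs_if)
      moreover have "x * \<bar>g' x\<bar> \<le> 1 / T * g x + T * Q x" using g'_bound[OF x'(1,2), of "1 / T"] T by (simp add: mult.commute)
      ultimately have "- (T * Q x) \<le> 1 / T * g x + x * g' x" by linarith
      then show "p * (- (T * Q x)) \<le> p * (1 / T * g x + x * g' x)" using p by (intro mult_left_mono) auto
      show "2 * T * (Q x / 2) \<le> 2 * T * (x * P' x)" using P'_lower[OF x'(1,2)] T by (intro mult_left_mono) auto
    qed
    also have "p * (- (T * Q x)) + 2 * T * (Q x / 2) = (1 - p) * (T * Q x)" by (simp add: algebra_simps)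
    also have "\<dots> \<ge> 0" using p T Q_nonneg[OF x'(1,2)] by (intro mult_nonneg_nonneg) auto
    finally have "0 \<le> (1 / T * x powr (1 / T - 1)) * g x + g' x * x powr (1 / T) + 2 * T * P' x"
      using x' by (simp add: zero_le_mult_iff)
    with d show "\<exists>y. ((\<lambda>x. x powr (1 / T) * g x + 2 * T * P x) has_real_derivative y) (at x) \<and> 0 \<le> y" by blast
  qed
  moreover have "r powr (1 / T) * g r = exp (- 1) * g r" using r T by (simp add: powr_def T_def)
  moreover have "r1 powr (1 / T) * g r1 \<le> 1 * g r1"
    using r1 T g_nonneg[OF r1(1) order_refl] powr_mono2[of "1 / T" r1 1] by (intro mult_right_mono) auto
  moreover have "0 \<le> 2 * T * P r" using P[OF r] T by simp
  ultimately have "exp (- 1) * g r \<le> g r1 + 2 * T * P r1" by linarith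
  then have "exp 1 * (exp (- 1) * g r) \<le> exp 1 * (g r1 + 2 * T * P r1)" by (rule mult_left_mono) simp
  then have "g r \<le> exp 1 * (g r1 + 2 * T * P r1)" by (simp add: mult.assoc[symmetric] exp_add[symmetric])
  then have "g r * r powr (2 * \<kappa>) \<le> exp 1 * (g r1 + 2 * T * P r1) * r powr (2 * \<kappa>)" by (rule mult_right_mono) simp
  moreover have "g r * r powr (2 * \<kappa>) = M r" using r by (simp add: g_def powr_minus)
  moreover have "T = \<bar>ln r\<bar>" using T by (simp add: T_def)
  ultimately show ?thesis by simp
qed

text \<open>As \<open>r1 < 1\<close>, the negative powers of \<open>r1\<close> are largest at
  \<open>\<kappa> = k\<close>, so the bounds do not depend on \<open>\<kappa>\<close>.\<close>

lemma initial_bounds: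
  assumes "M r1 \<le> K" "D r1 \<le> K"
  shows "g r1 \<le> r1 powr (- 2 * k) * K"
    and "P r1 \<le> weiss_bound m k \<gamma> h r1 K"
proof -
  have K: "0 \<le> K" using assms M_nonneg[of r1] by linarith
  show g1: "g r1 \<le> r1 powr (- 2 * k) * K"
    unfolding g_def by (rule mult_mono[OF powr_mono']) (use assms(1) M_nonneg[of r1] r1 \<kappa> K in auto)
  have "r1 powr (- a) * D r1 \<le> r1 powr (- (real m - 2 + 2 * k)) * K"
    by (rule mult_mono[OF powr_mono']) (use assms(2) D_nonneg[of r1] r1 constants(6) in auto)
  then have W: "W r1 \<le> r1 powr (- (real m - 2 + 2 * k)) * K"
    unfolding W_def using \<kappa> g_nonneg[OF r1(1) order_refl] by (smt (verit) mult_nonneg_nonneg)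
  have r\<gamma>: "r1 powr \<gamma> \<le> 1" using r1 \<gamma> powr_mono2[of \<gamma> r1 1] by simp
  have "\<beta> * r1 powr \<gamma> * g r1 \<le> \<beta> * 1 * (r1 powr (- 2 * k) * K)"
    using constants(2) r\<gamma> g1 g_nonneg[OF r1(1) order_refl] by (intro mult_mono) auto
  then have V: "V r1 \<le> r1 powr (- (real m - 2 + 2 * k)) * K + \<beta> * (r1 powr (- 2 * k) * K)"
    unfolding V_def using W by simp
  have e: "exp (c / \<gamma> * r1 powr \<gamma>) \<le> exp (c / \<gamma>)"
    using mult_left_mono[OF r\<gamma>, of "c / \<gamma>"] constants(1) \<gamma> by simp
  show "P r1 \<le> weiss_bound m k \<gamma> h r1 K" unfolding P_def weiss_bound_def c_def[symmetric] \<beta>_def[symmetric]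
    by (rule order_trans[OF mult_left_mono[OF V] mult_right_mono[OF e]]) (use K constants(2) in auto)
qed

lemma dichotomy:
  assumes K: "M r1 \<le> K" "D r1 \<le> K"
  shows "(\<exists>d>0. \<exists>r0>0. \<forall>r. 0 < r \<and> r \<le> r0 \<longrightarrow> d * r powr (2 * \<kappa>) \<le> M r) \<or>
    (\<forall>r. 0 < r \<and> r \<le> r1 \<longrightarrow>
      M r \<le> exp 1 * (r1 powr (- 2 * k) * K + 2 * \<bar>ln r\<bar> * weiss_bound m k \<gamma> h r1 K) * r powr (2 * \<kappa>))"
proof (cases "\<exists>r0. 0 < r0 \<and> r0 \<le> r1 \<and> P r0 < 0")
  case True
  then obtain r0 where r0: "0 < r0" "r0 \<le> r1" "P r0 < 0" by blast
  from mass_lower[OF this] r0(1) show ?thesis by blast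
next
  case False
  then have P: "0 \<le> P r" if "0 < r" "r \<le> r1" for r using that by force
  show ?thesis
  proof (intro disjI2 allI impI)
    fix r assume r: "0 < r \<and> r \<le> r1"
    have "M r \<le> exp 1 * (g r1 + 2 * \<bar>ln r\<bar> * P r1) * r powr (2 * \<kappa>)" using mass_upper P r by blast
    also have "\<dots> \<le> exp 1 * (r1 powr (- 2 * k) * K + 2 * \<bar>ln r\<bar> * weiss_bound m k \<gamma> h r1 K) * r powr (2 * \<kappa>)"
      using initial_bounds[OF K] by (intro mult_right_mono mult_left_mono add_mono) auto
    finally show "M r \<le> exp 1 * (r1 powr (- 2 * k) * K + 2 * \<bar>ln r\<bar> * weiss_bound m k \<gamma> h r1 K) * r powr (2 * \<kappa>)" .
  qed
qed

end

text \<open>The first summand bounds the Dirichlet energy, the second the sphere mass, both at gauge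
  radii up to \<open>1/40\<close>.\<close>

definition initial_const :: "nat \<Rightarrow> real" where
  "initial_const m = 400000 + real m * (sup_const m / (9/100) ^ m * 3 ^ m)"

text \<open>The factors \<open>2 ^ m\<close> and \<open>4 powr (2 * k)\<close> arise from bounding
  \<open>u\<close> on radius \<open>r\<close> by its integral over the disc of radius
  \<open>2 * r\<close> and then over the gauge ball of radius \<open>4 * r\<close>.\<close>

definition growth_const :: "nat \<Rightarrow> real \<Rightarrow> real \<Rightarrow> real \<Rightarrow> real \<Rightarrow> real" where
  "growth_const m k \<gamma> h r1 = sup_const m * 2 ^ m * 4 powr (2 * k) * (exp 1 *
     (r1 powr (- 2 * k) * initial_const m + 4 * weiss_bound m k \<gamma> h r1 (initial_const m)))"

section \<open>From sphere mass to integrals over balls and pointwise bounds\<close>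

context thin_problem
begin

text \<open>The polynomial in \<open>t\<close> is the expanded sphere integral of the square of the
  radial derivative minus \<open>t\<close> times \<open>u\<close>.\<close>

lemma radial_square: "0 \<le> radial r - 2 * t * mass' r + t\<^sup>2 * mass r"
proof -
  have n: "norm q \<le> 3/2" if "N q = 1" for q using norm_le_N[of q] that by simp
  have b0: "\<bar>gb (r *\<^sub>R q) \<bullet> q\<bar> \<le> bound * (3/2)" if "N q = 1" for q
    using bound n[OF that] by (intro order_trans[OF Cauchy_Schwarz_ineq2] mult_mono) (auto simp: less_imp_le)
  have b1: "\<bar>(gb (r *\<^sub>R q) \<bullet> q)^2\<bar> \<le> (bound * (3/2))^2" if "N q = 1" for q
    using power_mono[OF b0[OF that] abs_ge_zero, of 2] by simp
  have b2: "\<bar>(- 2 * t) * (ub (r *\<^sub>R q) * (gb (r *\<^sub>R q) \<bullet> q))\<bar> \<le> \<bar>2 * t\<bar> * (bound * (bound * (3/2)))" if "N q = 1" for q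
    unfolding abs_mult[of "- 2 * t"] abs_mult[of "ub (r *\<^sub>R q)"]
    using bound b0[OF that] by (intro mult_mono) (auto simp: less_imp_le)
  have b3: "\<bar>t\<^sup>2 * (ub (r *\<^sub>R q))^2\<bar> \<le> t\<^sup>2 * bound\<^sup>2" for q
    using power_mono[OF bound(2)[of "r *\<^sub>R q"] abs_ge_zero, of 2] by (simp add: abs_mult mult_left_mono)
  have b4: "\<bar>(- 2 * t) * (ub (r *\<^sub>R q) * (gb (r *\<^sub>R q) \<bullet> q)) + t\<^sup>2 * (ub (r *\<^sub>R q))^2\<bar>
      \<le> \<bar>2 * t\<bar> * (bound * (bound * (3/2))) + t\<^sup>2 * bound\<^sup>2" if "N q = 1" for q
    using order_trans[OF abs_triangle_ineq add_mono[OF b2[OF that] b3]] .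
  have "0 \<le> sphere_integral (\<lambda>q. (gb (r *\<^sub>R q) \<bullet> q - t * ub (r *\<^sub>R q))^2)"
    by (rule sphere_integral_nonneg) simp
  also have "(\<lambda>q. (gb (r *\<^sub>R q) \<bullet> q - t * ub (r *\<^sub>R q))^2) =
      (\<lambda>q. (gb (r *\<^sub>R q) \<bullet> q)^2 + ((- 2 * t) * (ub (r *\<^sub>R q) * (gb (r *\<^sub>R q) \<bullet> q)) + t\<^sup>2 * (ub (r *\<^sub>R q))^2))"
    by (simp add: fun_eq_iff power2_eq_square algebra_simps)
  also have "sphere_integral \<dots> = sphere_integral (\<lambda>q. (gb (r *\<^sub>R q) \<bullet> q)^2) +
      sphere_integral (\<lambda>q. (- 2 * t) * (ub (r *\<^sub>R q) * (gb (r *\<^sub>R q) \<bullet> q)) + t\<^sup>2 * (ub (r *\<^sub>R q))^2)"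
    by (rule sphere_integral_add[OF _ b1 _ b4]) measurable
  also have "sphere_integral (\<lambda>q. (- 2 * t) * (ub (r *\<^sub>R q) * (gb (r *\<^sub>R q) \<bullet> q)) + t\<^sup>2 * (ub (r *\<^sub>R q))^2) =
      sphere_integral (\<lambda>q. (- 2 * t) * (ub (r *\<^sub>R q) * (gb (r *\<^sub>R q) \<bullet> q))) + sphere_integral (\<lambda>q. t\<^sup>2 * (ub (r *\<^sub>R q))^2)"
    by (rule sphere_integral_add[OF _ b2 _ b3]) measurable
  finally show ?thesis unfolding sphere_integral_cmult radial_def mass'_def mass_def by linarith
qed

text \<open>The mass of a gauge ball mediates between sphere masses, by polar coordinates, and
  Euclidean half discs, by the equivalence of gauge and norm.\<close>

definition "J t = (LBINT x. indicator {x. N x < t} x * (ub x)^2)"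

lemma J_polar:
  "integrable lborel (\<lambda>s. indicator {0<..<t} s * (s ^ (m - 1) * mass s))"
  "J t = (LBINT s. indicator {0<..<t} s * (s ^ (m - 1) * mass s))"
proof -
  have f: "(\<lambda>x. (ub x)^2) \<in> borel_measurable borel" by measurable
  have b: "(ub x)^2 \<le> bound\<^sup>2" for x using power_mono[OF bound(2)[of x] abs_ge_zero, of 2] by simp
  from polar_integral[OF f zero_le_power2 b, of t]
  show "integrable lborel (\<lambda>s. indicator {0<..<t} s * (s ^ (m - 1) * mass s))"
    "J t = (LBINT s. indicator {0<..<t} s * (s ^ (m - 1) * mass s))" by (simp_all add: mass_def J_def m_def)
qed

lemma J_le_disc:
  assumes "0 < t" "t < 1/16"
  shows "J t \<le> disc_int (3/2 * t) (\<lambda>x. (u x)^2)" unfolding J_def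
proof (rule integral_mono')
  show "disc_integrable (3/2 * t) (\<lambda>x. (u x)^2)"
    using assms by (intro integrable_on_half_disc continuous_intros u_cont') auto
  fix x
  show "indicator {x. N x < t} x * (ub x)^2 \<le> indicator (half_disc (3/2 * t)) x * (u x)^2"
  proof (cases "x \<in> upper \<and> N x < t")
    case True
    then have "norm x \<le> 3/2 * t" using norm_le_N[of x] by linarith
    then have "x \<in> half_disc (3/2 * t)" using True by (simp add: half_disc_def)
    then show ?thesis using True ub_eq[of x] assms by simp
  next
    case False
    then have z: "indicator {x. N x < t} x * (ub x)^2 = 0" using ub_outside[of x] by auto
    show ?thesis unfolding z by simp
  qed
qed simp

lemma disc_le_J:
  assumes "0 < R" "2 * R < 1/16"
  shows "disc_int R (\<lambda>x. (u x)^2) \<le> J (2 * R)" unfolding J_def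
proof (rule integral_mono')
  have b: "(ub x)^2 \<le> bound\<^sup>2" for x using power_mono[OF bound(2)[of x] abs_ge_zero, of 2] by simp
  show "integrable lborel (\<lambda>x. indicator {x. N x < 2 * R} x * (ub x)^2)"
    by (rule integrableI_bounded_set[where A = "{x. N x < 2 * R}" and B = "bound\<^sup>2"])
       (use N_finite b in \<open>auto simp: indicator_def\<close>)
  fix x
  show "indicator (half_disc R) x * (u x)^2 \<le> indicator {x. N x < 2 * R} x * (ub x)^2"
  proof (cases "x \<in> half_disc R")
    case True
    then have "N x < 2 * R" using N_le_norm[of x] assms by (simp add: half_disc_def)
    then show ?thesis using True ub_eq[of x] assms by (simp add: half_disc_def)
  qed simp
qed simp

text \<open>The radii between \<open>t / 2\<close> and \<open>t\<close> already contribute the full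
  power; on them the integrand is at least its lower bound at \<open>t / 2\<close>.\<close>

lemma J_lower:
  assumes d: "0 < d" "\<And>r. 0 < r \<Longrightarrow> r \<le> r0 \<Longrightarrow> d * r powr (2 * \<kappa>) \<le> mass r"
    and t: "0 < t" "t \<le> r0" and \<kappa>: "1 \<le> \<kappa>"
  shows "d * (t / 2) powr (real m + 2 * \<kappa>) \<le> J t"
proof -
  have "d * (t / 2) powr (real m + 2 * \<kappa>) = (LBINT s. indicator {t/2<..<t} s * ((t / 2) ^ (m - 1) * (d * (t / 2) powr (2 * \<kappa>))))"
  proof -
    have "(LBINT s. indicator {t/2<..<t} s * ((t / 2) ^ (m - 1) * (d * (t / 2) powr (2 * \<kappa>)))) =
       t / 2 * ((t / 2) ^ (m - 1) * (d * (t / 2) powr (2 * \<kappa>)))" using t by simp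
    also have "\<dots> = (t / 2) ^ m * (d * (t / 2) powr (2 * \<kappa>))" using m_pos by (cases m) simp_all
    also have "\<dots> = d * (t / 2) powr (real m + 2 * \<kappa>)" using t by (simp add: powr_add powr_realpow)
    finally show ?thesis by (rule sym)
  qed
  also have "\<dots> \<le> J t" unfolding J_polar(2)
  proof (rule integral_mono'[OF J_polar(1)])
    fix s
    show "indicator {t/2<..<t} s * ((t / 2) ^ (m - 1) * (d * (t / 2) powr (2 * \<kappa>))) \<le> indicator {0<..<t} s * (s ^ (m - 1) * mass s)"
    proof (cases "s \<in> {t/2<..<t}")
      case True
      then have s: "0 < s" "s \<le> r0" "t / 2 \<le> s" using t by auto
      have "d * (t / 2) powr (2 * \<kappa>) \<le> d * s powr (2 * \<kappa>)" using s t d \<kappa> by (intro mult_left_mono powr_mono2) auto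
      also have "\<dots> \<le> mass s" using d(2) s by simp
      finally have "(t / 2) ^ (m - 1) * (d * (t / 2) powr (2 * \<kappa>)) \<le> s ^ (m - 1) * mass s"
        using s t d by (intro mult_mono power_mono) auto
      then show ?thesis using True t by (simp add: indicator_def)
    next
      case False
      then show ?thesis using mass_nonneg[of s] by (simp add: indicator_def)
    qed
    show "0 \<le> indicator {0<..<t} s * (s ^ (m - 1) * mass s)"
      using mass_nonneg[of s] by (simp add: indicator_def)
  qed
  finally show ?thesis .
qed

text \<open>The logarithm of a small radius is compared with the one at \<open>t\<close> by means of
  \<open>ln (t / s) \<le> t / s\<close>. The factor \<open>1 / s\<close> is harmless because the
  exponent \<open>e\<close> is at least 1, so the integrand is at most the constant
  \<open>K\<close>.\<close>

lemma J_upper: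
  assumes a: "0 \<le> a1" "0 \<le> a2" "\<And>r. 0 < r \<Longrightarrow> r \<le> t \<Longrightarrow> mass r \<le> (a1 + a2 * \<bar>ln r\<bar>) * r powr (2 * \<kappa>)"
    and t: "0 < t" "t < 1" and \<kappa>: "1 \<le> \<kappa>"
  shows "J t \<le> t powr (real m + 2 * \<kappa>) * (a1 + a2 + a2 * \<bar>ln t\<bar>)"
proof -
  define e where "e = real m - 1 + 2 * \<kappa>"
  have e: "1 \<le> e" using m_pos \<kappa> by (simp add: e_def)
  define K where "K = t powr e * (a1 + a2 + a2 * \<bar>ln t\<bar>)"
  have K: "0 \<le> K" using a by (simp add: K_def)
  have "J t \<le> (LBINT s. indicator {0<..<t} s * K)" unfolding J_polar(2)
  proof (rule integral_mono')
    show "integrable lborel (\<lambda>s. indicator {0<..<t} s * K)"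
      using t by (intro integrable_mult_left) (simp add: integrable_indicator_iff)
    fix s
    show "0 \<le> indicator {0<..<t} s * K" using K by simp
    show "indicator {0<..<t} s * (s ^ (m - 1) * mass s) \<le> indicator {0<..<t} s * K"
    proof (cases "s \<in> {0<..<t}")
      case True
      then have s: "0 < s" "s \<le> t" by auto
      have "\<bar>ln s\<bar> = \<bar>ln t\<bar> + ln (t / s)" using s t by (simp add: ln_div)
      also have "\<dots> \<le> \<bar>ln t\<bar> + t / s" using s t by (intro add_left_mono less_imp_le ln_less_self) simp
      finally have ls: "\<bar>ln s\<bar> \<le> \<bar>ln t\<bar> + t / s" .
      have "s ^ (m - 1) * mass s \<le> s ^ (m - 1) * ((a1 + a2 * \<bar>ln s\<bar>) * s powr (2 * \<kappa>))"
        using a(3)[OF s] s by (intro mult_left_mono) auto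
      also have "\<dots> = s powr e * (a1 + a2 * \<bar>ln s\<bar>)"
      proof -
        have "s ^ (m - 1) = s powr (real m - 1)" using s m_pos by (simp add: powr_realpow[symmetric])
        then show ?thesis by (simp add: e_def powr_add)
      qed
      also have "\<dots> \<le> s powr e * (a1 + a2 * (\<bar>ln t\<bar> + t / s))"
        using ls a by (intro mult_left_mono add_mono) auto
      also have "\<dots> = s powr e * (a1 + a2 * \<bar>ln t\<bar>) + a2 * (t * s powr (e - 1))"
        using s by (simp add: powr_diff algebra_simps)
      also have "\<dots> \<le> t powr e * (a1 + a2 * \<bar>ln t\<bar>) + a2 * (t * t powr (e - 1))"
        using s e a by (intro add_mono mult_right_mono mult_left_mono powr_mono2 add_nonneg_nonneg mult_nonneg_nonneg) auto
      also have "\<dots> = K" using t by (simp add: K_def powr_diff algebra_simps)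
      finally show ?thesis using True by simp
    qed simp
  qed
  also have "\<dots> = t * K" using t by simp
  also have "\<dots> = t powr (real m + 2 * \<kappa>) * (a1 + a2 + a2 * \<bar>ln t\<bar>)"
  proof -
    have "t powr (real m + 2 * \<kappa>) = t powr (1 + e)" by (simp add: e_def)
    also have "\<dots> = t * t powr e" using t by (simp add: powr_add)
    finally show ?thesis by (simp add: K_def)
  qed
  finally show ?thesis .
qed

context
  assumes normalized: "disc_int (9/100) (\<lambda>x. (u x)^2) \<le> 1"
begin

text \<open>Caccioppoli's inequality between the radii \<open>3/80 = 3/2 * 1/40\<close> and
  \<open>9/100\<close>, with the upper bound 2 of the matrix; the resulting number is just below
  400000.\<close>

lemma D_bound:
  assumes "0 < r" "r \<le> 1/40"
  shows "D r \<le> 400000"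
proof -
  have c: "continuous_on (half_disc (3/80)) gu" by (rule gu_cont') simp
  have "D r \<le> (LBINT x. 2 * (indicator (half_disc (3/80)) x * (norm (gu x))^2))" unfolding D_def
  proof (rule integral_mono')
    show "integrable lborel (\<lambda>x. 2 * (indicator (half_disc (3/80)) x * (norm (gu x))^2))"
      by (intro integrable_mult_right integrable_on_half_disc continuous_intros c)
    fix x
    show "indicator {x. N x < r} x * energy x \<le> 2 * (indicator (half_disc (3/80)) x * (norm (gu x))^2)"
    proof (cases "x \<in> upper \<and> N x < r")
      case True
      then have "norm x \<le> 3/80" using norm_le_N[of x] assms by linarith
      then have "x \<in> half_disc (3/80)" using True by (simp add: half_disc_def)
      moreover have "gb x = gu x" using True gb_eq[of x] assms by simp
      ultimately show ?thesis using True A_upper[of "gu x"] by (simp add: energy_def dot_square_norm)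
    next
      case False
      then have z: "indicator {x. N x < r} x * energy x = 0" using gb_outside[of x] by (auto simp: energy_def)
      show ?thesis unfolding z by simp
    qed
  qed simp
  also have "\<dots> = 2 * disc_int (3/80) (\<lambda>x. (norm (gu x))^2)" by simp
  also have "\<dots> \<le> 2 * (34 * (4 / (9/100 - 3/80))^2 * disc_int (9/100) (\<lambda>x. (u x)^2))"
    by (intro mult_left_mono energy_bound) auto
  also have "\<dots> \<le> 2 * (34 * (4 / (9/100 - 3/80))^2 * 1)" by (intro mult_left_mono normalized) auto
  also have "\<dots> \<le> 400000" by (simp add: power2_eq_square)
  finally show ?thesis .
qed

text \<open>Gauge radius \<open>1/40\<close> means norm at most \<open>3/80\<close>, less than half
  of \<open>9/100\<close>, so \<open>sup_bound\<close> holds at every point of the sphere in the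
  half space. The volume factor \<open>3 ^ m\<close> is that of a cube around the half disc of
  radius \<open>3/2\<close>.\<close>

lemma mass_bound:
  assumes "0 < r" "r \<le> 1/40"
  shows "mass r \<le> real m * (sup_const m / (9/100) ^ m * 3 ^ m)"
proof -
  define K where "K = sup_const m / (9/100) ^ m"
  have K: "0 \<le> K" using sup_const_pos[OF m_pos] by (simp add: K_def)
  have hd: "emeasure lborel (half_disc (3/2) :: 'n point set) \<le> ennreal (3 ^ m)"
    using half_disc_emeasure[of "3/2", where 'n = 'n] by (simp add: m_def)
  have fin: "emeasure lborel (half_disc (3/2) :: 'n point set) < \<infinity>" by (rule le_less_trans[OF hd]) simp
  have "(LBINT x. indicator {x. 0 < N x \<and> N x < 1} x * (ub (r *\<^sub>R (x /\<^sub>R N x)))^2) \<le>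
     (LBINT x. indicator (half_disc (3/2) :: 'n point set) x * K)"
  proof (rule integral_mono')
    show "integrable lborel (\<lambda>x. indicator (half_disc (3/2) :: 'n point set) x * K)"
      using fin by (intro integrable_mult_left) (simp add: integrable_indicator_iff)
    fix x :: "'n point"
    show "0 \<le> indicator (half_disc (3/2)) x * K" using K by simp
    show "indicator {x. 0 < N x \<and> N x < 1} x * (ub (r *\<^sub>R (x /\<^sub>R N x)))^2 \<le> indicator (half_disc (3/2)) x * K"
    proof (cases "0 < N x \<and> N x < 1")
      case True
      define y where "y = r *\<^sub>R (x /\<^sub>R N x)"
      have x0: "x \<noteq> 0" using True N_zero by auto
      have Ny: "N y = r" unfolding y_def using N_scale[of r "x /\<^sub>R N x"] N_normalized[OF x0] assms by simp
      have yN: "y $ None = (r / N x) * x $ None" by (simp add: y_def divide_inverse)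
      show ?thesis
      proof (cases "x \<in> upper")
        case upx: True
        then have y: "y \<in> upper" unfolding upper_def mem_Collect_eq yN using True assms by (simp add: upper_def)
        have "norm y < 9/100/2" using norm_le_N[of y] Ny assms by linarith
        then have "(u y)^2 \<le> K * disc_int (9/100) (\<lambda>x. (u x)^2)"
          unfolding K_def using y by (intro sup_bound) auto
        also have "\<dots> \<le> K * 1" by (intro mult_left_mono normalized K)
        finally have "(ub y)^2 \<le> K" using ub_eq[OF y] Ny assms by simp
        moreover have "x \<in> half_disc (3/2)" using upx True norm_le_N[of x] by (simp add: half_disc_def)
        ultimately show ?thesis using True by (simp add: y_def)
      next
        case False
        then have "x $ None < 0" by (simp add: upper_def)
        then have "y $ None < 0" unfolding yN using True assms by (intro mult_pos_neg) auto
        then have "y \<notin> upper" by (simp add: upper_def)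
        then have "ub (r *\<^sub>R (x /\<^sub>R N x)) = 0" using ub_outside unfolding y_def by blast
        then show ?thesis using K by (simp del: scaleR_scaleR)
      qed
    qed (use K in simp)
  qed
  also have "\<dots> = measure lborel (half_disc (3/2) :: 'n point set) * K" by simp
  also have "\<dots> \<le> 3 ^ m * K" using K hd by (intro mult_right_mono) (simp_all add: measure_def enn2real_leI)
  also have "3 ^ m * K = sup_const m / (9/100) ^ m * 3 ^ m" by (simp add: K_def)
  finally have "real m * (LBINT x. indicator {x. 0 < N x \<and> N x < 1} x * (ub (r *\<^sub>R (x /\<^sub>R N x)))^2) \<le>
      real m * (sup_const m / (9/100) ^ m * 3 ^ m)" by (rule mult_left_mono) simp
  moreover have "DIM('n point) = m" by (simp add: m_def)
  ultimately show ?thesis unfolding mass_def sphere_integral_def by presburger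
qed

text \<open>The two alternatives of the Weiss system are restated in Euclidean terms: a lower bound
  for the sphere mass becomes one for annuli, matching the definition of the vanishing order, and an
  upper bound becomes pointwise. The constant in the second alternative depends on \<open>k\<close>
  but not on \<open>\<kappa>\<close> or the solution.\<close>

lemma growth_dichotomy:
  fixes \<kappa> k r1 :: real
  defines "h \<equiv> 2 * (real m)^2 * H * 2 powr \<gamma>"
  assumes \<kappa>: "1 \<le> \<kappa>" "\<kappa> \<le> k" and r1: "0 < r1" "r1 \<le> 1/40" "4 * (8 * (real m + 2 * k) * h * k / \<gamma>) * r1 powr \<gamma> \<le> \<gamma>" "h * r1 powr \<gamma> \<le> 1/2"
  shows "(\<exists>d>0. \<exists>r0>0. \<forall>r. 0 < r \<and> r \<le> r0 \<longrightarrow>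
      d * r powr (real m + 2 * \<kappa>) \<le> (LBINT x. indicator (half_annulus 0 (r / 2) r) x * (u x)^2)) \<or>
    (\<forall>r x. 0 < r \<and> 4 * r \<le> r1 \<and> x \<in> half_ball 0 r \<longrightarrow>
      (u x)\<^sup>2 \<le> growth_const m k \<gamma> h r1 * r powr (2 * \<kappa>) * \<bar>ln r\<bar>)"
proof -
  define K where "K = initial_const m"
  define a1 a2 where "a1 = exp 1 * (r1 powr (- 2 * k) * K)" and "a2 = exp 1 * (2 * weiss_bound m k \<gamma> h r1 K)"
  have h0: "0 \<le> h" using H_nonneg by (simp add: h_def)
  have om: "om r = h * r powr \<gamma>" if "0 < r" for r using that by (simp add: om_def h_def powr_mult)
  have K: "mass r1 \<le> K" "D r1 \<le> K"
    using mass_bound[OF r1(1,2)] D_bound[OF r1(1,2)] mass_nonneg[of r1] unfolding K_def initial_const_def by linarith+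
  interpret ws: weiss_system mass D mass' sphere_energy radial m \<kappa> k \<gamma> h r1
  proof unfold_locales
    fix r assume r: "0 < r" "r \<le> r1"
    then have r': "r < 1/16" using r1 by simp
    show "(mass has_real_derivative 2 * mass' r) (at r)" by (rule mass_has_derivative[OF r(1) r'])
    show "(D has_real_derivative r ^ (m - 1) * sphere_energy r) (at r)" by (rule D_has_derivative[OF r(1) r'])
    have "h * r powr \<gamma> \<le> h * r1 powr \<gamma>" using h0 r \<gamma>_pos by (intro mult_left_mono powr_mono2) auto
    then have "om r \<le> 1/2" using r1 om r by simp
    from weiss_comparison[OF r(1) r' \<kappa>(1) this]
    show "(real m - 2 + 2 * \<kappa>) * D r \<le> (1 + 4 * (h * r powr \<gamma>)) * (r ^ m * ((\<kappa> / r)^2 * mass r + (sphere_energy r - radial r)))"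
      unfolding om[OF r(1)] .
    show "0 \<le> radial r - 2 * t * mass' r + t\<^sup>2 * mass r" for t by (rule radial_square)
  qed (use m_pos \<kappa> \<gamma>_pos h0 r1 mass_nonneg D_nonneg in auto)
  have K0: "0 \<le> K" using K mass_nonneg[of r1] by linarith
  have a: "0 \<le> a1" "0 \<le> a2" using K0 ws.constants(2) by (auto simp: a1_def a2_def weiss_bound_def ws.\<beta>_def simp del: times_divide_eq_left times_divide_eq_right intro!: mult_nonneg_nonneg add_nonneg_nonneg)
  from ws.dichotomy[OF K] show ?thesis
  proof (elim disjE)
    assume "\<exists>d>0. \<exists>r0>0. \<forall>r. 0 < r \<and> r \<le> r0 \<longrightarrow> d * r powr (2 * \<kappa>) \<le> mass r"
    then obtain d r0 where d: "0 < d" "0 < r0" "\<And>r. 0 < r \<Longrightarrow> r \<le> r0 \<Longrightarrow> d * r powr (2 * \<kappa>) \<le> mass r" by blast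
    define C where "C = 2000000 * (real m)^2"
    have C: "0 < C" using m_pos by (simp add: C_def)
    show ?thesis
    proof (intro disjI1 exI conjI allI impI)
      show "0 < d * (1/4) powr (real m + 2 * \<kappa>) / C" "0 < min r0 (1/20)" using d C by auto
      fix r assume "0 < r \<and> r \<le> min r0 (1/20)"
      then have r: "0 < r" "r \<le> r0" "r \<le> 1/20" by auto
      \<comment> \<open>Gauge radius \<open>r / 2\<close> is chosen because that ball lies in the
        half disc of radius \<open>3/4 * r\<close>, to which \<open>disc_le_annulus\<close>
        applies.\<close>
      have "d * (r / 2 / 2) powr (real m + 2 * \<kappa>) \<le> J (r / 2)"
        by (rule J_lower[OF d(1) d(3)]) (use r \<kappa> in auto)
      also have "\<dots> \<le> disc_int (3/2 * (r / 2)) (\<lambda>x. (u x)^2)"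
        by (rule J_le_disc) (use r in auto)
      also have "3/2 * (r / 2) = 3/4 * r" by simp
      also have "disc_int (3/4 * r) (\<lambda>x. (u x)^2) \<le>
          C * (LBINT x. indicator (half_annulus 0 (r / 2) r) x * (u x)^2)"
        unfolding C_def by (rule disc_le_annulus) (use r in auto)
      finally have "d * (r / 2 / 2) powr (real m + 2 * \<kappa>) / C \<le> (LBINT x. indicator (half_annulus 0 (r / 2) r) x * (u x)^2)"
        using C by (simp add: pos_divide_le_eq mult.commute)
      moreover have "(r / 2 / 2) powr (real m + 2 * \<kappa>) = (1/4) powr (real m + 2 * \<kappa>) * r powr (real m + 2 * \<kappa>)"
        using r powr_mult[of "1/4" r "real m + 2 * \<kappa>"] by simp
      ultimately show "d * (1/4) powr (real m + 2 * \<kappa>) / C * r powr (real m + 2 * \<kappa>) \<le>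
          (LBINT x. indicator (half_annulus 0 (r / 2) r) x * (u x)^2)" by (simp add: mult.assoc)
    qed
  next
    assume "\<forall>r. 0 < r \<and> r \<le> r1 \<longrightarrow>
      mass r \<le> exp 1 * (r1 powr (- 2 * k) * K + 2 * \<bar>ln r\<bar> * weiss_bound m k \<gamma> h r1 K) * r powr (2 * \<kappa>)"
    then have up: "mass r \<le> (a1 + a2 * \<bar>ln r\<bar>) * r powr (2 * \<kappa>)" if "0 < r" "r \<le> r1" for r
      using that unfolding a1_def a2_def by (simp add: distrib_left mult_ac)
    show ?thesis
    proof (intro disjI2 allI impI, elim conjE)
      fix r :: real and x :: "'n point" assume r: "0 < r" "4 * r \<le> r1" and x: "x \<in> half_ball 0 r"
      have "ln (4 * r) \<le> 0" "ln r \<le> ln (4 * r)" using r r1 by simp_all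
      then have l4: "\<bar>ln (4 * r)\<bar> \<le> \<bar>ln r\<bar>" by linarith
      \<comment> \<open>\<open>r \<le> 1/160\<close> is below \<open>exp (- 1)\<close>, so the terms
        without a logarithm can be absorbed into \<open>\<bar>ln r\<bar>\<close>.\<close>
      have l1: "1 \<le> \<bar>ln r\<bar>"
      proof -
        have "exp 1 \<le> (3 :: real)" by (rule exp_le)
        then have "r * exp 1 \<le> 1/160 * 3" using r r1 by (intro mult_mono) auto
        then have "r \<le> exp (- 1)" by (simp add: exp_minus field_simps)
        then have "ln r \<le> - 1" using r by (metis ln_exp ln_le_cancel_iff exp_gt_zero)
        then show ?thesis by simp
      qed
      have "(u x)^2 \<le> sup_const m / (2 * r) ^ m * disc_int (2 * r) (\<lambda>x. (u x)^2)"
        by (rule sup_bound) (use r r1 x in \<open>auto simp: half_ball_def upper_def\<close>)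
      also have "\<dots> \<le> sup_const m / (2 * r) ^ m * J (2 * (2 * r))"
        using sup_const_pos[OF m_pos] r r1 by (intro mult_left_mono disc_le_J) auto
      also have "\<dots> \<le> sup_const m / (2 * r) ^ m * ((2 * (2 * r)) powr (real m + 2 * \<kappa>) * (a1 + a2 + a2 * \<bar>ln (2 * (2 * r))\<bar>))"
        using sup_const_pos[OF m_pos] r r1 \<kappa> a up by (intro mult_left_mono J_upper) auto
      also have "\<dots> \<le> sup_const m / (2 * r) ^ m * ((2 * (2 * r)) powr (real m + 2 * \<kappa>) * ((a1 + 2 * a2) * \<bar>ln r\<bar>))"
      proof (intro mult_left_mono)
        have "a2 * \<bar>ln (2 * (2 * r))\<bar> \<le> a2 * \<bar>ln r\<bar>" using l4 a by (intro mult_left_mono) auto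
        moreover have "a1 * 1 \<le> a1 * \<bar>ln r\<bar>" "a2 * 1 \<le> a2 * \<bar>ln r\<bar>" using l1 a by (intro mult_left_mono; simp)+
        ultimately show "a1 + a2 + a2 * \<bar>ln (2 * (2 * r))\<bar> \<le> (a1 + 2 * a2) * \<bar>ln r\<bar>" by (simp add: distrib_right)
      qed (use sup_const_pos[OF m_pos] r in auto)
      also have "(2 * (2 * r)) powr (real m + 2 * \<kappa>) = 2 ^ m * (2 * r) ^ m * (4 powr (2 * \<kappa>) * r powr (2 * \<kappa>))"
      proof -
        have "(2 * (2 * r)) powr (real m + 2 * \<kappa>) = (2 * (2 * r)) ^ m * (4 * r) powr (2 * \<kappa>)"
          using r by (simp add: powr_add powr_realpow)
        also have "\<dots> = 2 ^ m * (2 * r) ^ m * (4 powr (2 * \<kappa>) * r powr (2 * \<kappa>))"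
          using r by (simp only: power_mult_distrib[of 2 "2 * r"] powr_mult)
        finally show ?thesis .
      qed
      also have "sup_const m / (2 * r) ^ m * (2 ^ m * (2 * r) ^ m * (4 powr (2 * \<kappa>) * r powr (2 * \<kappa>)) * ((a1 + 2 * a2) * \<bar>ln r\<bar>)) =
          4 powr (2 * \<kappa>) * (sup_const m * 2 ^ m * (a1 + 2 * a2) * r powr (2 * \<kappa>) * \<bar>ln r\<bar>)" using r by simp
      also have "\<dots> \<le> 4 powr (2 * k) * (sup_const m * 2 ^ m * (a1 + 2 * a2) * r powr (2 * \<kappa>) * \<bar>ln r\<bar>)"
        using \<kappa> a sup_const_pos[OF m_pos] by (intro mult_right_mono powr_mono mult_nonneg_nonneg) auto
      also have "a1 + 2 * a2 = exp 1 * (r1 powr (- 2 * k) * K + 4 * weiss_bound m k \<gamma> h r1 K)"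
        by (simp add: a1_def a2_def algebra_simps)
      finally show "(u x)^2 \<le> growth_const m k \<gamma> h r1 * r powr (2 * \<kappa>) * \<bar>ln r\<bar>"
        by (simp add: growth_const_def K_def mult_ac)
    qed
  qed
qed

end

end

section \<open>Growth at the free boundary\<close>

definition morrey_exponent :: "ennreal \<Rightarrow> nat \<Rightarrow> real" where
  "morrey_exponent p m = (if p = \<infinity> then 1 else 1 - real m / enn2real p)"

definition gradient_const :: "ennreal \<Rightarrow> nat \<Rightarrow> real \<Rightarrow> real" where
  "gradient_const p m M = (if p = \<infinity> then M * unit_ball_vol (real m) else unit_ball_vol (real m) + M powr enn2real p)"

lemma finite_exponent:
  assumes "of_nat m < p" "p \<noteq> \<infinity>"
  shows "real m < enn2real p" "p = ennreal (enn2real p)"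
proof -
  show p: "p = ennreal (enn2real p)" using assms(2) by (simp add: less_top)
  show "real m < enn2real p"
    using assms(1) by (subst (asm) p) (simp add: ennreal_of_nat_eq_real_of_nat ennreal_less_iff)
qed

lemma morrey_exponent_pos: "of_nat m < p \<Longrightarrow> 0 < morrey_exponent p m"
  using finite_exponent(1)[of m p] by (auto simp: morrey_exponent_def divide_less_eq)

text \<open>For finite \<open>p\<close>, with \<open>q\<close> its real value, Hoelder's inequality
  is replaced by the pointwise bound of the absolute value by
  \<open>l + l powr (1 - q) * \<bar>G x\<bar> powr q\<close>. With the threshold
  \<open>l = s powr (- (real CARD('m) / q))\<close> both terms scale like the right-hand side, and
  the sum of their coefficients is \<open>gradient_const\<close>.\<close>

lemma Lp_local_integral_bound:
  fixes G :: "real ^ 'm::finite \<Rightarrow> real"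
  assumes p: "of_nat CARD('m) < p" and M: "0 \<le> M" and U: "U \<in> sets lebesgue"
    and G: "G \<in> borel_measurable (lebesgue_on U)" "Lp_norm p U G = ennreal M" and s: "0 < s"
  shows "(\<integral>\<^sup>+x. ennreal (indicator (U \<inter> ball z s) x * \<bar>G x\<bar>) \<partial>lebesgue) \<le>
    ennreal (gradient_const p CARD('m) M * s powr (real CARD('m) - 1 + morrey_exponent p CARD('m)))"
proof -
  define v where "v = unit_ball_vol (real CARD('m))"
  have v: "0 \<le> v" by (simp add: v_def)
  have ball: "emeasure lborel (ball z s) = ennreal (v * s ^ CARD('m))"
    using emeasure_ball[of s z] s by (simp add: v_def)
  show ?thesis
  proof (cases "p = \<infinity>")
    case True
    have "AE x in lebesgue_on U. ennreal \<bar>G x\<bar> \<le> ennreal M"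
      using esssup_AE[of "\<lambda>x. ennreal \<bar>G x\<bar>" "lebesgue_on U"] G(2) True by (simp add: Lp_norm_def)
    then have "AE x in lebesgue. x \<in> U \<longrightarrow> ennreal \<bar>G x\<bar> \<le> ennreal M"
      using U by (simp add: AE_restrict_space_iff)
    then have "(\<integral>\<^sup>+x. ennreal (indicator (U \<inter> ball z s) x * \<bar>G x\<bar>) \<partial>lebesgue) \<le>
        (\<integral>\<^sup>+x. ennreal M * indicator (ball z s) x \<partial>lebesgue)"
      by (intro nn_integral_mono_AE) (auto elim!: eventually_mono simp: indicator_def)
    also have "\<dots> = ennreal (M * v * s powr (real CARD('m) - 1 + 1))"
      using s M v by (simp add: nn_integral_cmult_indicator ball ennreal_mult[symmetric] powr_realpow mult.assoc)
    finally show ?thesis using True by (simp add: morrey_exponent_def gradient_const_def v_def)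
  next
    case False
    define q where "q = enn2real p"
    have q: "real CARD('m) < q" using finite_exponent(1)[OF p False] by (simp add: q_def)
    have q1: "1 \<le> real CARD('m)" "1 < q" using q zero_less_card_finite[where 'a = 'm] by linarith+
    define \<gamma> where "\<gamma> = 1 - real CARD('m) / q"
    define K where "K = v + M powr q"
    define I where "I = (\<integral>\<^sup>+ x. ennreal (\<bar>G x\<bar> powr q) \<partial>lebesgue_on U)"
    have Lp: "Lp_norm p U G = (if I = \<infinity> then \<infinity> else ennreal (enn2real I powr (1 / q)))"
      using False by (simp add: Lp_norm_def q_def[symmetric] I_def[symmetric] Let_def)
    then have Ifin: "I \<noteq> \<infinity>" using G(2) by (auto split: if_splits)
    then have "enn2real I powr (1 / q) = M" using G(2) M Lp by simp
    then have "(enn2real I powr (1 / q)) powr q = M powr q" by simp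
    then have "enn2real I = M powr q" using q1 by (simp add: powr_powr)
    then have I: "I = ennreal (M powr q)" using Ifin by (metis ennreal_enn2real infinity_ennreal_def less_top)
    have m[measurable]: "(\<lambda>x. ennreal (\<bar>G x\<bar> powr q) * indicator U x) \<in> borel_measurable lebesgue"
    proof -
      have "(\<lambda>x. ennreal (\<bar>G x\<bar> powr q)) \<in> borel_measurable (lebesgue_on U)" using G(1) by measurable
      moreover have "U \<inter> space lebesgue \<in> sets lebesgue" using U by simp
      ultimately show ?thesis by (simp only: borel_measurable_restrict_space_iff_ennreal)
    qed
    have IU: "(\<integral>\<^sup>+ x. ennreal (\<bar>G x\<bar> powr q) * indicator U x \<partial>lebesgue) = ennreal (M powr q)"
      unfolding I[symmetric] I_def using U by (subst nn_integral_restrict_space) auto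
    define l where "l = s powr (- (real CARD('m) / q))"
    have l: "0 < l" using s by (simp add: l_def)
    have pt: "ennreal (indicator (U \<inter> ball z s) x * \<bar>G x\<bar>) \<le>
        ennreal l * indicator (ball z s) x + ennreal (l powr (1 - q)) * (ennreal (\<bar>G x\<bar> powr q) * indicator U x)" for x
    proof (cases "x \<in> U \<inter> ball z s")
      case True
      have "\<bar>G x\<bar> \<le> l + l powr (1 - q) * \<bar>G x\<bar> powr q"
      proof (cases "\<bar>G x\<bar> \<le> l")
        case False
        then have g: "l < \<bar>G x\<bar>" "0 < \<bar>G x\<bar>" using l by auto
        have "\<bar>G x\<bar> = \<bar>G x\<bar> powr (1 - q) * \<bar>G x\<bar> powr q" using g by (simp add: powr_add[symmetric])
        also have "\<dots> \<le> l powr (1 - q) * \<bar>G x\<bar> powr q" using g l q1 by (intro mult_right_mono powr_mono2') auto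
        finally show ?thesis using l by simp
      qed (simp add: add_increasing2)
      then have "ennreal \<bar>G x\<bar> \<le> ennreal (l + l powr (1 - q) * \<bar>G x\<bar> powr q)" by (rule ennreal_leI)
      also have "\<dots> = ennreal l + ennreal (l powr (1 - q)) * ennreal (\<bar>G x\<bar> powr q)"
        using l by (simp add: ennreal_plus ennreal_mult)
      finally show ?thesis using True by simp
    qed simp
    have "(\<integral>\<^sup>+x. ennreal (indicator (U \<inter> ball z s) x * \<bar>G x\<bar>) \<partial>lebesgue) \<le>
      (\<integral>\<^sup>+x. ennreal l * indicator (ball z s) x + ennreal (l powr (1 - q)) * (ennreal (\<bar>G x\<bar> powr q) * indicator U x) \<partial>lebesgue)"
      by (intro nn_integral_mono pt)
    also have "\<dots> = (\<integral>\<^sup>+x. ennreal l * indicator (ball z s) x \<partial>lebesgue) +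
        (\<integral>\<^sup>+x. ennreal (l powr (1 - q)) * (ennreal (\<bar>G x\<bar> powr q) * indicator U x) \<partial>lebesgue)"
      by (intro nn_integral_add borel_measurable_times_ennreal m borel_measurable_const borel_measurable_indicator) simp
    also have "\<dots> = ennreal l * ennreal (v * s ^ CARD('m)) + ennreal (l powr (1 - q)) * ennreal (M powr q)"
      using m by (simp add: nn_integral_cmult_indicator nn_integral_cmult IU ball)
    also have "\<dots> = ennreal (l * (v * s ^ CARD('m)) + l powr (1 - q) * M powr q)"
      using l v s by (simp add: ennreal_plus ennreal_mult[symmetric])
    also have "l * (v * s ^ CARD('m)) + l powr (1 - q) * M powr q = K * s powr (real CARD('m) - 1 + \<gamma>)"
    proof -
      have 1: "l * s ^ CARD('m) = s powr (real CARD('m) - 1 + \<gamma>)"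
      proof -
        have "l * s ^ CARD('m) = s powr (- (real CARD('m) / q)) * s powr (real CARD('m))"
          using s by (simp add: l_def powr_realpow)
        also have "\<dots> = s powr (- (real CARD('m) / q) + real CARD('m))" by (rule powr_add[symmetric])
        finally show ?thesis by (simp add: \<gamma>_def add.commute)
      qed
      have 2: "l powr (1 - q) = s powr (real CARD('m) - 1 + \<gamma>)"
      proof -
        have "- (real CARD('m) / q) * (1 - q) = real CARD('m) - 1 + \<gamma>" using q1 by (simp add: \<gamma>_def field_simps)
        then show ?thesis unfolding l_def powr_powr by simp
      qed
      show ?thesis unfolding K_def 2 distrib_right 1[symmetric] by simp
    qed
    finally show ?thesis using False by (simp add: morrey_exponent_def gradient_const_def v_def K_def \<gamma>_def q_def)
  qed
qed

text \<open>Exhaustion by countably many compact sets. It is meant for \<open>weak_partial\<close>,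
  a chosen function known only to be locally integrable, so that integrals of it over noncompact
  sets make sense.\<close>

lemma locally_integrable_measurable:
  fixes g :: "real ^ 'm::finite \<Rightarrow> real"
  assumes U: "open U" and g: "\<And>K. compact K \<Longrightarrow> K \<subseteq> U \<Longrightarrow> g absolutely_integrable_on K"
  shows "g \<in> borel_measurable (lebesgue_on U)"
proof -
  obtain C :: "nat \<Rightarrow> (real ^ 'm) set" where C: "\<And>n. compact (C n)" "\<And>n. C n \<subseteq> U" "\<Union>(range C) = U"
    using open_Union_compact_subsets[OF U] by metis
  have CM: "C n \<in> sets lebesgue" for n using C(1) by (simp add: compact_imp_closed borel_closed)
  show ?thesis
  proof (rule measurable_piecewise_restrict[of "range C"])
    show "countable (range C)" by simp
    show "space (lebesgue_on U) \<subseteq> \<Union>(range C)" using C(3) by simp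
    fix X assume "X \<in> range C"
    then obtain n where n: "X = C n" by blast
    show "X \<inter> space (lebesgue_on U) \<in> sets (lebesgue_on U)"
      using CM[of n] C(2)[of n] U by (simp add: n sets_restrict_space_iff borel_open Int_absorb2)
    have "(\<lambda>x. indicator (C n) x * g x) \<in> borel_measurable lebesgue"
      using g[OF C(1,2)[of n]] by (auto simp: set_integrable_def dest: borel_measurable_integrable)
    then have "g \<in> borel_measurable (lebesgue_on (C n))"
      using CM[of n] by (simp add: borel_measurable_restrict_space_iff)
    moreover have "restrict_space (lebesgue_on U) X = lebesgue_on (C n)"
      using CM[of n] C(2)[of n] U by (subst restrict_restrict_space) (auto simp: n borel_open Int_absorb1)
    ultimately show "g \<in> borel_measurable (restrict_space (lebesgue_on U) X)" by simp
  qed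
qed

text \<open>Every chosen weak derivative of an entry is dominated by the length of the full
  gradient, whose norm is prescribed; this gives the growth assumption of
  \<open>hoelder_of_gradient_bound\<close> with a constant depending on \<open>p\<close>,
  \<open>M\<close> and the dimension. The order of the quantifiers records the uniformity over all
  coefficients.\<close>

lemma coefficient_hoelder:
  fixes p :: ennreal and M :: real
  assumes p: "of_nat (CARD('n::finite) + 1) < p" and M: "0 \<le> M"
  shows "\<exists>\<gamma>>0. \<exists>H\<ge>0. \<forall>(a :: 'n coeff) x y i j. admissible_coeff p a \<longrightarrow> grad_norm p a = ennreal M \<longrightarrow>
    x $ None = 0 \<longrightarrow> norm x < 1/2 \<longrightarrow> y \<in> upper \<longrightarrow> norm (y - x) < 1/10 \<longrightarrow>
    \<bar>a y $ i $ j - a x $ i $ j\<bar> \<le> H * norm (y - x) powr \<gamma>"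
proof -
  define U where "U = (unit_half_ball_int :: 'n point set)"
  have Uo: "open U" by (simp add: U_def unit_half_ball_int_def)
  then have US: "U \<in> sets lebesgue" by (simp add: borel_open)
  define \<gamma> K where "\<gamma> = morrey_exponent p CARD('n option)" and "K = gradient_const p CARD('n option) M"
  have p': "of_nat CARD('n option) < p" using p by simp
  have \<gamma>: "0 < \<gamma>" unfolding \<gamma>_def by (rule morrey_exponent_pos[OF p'])
  have K: "0 \<le> K" using M by (simp add: K_def gradient_const_def)
  define C where "C = 4 * real CARD('n option) * 3 powr (real CARD('n option) - 1 + \<gamma>) / \<gamma> / (LBINT z. unit_bump (z :: 'n point))"
  have C: "0 \<le> C" using \<gamma> unit_bump_integral_pos[where 'n = 'n] by (simp add: C_def)
  show ?thesis
  proof (rule exI[of _ \<gamma>], rule conjI[OF \<gamma>], rule exI[of _ "C * K"], intro conjI allI impI)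
    show "0 \<le> C * K" using C K by simp
    fix a :: "'n coeff" and x y :: "'n point" and i j
    assume a: "admissible_coeff p a" "grad_norm p a = ennreal M"
      and xy: "x $ None = 0" "norm x < 1/2" "y \<in> upper" "norm (y - x) < 1/10"
    define W where "W k i j = weak_partial U k (\<lambda>y. a y $ i $ j)" for k i j
    have W: "is_weak_partial U k (\<lambda>y. a y $ i $ j) (W k i j)" for k i j
    proof -
      have "in_W1p p U (\<lambda>y. a y $ i $ j)" using a(1) by (simp add: admissible_coeff_def U_def)
      then have "\<exists>g. is_weak_partial U k (\<lambda>y. a y $ i $ j) g" unfolding in_W1p_def by blast
      then show ?thesis unfolding W_def weak_partial_def by (rule someI_ex)
    qed
    have Wm[measurable]: "W k i j \<in> borel_measurable (lebesgue_on U)" for k i j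
      using W[of k i j] by (intro locally_integrable_measurable[OF Uo]) (simp add: is_weak_partial_def)
    define G where "G x = sqrt (\<Sum>k\<in>UNIV. \<Sum>i\<in>UNIV. \<Sum>j\<in>UNIV. (W k i j x)^2)" for x
    have Gm: "G \<in> borel_measurable (lebesgue_on U)" unfolding G_def by measurable
    have Lp: "Lp_norm p U G = ennreal M" using a(2) by (simp add: grad_norm_def G_def[abs_def] W_def U_def)
    have WG: "\<bar>W k i j x\<bar> \<le> \<bar>G x\<bar>" for k i j x
    proof -
      have "(W k i j x)^2 \<le> (\<Sum>j\<in>UNIV. (W k i j x)^2)" by (rule member_le_sum) auto
      also have "\<dots> \<le> (\<Sum>i\<in>UNIV. \<Sum>j\<in>UNIV. (W k i j x)^2)" by (rule member_le_sum) (auto intro: sum_nonneg)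
      also have "\<dots> \<le> (\<Sum>k\<in>UNIV. \<Sum>i\<in>UNIV. \<Sum>j\<in>UNIV. (W k i j x)^2)" by (rule member_le_sum) (auto intro!: sum_nonneg)
      finally have "sqrt ((W k i j x)^2) \<le> G x" unfolding G_def by (rule real_sqrt_le_mono)
      then show ?thesis by simp
    qed
    have int: "set_integrable lebesgue (U \<inter> ball z s) (W k i j) \<and>
        (LINT y:U \<inter> ball z s|lebesgue. \<bar>W k i j y\<bar>) \<le> K * s powr (real CARD('n option) - 1 + \<gamma>)"
      if s: "0 < s" for k z s
    proof -
      let ?b = "K * s powr (real CARD('n option) - 1 + \<gamma>)"
      have m0: "(\<lambda>x. W k i j x * indicator U x) \<in> borel_measurable lebesgue"
        using Wm[of k i j] US by (simp add: borel_measurable_restrict_space_iff mult.commute)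
      then have m: "(\<lambda>x. indicator (ball z s) x * (W k i j x * indicator U x)) \<in> borel_measurable lebesgue"
        by (intro borel_measurable_times[OF _ m0]) (simp add: borel_measurable_indicator)
      then have m: "(\<lambda>x. indicator (U \<inter> ball z s) x * W k i j x) \<in> borel_measurable lebesgue"
        by (simp add: indicator_inter_arith mult_ac)
      have "(\<integral>\<^sup>+x. ennreal (norm (indicator (U \<inter> ball z s) x * W k i j x)) \<partial>lebesgue) \<le>
          (\<integral>\<^sup>+x. ennreal (indicator (U \<inter> ball z s) x * \<bar>G x\<bar>) \<partial>lebesgue)"
        using WG by (intro nn_integral_mono ennreal_leI) (simp add: abs_mult mult_left_mono)
      also have "\<dots> \<le> ennreal ?b" unfolding K_def \<gamma>_def by (rule Lp_local_integral_bound[OF p' M US Gm Lp s])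
      finally have b: "(\<integral>\<^sup>+x. ennreal (norm (indicator (U \<inter> ball z s) x * W k i j x)) \<partial>lebesgue) \<le> ennreal ?b" .
      have i: "integrable lebesgue (\<lambda>x. indicator (U \<inter> ball z s) x * W k i j x)"
        using m b by (intro integrableI_bounded) (auto intro: le_less_trans)
      have "(LINT y:U \<inter> ball z s|lebesgue. \<bar>W k i j y\<bar>) = (\<integral>x. norm (indicator (U \<inter> ball z s) x * W k i j x) \<partial>lebesgue)"
        unfolding set_lebesgue_integral_def by (intro Bochner_Integration.integral_cong) (auto simp: abs_mult)
      also have "\<dots> \<le> ?b" using nn_integral_eq_integral[OF integrable_norm[OF i]] b K by simp
      finally show ?thesis using i by (simp add: set_integrable_def)
    qed
    have cont: "continuous_on unit_half_ball (\<lambda>y. a y $ i $ j)"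
      using a(1) unfolding admissible_coeff_def by (intro continuous_on_component) auto
    show "\<bar>a y $ i $ j - a x $ i $ j\<bar> \<le> C * K * norm (y - x) powr \<gamma>" unfolding C_def
      by (rule hoelder_of_gradient_bound[OF \<gamma> cont, of "\<lambda>k. W k i j"]) (use W int K xy in \<open>auto simp: U_def\<close>)
  qed
qed

section \<open>Solutions on the half ball and their free boundary points\<close>

lemma unit_half_ball_eq: "unit_half_ball = upper \<inter> ball 0 1"
  by (auto simp: unit_half_ball_def half_ball_def upper_def)

lemma at_within_unit_half_ball:
  "norm x < 1 \<Longrightarrow> at x within (unit_half_ball :: 'n::finite point set) = at x within upper"
  by (rule at_within_nhd[of x "ball 0 1"]) (auto simp: unit_half_ball_eq)

locale obstacle_solution =
  fixes p :: ennreal and a :: "'n::finite coeff" and w :: "'n point \<Rightarrow> real"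
  assumes coeff: "admissible_coeff p a" and solution: "thin_obstacle_solution a w"
begin

definition gw :: "'n point \<Rightarrow> 'n point" where
  "gw x = (\<chi> k. partial_on unit_half_ball k w x)"

lemma w_has_derivative:
  assumes "x \<in> unit_half_ball"
  shows "(w has_gradient gw x) (at x within upper)"
proof -
  have "w differentiable_on unit_half_ball" using solution by (auto simp: thin_obstacle_solution_def C1_holder_loc_def)
  then have "w differentiable (at x within unit_half_ball)" using assms by (simp add: differentiable_on_def)
  then have d: "(w has_derivative frechet_derivative w (at x within unit_half_ball)) (at x within unit_half_ball)"
    by (simp add: frechet_derivative_works)
  then have l: "linear (frechet_derivative w (at x within unit_half_ball))" by (rule has_derivative_linear)
  have "frechet_derivative w (at x within unit_half_ball) h = gw x \<bullet> h" for h
  proof -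
    have "h = (\<Sum>k\<in>UNIV. h $ k *\<^sub>R axis k 1)" using basis_expansion[of h] by (simp add: scalar_mult_eq_scaleR)
    then have "frechet_derivative w (at x within unit_half_ball) h =
        frechet_derivative w (at x within unit_half_ball) (\<Sum>k\<in>UNIV. h $ k *\<^sub>R axis k 1)" by (rule arg_cong)
    also have "\<dots> = (\<Sum>k\<in>UNIV. frechet_derivative w (at x within unit_half_ball) (h $ k *\<^sub>R axis k 1))"
      by (rule linear_sum[OF l])
    also have "\<dots> = (\<Sum>k\<in>UNIV. h $ k * frechet_derivative w (at x within unit_half_ball) (axis k 1))"
      by (simp add: linear_scale[OF l])
    finally show ?thesis by (simp add: gw_def partial_on_def inner_vec_def mult.commute)
  qed
  then have "frechet_derivative w (at x within unit_half_ball) = (\<lambda>h. gw x \<bullet> h)" by blast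
  moreover have "norm x < 1" using assms by (simp add: unit_half_ball_eq)
  ultimately show ?thesis using d at_within_unit_half_ball by metis
qed

lemma w_continuous: "continuous_on unit_half_ball w"
proof -
  have "w differentiable_on unit_half_ball" using solution by (auto simp: thin_obstacle_solution_def C1_holder_loc_def)
  then show ?thesis by (rule differentiable_imp_continuous_on)
qed

text \<open>Every point has a compact half disc as a relative neighbourhood, on which the local
  Hoelder condition is available.\<close>

lemma gw_continuous: "continuous_on unit_half_ball gw"
proof -
  obtain \<alpha> where \<alpha>: "0 < \<alpha>" and C: "C1_holder_loc unit_half_ball \<alpha> w"
    using solution by (auto simp: thin_obstacle_solution_def)
  have "continuous_on unit_half_ball (\<lambda>x. partial_on unit_half_ball k w x)" for k
    unfolding continuous_on_eq_continuous_within
  proof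
    fix x :: "'n point" assume x: "x \<in> unit_half_ball"
    define \<rho> where "\<rho> = (1 + norm x) / 2"
    have \<rho>: "norm x < \<rho>" "\<rho> < 1" using x by (auto simp: unit_half_ball_eq \<rho>_def)
    have K: "compact (half_disc \<rho> :: 'n point set)" "half_disc \<rho> \<subseteq> (unit_half_ball :: 'n point set)"
      using \<rho> by (auto simp: half_disc_def unit_half_ball_eq intro: compact_half_disc[unfolded half_disc_def])
    then obtain L where L: "\<And>y z. y \<in> half_disc \<rho> \<Longrightarrow> z \<in> half_disc \<rho> \<Longrightarrow>
        \<bar>partial_on unit_half_ball k w y - partial_on unit_half_ball k w z\<bar> \<le> L * dist y z powr \<alpha>"
      using C unfolding C1_holder_loc_def by meson
    have xd: "x \<in> half_disc \<rho>" using x \<rho> by (simp add: half_disc_def unit_half_ball_eq)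
    have "((\<lambda>y. partial_on unit_half_ball k w y) \<longlongrightarrow> partial_on unit_half_ball k w x) (at x within half_disc \<rho>)"
    proof (rule Lim_transform_bound[where g = "\<lambda>y. L * dist y x powr \<alpha>", THEN Lim_null[THEN iffD2]])
      show "\<forall>\<^sub>F y in at x within half_disc \<rho>. norm (partial_on unit_half_ball k w y - partial_on unit_half_ball k w x) \<le> norm (L * dist y x powr \<alpha>)"
        unfolding eventually_at_filter using L[OF _ xd] by (intro always_eventually) (auto intro: order_trans[OF _ abs_ge_self])
      have "((\<lambda>y. L * dist y x powr \<alpha>) \<longlongrightarrow> L * dist x x powr \<alpha>) (at x within half_disc \<rho>)"
        using \<alpha> by (intro tendsto_mult tendsto_const tendsto_powr' tendsto_dist tendsto_ident_at) auto
      then show "((\<lambda>y. L * dist y x powr \<alpha>) \<longlongrightarrow> 0) (at x within half_disc \<rho>)" by simp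
    qed
    moreover have "at x within half_disc \<rho> = at x within unit_half_ball"
      by (rule at_within_nhd[of x "ball 0 \<rho>"]) (use \<rho> in \<open>auto simp: unit_half_ball_eq half_disc_def\<close>)
    ultimately show "continuous (at x within unit_half_ball) (\<lambda>y. partial_on unit_half_ball k w y)"
      by (simp add: continuous_within)
  qed
  then show ?thesis unfolding gw_def[abs_def] by (intro continuous_on_vec_lambda)
qed

lemma a_continuous: "continuous_on unit_half_ball a"
  and a_symmetric: "x \<in> unit_half_ball \<Longrightarrow> transpose (a x) = a x"
  and a_eigenvalue: "x \<in> unit_half_ball \<Longrightarrow> matrix_eigenvalue (a x) l \<Longrightarrow> 1/2 \<le> l \<and> l \<le> 2"
  using coeff unfolding admissible_coeff_def by blast+

lemma a_lower: "x \<in> unit_half_ball \<Longrightarrow> 1 / 2 * (v \<bullet> v) \<le> v \<bullet> (a x *v v)"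
  by (rule quadratic_form_ge_least_eigenvalue[OF a_symmetric]) (use a_eigenvalue in blast)+

lemma a_upper: "x \<in> unit_half_ball \<Longrightarrow> v \<bullet> (a x *v v) \<le> 2 * (v \<bullet> v)"
  by (rule quadratic_form_le_greatest_eigenvalue[OF a_symmetric]) (use a_eigenvalue in blast)+

text \<open>The mixed entries vanish on the flat boundary, so the conormal derivative is a positive
  multiple of the normal derivative. Signorini's conditions thereby pass from one to the
  other.\<close>

lemma flux_None:
  assumes x: "x \<in> unit_half_ball" "x $ None = 0"
  shows "(a x *v gw x) $ None = a x $ None $ None * gw x $ None" "0 < a x $ None $ None"
proof -
  have z: "a x $ None $ Some i = 0" for i
  proof -
    have "a x $ None $ Some i = transpose (a x) $ Some i $ None" by (simp add: transpose_def)
    also have "\<dots> = a x $ Some i $ None" using a_symmetric[OF x(1)] by simp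
    also have "\<dots> = 0" using coeff x by (auto simp: admissible_coeff_def unit_thin_ball_def)
    finally show ?thesis .
  qed
  have "(a x *v gw x) $ None = (\<Sum>j\<in>UNIV. a x $ None $ j * gw x $ j)" by (simp add: matrix_vector_mult_def)
  also have "\<dots> = a x $ None $ None * gw x $ None" by (simp add: UNIV_option_conv sum.insert sum.reindex z)
  finally show "(a x *v gw x) $ None = a x $ None $ None * gw x $ None" .
  have "1 / 2 * ((axis None 1 :: 'n point) \<bullet> axis None 1) \<le> axis None 1 \<bullet> (a x *v axis None 1)"
    by (rule a_lower[OF x(1)])
  then show "0 < a x $ None $ None" by (simp add: matrix_vector_mult_basis inner_axis' column_def)
qed

lemma signorini_w:
  assumes x: "x \<in> unit_half_ball" "x $ None = 0"
  shows "0 \<le> w x" "gw x $ None \<le> 0" "w x * gw x $ None = 0"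
proof -
  have "x \<in> unit_thin_ball" using x by (simp add: unit_thin_ball_def)
  then show "0 \<le> w x" "gw x $ None \<le> 0" "w x * gw x $ None = 0"
    using solution by (auto simp: thin_obstacle_solution_def gw_def)
qed

text \<open>The positivity set is relatively open, so \<open>w\<close> vanishes at its frontier.
  Near such a point there are points with \<open>w\<close> positive, where the normal derivative is
  zero, and continuity transfers this to \<open>x0\<close>. Tangentially \<open>x0\<close> is an
  interior minimum of \<open>w\<close> on the flat boundary.\<close>

lemma free_boundary_point:
  assumes "x0 \<in> free_boundary w"
  shows "x0 \<in> unit_half_ball" "x0 $ None = 0" "w x0 = 0" "gw x0 = 0"
proof -
  define T where "T = (unit_thin_ball :: 'n point set)"
  have TS: "T \<subseteq> unit_half_ball" by (auto simp: T_def unit_thin_ball_def)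
  have x0T: "x0 \<in> T"
    using assms frontier_of_subset_topspace[of "top_of_set T" "{x \<in> T. w x > 0}"] by (auto simp: free_boundary_def T_def)
  then show x0: "x0 \<in> unit_half_ball" and x0N: "x0 $ None = 0" by (auto simp: T_def unit_thin_ball_def)
  have wT: "continuous_on T w" and gT: "continuous_on T gw"
    using w_continuous gw_continuous TS continuous_on_subset by blast+
  have "openin (top_of_set T) (T \<inter> w -` {0<..})" by (rule continuous_openin_preimage_gen[OF wT open_greaterThan])
  moreover have "T \<inter> w -` {0<..} = {x \<in> T. w x > 0}" by auto
  ultimately have op: "openin (top_of_set T) {x \<in> T. w x > 0}" by simp
  then have fb: "x0 \<in> top_of_set T closure_of {x \<in> T. w x > 0}" "x0 \<notin> {x \<in> T. w x > 0}"
    using assms by (auto simp: free_boundary_def T_def frontier_of_def interior_of_openin)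
  show w0: "w x0 = 0" using fb(2) x0T signorini_w(1)[OF x0 x0N] by auto
  have n: "gw x0 $ None = 0"
  proof (rule ccontr)
    assume "gw x0 $ None \<noteq> 0"
    have "openin (top_of_set T) (T \<inter> (\<lambda>x. gw x $ None) -` (- {0}))"
      by (intro continuous_openin_preimage_gen continuous_on_component gT) auto
    moreover have "x0 \<in> T \<inter> (\<lambda>x. gw x $ None) -` (- {0})" using x0T \<open>gw x0 $ None \<noteq> 0\<close> by simp
    ultimately have "\<exists>y. y \<in> {x \<in> T. w x > 0} \<and> y \<in> T \<inter> (\<lambda>x. gw x $ None) -` (- {0})"
      using fb(1)[unfolded in_closure_of] by (meson IntI)
    then obtain y where "y \<in> T" "w y > 0" "gw y $ None \<noteq> 0" by auto
    then show False using signorini_w(3)[of y] by (auto simp: T_def unit_thin_ball_def)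
  qed
  have t: "gw x0 $ Some i = 0" for i
  proof -
    define e where "e = (axis (Some i) 1 :: 'n point)"
    define d where "d = 1 - norm x0"
    have d: "0 < d" using x0 by (simp add: d_def unit_half_ball_eq)
    have inT: "x0 + t *\<^sub>R e \<in> unit_half_ball" "(x0 + t *\<^sub>R e) $ None = 0" if "\<bar>t\<bar> < d" for t
    proof -
      have "norm (x0 + t *\<^sub>R e) \<le> norm x0 + \<bar>t\<bar>" by (rule order_trans[OF norm_triangle_ineq]) (simp add: e_def)
      then have "norm (x0 + t *\<^sub>R e) < 1" using that by (simp add: d_def)
      moreover show "(x0 + t *\<^sub>R e) $ None = 0" using x0N by (simp add: e_def axis_def)
      ultimately show "x0 + t *\<^sub>R e \<in> unit_half_ball" by (simp add: unit_half_ball_eq upper_def)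
    qed
    have "((\<lambda>t. w (x0 + t *\<^sub>R e)) has_derivative (\<lambda>s. gw x0 \<bullet> (s *\<^sub>R e))) (at 0)"
    proof -
      have l: "((\<lambda>t. x0 + t *\<^sub>R e) has_derivative (\<lambda>s. s *\<^sub>R e)) (at 0)"
        by (auto intro!: derivative_eq_intros)
      have "(\<lambda>t. x0 + t *\<^sub>R e) ` UNIV \<subseteq> upper" using x0N by (auto simp: upper_def e_def axis_def)
      then have "(w has_gradient gw x0) (at (x0 + 0 *\<^sub>R e) within (\<lambda>t. x0 + t *\<^sub>R e) ` UNIV)"
        using has_derivative_subset[OF w_has_derivative[OF x0]] by simp
      from has_derivative_in_compose[OF l this] show ?thesis .
    qed
    then have "((\<lambda>t. w (x0 + t *\<^sub>R e)) has_real_derivative gw x0 $ Some i) (at 0)"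
      unfolding has_field_derivative_def by (simp add: e_def inner_axis mult_commute_abs)
    moreover have "\<forall>t. \<bar>0 - t\<bar> < d \<longrightarrow> w (x0 + 0 *\<^sub>R e) \<le> w (x0 + t *\<^sub>R e)"
      using signorini_w(1)[OF inT] w0 by simp
    ultimately show ?thesis using DERIV_local_min[OF _ d] by blast
  qed
  show "gw x0 = 0" unfolding vec_eq_iff
  proof
    fix k show "gw x0 $ k = (0 :: 'n point) $ k" by (cases k) (simp_all add: n t)
  qed
qed

end

section \<open>Translation of a free boundary point to the origin\<close>

lemma mem_translation_iff: "x \<in> (+) a ` S \<longleftrightarrow> x - a \<in> S" for a :: "'a::ab_group_add"
proof
  assume "x - a \<in> S"
  then have "a + (x - a) \<in> (+) a ` S" by (rule imageI)
  then show "x \<in> (+) a ` S" by simp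
qed auto

context obstacle_solution
begin

context
  fixes x0 :: "'n point"
  assumes flat: "x0 $ None = 0" and x0: "norm x0 < 1/2"
begin

abbreviation "shift_w y \<equiv> w (x0 + y)"

lemma shift_in: "y \<in> half_ball 0 (1/10) \<Longrightarrow> x0 + y \<in> unit_half_ball"
  using flat x0 norm_triangle_ineq[of x0 y] by (simp add: half_ball_def unit_half_ball_eq upper_def)

text \<open>A shift along the flat boundary preserves the half space. The variational inequality
  comes from \<open>weak_eq_flat_boundary\<close> applied to the test function shifted back to
  \<open>x0\<close>.\<close>

lemma shift_thin_problem:
  assumes \<gamma>: "0 < \<gamma>" and H: "0 \<le> H"
    and hoelder: "\<And>y i j. y \<in> upper \<Longrightarrow> norm (y - x0) < 1/10 \<Longrightarrow> \<bar>a y $ i $ j - a x0 $ i $ j\<bar> \<le> H * norm (y - x0) powr \<gamma>"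
  shows "thin_problem (\<lambda>y. a (x0 + y)) shift_w (\<lambda>y. gw (x0 + y)) H \<gamma>"
proof
  have sub: "(+) x0 ` half_ball 0 (1/10) \<subseteq> unit_half_ball" using shift_in by auto
  have flux: "flux (\<lambda>y. a (x0 + y)) (\<lambda>y. gw (x0 + y)) y = a (x0 + y) *v gw (x0 + y)" for y by (simp add: flux_def)
  show "(shift_w has_gradient gw (x0 + y)) (at y within upper)" if y: "y \<in> half_ball 0 (1/10)" for y
  proof -
    have l: "((\<lambda>y. x0 + y) has_derivative (\<lambda>h. h)) (at y within upper)" by (auto intro!: derivative_eq_intros)
    have "(+) x0 ` upper \<subseteq> upper" using flat by (auto simp: upper_def)
    then have "(w has_gradient gw (x0 + y)) (at (x0 + y) within (+) x0 ` upper)"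
      by (rule has_derivative_subset[OF w_has_derivative[OF shift_in[OF y]]])
    from has_derivative_in_compose[OF l this] show ?thesis .
  qed
  show "continuous_on (half_ball 0 (1/10)) (\<lambda>y. gw (x0 + y))"
    by (rule continuous_on_compose2[OF gw_continuous _ sub]) (intro continuous_intros)
  show "continuous_on (half_ball 0 (1/10)) (\<lambda>y. a (x0 + y))"
    by (rule continuous_on_compose2[OF a_continuous _ sub]) (intro continuous_intros)
  show "transpose (a (x0 + y)) = a (x0 + y)" if "y \<in> half_ball 0 (1/10)" for y
    by (rule a_symmetric[OF shift_in[OF that]])
  show "1 / 2 * (v \<bullet> v) \<le> v \<bullet> (a (x0 + y) *v v)" "v \<bullet> (a (x0 + y) *v v) \<le> 2 * (v \<bullet> v)"
    if "y \<in> half_ball 0 (1/10)" for y v by (rule a_lower[OF shift_in[OF that]] a_upper[OF shift_in[OF that]])+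
  show "\<bar>a (x0 + y) $ i $ j - a (x0 + 0) $ i $ j\<bar> \<le> H * norm y powr \<gamma>" if "y \<in> half_ball 0 (1/10)" for y i j
    using hoelder[of "x0 + y"] that flat by (simp add: half_ball_def upper_def)
  show "0 < \<gamma>" "0 \<le> H" by (rule \<gamma> H)+
  show "0 \<le> shift_w y \<and> flux (\<lambda>y. a (x0 + y)) (\<lambda>y. gw (x0 + y)) y $ None \<le> 0 \<and>
      shift_w y * flux (\<lambda>y. a (x0 + y)) (\<lambda>y. gw (x0 + y)) y $ None = 0"
    if y: "y \<in> half_ball 0 (1/10)" "y $ None = 0" for y
  proof -
    have 1: "x0 + y \<in> unit_half_ball" "(x0 + y) $ None = 0" using shift_in[OF y(1)] y flat by auto
    show ?thesis unfolding flux flux_None(1)[OF 1]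
      using flux_None(2)[OF 1] signorini_w[OF 1] by (auto simp: mult_le_0_iff)
  qed
  fix S \<phi> g and L :: real and N :: "'n point set"
  assume S: "compact S" "S \<subseteq> half_ball 0 (1/10)"
    and lip: "\<And>x y :: 'n point. x \<in> upper \<Longrightarrow> y \<in> upper \<Longrightarrow> \<bar>\<phi> x - \<phi> y\<bar> \<le> L * norm (x - y)"
    and supp: "\<And>x. x \<in> upper \<Longrightarrow> x \<notin> S \<Longrightarrow> \<phi> x = 0" and N: "N \<in> null_sets lborel"
    and der: "\<And>x. x $ None > 0 \<Longrightarrow> x \<notin> N \<Longrightarrow> (\<phi> has_gradient g x) (at x)"
    and g[measurable]: "g \<in> borel_measurable borel" and gL: "\<And>x. norm (g x) \<le> L" and gS: "\<And>x. x \<notin> S \<Longrightarrow> g x = 0"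
    and sign: "\<And>x. x \<in> S \<Longrightarrow> x $ None = 0 \<Longrightarrow> flux (\<lambda>y. a (x0 + y)) (\<lambda>y. gw (x0 + y)) x $ None * \<phi> x \<le> 0"
  let ?F = "\<lambda>x. a x *v gw x" and ?S = "(+) x0 ` S"
  have mem: "x \<in> ?S \<longleftrightarrow> x - x0 \<in> S" for x by (rule mem_translation_iff)
  have F: "continuous_on unit_half_ball ?F" unfolding matrix_vector_mult_def
    by (intro continuous_on_vec_lambda continuous_on_sum continuous_on_mult continuous_on_component a_continuous gw_continuous)
  have S': "compact ?S" "?S \<subseteq> unit_half_ball" using S shift_in by (auto intro: compact_translation)
  have "0 \<le> (LBINT x. indicator ?S x *\<^sub>R (?F x \<bullet> g (x - x0)))"
  proof (rule weak_eq_flat_boundary[OF F _ S', where \<phi> = "\<lambda>x. \<phi> (x - x0)" and L = L and N = "{x. x - x0 \<in> N}"])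
    fix \<psi> :: "'n point \<Rightarrow> real" assume \<psi>: "test_function unit_half_ball_int \<psi>"
    have "(\<Sum>i\<in>UNIV. ?F x $ i * partial_on UNIV i \<psi> x) =
       (\<Sum>i\<in>UNIV. \<Sum>j\<in>UNIV. a x $ i $ j * partial_on unit_half_ball j w x * partial_on UNIV i \<psi> x)" for x
      by (simp add: matrix_vector_mult_def gw_def sum_distrib_right)
    then show "(LINT x:unit_half_ball_int|lebesgue. \<Sum>i\<in>UNIV. ?F x $ i * partial_on UNIV i \<psi> x) = 0"
      using solution \<psi> by (simp add: thin_obstacle_solution_def weak_solution_def)
  next
    fix x y :: "'n point" assume "0 \<le> x $ None" "0 \<le> y $ None"
    then show "\<bar>\<phi> (x - x0) - \<phi> (y - x0)\<bar> \<le> L * norm (x - y)"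
      using lip[of "x - x0" "y - x0"] flat by (simp add: upper_def)
  next
    fix x :: "'n point" assume "0 \<le> x $ None" "x \<notin> ?S"
    then show "\<phi> (x - x0) = 0" using flat by (intro supp) (simp_all add: mem upper_def)
  next
    show "{x. x - x0 \<in> N} \<in> null_sets lborel" by (rule null_sets_translation[OF N])
  next
    fix x :: "'n point" assume "0 < x $ None" "x \<notin> {x. x - x0 \<in> N}"
    then have d: "(\<phi> has_gradient g (x - x0)) (at (x - x0))" using der[of "x - x0"] flat by simp
    have l: "((\<lambda>x. x - x0) has_derivative (\<lambda>h. h)) (at x)" by (auto intro!: derivative_eq_intros)
    from has_derivative_compose[OF l d]
    show "((\<lambda>x. \<phi> (x - x0)) has_gradient g (x - x0)) (at x)" .
  next
    show "(\<lambda>x. g (x - x0)) \<in> borel_measurable borel" by measurable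
    show "norm (g (x - x0)) \<le> L" for x by (rule gL)
    show "x \<notin> ?S \<Longrightarrow> g (x - x0) = 0" for x by (rule gS) (simp add: mem)
    show "?F x $ None * \<phi> (x - x0) \<le> 0" if "x \<in> ?S" "x $ None = 0" for x
      using sign[of "x - x0"] that flat unfolding mem flux by simp
  qed
  also have "\<dots> = (LBINT y. indicator ?S (x0 + y) *\<^sub>R (?F (x0 + y) \<bullet> g (x0 + y - x0)))"
  proof (rule integral_lborel_translate[symmetric])
    have "(\<lambda>x. indicator ?S x *\<^sub>R ?F x) \<in> borel_measurable borel"
      by (rule borel_measurable_continuous_on_indicator) (use S' F continuous_on_subset in \<open>auto simp: compact_imp_closed borel_closed\<close>)
    then have "(\<lambda>x. (indicator ?S x *\<^sub>R ?F x) \<bullet> g (x - x0)) \<in> borel_measurable borel" by measurable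
    then show "(\<lambda>x. indicator ?S x *\<^sub>R (?F x \<bullet> g (x - x0))) \<in> borel_measurable borel" by simp
  qed
  also have "\<dots> = (LBINT y. indicator S y *\<^sub>R (flux (\<lambda>y. a (x0 + y)) (\<lambda>y. gw (x0 + y)) y \<bullet> g y))"
    unfolding flux by (intro Bochner_Integration.integral_cong) (auto simp: indicator_def)
  finally show "0 \<le> (LBINT y. indicator S y *\<^sub>R (flux (\<lambda>y. a (x0 + y)) (\<lambda>y. gw (x0 + y)) y \<bullet> g y))" .
qed

lemma shift_w_measurable:
  assumes "E \<in> sets borel" "E \<subseteq> half_ball 0 (1/10)"
  shows "(\<lambda>y. indicator E y * (shift_w y)^2) \<in> borel_measurable borel"
proof -
  have "continuous_on E (\<lambda>y. (shift_w y)^2)"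
    by (intro continuous_on_power continuous_on_compose2[OF w_continuous] continuous_intros) (use shift_in assms(2) in auto)
  from borel_measurable_continuous_on_indicator[OF assms(1) this] show ?thesis by simp
qed

lemma shift_integral:
  assumes E: "E \<in> sets borel" "E \<subseteq> half_ball 0 (1/10)"
  shows "(LBINT y. indicator E y * (shift_w y)^2) = (LINT x:(+) x0 ` E|lebesgue. (w x)^2)"
proof -
  have mem: "indicator E (x - x0) = (indicator ((+) x0 ` E) x :: real)" for x
    by (simp only: indicator_def mem_translation_iff)
  have m[measurable]: "(\<lambda>y. indicator E y * (shift_w y)^2) \<in> borel_measurable borel" by (rule shift_w_measurable[OF E])
  have "(\<lambda>x. indicator E (x - x0) * (shift_w (x - x0))^2) \<in> borel_measurable borel"
    by (rule measurable_compose[OF _ m]) measurable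
  then have m': "(\<lambda>x. indicator ((+) x0 ` E) x * (w x)^2) \<in> borel_measurable borel" unfolding mem by simp
  have "(LINT x:(+) x0 ` E|lebesgue. (w x)^2) = (LBINT x. indicator ((+) x0 ` E) x * (w x)^2)"
    unfolding set_lebesgue_integral_def using m' by (simp add: integral_completion)
  also have "\<dots> = (LBINT y. indicator ((+) x0 ` E) (x0 + y) * (w (x0 + y))^2)"
    by (rule integral_lborel_translate[OF m', symmetric])
  finally show ?thesis unfolding mem[symmetric] by simp
qed

text \<open>The shifted half disc lies in the unit half ball because \<open>norm x0 < 1/2\<close>,
  so its share of the L2 norm is at most 1.\<close>

lemma shift_normalized:
  assumes norm: "Lp_norm 2 unit_half_ball w = 1"
  shows "(LBINT y. indicator (half_disc (9/100)) y * (shift_w y)^2) \<le> 1"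
proof -
  define I where "I = (\<integral>\<^sup>+ x. ennreal (\<bar>w x\<bar> powr 2) \<partial>lebesgue_on unit_half_ball)"
  have "Lp_norm 2 unit_half_ball w = (if I = \<infinity> then \<infinity> else ennreal (enn2real I powr (1 / 2)))"
    by (simp add: Lp_norm_def I_def Let_def)
  then have Ifin: "I \<noteq> \<infinity>" and "ennreal (enn2real I powr (1 / 2)) = 1" using norm by (auto split: if_splits)
  then have "enn2real I powr (1 / 2) = 1" by simp
  then have "enn2real I = 1" by (simp add: powr_half_sqrt)
  then have I: "I = 1" using Ifin by (metis ennreal_1 ennreal_enn2real infinity_ennreal_def less_top)
  have E: "(half_disc (9/100) :: 'n point set) \<in> sets borel" "(half_disc (9/100) :: 'n point set) \<subseteq> half_ball 0 (1/10)"
    using half_disc_sub[of "9/100"] by auto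
  have sub: "(+) x0 ` half_disc (9/100) \<subseteq> unit_half_ball" using E(2) shift_in by auto
  have ub: "(unit_half_ball :: 'n point set) \<in> sets lebesgue" by (simp add: unit_half_ball_eq)
  show ?thesis unfolding shift_integral[OF E] set_lebesgue_integral_def
  proof (rule integral_real_bounded)
    have "(\<integral>\<^sup>+x. ennreal (indicator ((+) x0 ` half_disc (9/100)) x *\<^sub>R (w x)\<^sup>2) \<partial>lebesgue) \<le>
       (\<integral>\<^sup>+x. ennreal (\<bar>w x\<bar> powr 2) * indicator unit_half_ball x \<partial>lebesgue)"
      using sub by (intro nn_integral_mono) (auto simp: indicator_def)
    also have "\<dots> = 1" unfolding I[symmetric] I_def using ub by (subst nn_integral_restrict_space) auto
    finally show "(\<integral>\<^sup>+x. ennreal (indicator ((+) x0 ` half_disc (9/100)) x *\<^sub>R (w x)\<^sup>2) \<partial>lebesgue) \<le> ennreal 1" by simp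
  qed simp
qed

lemma shift_annulus: "(+) x0 ` half_annulus 0 s r = half_annulus x0 s r"
proof -
  have "x \<in> (+) x0 ` half_annulus 0 s r \<longleftrightarrow> x \<in> half_annulus x0 s r" for x
    unfolding mem_translation_iff using flat by (simp add: half_annulus_def half_ball_def)
  then show ?thesis by blast
qed

lemma half_annulus_borel: "half_annulus (0 :: 'n point) s r \<in> sets borel"
proof -
  have "half_ball (0 :: 'n point) s = upper \<inter> ball 0 s" for s by (auto simp: half_ball_def upper_def)
  then show ?thesis by (simp add: half_annulus_def)
qed

lemma annulus_integral:
  assumes "r \<le> 1/10"
  shows "(LBINT y. indicator (half_annulus 0 (r / 2) r) y * (shift_w y)^2) =
    (LINT x:half_annulus x0 (r / 2) r|lebesgue. (w x)^2)"
proof -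
  have "half_annulus 0 (r / 2) r \<subseteq> half_ball (0 :: 'n point) (1/10)"
    using assms by (auto simp: half_annulus_def half_ball_def)
  from shift_integral[OF half_annulus_borel this] show ?thesis unfolding shift_annulus .
qed

lemma annulus_measure:
  assumes "0 < r"
  shows "measure lebesgue (half_annulus x0 (r / 2) r) \<le> unit_ball_vol (real CARD('n option)) * r ^ CARD('n option)"
    "half_annulus x0 (r / 2) r \<in> lmeasurable"
proof -
  have m: "half_annulus x0 (r / 2) r \<in> sets lebesgue"
  proof -
    have "half_ball x0 s = upper \<inter> ball x0 s" for s by (auto simp: half_ball_def upper_def dist_norm norm_minus_commute)
    then show ?thesis by (simp add: half_annulus_def)
  qed
  have sub: "half_annulus x0 (r / 2) r \<subseteq> ball x0 r" by (auto simp: half_annulus_def half_ball_def dist_norm norm_minus_commute)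
  have "measure lebesgue (half_annulus x0 (r / 2) r) \<le> measure lebesgue (ball x0 r)"
    using sub m by (intro measure_mono_fmeasurable) auto
  then show "measure lebesgue (half_annulus x0 (r / 2) r) \<le> unit_ball_vol (real CARD('n option)) * r ^ CARD('n option)"
    using assms by (simp add: content_ball)
  show "half_annulus x0 (r / 2) r \<in> lmeasurable" by (rule fmeasurableI2[OF lmeasurable_ball sub m])
qed

text \<open>Dividing the lower bound by the volume, of order \<open>r ^ CARD('n option)\<close>, and
  taking logarithms gives \<open>\<kappa> * ln r\<close> plus a constant. Division by
  \<open>ln r < 0\<close> reverses the inequality, and the constant disappears in the limit.\<close>

lemma vanishing_order_le:
  assumes d: "0 < d" "0 < r0"
    and lower: "\<And>r. 0 < r \<Longrightarrow> r \<le> r0 \<Longrightarrow>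
      d * r powr (real CARD('n option) + 2 * \<kappa>) \<le> (LBINT y. indicator (half_annulus 0 (r / 2) r) y * (shift_w y)^2)"
  shows "vanishing_order w x0 \<le> ereal \<kappa>"
proof -
  define v where "v = unit_ball_vol (real CARD('n option))"
  have v: "0 < v" by (simp add: v_def)
  define c where "c = ln (sqrt (d / v))"
  have "eventually (\<lambda>r. r \<in> {0<..<min r0 (1/10)}) (at_right 0)" using d by (intro eventually_at_right_real) auto
  then have ev: "eventually (\<lambda>r. ext_ln (sqrt (1 / measure lebesgue (half_annulus x0 (r/2) r) *
      (LINT x:half_annulus x0 (r/2) r|lebesgue. (w x)^2))) / ereal (ln r) \<le> ereal (\<kappa> + c / ln r)) (at_right 0)"
  proof eventually_elim
    case (elim r)
    then have r: "0 < r" "r \<le> r0" "r \<le> 1/10" by auto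
    define V I where "V = measure lebesgue (half_annulus x0 (r/2) r)" and "I = (LINT x:half_annulus x0 (r/2) r|lebesgue. (w x)^2)"
    have I: "d * r powr (real CARD('n option) + 2 * \<kappa>) \<le> I"
      using lower[OF r(1,2)] unfolding I_def annulus_integral[OF r(3)] .
    have I0: "0 < I" by (rule less_le_trans[OF _ I]) (use d r in simp)
    have V: "V \<le> v * r ^ CARD('n option)" unfolding V_def v_def by (rule annulus_measure[OF r(1)])
    \<comment> \<open>Division by zero yields 0, so the volume has to be known nonzero before the
      quotient is estimated. It follows from the positive integral.\<close>
    have V0: "V \<noteq> 0"
    proof
      assume "V = 0"
      then have n: "half_annulus x0 (r/2) r \<in> null_sets lebesgue"
        using annulus_measure(2)[OF r(1)] emeasure_eq_measure2[OF annulus_measure(2)[OF r(1)]]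
        by (intro null_setsI) (simp_all add: V_def fmeasurableD)
      have "I = 0" unfolding I_def set_lebesgue_integral_def
        by (rule integral_eq_zero_AE) (use AE_not_in[OF n] in \<open>auto elim!: eventually_mono\<close>)
      then show False using I0 by simp
    qed
    then have V1: "0 < V" by (simp add: V_def less_le)
    have "d * r powr (real CARD('n option) + 2 * \<kappa>) / (v * r ^ CARD('n option)) \<le> I / V"
      using I V V1 I0 d by (intro frac_le) auto
    moreover have "d * r powr (real CARD('n option) + 2 * \<kappa>) / (v * r ^ CARD('n option)) = d / v * r powr (2 * \<kappa>)"
      using r by (simp add: powr_add powr_realpow)
    ultimately have IV: "d / v * r powr (2 * \<kappa>) \<le> I / V" by simp
    have "r powr (2 * \<kappa>) = (r powr \<kappa>)^2" using powr_add[of r \<kappa> \<kappa>] by (simp add: power2_eq_square)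
    then have "sqrt (d / v) * r powr \<kappa> = sqrt (d / v * r powr (2 * \<kappa>))"
      by (simp only: real_sqrt_mult real_sqrt_abs abs_of_nonneg[OF powr_ge_zero])
    also have "\<dots> \<le> sqrt (1 / V * I)" using IV by simp
    finally have s: "sqrt (d / v) * r powr \<kappa> \<le> sqrt (1 / V * I)" .
    have s0: "0 < sqrt (d / v) * r powr \<kappa>" using d v r by simp
    have "c + \<kappa> * ln r = ln (sqrt (d / v) * r powr \<kappa>)" using d v r by (simp add: c_def ln_mult ln_powr)
    also have "\<dots> \<le> ln (sqrt (1 / V * I))" by (rule iffD2[OF ln_le_cancel_iff[OF s0 less_le_trans[OF s0 s]] s])
    finally have l: "c + \<kappa> * ln r \<le> ln (sqrt (1 / V * I))" .
    have lr: "ln r < 0" using r by simp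
    have "ln (sqrt (1 / V * I)) / ln r \<le> (c + \<kappa> * ln r) / ln r" using l lr by (simp add: divide_right_mono_neg)
    also have "\<dots> = \<kappa> + c / ln r" using lr by (simp add: field_simps)
    finally have "ln (sqrt (1 / V * I)) / ln r \<le> \<kappa> + c / ln r" .
    moreover have "ext_ln (sqrt (1 / V * I)) = ereal (ln (sqrt (1 / V * I)))"
      unfolding ext_ln_def using less_le_trans[OF s0 s] by (intro if_not_P) linarith
    ultimately show ?case using lr unfolding V_def[symmetric] I_def[symmetric] by simp
  qed
  have "((\<lambda>r. \<kappa> + c / ln r) \<longlongrightarrow> \<kappa> + 0) (at_right 0)"
    by (intro tendsto_add tendsto_const tendsto_divide_0[OF tendsto_const] filterlim_at_bot_imp_at_infinity ln_at_0)
  then have "((\<lambda>r. ereal (\<kappa> + c / ln r)) \<longlongrightarrow> ereal \<kappa>) (at_right 0)" by simp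
  then have "Limsup (at_right 0) (\<lambda>r. ereal (\<kappa> + c / ln r)) = ereal \<kappa>" by (intro lim_imp_Limsup) auto
  moreover have "vanishing_order w x0 \<le> Limsup (at_right 0) (\<lambda>r. ereal (\<kappa> + c / ln r))"
    unfolding vanishing_order_def by (rule Limsup_mono[OF ev])
  ultimately show ?thesis by simp
qed

text \<open>With value and gradient zero, \<open>w\<close> is of smaller order than the distance to
  \<open>x0\<close>. This rules out the lower bound with exponent corresponding to
  \<open>\<kappa> = 1\<close>, a case in which no strict inequality with the vanishing order is
  assumed.\<close>

lemma annulus_superlinear_decay:
  assumes "w x0 = 0" "gw x0 = 0" and d: "0 < d" "0 < r0"
  shows "\<exists>r. 0 < r \<and> r \<le> r0 \<and>
    (LBINT y. indicator (half_annulus 0 (r / 2) r) y * (shift_w y)^2) < d * r powr (real CARD('n option) + 2)"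
proof -
  define v where "v = unit_ball_vol (real CARD('n option))"
  have v: "0 < v" by (simp add: v_def)
  define e where "e = sqrt (d / (2 * v))"
  have e: "0 < e" "e\<^sup>2 * v < d" using d v by (simp_all add: e_def)
  have x0u: "x0 \<in> unit_half_ball" using flat x0 by (simp add: unit_half_ball_eq upper_def)
  have "(w has_derivative (\<lambda>h. 0)) (at x0 within upper)" using w_has_derivative[OF x0u] assms(2) by simp
  then obtain \<delta> where \<delta>: "0 < \<delta>" "\<And>y. y \<in> upper \<Longrightarrow> norm (y - x0) < \<delta> \<Longrightarrow> \<bar>w y\<bar> \<le> e * norm (y - x0)"
    using e(1) assms(1) unfolding has_derivative_within_alt by fastforce
  define r where "r = min r0 (min (\<delta> / 2) (1/10))"
  have r: "0 < r" "r \<le> r0" "r \<le> 1/10" "r < \<delta>" using d \<delta> by (auto simp: r_def)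
  have "(LBINT y. indicator (half_annulus 0 (r / 2) r) y * (shift_w y)^2) = (LINT x:half_annulus x0 (r / 2) r|lebesgue. (w x)^2)"
    by (rule annulus_integral[OF r(3)])
  also have "\<dots> \<le> (\<integral>x. indicator (half_annulus x0 (r / 2) r) x * (e * r)^2 \<partial>lebesgue)"
    unfolding set_lebesgue_integral_def
  proof (rule integral_mono')
    show "integrable lebesgue (\<lambda>x. indicator (half_annulus x0 (r / 2) r) x * (e * r)^2)"
      by (intro integrable_mult_left integrable_real_indicator) (use annulus_measure(2)[OF r(1)] in \<open>auto simp only: fmeasurable_def mem_Collect_eq\<close>)
    fix x
    show "indicator (half_annulus x0 (r / 2) r) x *\<^sub>R (w x)\<^sup>2 \<le> indicator (half_annulus x0 (r / 2) r) x * (e * r)^2"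
    proof (cases "x \<in> half_annulus x0 (r / 2) r")
      case True
      then have x: "x \<in> upper" "norm (x - x0) < r" by (auto simp: half_annulus_def half_ball_def upper_def)
      then have "\<bar>w x\<bar> \<le> e * norm (x - x0)" using r by (intro \<delta>) auto
      also have "\<dots> \<le> e * r" using x e by simp
      finally have "\<bar>w x\<bar>\<^sup>2 \<le> (e * r)^2" by (intro power_mono) auto
      then show ?thesis using True by simp
    qed simp
  qed simp
  also have "\<dots> = measure lebesgue (half_annulus x0 (r / 2) r) * (e * r)^2"
    using annulus_measure(2)[OF r(1)] by (simp add: fmeasurable_def)
  also have "\<dots> \<le> v * r ^ CARD('n option) * (e * r)^2"
    unfolding v_def by (intro mult_right_mono annulus_measure r) simp
  also have "\<dots> = (e\<^sup>2 * v) * (r ^ CARD('n option) * r\<^sup>2)" by (simp add: power_mult_distrib)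
  also have "\<dots> < d * (r ^ CARD('n option) * r\<^sup>2)" using e r by (intro mult_strict_right_mono) auto
  also have "r ^ CARD('n option) * r\<^sup>2 = r powr (real CARD('n option) + 2)"
    using powr_realpow[of r "CARD('n option) + 2"] r by (simp add: power2_eq_square power_add add.commute)
  finally show ?thesis using r by blast
qed

end

end

section \<open>Uniform growth and the passage to the limiting exponent\<close>

lemma exists_small_radius:
  fixes A B \<gamma> :: real
  assumes "0 < \<gamma>" "0 \<le> A" "0 \<le> B"
  shows "\<exists>r>0. r \<le> 1/40 \<and> A * r powr \<gamma> \<le> \<gamma> \<and> B * r powr \<gamma> \<le> 1/2"
proof -
  have "eventually (\<lambda>r :: real. 0 \<le> r) (at_right 0)" using eventually_at_right_less[of 0] by eventually_elim simp
  then have "((\<lambda>r :: real. r powr \<gamma>) \<longlongrightarrow> 0 powr \<gamma>) (at_right 0)"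
    using assms(1) by (intro tendsto_powr' tendsto_ident_at tendsto_const) simp
  then have z: "((\<lambda>r :: real. r powr \<gamma>) \<longlongrightarrow> 0) (at_right 0)" by simp
  have "eventually (\<lambda>r. A * r powr \<gamma> < \<gamma>) (at_right 0)"
    using tendsto_mult[OF tendsto_const z, of A] assms(1) by (intro order_tendstoD(2)[of _ 0]) simp_all
  moreover have "eventually (\<lambda>r. B * r powr \<gamma> < 1/2) (at_right 0)"
    using tendsto_mult[OF tendsto_const z, of B] by (intro order_tendstoD(2)[of _ 0]) simp_all
  moreover have "eventually (\<lambda>r :: real. r \<in> {0<..<1/40}) (at_right 0)" by (rule eventually_at_right_real) simp
  ultimately have "eventually (\<lambda>r. 0 < r \<and> r \<le> 1/40 \<and> A * r powr \<gamma> \<le> \<gamma> \<and> B * r powr \<gamma> \<le> 1/2) (at_right (0 :: real))"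
    by eventually_elim auto
  from eventually_happens[OF this] show ?thesis by auto
qed

text \<open>The assumption on \<open>\<kappa>\<close> excludes the first alternative of
  \<open>growth_dichotomy\<close>: by \<open>vanishing_order_le\<close> when \<open>\<kappa>\<close>
  is below the vanishing order, and by \<open>annulus_superlinear_decay\<close> when
  \<open>\<kappa> = 1\<close>. The radius and the constant are fixed before \<open>\<kappa>\<close>
  and the solution, as the later limit requires.\<close>

lemma growth_at_free_boundary:
  fixes k M :: real and p :: ennreal
  assumes k: "1 \<le> k" and p: "of_nat (CARD('n::finite) + 1) < p" and M: "0 \<le> M"
  shows "\<exists>r1 C. 0 < r1 \<and> r1 \<le> 1/40 \<and> 0 \<le> C \<and>
    (\<forall>(a :: 'n coeff) w x0 \<kappa> r x. admissible_coeff p a \<longrightarrow> grad_norm p a = ennreal M \<longrightarrow>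
       thin_obstacle_solution a w \<longrightarrow> Lp_norm 2 unit_half_ball w = 1 \<longrightarrow> x0 \<in> free_boundary w \<longrightarrow> norm x0 < 1/2 \<longrightarrow>
       1 \<le> \<kappa> \<longrightarrow> \<kappa> \<le> k \<longrightarrow> \<kappa> = 1 \<or> ereal \<kappa> < vanishing_order w x0 \<longrightarrow> 0 < r \<longrightarrow> r \<le> r1 \<longrightarrow> x \<in> half_ball x0 r \<longrightarrow>
       \<bar>w x\<bar> \<le> C * r powr \<kappa> * \<bar>ln r\<bar>\<^sup>2)"
proof -
  obtain \<gamma> H where \<gamma>: "0 < \<gamma>" and H: "0 \<le> H"
    and hoelder: "\<And>(a :: 'n coeff) x y i j. admissible_coeff p a \<Longrightarrow> grad_norm p a = ennreal M \<Longrightarrow>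
    x $ None = 0 \<Longrightarrow> norm x < 1/2 \<Longrightarrow> y \<in> upper \<Longrightarrow> norm (y - x) < 1/10 \<Longrightarrow>
    \<bar>a y $ i $ j - a x $ i $ j\<bar> \<le> H * norm (y - x) powr \<gamma>" using coefficient_hoelder[OF p M] by blast
  define m where "m = CARD('n option)"
  define h where "h = 2 * (real m)^2 * H * 2 powr \<gamma>"
  define \<beta> where "\<beta> = 8 * (real m + 2 * k) * h * k / \<gamma>"
  have h0: "0 \<le> h" using H by (simp add: h_def)
  have \<beta>0: "0 \<le> \<beta>" using k h0 \<gamma> by (simp add: \<beta>_def)
  obtain r1 where r1: "0 < r1" "r1 \<le> 1/40" "4 * \<beta> * r1 powr \<gamma> \<le> \<gamma>" "h * r1 powr \<gamma> \<le> 1/2"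
    using exists_small_radius[OF \<gamma>, of "4 * \<beta>" h] \<beta>0 h0 by auto
  define Q where "Q = growth_const m k \<gamma> h r1"
  have "0 < sup_const m" by (rule sup_const_pos) (simp add: m_def)
  then have Q0: "0 \<le> Q" using \<beta>0 unfolding Q_def growth_const_def weiss_bound_def initial_const_def \<beta>_def[symmetric]
    by (intro mult_nonneg_nonneg add_nonneg_nonneg divide_nonneg_nonneg) simp_all
  show ?thesis
  proof (rule exI[of _ "r1 / 4"], rule exI[of _ "sqrt Q"], intro conjI allI impI)
    show "0 < r1 / 4" "r1 / 4 \<le> 1/40" "0 \<le> sqrt Q" using r1 Q0 by simp_all
    fix a :: "'n coeff" and w x0 \<kappa> r and x :: "'n point"
    assume a: "admissible_coeff p a" "grad_norm p a = ennreal M" and w: "thin_obstacle_solution a w" "Lp_norm 2 unit_half_ball w = 1"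
      and x0: "x0 \<in> free_boundary w" "norm x0 < 1/2" and \<kappa>: "1 \<le> \<kappa>" "\<kappa> \<le> k" "\<kappa> = 1 \<or> ereal \<kappa> < vanishing_order w x0"
      and r: "0 < r" "r \<le> r1 / 4" and x: "x \<in> half_ball x0 r"
    interpret obstacle_solution p a w by unfold_locales (rule a w)+
    note fb = free_boundary_point[OF x0(1)]
    interpret tp: thin_problem "\<lambda>y. a (x0 + y)" "\<lambda>y. w (x0 + y)" "\<lambda>y. gw (x0 + y)" H \<gamma>
      by (rule shift_thin_problem[OF fb(2) x0(2) \<gamma> H hoelder[OF a fb(2) x0(2)]])
    have norm: "(LBINT y. indicator (half_disc (9/100)) y * (w (x0 + y))^2) \<le> 1"
      by (rule shift_normalized[OF fb(2) x0(2) w(2)])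
    have tm: "tp.m = m" by (simp add: tp.m_def m_def)
    have dichotomy: "(\<exists>d>0. \<exists>r0>0. \<forall>r. 0 < r \<and> r \<le> r0 \<longrightarrow>
      d * r powr (real m + 2 * \<kappa>) \<le> (LBINT y. indicator (half_annulus 0 (r / 2) r) y * (w (x0 + y))^2)) \<or>
      (\<forall>r y. 0 < r \<and> 4 * r \<le> r1 \<and> y \<in> half_ball 0 r \<longrightarrow> (w (x0 + y))\<^sup>2 \<le> Q * r powr (2 * \<kappa>) * \<bar>ln r\<bar>)"
      using tp.growth_dichotomy[OF norm \<kappa>(1,2) r1(1,2), unfolded tm,
          OF r1(3)[unfolded \<beta>_def h_def] r1(4)[unfolded h_def]] unfolding Q_def h_def .
    have not_lower: False if d: "0 < d" "0 < r0" and lower: "\<And>r. 0 < r \<Longrightarrow> r \<le> r0 \<Longrightarrow>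
      d * r powr (real m + 2 * \<kappa>) \<le> (LBINT y. indicator (half_annulus 0 (r / 2) r) y * (w (x0 + y))^2)" for d r0
    proof (cases "\<kappa> = 1")
      case True
      obtain s where s: "0 < s" "s \<le> r0"
        "(LBINT y. indicator (half_annulus 0 (s / 2) s) y * (w (x0 + y))^2) < d * s powr (real m + 2)"
        using annulus_superlinear_decay[OF fb(2) x0(2) fb(3,4) d] unfolding m_def by blast
      with lower[OF s(1,2)] True show False by simp
    next
      case False
      have "vanishing_order w x0 \<le> ereal \<kappa>"
        by (rule vanishing_order_le[OF fb(2) x0(2) d]) (use lower in \<open>simp add: m_def\<close>)
      then show False using \<kappa>(3) False by simp
    qed
    have y: "x - x0 \<in> half_ball 0 r" using x fb(2) by (simp add: half_ball_def)
    from dichotomy have "(w (x0 + (x - x0)))^2 \<le> Q * r powr (2 * \<kappa>) * \<bar>ln r\<bar>"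
    proof (elim disjE exE conjE)
      fix d r0 :: real
      assume "0 < d" "0 < r0" "\<forall>r. 0 < r \<and> r \<le> r0 \<longrightarrow>
        d * r powr (real m + 2 * \<kappa>) \<le> (LBINT y. indicator (half_annulus 0 (r / 2) r) y * (w (x0 + y))^2)"
      then show ?thesis using not_lower[of d r0] by simp
    next
      assume "\<forall>r y. 0 < r \<and> 4 * r \<le> r1 \<and> y \<in> half_ball 0 r \<longrightarrow> (w (x0 + y))\<^sup>2 \<le> Q * r powr (2 * \<kappa>) * \<bar>ln r\<bar>"
      from this[rule_format, of r "x - x0"] show ?thesis using r y by simp
    qed
    then have 1: "(w x)^2 \<le> Q * r powr (2 * \<kappa>) * \<bar>ln r\<bar>" by simp
    have l1: "1 \<le> \<bar>ln r\<bar>"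
    proof -
      have "r * exp 1 \<le> 1/160 * 3" using r r1 exp_le by (intro mult_mono) auto
      then have "r \<le> exp (- 1)" by (simp add: exp_minus field_simps)
      then have "ln r \<le> - 1" using r by (metis ln_exp ln_le_cancel_iff exp_gt_zero)
      then show ?thesis by simp
    qed
    \<comment> \<open>The bound just proved has one logarithm for the square of \<open>w\<close>;
      the fourth power is the square of the factor in the claim.\<close>
    have "\<bar>ln r\<bar> \<le> \<bar>ln r\<bar> ^ 4" using power_increasing[of 1 4 "\<bar>ln r\<bar>"] l1 by simp
    then have "Q * r powr (2 * \<kappa>) * \<bar>ln r\<bar> \<le> Q * r powr (2 * \<kappa>) * \<bar>ln r\<bar> ^ 4"
      using Q0 by (intro mult_left_mono) auto
    also have "\<dots> = (sqrt Q * r powr \<kappa> * \<bar>ln r\<bar>\<^sup>2)^2"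
    proof -
      have "r powr (2 * \<kappa>) = (r powr \<kappa>)^2" using powr_add[of r \<kappa> \<kappa>] by (simp add: power2_eq_square)
      then show ?thesis using Q0 by (simp add: power_mult_distrib flip: power_mult)
    qed
    finally have "(w x)^2 \<le> (sqrt Q * r powr \<kappa> * \<bar>ln r\<bar>\<^sup>2)^2" using 1 by linarith
    from abs_le_square_iff[THEN iffD2, OF this] show "\<bar>w x\<bar> \<le> sqrt Q * r powr \<kappa> * \<bar>ln r\<bar>\<^sup>2"
      using Q0 by (simp add: abs_mult)
  qed
qed

theorem lemma4p1:
  fixes kbar M :: real and p :: ennreal
  assumes "0 < kbar"
    and "of_nat (CARD('n::finite) + 1) < p"
    and "0 \<le> M"
  shows "\<exists>R0 C :: real. 0 < R0 \<and> R0 < 1/2 \<and>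
    (\<forall>(a :: 'n coeff) (w :: 'n point \<Rightarrow> real).
       admissible_coeff p a \<and> grad_norm p a = ennreal M \<and>
       thin_obstacle_solution a w \<and> Lp_norm 2 unit_half_ball w = 1 \<longrightarrow>
       (\<forall>x0 \<in> free_boundary w \<inter> ball 0 (1/2). \<forall>r. 0 < r \<and> r \<le> R0 \<longrightarrow>
          (SUP x\<in>half_ball x0 r. ereal \<bar>w x\<bar>)
            \<le> ereal (C * r powr real_of_ereal (min (vanishing_order w x0) (ereal kbar)) * \<bar>ln r\<bar>\<^sup>2)))"
proof -
  \<comment> \<open>\<open>kbar\<close> may be at most 1. A ceiling above 1 leaves room for
    exponents strictly between 1 and the limiting one.\<close>
  define k where "k = max kbar 2"
  have k: "1 \<le> k" by (simp add: k_def)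
  obtain r1 C where r1: "0 < r1" "r1 \<le> 1/40" and C: "0 \<le> C"
    and growth: "\<And>(a :: 'n coeff) w x0 \<kappa> r x. admissible_coeff p a \<Longrightarrow> grad_norm p a = ennreal M \<Longrightarrow>
       thin_obstacle_solution a w \<Longrightarrow> Lp_norm 2 unit_half_ball w = 1 \<Longrightarrow> x0 \<in> free_boundary w \<Longrightarrow> norm x0 < 1/2 \<Longrightarrow>
       1 \<le> \<kappa> \<Longrightarrow> \<kappa> \<le> k \<Longrightarrow> \<kappa> = 1 \<or> ereal \<kappa> < vanishing_order w x0 \<Longrightarrow> 0 < r \<Longrightarrow> r \<le> r1 \<Longrightarrow> x \<in> half_ball x0 r \<Longrightarrow>
       \<bar>w x\<bar> \<le> C * r powr \<kappa> * \<bar>ln r\<bar>\<^sup>2" using growth_at_free_boundary[OF k assms(2,3)] by blast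
  show ?thesis
  proof (rule exI[of _ r1], rule exI[of _ C], intro conjI allI impI ballI)
    show "0 < r1" "r1 < 1/2" using r1 by simp_all
    fix a :: "'n coeff" and w x0 r
    assume A: "admissible_coeff p a \<and> grad_norm p a = ennreal M \<and>
       thin_obstacle_solution a w \<and> Lp_norm 2 unit_half_ball w = 1"
      and x0: "x0 \<in> free_boundary w \<inter> ball 0 (1/2)" and r: "0 < r \<and> r \<le> r1"
    define v where "v = vanishing_order w x0"
    define \<kappa>0 where "\<kappa>0 = real_of_ereal (min v (ereal kbar))"
    have G: "\<bar>w x\<bar> \<le> C * r powr \<kappa> * \<bar>ln r\<bar>\<^sup>2"
      if "1 \<le> \<kappa>" "\<kappa> \<le> k" "\<kappa> = 1 \<or> ereal \<kappa> < v" "x \<in> half_ball x0 r" for \<kappa> x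
      using A x0 r that by (intro growth) (auto simp: v_def)
    have "\<bar>w x\<bar> \<le> C * r powr \<kappa>0 * \<bar>ln r\<bar>\<^sup>2" if x: "x \<in> half_ball x0 r" for x
    proof -
      obtain s where s: "\<kappa>0 \<le> s" "\<bar>w x\<bar> \<le> C * r powr s * \<bar>ln r\<bar>\<^sup>2"
      proof (cases "v \<le> 1")
        case True
        \<comment> \<open>Since \<open>r < 1\<close>, the estimate for exponent 1 covers all smaller
          exponents. The value \<open>real_of_ereal\<close> of an infinite minimum is 0, so this
          includes a vanishing order of minus infinity.\<close>
        have "min v (ereal kbar) \<le> ereal 1" using True by (simp add: min_le_iff_disj one_ereal_def)
        then have "\<kappa>0 \<le> 1" unfolding \<kappa>0_def by (cases "min v (ereal kbar)") auto
        then show ?thesis using that G[of 1 x] k x by blast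
      next
        case False
        define s where "s = real_of_ereal (min v (ereal k))"
        have v1: "ereal 1 < v" using False by (simp add: one_ereal_def)
        have "1 < k" by (simp add: k_def)
        then have "ereal 1 < ereal k" by simp
        then have m: "ereal 1 < min v (ereal k)" using v1 by (simp only: min_less_iff_conj)
        then have es: "ereal s = min v (ereal k)" unfolding s_def by (cases "min v (ereal k)") (auto simp: min_def split: if_splits)
        have s: "1 < s" "s \<le> k" "ereal s \<le> v"
          using m unfolding es[symmetric] by (simp, metis es ereal_less_eq(3) min.cobounded2, metis es min.cobounded1)
        have "ereal \<kappa>0 \<le> ereal s"
        proof -
          have "min v (ereal kbar) \<le> min v (ereal k)" by (intro min.mono) (auto simp: k_def)
          moreover have "ereal \<kappa>0 = min v (ereal kbar)"
            unfolding \<kappa>0_def using v1 by (cases v) (auto simp: min_def)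
          ultimately show ?thesis using es by simp
        qed
        then have s0: "\<kappa>0 \<le> s" by simp
        \<comment> \<open>Exponents strictly below \<open>s\<close> are strictly below the vanishing
          order, also when \<open>s\<close> equals it; the constant does not depend on them, so the
          bound survives the limit from the left.\<close>
        have ev: "eventually (\<lambda>\<kappa>. \<bar>w x\<bar> \<le> C * r powr \<kappa> * \<bar>ln r\<bar>\<^sup>2) (at_left s)"
        proof -
          have "eventually (\<lambda>\<kappa>. \<kappa> \<in> {1<..<s}) (at_left s)" by (rule eventually_at_left_real[OF s(1)])
          then show ?thesis
          proof eventually_elim
            case (elim \<kappa>)
            then have "ereal \<kappa> < v" by (intro less_le_trans[OF _ s(3)]) simp
            then show ?case using elim s x by (intro G) auto
          qed
        qed
        have "((\<lambda>\<kappa>. C * r powr \<kappa> * \<bar>ln r\<bar>\<^sup>2) \<longlongrightarrow> C * r powr s * \<bar>ln r\<bar>\<^sup>2) (at_left s)"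
          using r by (intro tendsto_intros) auto
        then have "\<bar>w x\<bar> \<le> C * r powr s * \<bar>ln r\<bar>\<^sup>2" by (rule tendsto_lowerbound[OF _ ev]) simp
        then show ?thesis using that[OF s0] by blast
      qed
      have "C * r powr s * \<bar>ln r\<bar>\<^sup>2 \<le> C * r powr \<kappa>0 * \<bar>ln r\<bar>\<^sup>2"
        using s(1) r r1 C by (intro mult_right_mono mult_left_mono powr_mono') auto
      then show ?thesis using s(2) by linarith
    qed
    then show "(SUP x\<in>half_ball x0 r. ereal \<bar>w x\<bar>)
        \<le> ereal (C * r powr real_of_ereal (min (vanishing_order w x0) (ereal kbar)) * \<bar>ln r\<bar>\<^sup>2)"
      unfolding \<kappa>0_def v_def by (intro SUP_least) simp
  qed
qed

end
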